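(* Fix $0<\varpi<1/4$ and suppose the following Type II estimate holds for this $\varpi$: there is a fixed $\delta>0$ such that for every fixed $A>0$ and every fixed $C_0\ge1$ there is a constant $C$ such that, for all sufficiently large $x$, all squarefree $P$ all of whose prime factors are at most $x^\delta$, all $N,M$ with $C_0^{-1}x^{1/2-2\varpi}\le N\le C_0M$, $M\le C_0x^{1/2+2\varpi}$ and $C_0^{-1}x\le NM\le C_0x$, all $\alpha:\mathbb N\to\mathbb R$ supported on $[M,2M]$ with $|\alpha(n)|\le C_0$ for all $n$, and $\beta=1_{[N,2N]}$, one has $$\sup_{1\le a\le x:\ (a,P)=1}\ \sum_{r\le C_0x^{1/2+2\varpi}:\ r\mid P}|\Delta(\alpha*\beta;a\ (r))|\le C\,x\log^{-A}x.$$ Then for every sufficiently small fixed $\varepsilon>0$ and every fixed $A>0$ there is a constant $C'$ such that for every natural number $q$ (not necessarily prime) and every non-principal primitive Dirichlet character $\chi$ of conductor $q$, $$\Big|\sum_{n<q^{1/2-2\varpi+\varepsilon}}\chi(n)\Big|\le C'\,q^{1/2-2\varpi+\varepsilon}\log^{-A}q .$$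
   Context: For $\alpha:\mathbb N\to\mathbb C$ of finite support and a primitive residue class $a\ (r)$ (i.e. $(a,r)=1$), the discrepancy is $\Delta(\alpha;a\ (r))=\sum_{n\equiv a\ (r)}\alpha(n)-\frac{1}{\phi(r)}\sum_{(n,r)=1}\alpha(n)$, where $\phi$ is Euler's totient function. $\alpha*\beta$ is the Dirichlet convolution $(\alpha*\beta)(n)=\sum_{d\mid n}\alpha(d)\beta(n/d)$. $1_{[N,2N]}$ is the indicator function of $[N,2N]$. *)

theory Defs
  imports "HOL-Number_Theory.Number_Theory" "HOL-Computational_Algebra.Squarefree"
begin

definition dconv :: "(nat \<Rightarrow> real) \<Rightarrow> (nat \<Rightarrow> real) \<Rightarrow> nat \<Rightarrow> real" where
  "dconv \<alpha> \<beta> n = (\<Sum>d | d dvd n. \<alpha> d * \<beta> (n div d))"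

text \<open>Discrepancy of a finitely supported function on a residue class a (r)
  (sums range over positive integers in the (finite) support).\<close>
definition disc :: "(nat \<Rightarrow> real) \<Rightarrow> nat \<Rightarrow> nat \<Rightarrow> real" where
  "disc \<alpha> a r =
     (\<Sum>n | 1 \<le> n \<and> \<alpha> n \<noteq> 0 \<and> [n = a] (mod r). \<alpha> n)
     - (1 / real (totient r)) * (\<Sum>n | 1 \<le> n \<and> \<alpha> n \<noteq> 0 \<and> coprime n r. \<alpha> n)"

definition dirichlet_character :: "nat \<Rightarrow> (nat \<Rightarrow> complex) \<Rightarrow> bool" where
  "dirichlet_character q \<chi> \<longleftrightarrow> q \<ge> 1 \<and> \<chi> 1 = 1 \<and>
     (\<forall>n. \<chi> (n + q) = \<chi> n) \<and>
     (\<forall>m n. \<chi> (m * n) = \<chi> m * \<chi> n) \<and>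
     (\<forall>n. \<chi> n = 0 \<longleftrightarrow> \<not> coprime n q)"

definition principal_character :: "nat \<Rightarrow> (nat \<Rightarrow> complex) \<Rightarrow> bool" where
  "principal_character q \<chi> \<longleftrightarrow> (\<forall>n. coprime n q \<longrightarrow> \<chi> n = 1)"

text \<open>Conductor: least modulus d dividing q such that the character mod q is
  induced by a character mod d, i.e. is trivial on units congruent to 1 mod d.\<close>
definition conductor :: "nat \<Rightarrow> (nat \<Rightarrow> complex) \<Rightarrow> nat" where
  "conductor q \<chi> = (LEAST d. 0 < d \<and> d dvd q \<and>
      (\<forall>n. coprime n q \<and> [n = 1] (mod d) \<longrightarrow> \<chi> n = 1))"

definition primitive_character :: "nat \<Rightarrow> (nat \<Rightarrow> complex) \<Rightarrow> bool" where
  "primitive_character q \<chi> \<longleftrightarrow> dirichlet_character q \<chi> \<and> conductor q \<chi> = q"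

end

theory Submission
  imports Defs "HOL-Library.FuncSet" "HOL-Real_Asymp.Real_Asymp"
begin

text \<open>
  Take \<open>N\<close> between \<open>q\<^bsup>1/2-2w+\<epsilon>/2\<^esup>\<close> and \<open>q\<^bsup>1/2-2w+\<epsilon>\<^esup>\<close>, \<open>N M = q\<^bsup>1+\<epsilon>/3\<^esup>\<close> and \<open>R = M / \<mu>\<close> with
  \<open>1/2 \<le> \<mu> \<le> 1\<close>. If \<open>m n = r k + q\<close>, then reduction modulo \<open>q\<close> gives
  \<open>\<chi>(m) cnj (\<chi>(r)) = cnj (\<chi>(n)) \<chi>(k)\<close>. Summing over \<open>n \<in> [N,2N]\<close>, \<open>m \<in> (M,2M]\<close> and smooth moduli
  \<open>r \<in> (R,(1+\<kappa>)R]\<close>, the left-hand side counts \<open>\<chi>(m)\<close> over \<open>m n \<equiv> q (mod r)\<close>: removing the common factor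
  of \<open>n\<close> and \<open>q\<close>, the Type II estimate replaces it by its mean over residues coprime to \<open>r\<close>, and that
  mean is small by the Polya-Vinogradov inequality. On the right-hand side the moduli
  \<open>r = r\<^sub>1 t l\<close> (products of \<open>b\<close> and of \<open>a\<close> primes, and an \<open>l\<close> with a sieve weight) are so flexible that, by a
  variance bound for \<open>t\<close>, the condition \<open>n | r k + q\<close> can be replaced by its density \<open>1/n\<close>. What remains is
  \<open>\<Sum>\<^sub>n cnj (\<chi>(n)) / n \<Sum>\<^sub>k \<chi>(k)\<close> over coprime \<open>n, k\<close> with \<open>\<mu> n < k \<le> 2 \<mu> n\<close>, which is therefore
  \<open>O(N log\<^bsup>-B\<^esup> q)\<close>. Dropping the coprimality condition and covering a square by such windows turns
  this into a bound for \<open>|\<Sum>\<^sub>n\<^sub>\<le>\<^sub>Y \<chi>(n)|\<^sup>2\<close>.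
\<close>

section \<open>Prime factors and the totient function\<close>

text \<open>Only powers of \<open>ln q\<close> have to be saved, so any construction whose density
  is a power of the logarithm is affordable; \<open>B2\<close> and \<open>A2\<close> repay it. The
  switch is useful because \<open>k = (m n - q) / r\<close> has the size of \<open>n\<close>: a sum
  over \<open>m\<close> that Polya-Vinogradov controls becomes a bilinear form in two variables of
  length \<open>N\<close>, the length of the wanted character sum. The obstacle is that for given
  \<open>n\<close> and \<open>k\<close> the moduli with \<open>n | r k + q\<close> must be counted
  asymptotically on average, although the Type II estimate admits only smooth squarefree
  \<open>r\<close>. A factor \<open>t\<close> slightly shorter than \<open>N\<close> together with a
  free factor \<open>l\<close>, as long as a small power of \<open>q\<close>, makes this elementary:
  a variance over progressions suffices. The weight on \<open>l\<close> forces squarefreeness and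
  coprimality to \<open>q\<close> and is normalised so that its density does not depend on
  \<open>n\<close>; otherwise an arithmetic factor of \<open>n\<close> would spoil the scale
  invariance by which the coprimality of \<open>n\<close> and \<open>k\<close> is dropped. The
  freedom in \<open>\<mu> = M / R\<close> lets the windows for \<open>k\<close> be fitted to a fixed
  interval.\<close>

lemma ln_2_ge: "3 / 5 \<le> ln (2::real)"
proof -
  \<comment> \<open>The claim amounts to \<open>e ^ 3 <= 2 ^ 5\<close>, and \<open>e <= 3\<close>
    gives 27 against 32.\<close>
  have "exp (3/5 :: real) ^ 5 = exp 1 ^ 3" by (simp add: exp_of_nat_mult[symmetric])
  also have "\<dots> \<le> 3 ^ 3" by (intro power_mono exp_le) auto
  also have "\<dots> \<le> (2::real) ^ 5" by simp
  finally have "exp (3/5 :: real) \<le> 2" using power_mono_iff[of "exp (3/5 :: real)" 2 5] by simp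
  thus ?thesis by (metis exp_gt_zero ln_exp ln_le_cancel_iff zero_less_numeral)
qed

text \<open>The i-th smallest element of \<open>S\<close> is at least \<open>i + 1\<close>, so the
  product is dominated by the telescoping product of \<open>(i + 1) / i\<close>. This later bounds
  \<open>n / totient n\<close>, the sieve weight and \<open>1 / cq\<close> by logarithms.\<close>

lemma prod_ratio_pred_le:
  fixes S :: "nat set"
  assumes "finite S" "\<And>p. p \<in> S \<Longrightarrow> p \<ge> 2"
  shows "(\<Prod>p\<in>S. real p / (real p - 1)) \<le> real (card S) + 1"
  using assms
proof (induction S rule: finite_linorder_max_induct)
  case empty
  then show ?case by simp
next
  case (insert b A)
  have "A \<subseteq> {2..<b}" using insert by auto
  hence "card A \<le> b - 2" using card_mono[of "{2..<b}" A] by simp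
  moreover have "b \<ge> 2" using insert.prems[of b] by simp
  ultimately have cA: "real (card A) + 2 \<le> real b" by linarith
  have pos: "0 \<le> real b / (real b - 1)" using cA by simp
  have "(\<Prod>p\<in>insert b A. real p / (real p - 1)) = real b / (real b - 1) * (\<Prod>p\<in>A. real p / (real p - 1))"
    using insert.hyps by (subst prod.insert) auto
  also have "\<dots> \<le> real b / (real b - 1) * (real (card A) + 1)"
    using insert.IH insert.prems by (intro mult_left_mono pos) auto
  also have "\<dots> \<le> real (card A) + 2"
  proof -
    have "real b * (real (card A) + 1) \<le> (real (card A) + 2) * (real b - 1)"
      using cA by (simp add: algebra_simps)
    thus ?thesis using cA by (simp add: field_simps)
  qed
  also have "\<dots> = real (card (insert b A)) + 1"
    using insert.hyps by (subst card_insert_disjoint) auto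
  finally show ?case .
qed

lemma two_power_card_prime_factors_le:
  fixes n :: nat assumes "n > 0" shows "2 ^ card (prime_factors n) \<le> n"
proof -
  have "2 ^ card (prime_factors n) = (\<Prod>p\<in>prime_factors n. 2)" by simp
  also have "\<dots> \<le> \<Prod>(prime_factors n)"
    by (intro prod_mono) (auto simp: in_prime_factors_iff prime_ge_2_nat)
  also have "\<dots> dvd n"
  proof -
    have "\<Prod>(prime_factors n) dvd (\<Prod>p\<in>prime_factors n. p ^ multiplicity p n)"
      by (intro prod_dvd_prod) (auto simp: in_prime_factors_iff prime_factors_multiplicity intro!: dvd_power)
    thus ?thesis using prime_factorization_nat[of n] assms by simp
  qed
  hence "\<Prod>(prime_factors n) \<le> n" using assms by (simp add: dvd_imp_le)
  finally show ?thesis .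
qed

lemma card_prime_factors_le_ln:
  fixes n :: nat assumes "n > 0" shows "real (card (prime_factors n)) \<le> 2 * ln (real n)"
proof -
  have "real (2 ^ card (prime_factors n)) \<le> real n"
    using two_power_card_prime_factors_le[OF assms] of_nat_le_iff by blast
  hence "ln (2 ^ card (prime_factors n)) \<le> ln (real n)"
    using assms by (subst ln_le_cancel_iff) auto
  hence "real (card (prime_factors n)) * ln 2 \<le> ln (real n)" by (simp add: ln_realpow)
  moreover have "(1::real) / 2 \<le> ln 2" using ln_2_ge by simp
  hence "real (card (prime_factors n)) * (1/2) \<le> real (card (prime_factors n)) * ln 2"
    by (intro mult_left_mono) auto
  ultimately show ?thesis by simp
qed

text \<open>Primes above \<open>2 powr (1/\<eta>)\<close> satisfy \<open>2 <= p powr \<eta>\<close>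
  and pay for themselves; the primes up to \<open>K\<close> contribute at most the constant
  \<open>2 ^ K\<close>.\<close>

lemma two_power_card_prime_factors_bound:
  assumes "\<eta> > 0"
  obtains C where "C \<ge> 1" "\<And>n::nat. n > 0 \<Longrightarrow> 2 ^ card (prime_factors n) \<le> C * real n powr \<eta>"
proof -
  define K where "K = nat \<lceil>2 powr (1/\<eta>)\<rceil>"
  have big: "2 \<le> real p powr \<eta>" if "p > K" for p :: nat
  proof -
    have "2 powr (1/\<eta>) \<le> real p" using that unfolding K_def by linarith
    hence "(2 powr (1/\<eta>)) powr \<eta> \<le> real p powr \<eta>" using assms by (intro powr_mono2) auto
    thus ?thesis using assms by (simp add: powr_powr)
  qed
  show ?thesis
  proof (rule that[of "2 ^ K"])
    fix n :: nat assume n: "n > 0"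
    let ?A = "{p\<in>prime_factors n. p \<le> K}" and ?B = "{p\<in>prime_factors n. p > K}"
    have split: "prime_factors n = ?A \<union> ?B" by auto
    have "card (prime_factors n) = card ?A + card ?B"
      by (subst split, rule card_Un_disjoint) auto
    moreover have "card ?A \<le> card {1..K}"
      by (rule card_mono) (auto simp: in_prime_factors_iff prime_gt_0_nat Suc_le_eq)
    ultimately have "(2::real) ^ card (prime_factors n) \<le> 2 ^ K * 2 ^ card ?B"
      unfolding power_add[symmetric] by (intro power_increasing) auto
    also have "(2::real) ^ card ?B = (\<Prod>p\<in>?B. 2)" by simp
    also have "\<dots> \<le> (\<Prod>p\<in>?B. real p powr \<eta>)" by (intro prod_mono) (use big in auto)
    also have "\<dots> = real (\<Prod>?B) powr \<eta>" by (simp add: prod_powr_distrib)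
    also have "\<dots> \<le> real n powr \<eta>"
    proof -
      have "\<Prod>?B dvd \<Prod>(prime_factors n)" by (rule prod_dvd_prod_subset) auto
      also have "\<dots> dvd (\<Prod>p\<in>prime_factors n. p ^ multiplicity p n)"
        by (intro prod_dvd_prod) (auto simp: in_prime_factors_iff prime_factors_multiplicity intro!: dvd_power)
      also have "\<dots> = n" using prime_factorization_nat[of n] n by simp
      finally have "\<Prod>?B \<le> n" using n by (simp add: dvd_imp_le)
      thus ?thesis using assms by (intro powr_mono2) (auto simp del: of_nat_prod)
    qed
    finally show "2 ^ card (prime_factors n) \<le> 2 ^ K * real n powr \<eta>" by simp
  qed auto
qed

lemma le_totient_mult:
  fixes n :: nat assumes "n > 0"
  shows "real n \<le> real (totient n) * (real (card (prime_factors n)) + 1)"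
proof -
  let ?P = "prime_factors n"
  have "real (totient n) = real n * (\<Prod>p\<in>?P. 1 - 1 / real p)"
    by (rule totient_formula2)
  also have "(\<Prod>p\<in>?P. 1 - 1 / real p) = inverse (\<Prod>p\<in>?P. real p / (real p - 1))"
    unfolding prod_inversef[symmetric] comp_def
    by (intro prod.cong refl) (auto simp: field_simps in_prime_factors_iff dest: prime_gt_1_nat)
  finally have E: "real (totient n) = real n * inverse (\<Prod>p\<in>?P. real p / (real p - 1))" .
  have "0 < real p / (real p - 1)" if "p \<in> ?P" for p
  proof -
    have "p > 1" using that prime_gt_1_nat[of p] by (auto simp: in_prime_factors_iff)
    thus ?thesis by simp
  qed
  hence "(\<Prod>p\<in>?P. real p / (real p - 1)) > 0" by (intro prod_pos) blast
  hence *: "real (totient n) * (\<Prod>p\<in>?P. real p / (real p - 1)) = real n"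
    unfolding E by (metis (no_types) less_irrefl mult.assoc mult.right_neutral left_inverse)
  have "(\<Prod>p\<in>?P. real p / (real p - 1)) \<le> real (card ?P) + 1"
    by (intro prod_ratio_pred_le) (auto simp: in_prime_factors_iff prime_ge_2_nat)
  hence "real (totient n) * (\<Prod>p\<in>?P. real p / (real p - 1)) \<le> real (totient n) * (real (card ?P) + 1)"
    by (intro mult_left_mono) auto
  thus ?thesis using * by simp
qed

section \<open>Chebyshev lower bound for primes\<close>

text \<open>The divisibility behind Nair's Chebyshev bound. Induction over \<open>k\<close> for all
  \<open>n\<close>: the lcm \<open>d\<close> is a multiple of both \<open>k C(n-1,k)\<close> and
  \<open>k C(n,k)\<close>, with cofactors \<open>u\<close> and \<open>v\<close>; subtracting
  \<open>n - k\<close> times the second identity from \<open>n\<close> times the first gives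
  \<open>d = (k+1) C(n,k+1) (u - v)\<close>.\<close>

lemma mult_binomial_dvd_Lcm:
  fixes k n :: nat assumes "1 \<le> k" "k \<le> n"
  shows "k * (n choose k) dvd Lcm {1..n}"
  using assms
proof (induction k arbitrary: n rule: nat_induct_at_least)
  case base
  then show ?case by (auto intro!: dvd_Lcm)
next
  case (Suc k)
  define d where "d = Lcm {1..n}"
  have n: "n = Suc (n - 1)" "k \<le> n - 1" using Suc.prems by auto
  have "Lcm {1..n-1} dvd d" unfolding d_def by (rule Lcm_subset) auto
  with Suc.IH[of "n-1"] n have "k * (n - 1 choose k) dvd d" by (auto intro: dvd_trans)
  then obtain u where u: "d = k * (n - 1 choose k) * u" by (elim dvdE)
  have "k * (n choose k) dvd d" unfolding d_def using Suc.IH[of n] Suc.prems by auto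
  then obtain v where v: "d = k * (n choose k) * v" by (elim dvdE)
  define c where "c = real (n choose k)"
  have c: "c > 0" using Suc.prems by (simp add: c_def)
  have e1: "real (Suc k) * real (n choose Suc k) = real (n - k) * c"
  proof -
    have "Suc k * (n choose Suc k) = n * (n - 1 choose k)"
      using times_binomial_minus1_eq[of "Suc k" n] by simp
    also have "\<dots> = (n - k) * (n choose k)"
      using binomial_absorb_comp[of n k] by simp
    finally show ?thesis unfolding c_def by (metis of_nat_mult)
  qed
  have e2: "real n * real (n - 1 choose k) = real (n - k) * c"
    using binomial_absorb_comp[of n k] unfolding c_def by (metis of_nat_mult)
  have nk: "real (n - k) = real n - real k" "real (n - k) > 0" using Suc.prems by auto
  have "real d * real n = real k * (real (n - k) * c) * real u"
    unfolding u using e2 by (simp add: algebra_simps)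
  moreover have "real d = real k * c * real v" unfolding v c_def by simp
  ultimately have "real d * real n - real d * (real n - real k) = real k * (real (n-k) * c) * (real u - real v)"
    using nk by (simp add: algebra_simps)
  hence "real k * real d = real k * ((real (n-k) * c) * (real u - real v))"
    by (simp add: algebra_simps)
  hence main: "real d = (real (n-k) * c) * (real u - real v)" using Suc.hyps by simp
  \<comment> \<open>The conclusion is a divisibility of natural numbers, so the difference
    \<open>u - v\<close> must not be truncated.\<close>
  have "real v \<le> real u"
  proof (rule ccontr)
    assume "\<not> ?thesis"
    hence "(real (n-k) * c) * (real u - real v) < 0" using nk c by (intro mult_pos_neg) auto
    thus False using main by simp
  qed
  hence "real d = real (Suc k * (n choose Suc k) * (u - v))"
    unfolding main e1[symmetric] by (simp only: of_nat_mult of_nat_diff of_nat_le_iff)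
  hence "d = Suc k * (n choose Suc k) * (u - v)" by (simp only: of_nat_eq_iff)
  thus ?case unfolding d_def by (metis dvd_triv_left)
qed

text \<open>A prime enters the lcm with its largest power not exceeding \<open>n\<close>, so every
  prime up to \<open>n\<close> contributes a factor of at most \<open>n\<close>.\<close>

lemma Lcm_upto_le:
  fixes n :: nat assumes "n \<ge> 1"
  shows "Lcm {1..n} \<le> n ^ card {p. prime p \<and> p \<le> n}"
proof -
  let ?P = "{p. prime p \<and> p \<le> n}"
  define a where "a p = (GREATEST a. p ^ a \<le> n)" for p
  have b: "y \<le> n" if "prime p" "p ^ y \<le> n" for p y
    using that less_exp[of y] power_mono[of 2 p y] prime_ge_2_nat[of p] by linarith
  have a1: "p ^ a p \<le> n" if "prime p" for p
    unfolding a_def using GreatestI_nat[of "\<lambda>a. p ^ a \<le> n" 0 n] b[OF that] assms by auto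
  have a2: "k \<le> a p" if "prime p" "p ^ k \<le> n" for p k
    unfolding a_def using Greatest_le_nat[of "\<lambda>a. p ^ a \<le> n" k n] b[OF that(1)] that by auto
  have "Lcm {1..n} dvd (\<Prod>p\<in>?P. p ^ a p)"
  proof (rule Lcm_least)
    fix i assume i: "i \<in> {1..n}"
    have "i = (\<Prod>p\<in>prime_factors i. p ^ multiplicity p i)"
      using prime_factorization_nat[of i] i by simp
    also have "\<dots> dvd (\<Prod>p\<in>prime_factors i. p ^ a p)"
    proof (rule prod_dvd_prod)
      fix p assume p: "p \<in> prime_factors i"
      have "p ^ multiplicity p i dvd i" by (rule multiplicity_dvd)
      hence "p ^ multiplicity p i \<le> n" using i by (auto dest: dvd_imp_le)
      thus "p ^ multiplicity p i dvd p ^ a p"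
        using a2 p by (intro le_imp_power_dvd) (auto simp: in_prime_factors_iff)
    qed
    also have "\<dots> dvd (\<Prod>p\<in>?P. p ^ a p)"
      using i by (intro prod_dvd_prod_subset) (auto simp: in_prime_factors_iff dest!: dvd_imp_le)
    finally show "i dvd (\<Prod>p\<in>?P. p ^ a p)" .
  qed
  moreover have "(\<Prod>p\<in>?P. p ^ a p) > 0" by (auto intro!: prod_pos dest: prime_gt_0_nat)
  ultimately have "Lcm {1..n} \<le> (\<Prod>p\<in>?P. p ^ a p)" by (rule dvd_imp_le)
  also have "\<dots> \<le> (\<Prod>p\<in>?P. n)" by (intro prod_mono) (auto intro: a1)
  finally show ?thesis by simp
qed

lemma chebyshev_lower_even:
  fixes m :: nat assumes "m \<ge> 3"
  shows "real m \<le> real (card {p. prime p \<and> p \<le> 2 * m}) * ln (2 * real m)"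
proof -
  have "real m * (4 ^ m / (2 * real m)) \<le> real m * real (2 * m choose m)"
    using assms by (intro mult_left_mono central_binomial_lower_bound) auto
  also have "\<dots> \<le> real (Lcm {1..2*m})"
    unfolding of_nat_mult[symmetric] of_nat_le_iff
    using assms by (intro dvd_imp_le mult_binomial_dvd_Lcm) (auto simp: Lcm_0_iff intro!: Nat.gr0I)
  also have "\<dots> \<le> real ((2*m) ^ card {p. prime p \<and> p \<le> 2 * m})"
    unfolding of_nat_le_iff using assms by (intro Lcm_upto_le) auto
  finally have "4 ^ m / 2 \<le> (2 * real m) ^ card {p. prime p \<and> p \<le> 2 * m}" using assms by simp
  hence "ln (4 ^ m / 2) \<le> ln ((2 * real m) ^ card {p. prime p \<and> p \<le> 2 * m})"
    using assms by (subst ln_le_cancel_iff) auto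
  hence "real m * ln 4 - ln 2 \<le> real (card {p. prime p \<and> p \<le> 2 * m}) * ln (2 * real m)"
    using assms by (subst (asm) ln_realpow, simp) (simp add: ln_div ln_realpow)
  moreover have "ln (4::real) = 2 * ln 2" using ln_realpow[of "2::real" 2] by simp
  \<comment> \<open>With \<open>ln 2 >= 3/5\<close> this reduces to
    \<open>(6 m - 3) / 5 >= m\<close>, which is exactly \<open>m >= 3\<close>.\<close>
  moreover have "real m * 2 * ln 2 - ln 2 \<ge> real m"
  proof -
    have "(2 * real m - 1) * (3/5) \<le> (2 * real m - 1) * ln 2" 
      using assms ln_2_ge by (intro mult_left_mono) auto
    moreover have "(2 * real m - 1) * (3/5) \<ge> real m" using assms by (simp add: field_simps)
    moreover have "real m * 2 * ln 2 - ln 2 = (2 * real m - 1) * ln 2" by (simp add: algebra_simps)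
    ultimately show ?thesis by linarith
  qed
  ultimately show ?thesis by simp
qed

lemma chebyshev_lower:
  fixes Z :: real assumes "Z \<ge> 6"
  shows "Z / (4 * ln Z) \<le> real (card {p. prime p \<and> real p \<le> Z})"
proof -
  define m where "m = nat \<lfloor>Z / 2\<rfloor>"
  have m: "m \<ge> 3" "2 * real m \<le> Z" "Z / 4 \<le> real m" using assms unfolding m_def by linarith+
  have "Z / 4 \<le> real (card {p. prime p \<and> p \<le> 2 * m}) * ln (2 * real m)"
    using chebyshev_lower_even[OF m(1)] m by linarith
  also have "\<dots> \<le> real (card {p. prime p \<and> real p \<le> Z}) * ln Z"
  proof (intro mult_mono)
    have "finite {p. prime p \<and> real p \<le> Z}"
      by (rule finite_subset[of _ "{..nat \<lfloor>Z\<rfloor>}"]) (auto simp: le_nat_floor)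
    thus "real (card {p. prime p \<and> p \<le> 2 * m}) \<le> real (card {p. prime p \<and> real p \<le> Z})"
      unfolding of_nat_le_iff using m(2) by (intro card_mono) auto
    show "ln (2 * real m) \<le> ln Z" using m by (subst ln_le_cancel_iff) auto
  qed (use m in auto)
  finally show ?thesis using assms by (simp add: field_simps)
qed

text \<open>Discards the at most \<open>X\<close> primes up to \<open>X\<close> and the at most
  \<open>2 ln q\<close> primes dividing \<open>q\<close>. For \<open>Z = X L ^ 2\<close> both losses
  are smaller than the Chebyshev count.\<close>

lemma card_primes_window:
  fixes X Z :: real and q :: nat assumes "Z \<ge> 6" "X \<ge> 0" "q > 0"
  shows "Z / (4 * ln Z) - X - 2 * ln q \<le> real (card {p. prime p \<and> X < real p \<and> real p \<le> Z \<and> \<not> p dvd q})"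
proof -
  let ?W = "{p. prime p \<and> X < real p \<and> real p \<le> Z \<and> \<not> p dvd q}"
  have fin: "finite {p. real p \<le> Z}"
    by (rule finite_subset[of _ "{..nat \<lfloor>Z\<rfloor>}"]) (auto simp: le_nat_floor)
  have "{p. prime p \<and> real p \<le> Z} \<subseteq> ?W \<union> {1..nat \<lfloor>X\<rfloor>} \<union> prime_factors q"
  proof
    fix p assume "p \<in> {p. prime p \<and> real p \<le> Z}"
    thus "p \<in> ?W \<union> {1..nat \<lfloor>X\<rfloor>} \<union> prime_factors q"
      using assms prime_gt_0_nat[of p] 
      by (cases "X < real p") (auto simp: in_prime_factors_iff le_nat_floor Suc_le_eq)
  qed
  hence "card {p. prime p \<and> real p \<le> Z} \<le> card (?W \<union> {1..nat \<lfloor>X\<rfloor>} \<union> prime_factors q)"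
    using fin by (intro card_mono) (auto intro: finite_subset[OF _ fin])
  also have "\<dots> \<le> card ?W + nat \<lfloor>X\<rfloor> + card (prime_factors q)"
    by (intro order.trans[OF card_Un_le] add_mono) auto
  finally have "real (card {p. prime p \<and> real p \<le> Z}) \<le> real (card ?W) + real (nat \<lfloor>X\<rfloor>) + real (card (prime_factors q))"
    by linarith
  moreover have "real (nat \<lfloor>X\<rfloor>) \<le> X" using assms by simp
  ultimately show ?thesis using chebyshev_lower[OF assms(1)] card_prime_factors_le_ln[OF assms(3)] by linarith
qed

section \<open>Dirichlet characters and the Polya-Vinogradov inequality\<close>

lemma sum_inverse_le_one_plus_ln:
  assumes "n > 0" shows "(\<Sum>k=1..n. 1 / real k) \<le> 1 + ln (real n)"
  using assms
proof (induction n rule: nat_induct_non_zero)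
  case (Suc n)
  have "ln (real n / real (Suc n)) \<le> real n / real (Suc n) - 1"
    using Suc.hyps by (intro ln_le_minus_one) auto
  also have "\<dots> = - (1 / real (Suc n))" by (simp add: field_simps)
  finally have "1 / real (Suc n) \<le> ln (real (Suc n)) - ln (real n)"
    using Suc.hyps by (simp add: ln_div)
  thus ?case using Suc.IH by simp
qed auto

lemma dirichlet_character_cong:
  assumes "dirichlet_character q \<chi>" "[a = b] (mod q)"
  shows "\<chi> a = \<chi> b"
proof -
  have *: "\<chi> (n + k * q) = \<chi> n" for n k
  proof (induction k)
    case (Suc k)
    have "\<chi> ((n + k * q) + q) = \<chi> (n + k * q)" using assms(1) unfolding dirichlet_character_def by blast
    thus ?case using Suc by (simp add: add_ac)
  qed auto
  have "\<chi> n = \<chi> (n mod q)" for n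
    using *[of "n mod q" "n div q"] by (simp add: add.commute)
  thus ?thesis using assms(2) unfolding unique_euclidean_semiring_class.cong_def by metis
qed

lemma dirichlet_character_mult:
  "dirichlet_character q \<chi> \<Longrightarrow> \<chi> (m * n) = \<chi> m * \<chi> n"
  unfolding dirichlet_character_def by blast

lemma dirichlet_character_eq_0_iff:
  "dirichlet_character q \<chi> \<Longrightarrow> \<chi> n = 0 \<longleftrightarrow> \<not> coprime n q"
  unfolding dirichlet_character_def by blast

lemma norm_dirichlet_character:
  assumes "dirichlet_character q \<chi>" "coprime n q"
  shows "norm (\<chi> n) = 1"
proof -
  have q: "q > 0" using assms unfolding dirichlet_character_def by auto
  have pow: "\<chi> (n ^ k) = \<chi> n ^ k" for k
    using assms(1) unfolding dirichlet_character_def by (induction k) auto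
  have "[n ^ totient q = 1] (mod q)" using assms(2) by (rule euler_theorem)
  hence "\<chi> n ^ totient q = \<chi> 1"
    using dirichlet_character_cong[OF assms(1)] pow by metis
  hence "\<chi> n ^ totient q = 1" using assms(1) unfolding dirichlet_character_def by simp
  hence "norm (\<chi> n) ^ totient q = 1" by (metis norm_power norm_one)
  hence "norm (\<chi> n) ^ totient q = 1 ^ totient q" by simp
  thus ?thesis by (rule power_eq_imp_eq_base) (use q in auto)
qed

lemma norm_dirichlet_character_le_1:
  assumes "dirichlet_character q \<chi>" shows "norm (\<chi> n) \<le> 1"
proof (cases "coprime n q")
  case True
  show ?thesis unfolding norm_dirichlet_character[OF assms True] by simp
next
  case False
  hence "\<chi> n = 0" unfolding dirichlet_character_eq_0_iff[OF assms] .
  thus ?thesis by simp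
qed

lemma dirichlet_character_cnj_mult:
  assumes "dirichlet_character q \<chi>" "coprime n q"
  shows "cnj (\<chi> n) * \<chi> n = 1" "\<chi> n * cnj (\<chi> n) = 1"
proof -
  have "\<chi> n * cnj (\<chi> n) = complex_of_real ((norm (\<chi> n))\<^sup>2)" by (rule complex_norm_square[symmetric])
  thus "\<chi> n * cnj (\<chi> n) = 1" unfolding norm_dirichlet_character[OF assms] by simp
  thus "cnj (\<chi> n) * \<chi> n = 1" by (simp only: mult.commute)
qed

section \<open>Gauss sums of primitive characters\<close>

lemma bij_betw_mult_mod:
  fixes u q :: nat assumes "coprime u q" "q > 0"
  shows "bij_betw (\<lambda>b. u * b mod q) {..<q} {..<q}"
proof -
  have "inj_on (\<lambda>b. u * b mod q) {..<q}"
  proof (rule inj_onI)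
    fix a b assume ab: "a \<in> {..<q}" "b \<in> {..<q}" "u * a mod q = u * b mod q"
    hence "[u * a = u * b] (mod q)" by (simp add: unique_euclidean_semiring_class.cong_def)
    hence "[a = b] (mod q)" using assms(1) by (simp add: cong_mult_lcancel_nat)
    thus "a = b" using ab by (simp add: unique_euclidean_semiring_class.cong_def)
  qed
  moreover have "(\<lambda>b. u * b mod q) ` {..<q} \<subseteq> {..<q}" using assms by auto
  ultimately show ?thesis unfolding bij_betw_def by (simp add: endo_inj_surj)
qed

lemma cis_mod_eq:
  assumes "[a = b] (mod q)" "q > 0"
  shows "cis (2 * pi * real a / real q) = cis (2 * pi * real b / real q)"
proof -
  have *: "cis (2 * pi * real n / real q) = cis (2 * pi * real (n mod q) / real q)" for n
  proof -
    have "real n = real (n div q) * real q + real (n mod q)"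
      unfolding of_nat_mult[symmetric] of_nat_add[symmetric] by simp
    hence "2 * pi * real n / real q = 2 * pi * real (n div q) + 2 * pi * real (n mod q) / real q"
      using assms(2) by (simp add: field_simps)
    thus ?thesis by (simp add: cis_mult[symmetric] cis_multiple_2pi)
  qed
  show ?thesis using *[of a] *[of b] assms(1) by (simp add: unique_euclidean_semiring_class.cong_def)
qed

text \<open>Gauss sum of the conjugate character at frequency \<open>m\<close>; the conjugate makes
  separability read \<open>gauss_sum q \<chi> m = \<chi> m * gauss_sum q \<chi> 1\<close>.\<close>

definition gauss_sum :: "nat \<Rightarrow> (nat \<Rightarrow> complex) \<Rightarrow> nat \<Rightarrow> complex" where
  "gauss_sum q \<chi> m = (\<Sum>b<q. cnj (\<chi> b) * cis (2 * pi * real (b * m) / real q))"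

lemma gauss_sum_shift:
  assumes \<chi>: "dirichlet_character q \<chi>" and u: "coprime u q"
  shows "gauss_sum q \<chi> m = cnj (\<chi> u) * gauss_sum q \<chi> (u * m)"
proof -
  have q: "q > 0" using \<chi> unfolding dirichlet_character_def by auto
  let ?F = "\<lambda>b. cnj (\<chi> b) * cis (2 * pi * real (b * m) / real q)"
  have "gauss_sum q \<chi> m = (\<Sum>b<q. ?F (u * b mod q))"
    unfolding gauss_sum_def by (rule sum.reindex_bij_betw[symmetric, OF bij_betw_mult_mod[OF u q]])
  also have "\<dots> = (\<Sum>b<q. cnj (\<chi> u) * (cnj (\<chi> b) * cis (2 * pi * real (b * (u * m)) / real q)))"
  proof (intro sum.cong refl)
    fix b
    have "\<chi> (u * b mod q) = \<chi> (u * b)" by (rule dirichlet_character_cong[OF \<chi>]) (simp add: unique_euclidean_semiring_class.cong_def)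
    moreover have "[u * b mod q * m = u * b * m] (mod q)"
      by (intro cong_scalar_right) (simp add: unique_euclidean_semiring_class.cong_def)
    hence "[u * b mod q * m = b * (u * m)] (mod q)" by (simp only: mult_ac)
    ultimately show "?F (u * b mod q) = cnj (\<chi> u) * (cnj (\<chi> b) * cis (2 * pi * real (b * (u * m)) / real q))"
      using cis_mod_eq[of "u * b mod q * m" "b * (u * m)" q] q 
      by (simp add: dirichlet_character_mult[OF \<chi>] mult_ac)
  qed
  finally show ?thesis unfolding gauss_sum_def by (simp add: sum_distrib_left)
qed

lemma gauss_sum_cong:
  assumes "[a = b] (mod q)" "q > 0" shows "gauss_sum q \<chi> a = gauss_sum q \<chi> b"
  unfolding gauss_sum_def
proof (intro sum.cong refl arg_cong2[where f = "(*)"])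
  fix c show "cis (2 * pi * real (c * a) / real q) = cis (2 * pi * real (c * b) / real q)"
    by (rule cis_mod_eq) (use assms in \<open>auto intro: cong_scalar_left\<close>)
qed

text \<open>For \<open>m\<close> coprime to \<open>q\<close>, shift by \<open>m\<close>. Otherwise
  \<open>d = q / gcd(m, q)\<close> is a proper divisor of \<open>q\<close>, so minimality of the
  conductor supplies a unit \<open>u = 1 (mod d)\<close> with \<open>\<chi> u\<close> different from
  1. Since \<open>u m = m (mod q)\<close>, the shift by \<open>u\<close> forces the sum to vanish,
  as \<open>\<chi> m\<close> does.\<close>

lemma gauss_sum_primitive:
  assumes "primitive_character q \<chi>"
  shows "gauss_sum q \<chi> m = \<chi> m * gauss_sum q \<chi> 1"
proof -
  have \<chi>: "dirichlet_character q \<chi>" and cond: "conductor q \<chi> = q"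
    using assms unfolding primitive_character_def by auto
  have q: "q > 0" using \<chi> unfolding dirichlet_character_def by auto
  show ?thesis
  proof (cases "coprime m q")
    case True
    have "\<chi> m * gauss_sum q \<chi> 1 = \<chi> m * (cnj (\<chi> m) * gauss_sum q \<chi> m)"
      using gauss_sum_shift[OF \<chi> True, of 1] by simp
    also have "\<dots> = gauss_sum q \<chi> m"
      using dirichlet_character_cnj_mult(2)[OF \<chi> True] by (simp add: mult.assoc[symmetric])
    finally show ?thesis by simp
  next
    case False
    define g where "g = gcd m q"
    define d where "d = q div g"
    have "g \<noteq> 1" using False unfolding g_def coprime_iff_gcd_eq_1 .
    moreover have "g \<noteq> 0" using q unfolding g_def by simp
    ultimately have g: "g > 1" by simp
    have dg: "d * g = q" unfolding d_def g_def by simp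
    have "d > 0" using dg q by (cases d) auto
    have "d < q" using dg g \<open>d > 0\<close> n_less_m_mult_n[of d g] by (simp add: mult.commute)
    have "d dvd q" unfolding dg[symmetric] by simp
    have "d < (LEAST d. 0 < d \<and> d dvd q \<and> (\<forall>n. coprime n q \<and> [n = 1] (mod d) \<longrightarrow> \<chi> n = 1))"
      using cond \<open>d < q\<close> unfolding conductor_def by simp
    from not_less_Least[OF this] obtain u where u: "coprime u q" "[u = 1] (mod d)" "\<chi> u \<noteq> 1"
      using \<open>d > 0\<close> \<open>d dvd q\<close> by blast
    have "[u * m = m] (mod q)"
    proof -
      have "g dvd m" unfolding g_def by simp
      then obtain m' where m': "m = g * m'" by blast
      have "[u * g = 1 * g] (mod (d * g))" using u(2) by (simp add: unique_euclidean_semiring_class.cong_def mod_mult_mult2)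
      hence "[u * g * m' = 1 * g * m'] (mod q)" unfolding dg by (rule cong_scalar_right)
      thus ?thesis unfolding m' by (simp add: mult_ac)
    qed
    hence e: "gauss_sum q \<chi> (u * m) = gauss_sum q \<chi> m" by (rule gauss_sum_cong[OF _ q])
    have "gauss_sum q \<chi> m = cnj (\<chi> u) * gauss_sum q \<chi> m"
      by (rule gauss_sum_shift[OF \<chi> u(1), of m, unfolded e])
    hence "gauss_sum q \<chi> m = 0 \<or> cnj (\<chi> u) = 1" unfolding mult_cancel_right1 .
    moreover have "cnj (\<chi> u) \<noteq> 1" using u(3) by simp
    ultimately have "gauss_sum q \<chi> m = 0" by blast
    moreover have "\<chi> m = 0" using False dirichlet_character_eq_0_iff[OF \<chi>] by simp
    ultimately show ?thesis by simp
  qed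
qed

lemma sum_cis_orthogonal:
  fixes a b q :: nat assumes "a < q" "b < q"
  shows "(\<Sum>m<q. cis (2 * pi * real (a * m) / real q) * cnj (cis (2 * pi * real (b * m) / real q)))
    = (if a = b then of_nat q else 0)"
proof -
  define z where "z = cis (2 * pi * (real a - real b) / real q)"
  have q: "real q > 0" using assms by simp
  have t: "cis (2 * pi * real (a * m) / real q) * cnj (cis (2 * pi * real (b * m) / real q)) = z ^ m" for m
  proof -
    have "cis (2 * pi * real (a * m) / real q) * cnj (cis (2 * pi * real (b * m) / real q)) =
      cis (2 * pi * real (a * m) / real q - 2 * pi * real (b * m) / real q)"
      by (simp add: cis_cnj cis_mult)
    also have "2 * pi * real (a * m) / real q - 2 * pi * real (b * m) / real q = real m * (2 * pi * (real a - real b) / real q)"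
      by (simp add: diff_divide_distrib[symmetric] algebra_simps)
    finally show ?thesis unfolding z_def by (simp only: DeMoivre)
  qed
  show ?thesis
  proof (cases "a = b")
    case True
    hence "z = 1" by (simp add: z_def)
    thus ?thesis unfolding t using True by simp
  next
    case False
    have "z ^ q = cis (2 * pi * (real a - real b))" using q unfolding z_def by (simp add: DeMoivre)
    also have "\<dots> = 1"
      by (metis Ints_diff Ints_of_nat cis_multiple_2pi)
    finally have zq: "z ^ q = 1" .
    \<comment> \<open>\<open>z = 1\<close> would make \<open>q\<close> divide \<open>a - b\<close>,
      impossible for distinct numbers below \<open>q\<close>.\<close>
    have "z \<noteq> 1"
    proof
      assume "z = 1"
      hence "cos (2 * pi * (real a - real b) / real q) = 1" unfolding z_def by (metis cis.simps(1) one_complex.simps(1))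
      then obtain n :: int where "2 * pi * (real a - real b) / real q = real_of_int n * 2 * pi"
        by (auto simp: cos_one_2pi_int)
      hence "2 * pi * (real a - real b) = 2 * pi * (real_of_int n * real q)" using q by (simp add: field_simps)
      hence "real a - real b = real_of_int n * real q" by (simp only: mult_cancel_left) simp
      hence "real_of_int (int a - int b) = real_of_int (n * int q)" by simp
      hence e: "int a - int b = n * int q" by (simp only: of_int_eq_iff)
      moreover have "\<bar>int a - int b\<bar> < int q" using assms by linarith
      ultimately have "\<bar>n\<bar> * int q < 1 * int q" by (simp add: abs_mult)
      hence "\<bar>n\<bar> < 1" by (rule mult_right_less_imp_less) simp
      hence "n = 0" by simp
      thus False using e False by simp
    qed
    hence "(\<Sum>m<q. z ^ m) = 0" using geometric_sum[of z q] zq by simp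
    thus ?thesis using False by (simp only: t) simp
  qed
qed

text \<open>The sum of the squared norms over all frequencies is computed twice: orthogonality of
  the additive characters gives \<open>q \<Phi>\<close>, separability gives the squared norm at
  frequency 1 times \<open>\<Phi>\<close>, where \<open>\<Phi>\<close> is the number of
  units.\<close>

lemma norm_gauss_sum:
  assumes "primitive_character q \<chi>"
  shows "norm (gauss_sum q \<chi> 1) = sqrt (real q)"
proof -
  have \<chi>: "dirichlet_character q \<chi>"
    using assms unfolding primitive_character_def by auto
  have q: "q > 0" using \<chi> unfolding dirichlet_character_def by auto
  let ?e = "\<lambda>b m. cis (2 * pi * real (b * m) / real q)"
  define \<Phi> where "\<Phi> = (\<Sum>b<q. \<chi> b * cnj (\<chi> b))"
  have "(\<Sum>m<q. gauss_sum q \<chi> m * cnj (gauss_sum q \<chi> m)) =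
     (\<Sum>m<q. \<Sum>a<q. \<Sum>b<q. cnj (\<chi> a) * \<chi> b * (?e a m * cnj (?e b m)))"
    unfolding gauss_sum_def cnj_sum sum_product complex_cnj_mult complex_cnj_cnj
    by (intro sum.cong[OF refl]) (simp only: mult_ac)
  also have "\<dots> = (\<Sum>a<q. \<Sum>m<q. \<Sum>b<q. cnj (\<chi> a) * \<chi> b * (?e a m * cnj (?e b m)))"
    by (rule sum.swap)
  also have "\<dots> = (\<Sum>a<q. \<Sum>b<q. \<Sum>m<q. cnj (\<chi> a) * \<chi> b * (?e a m * cnj (?e b m)))"
    by (rule sum.cong[OF refl], rule sum.swap)
  also have "\<dots> = (\<Sum>a<q. \<Sum>b<q. cnj (\<chi> a) * \<chi> b * (if a = b then of_nat q else 0))"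
  proof (rule sum.cong[OF refl], rule sum.cong[OF refl])
    fix a b assume "a \<in> {..<q}" "b \<in> {..<q}"
    thus "(\<Sum>m<q. cnj (\<chi> a) * \<chi> b * (?e a m * cnj (?e b m))) = cnj (\<chi> a) * \<chi> b * (if a = b then of_nat q else 0)"
      unfolding sum_distrib_left[symmetric] by (simp only: sum_cis_orthogonal lessThan_iff)
  qed
  also have "\<dots> = of_nat q * \<Phi>"
    unfolding \<Phi>_def sum_distrib_left
  proof (rule sum.cong[OF refl])
    fix a assume a: "a \<in> {..<q}"
    have "(\<Sum>b<q. cnj (\<chi> a) * \<chi> b * (if a = b then of_nat q else 0)) =
      (\<Sum>b<q. if a = b then of_nat q * (\<chi> a * cnj (\<chi> a)) else 0)"
      by (rule sum.cong[OF refl]) auto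
    also have "\<dots> = of_nat q * (\<chi> a * cnj (\<chi> a))" using a by (subst sum.delta') auto
    finally show "(\<Sum>b<q. cnj (\<chi> a) * \<chi> b * (if a = b then of_nat q else 0)) = of_nat q * (\<chi> a * cnj (\<chi> a))" .
  qed
  finally have 1: "(\<Sum>m<q. gauss_sum q \<chi> m * cnj (gauss_sum q \<chi> m)) = of_nat q * \<Phi>" .
  have 2: "(\<Sum>m<q. gauss_sum q \<chi> m * cnj (gauss_sum q \<chi> m)) = gauss_sum q \<chi> 1 * cnj (gauss_sum q \<chi> 1) * \<Phi>"
    unfolding \<Phi>_def sum_distrib_left
  proof (rule sum.cong[OF refl])
    fix m
    define G where "G = gauss_sum q \<chi> 1"
    have "gauss_sum q \<chi> m = \<chi> m * G" unfolding G_def by (rule gauss_sum_primitive[OF assms])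
    thus "gauss_sum q \<chi> m * cnj (gauss_sum q \<chi> m) = gauss_sum q \<chi> 1 * cnj (gauss_sum q \<chi> 1) * (\<chi> m * cnj (\<chi> m))"
      unfolding G_def[symmetric] by (simp only: complex_cnj_mult mult_ac)
  qed
  have "\<Phi> \<noteq> 0"
  proof -
    have e: "\<chi> b * cnj (\<chi> b) = of_real ((norm (\<chi> b))\<^sup>2)" for b
      by (simp only: complex_norm_square)
    have "\<Phi> = of_real (\<Sum>b<q. (norm (\<chi> b))\<^sup>2)" unfolding \<Phi>_def e by simp
    moreover have "(\<Sum>b<q. (norm (\<chi> b))\<^sup>2) \<ge> (norm (\<chi> (1 mod q)))\<^sup>2"
      using q by (intro member_le_sum) auto
    moreover have "\<chi> (1 mod q) = \<chi> 1" by (rule dirichlet_character_cong[OF \<chi>]) (simp add: unique_euclidean_semiring_class.cong_def)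
    moreover have "\<chi> 1 = 1" using \<chi> unfolding dirichlet_character_def by simp
    ultimately show ?thesis by (auto simp del: of_real_sum)
  qed
  hence "gauss_sum q \<chi> 1 * cnj (gauss_sum q \<chi> 1) = of_nat q" using 1 2 by simp
  hence "complex_of_real ((norm (gauss_sum q \<chi> 1))\<^sup>2) = complex_of_real (real q)"
    by (simp only: complex_norm_square of_real_of_nat_eq)
  hence "(norm (gauss_sum q \<chi> 1))\<^sup>2 = real q" by (simp only: of_real_eq_iff)
  thus ?thesis by (intro real_sqrt_unique[symmetric]) auto
qed

section \<open>Completion and the Polya-Vinogradov inequality\<close>

lemma sin_ge_third:
  fixes x :: real assumes "0 \<le> x" "x \<le> pi / 2" shows "x / 3 \<le> sin x"
proof -
  have "\<bar>sin x - (\<Sum>m<3. sin_coeff m * x ^ m)\<bar> \<le> inverse (fact 3) * \<bar>x\<bar> ^ 3"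
    by (rule Maclaurin_sin_bound)
  hence "\<bar>sin x - x\<bar> \<le> x ^ 3 / 6"
  proof -
    have "(\<Sum>m<3. sin_coeff m * x ^ m) = x" by (simp add: numeral_3_eq_3 sin_coeff_def)
    moreover have "fact 3 = (6::real)" by (simp add: fact_numeral)
    ultimately show ?thesis using \<open>\<bar>sin x - _\<bar> \<le> _\<close> assms by simp
  qed
  moreover have "x ^ 3 / 6 \<le> 2 * x / 3"
  proof -
    have "x \<le> 2" using assms pi_half_less_two by linarith
    hence "x * x \<le> 2 * 2" using assms by (intro mult_mono) auto
    hence "x * (x * x) \<le> x * 4" using assms by (intro mult_left_mono) auto
    thus ?thesis by (simp add: power3_eq_cube mult.assoc)
  qed
  ultimately show ?thesis by linarith
qed

text \<open>The geometric sum is at most \<open>1 / sin (pi b / q)\<close>. Adding the bounds that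
  hold for \<open>b\<close> in the lower and in the upper half of the residues avoids a case
  distinction later: summed over \<open>b\<close>, both parts are the same harmonic sum.\<close>

lemma norm_sum_cis_le:
  fixes a c b q :: nat assumes "0 < b" "b < q"
  shows "norm (\<Sum>m\<in>{a..<c}. cis (2 * pi * real (b * m) / real q)) \<le> real q / real b + real q / real (q - b)"
proof -
  define \<theta> where "\<theta> = pi * real b / real q"
  define z where "z = cis (2 * \<theta>)"
  have q: "real q > 0" using assms by simp
  have s: "(1 - z) * (\<Sum>m\<in>{a..<c}. cis (2 * pi * real (b * m) / real q)) = (if a \<le> c then z ^ a - z ^ c else 0)"
  proof -
    have "cis (2 * pi * real (b * m) / real q) = z ^ m" for m
      unfolding z_def \<theta>_def DeMoivre by (simp add: field_simps)
    hence "(\<Sum>m\<in>{a..<c}. cis (2 * pi * real (b * m) / real q)) = (\<Sum>m\<in>{a..<c}. z ^ m)" by simp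
    moreover have "(1 - z) * (\<Sum>m\<in>{a..<c}. z ^ m) = (\<Sum>m\<in>{a..<c}. z ^ m - z ^ Suc m)"
      by (simp add: sum_distrib_left algebra_simps)
    moreover have "(\<Sum>m\<in>{a..<c}. z ^ m - z ^ Suc m) = z ^ a - z ^ c" if "a \<le> c"
      using sum_Suc_diff'[OF that, of "\<lambda>m. - (z ^ m)"] by simp
    ultimately show ?thesis by auto
  qed
  have nz: "norm z = 1" unfolding z_def by simp
  have "norm ((1 - z) * (\<Sum>m\<in>{a..<c}. cis (2 * pi * real (b * m) / real q))) \<le> 2"
    unfolding s using norm_triangle_ineq4[of "z ^ a" "z ^ c"] by (simp add: norm_power nz)
  hence le: "norm (1 - z) * norm (\<Sum>m\<in>{a..<c}. cis (2 * pi * real (b * m) / real q)) \<le> 2"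
    by (simp add: norm_mult)
  have th: "0 < \<theta>" "\<theta> < pi" using assms q unfolding \<theta>_def by (auto simp: field_simps)
  have nz1: "norm (1 - z) = 2 * sin \<theta>"
  proof -
    have "(norm (1 - z))\<^sup>2 = (1 - cos (2*\<theta>))\<^sup>2 + (sin (2 * \<theta>))\<^sup>2"
      unfolding z_def cmod_power2 by simp
    also have "\<dots> = 2 - 2 * cos (2 * \<theta>)"
      using sin_cos_squared_add[of "2*\<theta>"] by (simp add: power2_eq_square algebra_simps)
    also have "\<dots> = (2 * sin \<theta>)\<^sup>2" by (simp add: cos_double_sin power_mult_distrib)
    finally show ?thesis by (rule power2_eq_imp_eq) (use th sin_ge_zero[of \<theta>] in auto)
  qed
  have *: "2 * sin \<theta> * (real q / real b + real q / real (q - b)) \<ge> 2"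
  proof -
    define D where "D = real (q - b)"
    have D: "D = real q - real b" "D > 0" using assms unfolding D_def by (auto simp: of_nat_diff)
    \<comment> \<open>\<open>pi >= 3\<close> cancels the factor 1/3 lost in
      \<open>sin_ge_third\<close>.\<close>
    have pi3: "pi \<ge> 3" using sin_30 sin_x_le_x[of "pi / 6"] by simp
    have fin: "2 * s * (A + B) \<ge> 2" if "s * A \<ge> 1" "s * B \<ge> 0" for s A B :: real
      using that by (simp add: algebra_simps)
    have fin': "2 * s * (A + B) \<ge> 2" if "s * B \<ge> 1" "s * A \<ge> 0" for s A B :: real
      using that by (simp add: algebra_simps)
    have s0: "sin \<theta> \<ge> 0" using th by (simp add: sin_ge_zero)
    consider "\<theta> \<le> pi / 2" | "pi - \<theta> \<le> pi / 2" by linarith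
    thus ?thesis unfolding D_def[symmetric]
    proof cases
      case 1
      have "\<theta> / 3 \<le> sin \<theta>" by (rule sin_ge_third) (use th 1 in auto)
      hence "\<theta> / 3 * (real q / real b) \<le> sin \<theta> * (real q / real b)" by (rule mult_right_mono) auto
      moreover have "\<theta> / 3 * (real q / real b) = pi / 3" using assms unfolding \<theta>_def by simp
      ultimately have "1 \<le> sin \<theta> * (real q / real b)" using pi3 by linarith
      thus "2 \<le> 2 * sin \<theta> * (real q / real b + real q / D)" by (rule fin) (use s0 D in auto)
    next
      case 2
      have e: "pi - \<theta> = pi * D / real q" using q unfolding \<theta>_def D(1) by (simp add: field_simps)
      have "(pi - \<theta>) / 3 \<le> sin (pi - \<theta>)" by (rule sin_ge_third) (use th 2 in auto)
      hence "pi * D / real q / 3 \<le> sin \<theta>" unfolding e[symmetric] sin_pi_minus .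
      hence "pi * D / real q / 3 * (real q / D) \<le> sin \<theta> * (real q / D)" by (rule mult_right_mono) (use D q in auto)
      moreover have "pi * D / real q / 3 * (real q / D) = pi / 3" using D(2) q by simp
      ultimately have "1 \<le> sin \<theta> * (real q / D)" using pi3 by linarith
      thus "2 \<le> 2 * sin \<theta> * (real q / real b + real q / D)" by (rule fin') (use s0 in auto)
    qed
  qed
  have pos: "0 < 2 * sin \<theta>" using th sin_gt_zero by auto
  have "2 * sin \<theta> * norm (\<Sum>m\<in>{a..<c}. cis (2 * pi * real (b * m) / real q))
     \<le> 2 * sin \<theta> * (real q / real b + real q / real (q - b))"
    using order.trans[OF le[unfolded nz1] *] .
  thus ?thesis unfolding mult_le_cancel_left_pos[OF pos] .
qed

text \<open>Expressing \<open>\<chi> m\<close> through Gauss sums replaces the incomplete character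
  sum by incomplete geometric sums. Their bounds add up to \<open>2 q\<close> times a harmonic sum,
  and division by the norm \<open>sqrt q\<close> of the Gauss sum leaves the claim.\<close>

theorem polya_vinogradov:
  assumes "primitive_character q \<chi>" "q > 1"
  shows "norm (\<Sum>m\<in>{a..<c}. \<chi> m) \<le> 2 * sqrt (real q) * (1 + ln (real q))"
proof -
  have \<chi>: "dirichlet_character q \<chi>"
    using assms unfolding primitive_character_def by auto
  have g: "gauss_sum q \<chi> m = gauss_sum q \<chi> 1 * \<chi> m" for m
    using gauss_sum_primitive[OF assms(1), of m] by (simp only: mult.commute)
  have "(\<Sum>m\<in>{a..<c}. gauss_sum q \<chi> m) = gauss_sum q \<chi> 1 * (\<Sum>m\<in>{a..<c}. \<chi> m)"
    unfolding sum_distrib_left by (rule sum.cong[OF refl g])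
  hence "sqrt (real q) * norm (\<Sum>m\<in>{a..<c}. \<chi> m) = norm (\<Sum>m\<in>{a..<c}. gauss_sum q \<chi> m)"
    by (simp only: norm_mult norm_gauss_sum[OF assms(1)])
  also have "(\<Sum>m\<in>{a..<c}. gauss_sum q \<chi> m) = (\<Sum>b<q. cnj (\<chi> b) * (\<Sum>m\<in>{a..<c}. cis (2 * pi * real (b * m) / real q)))"
    unfolding gauss_sum_def sum_distrib_left by (rule sum.swap)
  also have "\<dots> = (\<Sum>b=1..<q. cnj (\<chi> b) * (\<Sum>m\<in>{a..<c}. cis (2 * pi * real (b * m) / real q)))"
  \<comment> \<open>The frequency \<open>b = 0\<close>, whose geometric sum shows no cancellation,
    drops out because \<open>\<chi> 0 = 0\<close> for \<open>q > 1\<close>.\<close>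
  proof (rule sum.mono_neutral_right)
    have "\<chi> 0 = 0" using assms dirichlet_character_eq_0_iff[OF \<chi>, of 0] by auto
    thus "\<forall>b\<in>{..<q} - {1..<q}. cnj (\<chi> b) * (\<Sum>m\<in>{a..<c}. cis (2 * pi * real (b * m) / real q)) = 0"
      by (auto simp: not_less_eq_eq)
  qed auto
  also have "norm \<dots> \<le> (\<Sum>b=1..<q. real q / real b + real q / real (q - b))"
  proof (rule sum_norm_le)
    fix b assume b: "b \<in> {1..<q}"
    have "norm (\<chi> b) * norm (\<Sum>m\<in>{a..<c}. cis (2 * pi * real (b * m) / real q)) \<le> 1 * (real q / real b + real q / real (q - b))"
      using b by (intro mult_mono norm_dirichlet_character_le_1[OF \<chi>] norm_sum_cis_le) auto
    thus "norm (cnj (\<chi> b) * (\<Sum>m\<in>{a..<c}. cis (2 * pi * real (b * m) / real q))) \<le> real q / real b + real q / real (q - b)"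
      by (simp add: norm_mult)
  qed
  also have "\<dots> = 2 * real q * (\<Sum>k=1..q-1. 1 / real k)"
  proof -
    have "(\<Sum>b=1..<q. real q / real (q - b)) = (\<Sum>b=1..<q. real q / real b)"
      by (rule sum.reindex_bij_witness[of _ "\<lambda>b. q - b" "\<lambda>b. q - b"]) auto
    moreover have "(\<Sum>b=1..<q. real q / real b) = real q * (\<Sum>k=1..q-1. 1 / real k)"
      unfolding sum_distrib_left by (rule sum.cong) (use assms in auto)
    ultimately show ?thesis by (simp add: sum.distrib)
  qed
  also have "(\<Sum>k=1..q-1. 1 / real k) \<le> (1 + ln (real q))"
  proof -
    have "(\<Sum>k=1..q-1. 1 / real k) \<le> 1 + ln (real (q - 1))" using assms by (intro sum_inverse_le_one_plus_ln) auto
    also have "\<dots> \<le> 1 + ln (real q)" using assms by simp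
    finally show ?thesis .
  qed
  hence "2 * real q * (\<Sum>k=1..q-1. 1 / real k) \<le> 2 * real q * (1 + ln (real q))" by (rule mult_left_mono) simp
  also have "2 * real q * (1 + ln (real q)) = sqrt (real q) * (2 * sqrt (real q) * (1 + ln (real q)))"
  proof -
    have "2 * (s * s) * K = s * (2 * s * K)" for s K :: real by simp
    from this[of "sqrt (real q)" "1 + ln (real q)"] show ?thesis
      by (simp only: real_sqrt_mult_self abs_of_nat)
  qed
  finally have *: "sqrt (real q) * norm (\<Sum>m\<in>{a..<c}. \<chi> m) \<le> sqrt (real q) * (2 * sqrt (real q) * (1 + ln (real q)))" .
  have "0 < sqrt (real q)" using assms(2) by simp
  from * show ?thesis unfolding mult_le_cancel_left_pos[OF \<open>0 < sqrt (real q)\<close>] .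
qed

section \<open>A variance bound for divisor counts\<close>

lemma mod_eq_imp_eq_nat:
  fixes a b t :: nat assumes "a mod t = b mod t" "a < b + t" "b < a + t"
  shows "a = b"
proof (rule ccontr)
  assume "a \<noteq> b"
  have *: False if "x < y" "y < x + t" "x mod t = y mod t" for x y :: nat
  proof -
    have "t dvd y - x" using mod_eq_dvd_iff_nat[of x y t] that by auto
    hence "t \<le> y - x" using that by (intro dvd_imp_le) auto
    thus False using that by linarith
  qed
  show False using *[of a b] *[of b a] assms \<open>a \<noteq> b\<close> by linarith
qed

text \<open>Induction over the length: a block of \<open>t\<close> consecutive integers meets the
  class exactly once, a remainder shorter than \<open>t\<close> at most once.\<close>

lemma card_residue_class_interval:
  fixes A L t c :: nat assumes "t > 0"
  shows "\<bar>real (card {n\<in>{A..<A+L}. n mod t = c mod t}) - real L / real t\<bar> \<le> 1"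
proof (induction L arbitrary: A rule: less_induct)
  case (less L)
  define S where "S A L = {n\<in>{A..<A+L}. n mod t = c mod t}" for A L
  have finS: "finite (S A L)" for A L unfolding S_def by simp
  have le1: "card (S A L) \<le> 1" if "L \<le> t" for A L
    unfolding One_nat_def card_le_Suc0_iff_eq[OF finS]
  proof (intro ballI)
    fix a b assume "a \<in> S A L" "b \<in> S A L"
    thus "a = b" using that by (intro mod_eq_imp_eq_nat[of a t b]) (auto simp: S_def)
  qed
  have "\<bar>real (card (S A L)) - real L / real t\<bar> \<le> 1"
  proof (cases "L < t")
    case True
    hence "card (S A L) \<le> 1" by (intro le1) simp
    moreover have "real L / real t < 1" "0 \<le> real L / real t" using True assms by auto
    ultimately show ?thesis by linarith
  next
    case False
    have inj: "inj_on (\<lambda>n. n mod t) {A..<A+t}"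
      by (rule inj_onI, rule mod_eq_imp_eq_nat[of _ t]) auto
    have "(\<lambda>n. n mod t) ` {A..<A+t} = {..<t}"
      by (rule card_subset_eq) (use assms card_image[OF inj] in auto)
    moreover have "c mod t \<in> {..<t}" using assms by simp
    ultimately obtain n0 where n0: "n0 \<in> {A..<A+t}" "n0 mod t = c mod t" by (metis (no_types, lifting) imageE)
    hence "card {n0} \<le> card (S A t)" by (intro card_mono finS) (auto simp: S_def)
    with le1[of t A] have "card (S A t) = 1" by simp
    moreover have "S A L = S A t \<union> S (A + t) (L - t)" "S A t \<inter> S (A + t) (L - t) = {}"
      using False by (auto simp: S_def)
    ultimately have "card (S A L) = 1 + card (S (A + t) (L - t))"
      using card_Un_disjoint[OF finS finS, of A t "A + t" "L - t"] by simp
    moreover have "\<bar>real (card (S (A + t) (L - t))) - real (L - t) / real t\<bar> \<le> 1"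
      using False assms unfolding S_def by (intro less.IH) auto
    moreover have "real (L - t) / real t = real L / real t - 1"
    proof -
      have "real (L - t) = real L - real t" using False by (intro of_nat_diff) simp
      thus ?thesis using assms by (simp add: diff_divide_distrib)
    qed
    ultimately show ?thesis by simp
  qed
  thus ?case unfolding S_def .
qed

lemma nat_interval_eq:
  fixes u v :: real assumes "0 \<le> u" "u \<le> v"
  shows "{l::nat. u < real l \<and> real l \<le> v} = {nat \<lfloor>u\<rfloor> + 1..<nat \<lfloor>u\<rfloor> + 1 + (nat \<lfloor>v\<rfloor> - nat \<lfloor>u\<rfloor>)}"
proof -
  have "nat \<lfloor>u\<rfloor> \<le> nat \<lfloor>v\<rfloor>" using assms by (intro nat_mono floor_mono)
  moreover have "u < real l \<longleftrightarrow> nat \<lfloor>u\<rfloor> + 1 \<le> l" for l :: nat using assms by linarith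
  moreover have "real l \<le> v \<longleftrightarrow> l < nat \<lfloor>v\<rfloor> + 1" for l :: nat using assms by linarith
  ultimately show ?thesis by auto
qed

lemma finite_nat_interval: "finite {l::nat. u < real l \<and> real l \<le> v}"
  by (rule finite_subset[of _ "{..nat \<lfloor>v\<rfloor>}"]) (auto simp: le_nat_floor)

lemma card_nat_interval:
  fixes u v :: real assumes "0 \<le> u" "u \<le> v"
  shows "\<bar>real (card {l::nat. u < real l \<and> real l \<le> v}) - (v - u)\<bar> \<le> 1"
proof -
  have "nat \<lfloor>u\<rfloor> \<le> nat \<lfloor>v\<rfloor>" using assms by (intro nat_mono floor_mono)
  thus ?thesis unfolding nat_interval_eq[OF assms] using assms by simp linarith
qed

lemma card_residue_class_nat_interval:
  fixes u v :: real assumes "0 \<le> u" "u \<le> v" "t > 0"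
  shows "\<bar>real (card {l::nat. u < real l \<and> real l \<le> v \<and> l mod t = c mod t}) - (v - u) / real t\<bar> \<le> 2"
proof -
  define L where "L = nat \<lfloor>v\<rfloor> - nat \<lfloor>u\<rfloor>"
  have "nat \<lfloor>u\<rfloor> \<le> nat \<lfloor>v\<rfloor>" using assms by (intro nat_mono floor_mono)
  hence "\<bar>real L - (v - u)\<bar> \<le> 1" unfolding L_def using assms by linarith
  moreover have "\<bar>real L / real t - (v - u) / real t\<bar> = \<bar>real L - (v - u)\<bar> / real t"
    by (simp add: diff_divide_distrib[symmetric])
  moreover have "\<bar>real L - (v - u)\<bar> / real t \<le> \<bar>real L - (v - u)\<bar> / 1"
    using assms(3) by (intro divide_left_mono) auto
  hence "\<bar>real L - (v - u)\<bar> / real t \<le> \<bar>real L - (v - u)\<bar>" by simp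
  ultimately have "\<bar>real L / real t - (v - u) / real t\<bar> \<le> 1" by linarith
  moreover have e: "{l::nat. u < real l \<and> real l \<le> v \<and> l mod t = c mod t} = {n\<in>{nat \<lfloor>u\<rfloor> + 1..<nat \<lfloor>u\<rfloor> + 1 + L}. n mod t = c mod t}"
    unfolding L_def nat_interval_eq[OF assms(1,2), symmetric] by auto
  ultimately show ?thesis 
    using card_residue_class_interval[OF assms(3), of "nat \<lfloor>u\<rfloor> + 1" L c]
    unfolding e by linarith
qed

text \<open>\<open>j\<close> is invertible modulo \<open>t\<close>, so the divisibility is a single
  residue class for \<open>n\<close>. The error 1 does not grow with the length \<open>L\<close>;
  the gain of the divisor switch rests on this.\<close>

lemma ap_deviation_le:
  fixes A L t l j :: nat assumes "t > 0" "coprime t j"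
  shows "\<bar>(\<Sum>n\<in>{A..<A+L}. (if t dvd l + n * j then 1 else 0) - 1 / real t)\<bar> \<le> 1"
proof -
  obtain i where i: "[j * i = 1] (mod t)"
    using cong_solve_coprime_nat[of j t] assms(2) by (auto simp: coprime_commute)
  \<comment> \<open>Represents \<open>- l / j\<close> modulo \<open>t\<close>, with
    \<open>t - l mod t\<close> standing for \<open>- l\<close>.\<close>
  define c where "c = (t - l mod t) * i"
  have c: "t dvd l + c * j"
  proof -
    have "[c * j = (t - l mod t) * (j * i)] (mod t)" unfolding c_def by (simp only: mult_ac cong_refl)
    also have "[(t - l mod t) * (j * i) = (t - l mod t) * 1] (mod t)" by (rule cong_scalar_left[OF i])
    finally have "[l mod t + c * j = l mod t + (t - l mod t) * 1] (mod t)" by (rule cong_add[OF cong_refl])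
    moreover have "l mod t + (t - l mod t) * 1 = t" using assms(1) by (simp add: less_imp_le)
    ultimately have "[l mod t + c * j = t] (mod t)" by simp
    hence "(l mod t + c * j) mod t = 0" unfolding unique_euclidean_semiring_class.cong_def by simp
    hence "(l + c * j) mod t = 0" by (simp add: mod_add_left_eq)
    thus ?thesis by (rule mod_0_imp_dvd)
  qed
  have iff: "t dvd l + n * j \<longleftrightarrow> n mod t = c mod t" for n
  proof
    assume "t dvd l + n * j"
    hence "[l + n * j = l + c * j] (mod t)" using c unfolding unique_euclidean_semiring_class.cong_def by (simp add: dvd_eq_mod_eq_0)
    hence "[n * j = c * j] (mod t)" by (simp only: cong_add_lcancel_nat)
    hence "[n = c] (mod t)" using assms(2) by (simp add: cong_mult_rcancel_nat coprime_commute)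
    thus "n mod t = c mod t" unfolding unique_euclidean_semiring_class.cong_def .
  next
    assume "n mod t = c mod t"
    hence "[n = c] (mod t)" unfolding unique_euclidean_semiring_class.cong_def .
    hence "[l + n * j = l + c * j] (mod t)" by (intro cong_add cong_refl cong_scalar_right)
    thus "t dvd l + n * j" using c by (simp add: cong_dvd_iff)
  qed
  have "(\<Sum>n\<in>{A..<A+L}. (if t dvd l + n * j then 1 else 0) - 1 / real t) =
    (\<Sum>n\<in>{A..<A+L}. if t dvd l + n * j then 1 else 0) - real L / real t"
    by (simp add: sum_subtractf)
  also have "(\<Sum>n\<in>{A..<A+L}. if t dvd l + n * j then 1 else 0) = real (card {n\<in>{A..<A+L}. n mod t = c mod t})"
    unfolding iff by (simp add: sum.If_cases Int_def)
  finally show ?thesis using card_residue_class_interval[OF assms(1), of A L c] by simp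
qed

section \<open>Second moments of divisor counts over residue classes\<close>

lemma sum_residue_classes_square:
  fixes a :: "nat \<Rightarrow> real" assumes "finite I" "n > 0"
  shows "(\<Sum>b<n. (\<Sum>l\<in>{l\<in>I. l mod n = b}. a l)\<^sup>2) =
    (\<Sum>l\<in>I. (a l)\<^sup>2) + 2 * (\<Sum>l\<in>I. a l * (\<Sum>l'\<in>{l'\<in>I. l < l' \<and> n dvd l' - l}. a l'))"
proof -
  have "(\<Sum>b<n. (\<Sum>l\<in>{l\<in>I. l mod n = b}. a l)\<^sup>2) =
    (\<Sum>b<n. \<Sum>l\<in>{l\<in>I. l mod n = b}. a l * (\<Sum>l'\<in>{l'\<in>I. l' mod n = l mod n}. a l'))"
    by (rule sum.cong[OF refl]) (simp add: power2_eq_square sum_distrib_right)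
  also have "\<dots> = (\<Sum>l\<in>I. a l * (\<Sum>l'\<in>{l'\<in>I. l' mod n = l mod n}. a l'))"
    by (rule sum.group) (use assms in auto)
  also have "\<dots> = (\<Sum>l\<in>I. a l * (a l + (\<Sum>l'\<in>{l'\<in>I. l < l' \<and> n dvd l' - l}. a l') + (\<Sum>l'\<in>{l'\<in>I. l' < l \<and> n dvd l - l'}. a l')))"
  proof (rule sum.cong[OF refl])
    fix l assume l: "l \<in> I"
    let ?A = "{l'\<in>I. l < l' \<and> n dvd l' - l}" and ?B = "{l'\<in>I. l' < l \<and> n dvd l - l'}"
    \<comment> \<open>Splitting the class around \<open>l\<close> keeps the differences
      \<open>l' - l\<close> untruncated; the part below \<open>l\<close> turns into the part above
      when the two variables exchange roles.\<close>
    have "{l'\<in>I. l' mod n = l mod n} = insert l (?A \<union> ?B)"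
    proof (intro equalityI subsetI)
      fix x assume "x \<in> {l'\<in>I. l' mod n = l mod n}"
      thus "x \<in> insert l (?A \<union> ?B)"
        using mod_eq_dvd_iff_nat[of x l n] mod_eq_dvd_iff_nat[of l x n] by (cases x l rule: linorder_cases) auto
    next
      fix x assume "x \<in> insert l (?A \<union> ?B)"
      thus "x \<in> {l'\<in>I. l' mod n = l mod n}"
        using l mod_eq_dvd_iff_nat[of x l n] mod_eq_dvd_iff_nat[of l x n] by auto
    qed
    moreover have "(\<Sum>l'\<in>insert l (?A \<union> ?B). a l') = a l + (sum a ?A + sum a ?B)"
      using assms(1) by (subst sum.insert, simp, simp, subst sum.union_disjoint) auto
    ultimately show "a l * (\<Sum>l'\<in>{l'\<in>I. l' mod n = l mod n}. a l') = a l * (a l + sum a ?A + sum a ?B)" by simp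
  qed
  also have "\<dots> = (\<Sum>l\<in>I. (a l)\<^sup>2) + (\<Sum>l\<in>I. a l * (\<Sum>l'\<in>{l'\<in>I. l < l' \<and> n dvd l' - l}. a l'))
       + (\<Sum>l\<in>I. a l * (\<Sum>l'\<in>{l'\<in>I. l' < l \<and> n dvd l - l'}. a l'))"
    by (simp only: distrib_left sum.distrib power2_eq_square)
  also have "(\<Sum>l\<in>I. a l * (\<Sum>l'\<in>{l'\<in>I. l' < l \<and> n dvd l - l'}. a l')) =
     (\<Sum>l\<in>I. \<Sum>l'\<in>{l'\<in>I. l' < l \<and> n dvd l - l'}. a l * a l')" by (simp only: sum_distrib_left)
  also have "\<dots> = (\<Sum>l'\<in>I. \<Sum>l\<in>{l\<in>I. l' < l \<and> n dvd l - l'}. a l * a l')"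
    by (rule sum.swap_restrict) (use assms in auto)
  also have "\<dots> = (\<Sum>l\<in>I. a l * (\<Sum>l'\<in>{l'\<in>I. l < l' \<and> n dvd l' - l}. a l'))"
    unfolding sum_distrib_left by (intro sum.cong[OF refl] mult.commute)
  finally show ?thesis by simp
qed

text \<open>Centred so that sums over progressions whose difference is coprime to all of
  \<open>T\<close> cancel down to \<open>card T\<close>, whatever their length.\<close>

definition dev_fun :: "nat set \<Rightarrow> nat \<Rightarrow> real" where
  "dev_fun T l = (\<Sum>t\<in>T. (if t dvd l then 1 else 0) - 1 / real t)"

lemma sum_dev_fun_ap_le:
  assumes "finite T" "\<And>t. t \<in> T \<Longrightarrow> t > 0" "\<And>t. t \<in> T \<Longrightarrow> coprime t j"
  shows "\<bar>\<Sum>n\<in>{A..<A+L}. dev_fun T (l + n * j)\<bar> \<le> real (card T)"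
proof -
  have "(\<Sum>n\<in>{A..<A+L}. dev_fun T (l + n * j)) =
     (\<Sum>t\<in>T. \<Sum>n\<in>{A..<A+L}. (if t dvd l + n * j then 1 else 0) - 1 / real t)"
    unfolding dev_fun_def by (rule sum.swap)
  also have "\<bar>\<dots>\<bar> \<le> (\<Sum>t\<in>T. 1)"
    by (rule order.trans[OF sum_abs]) (intro sum_mono ap_deviation_le assms)
  finally show ?thesis by simp
qed

text \<open>The divisor switch: a pair \<open>l < l'\<close> congruent modulo \<open>n\<close> is \<open>l' = l + n j\<close> with a small \<open>j\<close>,
  and for fixed \<open>l, j\<close> the points \<open>l + n j\<close> run through a progression to the modulus \<open>j\<close>.\<close>
lemma sum_dev_fun_switch_le:
  fixes u v :: real and T :: "nat set" and N1 N2 J l :: nat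
  defines "I \<equiv> {l. u < real l \<and> real l \<le> v}"
  assumes "finite T" "\<And>t. t \<in> T \<Longrightarrow> t > 0" "\<And>t j. t \<in> T \<Longrightarrow> j \<in> {1..J} \<Longrightarrow> coprime t j"
  assumes uv: "0 \<le> u" "u \<le> v" "v - u < real (J + 1) * real N1" and N1: "1 \<le> N1" and l: "l \<in> I"
  shows "\<bar>\<Sum>n\<in>{N1..N2}. \<Sum>l'\<in>{l'\<in>I. l < l' \<and> n dvd l' - l}. dev_fun T l'\<bar> \<le> real J * real (card T)"
proof -
  have 1: "(\<Sum>l'\<in>{l'\<in>I. l < l' \<and> n dvd l' - l}. dev_fun T l') = (\<Sum>j\<in>{j\<in>{1..J}. l + n * j \<in> I}. dev_fun T (l + n * j))"
    if n: "n \<in> {N1..N2}" for n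
  proof (rule sum.reindex_bij_witness[of _ "\<lambda>j. l + n * j" "\<lambda>l'. (l' - l) div n"], goal_cases)
    case (1 a)
    thus ?case using n by auto
  next
    case (2 a)
    then obtain k where k: "a - l = n * k" "l < a" "a \<in> I" by (auto elim!: dvdE)
    hence a: "a = l + n * k" by simp
    \<comment> \<open>Otherwise \<open>l' - l = n k\<close> would exceed the length
      \<open>v - u\<close> of \<open>I\<close>; hence only \<open>J\<close> differences
      occur.\<close>
    have "k \<le> J"
    proof (rule ccontr)
      assume "\<not> k \<le> J"
      hence "real (J + 1) * real N1 \<le> real k * real n" using n by (intro mult_mono) auto
      also have "\<dots> = real a - real l" unfolding a by simp
      also have "\<dots> < v - u" using k(3) l unfolding I_def by auto
      finally show False using uv by simp
    qed
    moreover have "k \<ge> 1" using a k(2) by (cases k) auto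
    moreover have "(a - l) div n = k" using k(1) n N1 by simp
    ultimately show ?case using k(3) a by simp
  next
    case (3 b)
    thus ?case using n N1 by simp
  next
    case (4 b)
    thus ?case using n N1 by auto
  next
    case (5 a)
    thus ?case using n by auto
  qed
  have "(\<Sum>n\<in>{N1..N2}. \<Sum>l'\<in>{l'\<in>I. l < l' \<and> n dvd l' - l}. dev_fun T l') =
     (\<Sum>n\<in>{N1..N2}. \<Sum>j\<in>{j\<in>{1..J}. l + n * j \<in> I}. dev_fun T (l + n * j))"
    by (rule sum.cong[OF refl 1])
  also have "\<dots> = (\<Sum>j\<in>{1..J}. \<Sum>n\<in>{n\<in>{N1..N2}. l + n * j \<in> I}. dev_fun T (l + n * j))"
    by (rule sum.swap_restrict) auto
  also have "\<bar>\<dots>\<bar> \<le> (\<Sum>j\<in>{1..J}. real (card T))"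
  proof (rule order.trans[OF sum_abs], rule sum_mono)
    fix j assume j: "j \<in> {1..J}"
    \<comment> \<open>For fixed \<open>j\<close> the point \<open>l + n j\<close> stays in
      \<open>I\<close> exactly for \<open>n <= K\<close>, so \<open>n\<close> runs over an interval
      again.\<close>
    define K where "K = (nat \<lfloor>v\<rfloor> - l) div j"
    have lv: "l \<le> nat \<lfloor>v\<rfloor>" using l unfolding I_def by (auto simp: le_nat_floor)
    have iffK: "l + n * j \<in> I \<longleftrightarrow> n \<le> K" for n
    proof -
      have "l + n * j \<in> I \<longleftrightarrow> real (l + n * j) \<le> v"
      proof -
        have "real l \<le> real (l + n * j)" by simp
        moreover have "u < real l" using l unfolding I_def by simp
        ultimately have "u < real (l + n * j)" by linarith
        thus ?thesis unfolding I_def by blast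
      qed
      also have "\<dots> \<longleftrightarrow> l + n * j \<le> nat \<lfloor>v\<rfloor>" using uv by linarith
      also have "\<dots> \<longleftrightarrow> n * j \<le> nat \<lfloor>v\<rfloor> - l" using lv by linarith
      also have "\<dots> \<longleftrightarrow> n \<le> K" unfolding K_def using j by (simp add: less_eq_div_iff_mult_less_eq)
      finally show ?thesis .
    qed
    have "{n\<in>{N1..N2}. l + n * j \<in> I} = {N1..<N1 + (min (N2 + 1) (K + 1) - N1)}"
      unfolding iffK by (auto simp: min_def)
    thus "\<bar>\<Sum>n\<in>{n\<in>{N1..N2}. l + n * j \<in> I}. dev_fun T (l + n * j)\<bar> \<le> real (card T)"
      using sum_dev_fun_ap_le[where T = T and j = j and A = N1 and L = "min (N2 + 1) (K + 1) - N1" and l = l] assms(2,3,4) j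
      by simp
  qed
  finally show ?thesis by simp
qed

text \<open>On the diagonal \<open>dev_fun\<close> is bounded by \<open>B\<close>. Off the diagonal
  the sum over \<open>n\<close> is moved inside, where the switch bounds it by
  \<open>J * card T\<close> for each \<open>l\<close>.\<close>

lemma variance_dev_fun_le:
  fixes u v B :: real and T :: "nat set" and N1 N2 J :: nat
  defines "I \<equiv> {l. u < real l \<and> real l \<le> v}"
  assumes "finite T" "\<And>t. t \<in> T \<Longrightarrow> t > 0" "\<And>t j. t \<in> T \<Longrightarrow> j \<in> {1..J} \<Longrightarrow> coprime t j"
  assumes uv: "0 \<le> u" "u \<le> v" "v - u < real (J + 1) * real N1" and N1: "1 \<le> N1"
  assumes B: "\<And>l. l \<in> I \<Longrightarrow> \<bar>dev_fun T l\<bar> \<le> B" "B \<ge> 0"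
  shows "(\<Sum>n\<in>{N1..N2}. \<Sum>b<n. (\<Sum>l\<in>{l\<in>I. l mod n = b}. dev_fun T l)\<^sup>2) \<le>
    real (card I) * B\<^sup>2 * real (card {N1..N2}) + 2 * real (card I) * B * real J * real (card T)"
proof -
  have finI: "finite I" unfolding I_def by (rule finite_nat_interval)
  have "(\<Sum>n\<in>{N1..N2}. \<Sum>b<n. (\<Sum>l\<in>{l\<in>I. l mod n = b}. dev_fun T l)\<^sup>2) =
    (\<Sum>n\<in>{N1..N2}. (\<Sum>l\<in>I. (dev_fun T l)\<^sup>2) + 2 * (\<Sum>l\<in>I. dev_fun T l * (\<Sum>l'\<in>{l'\<in>I. l < l' \<and> n dvd l' - l}. dev_fun T l')))"
    by (rule sum.cong[OF refl], rule sum_residue_classes_square[OF finI]) (use N1 in auto)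
  also have "\<dots> = real (card {N1..N2}) * (\<Sum>l\<in>I. (dev_fun T l)\<^sup>2) +
     2 * (\<Sum>n\<in>{N1..N2}. \<Sum>l\<in>I. dev_fun T l * (\<Sum>l'\<in>{l'\<in>I. l < l' \<and> n dvd l' - l}. dev_fun T l'))"
    by (simp only: sum.distrib sum_distrib_left[symmetric] sum_constant)
  also have "(\<Sum>n\<in>{N1..N2}. \<Sum>l\<in>I. dev_fun T l * (\<Sum>l'\<in>{l'\<in>I. l < l' \<and> n dvd l' - l}. dev_fun T l')) =
    (\<Sum>l\<in>I. dev_fun T l * (\<Sum>n\<in>{N1..N2}. \<Sum>l'\<in>{l'\<in>I. l < l' \<and> n dvd l' - l}. dev_fun T l'))"
    by (subst sum.swap) (simp only: sum_distrib_left)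
  finally have eq: "(\<Sum>n\<in>{N1..N2}. \<Sum>b<n. (\<Sum>l\<in>{l\<in>I. l mod n = b}. dev_fun T l)\<^sup>2) =
    real (card {N1..N2}) * (\<Sum>l\<in>I. (dev_fun T l)\<^sup>2) +
     2 * (\<Sum>l\<in>I. dev_fun T l * (\<Sum>n\<in>{N1..N2}. \<Sum>l'\<in>{l'\<in>I. l < l' \<and> n dvd l' - l}. dev_fun T l'))" .
  have b1: "(\<Sum>l\<in>I. dev_fun T l * (\<Sum>n\<in>{N1..N2}. \<Sum>l'\<in>{l'\<in>I. l < l' \<and> n dvd l' - l}. dev_fun T l')) \<le> (\<Sum>l\<in>I. B * (real J * real (card T)))"
  proof (rule sum_mono)
    fix l assume l: "l \<in> I"
    have "dev_fun T l * (\<Sum>n\<in>{N1..N2}. \<Sum>l'\<in>{l'\<in>I. l < l' \<and> n dvd l' - l}. dev_fun T l')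
      \<le> \<bar>dev_fun T l\<bar> * \<bar>\<Sum>n\<in>{N1..N2}. \<Sum>l'\<in>{l'\<in>I. l < l' \<and> n dvd l' - l}. dev_fun T l'\<bar>"
      unfolding abs_mult[symmetric] by (rule abs_ge_self)
    also have "\<dots> \<le> B * (real J * real (card T))"
      using l B(2) assms unfolding I_def
      by (intro mult_mono B(1)[unfolded I_def] sum_dev_fun_switch_le) auto
    finally show "dev_fun T l * (\<Sum>n\<in>{N1..N2}. \<Sum>l'\<in>{l'\<in>I. l < l' \<and> n dvd l' - l}. dev_fun T l') \<le> B * (real J * real (card T))" .
  qed
  have b2: "(\<Sum>l\<in>I. (dev_fun T l)\<^sup>2) \<le> (\<Sum>l\<in>I. B\<^sup>2)"
  proof (rule sum_mono)
    fix l assume l: "l \<in> I"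
    show "(dev_fun T l)\<^sup>2 \<le> B\<^sup>2" using power_mono[OF B(1)[OF l], of 2] by simp
  qed
  show ?thesis unfolding eq
    using mult_left_mono[OF b2, of "real (card {N1..N2})"] b1
    by (simp only: sum_constant) (simp add: mult_ac)
qed

text \<open>In a class modulo \<open>n\<close> the count is the sum of \<open>dev_fun\<close> plus
  \<open>H\<close> times the size of the class, and that size is \<open>(v - u) / n\<close> up to 2.
  The constant 8 is \<open>2 * 2 ^ 2\<close> and arises once for each of the \<open>n <= N2\<close>
  classes.\<close>

lemma variance_divisor_count_le:
  fixes u v B H :: real and T :: "nat set" and N1 N2 J :: nat
  defines "I \<equiv> {l. u < real l \<and> real l \<le> v}"
  defines "H \<equiv> \<Sum>t\<in>T. 1 / real t"
  assumes "finite T" "\<And>t. t \<in> T \<Longrightarrow> t > 0" "\<And>t j. t \<in> T \<Longrightarrow> j \<in> {1..J} \<Longrightarrow> coprime t j"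
  assumes uv: "0 \<le> u" "u \<le> v" "v - u < real (J + 1) * real N1" and N1: "1 \<le> N1"
  assumes B: "\<And>l. l \<in> I \<Longrightarrow> \<bar>dev_fun T l\<bar> \<le> B" "B \<ge> 0"
  shows "(\<Sum>n\<in>{N1..N2}. \<Sum>b<n. (real (card {(t, y). t \<in> T \<and> y \<in> I \<and> t dvd y \<and> y mod n = b}) - H * (v - u) / real n)\<^sup>2) \<le>
    2 * (real (card I) * B\<^sup>2 * real (card {N1..N2}) + 2 * real (card I) * B * real J * real (card T))
     + 8 * H\<^sup>2 * real (card {N1..N2}) * real N2"
proof -
  have finI: "finite I" unfolding I_def by (rule finite_nat_interval)
  have pt: "(real (card {(t, y). t \<in> T \<and> y \<in> I \<and> t dvd y \<and> y mod n = b}) - H * (v - u) / real n)\<^sup>2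
     \<le> 2 * (\<Sum>l\<in>{l\<in>I. l mod n = b}. dev_fun T l)\<^sup>2 + 8 * H\<^sup>2" if n: "n \<in> {N1..N2}" "b < n" for n b
  proof -
    define E where "E = real (card {l\<in>I. l mod n = b}) - (v - u) / real n"
    have "{l\<in>I. l mod n = b} = {l. u < real l \<and> real l \<le> v \<and> l mod n = b mod n}" using n unfolding I_def by auto
    hence E: "\<bar>E\<bar> \<le> 2" unfolding E_def
      using card_residue_class_nat_interval[OF uv(1,2), of n b] n N1 by simp
    have "real (card {(t, y). t \<in> T \<and> y \<in> I \<and> t dvd y \<and> y mod n = b}) = (\<Sum>l\<in>{l\<in>I. l mod n = b}. \<Sum>t\<in>T. if t dvd l then 1 else 0)"
    proof -
      have "{(t, y). t \<in> T \<and> y \<in> I \<and> t dvd y \<and> y mod n = b} = (\<lambda>(y,t). (t,y)) ` (SIGMA y:{l\<in>I. l mod n = b}. {t\<in>T. t dvd y})"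
        by auto
      hence "card {(t, y). t \<in> T \<and> y \<in> I \<and> t dvd y \<and> y mod n = b} = card (SIGMA y:{l\<in>I. l mod n = b}. {t\<in>T. t dvd y})"
        by (simp add: card_image inj_on_def)
      also have "\<dots> = (\<Sum>y\<in>{l\<in>I. l mod n = b}. card {t\<in>T. t dvd y})"
        using finI assms(3) by (intro card_SigmaI) auto
      finally show ?thesis using assms(3) by (simp add: sum.If_cases Int_def)
    qed
    also have "\<dots> = (\<Sum>l\<in>{l\<in>I. l mod n = b}. dev_fun T l + H)"
      unfolding dev_fun_def H_def by (simp only: sum.distrib[symmetric] diff_add_cancel)
    also have "\<dots> = (\<Sum>l\<in>{l\<in>I. l mod n = b}. dev_fun T l) + real (card {l\<in>I. l mod n = b}) * H"
      by (simp only: sum.distrib sum_constant)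
    finally have eq: "real (card {(t, y). t \<in> T \<and> y \<in> I \<and> t dvd y \<and> y mod n = b}) - H * (v - u) / real n
       = (\<Sum>l\<in>{l\<in>I. l mod n = b}. dev_fun T l) + H * E"
      unfolding E_def by (simp add: algebra_simps)
    moreover have "((\<Sum>l\<in>{l\<in>I. l mod n = b}. dev_fun T l) + H * E)\<^sup>2 \<le> 2 * (\<Sum>l\<in>{l\<in>I. l mod n = b}. dev_fun T l)\<^sup>2 + 2 * (H * E)\<^sup>2"
      using sum_squares_bound[of "\<Sum>l\<in>{l\<in>I. l mod n = b}. dev_fun T l" "H * E"] by (simp add: power2_sum)
    moreover have "(H * E)\<^sup>2 \<le> 4 * H\<^sup>2"
      using power_mono[OF E, of 2] mult_left_mono[of "E\<^sup>2" 4 "H\<^sup>2"] by (simp add: power_mult_distrib mult.commute)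
    ultimately show ?thesis unfolding eq by linarith
  qed
  have "(\<Sum>n\<in>{N1..N2}. \<Sum>b<n. (real (card {(t, y). t \<in> T \<and> y \<in> I \<and> t dvd y \<and> y mod n = b}) - H * (v - u) / real n)\<^sup>2)
    \<le> (\<Sum>n\<in>{N1..N2}. \<Sum>b<n. 2 * (\<Sum>l\<in>{l\<in>I. l mod n = b}. dev_fun T l)\<^sup>2 + 8 * H\<^sup>2)"
    by (intro sum_mono pt) auto
  also have "\<dots> = 2 * (\<Sum>n\<in>{N1..N2}. \<Sum>b<n. (\<Sum>l\<in>{l\<in>I. l mod n = b}. dev_fun T l)\<^sup>2) + (\<Sum>n\<in>{N1..N2}. real n * (8 * H\<^sup>2))"
    by (simp add: sum.distrib sum_distrib_left)
  finally have 1: "(\<Sum>n\<in>{N1..N2}. \<Sum>b<n. (real (card {(t, y). t \<in> T \<and> y \<in> I \<and> t dvd y \<and> y mod n = b}) - H * (v - u) / real n)\<^sup>2)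
    \<le> 2 * (\<Sum>n\<in>{N1..N2}. \<Sum>b<n. (\<Sum>l\<in>{l\<in>I. l mod n = b}. dev_fun T l)\<^sup>2) + (\<Sum>n\<in>{N1..N2}. real n * (8 * H\<^sup>2))" .
  have 2: "(\<Sum>n\<in>{N1..N2}. real n * (8 * H\<^sup>2)) \<le> (\<Sum>n\<in>{N1..N2}. real N2 * (8 * H\<^sup>2))"
    by (intro sum_mono mult_right_mono) auto
  have 3: "(\<Sum>n\<in>{N1..N2}. \<Sum>b<n. (\<Sum>l\<in>{l\<in>I. l mod n = b}. dev_fun T l)\<^sup>2) \<le>
     real (card I) * B\<^sup>2 * real (card {N1..N2}) + 2 * real (card I) * B * real J * real (card T)"
    unfolding I_def using assms by (intro variance_dev_fun_le) auto
  have 4: "(\<Sum>n\<in>{N1..N2}. real N2 * (8 * H\<^sup>2)) = 8 * H\<^sup>2 * real (card {N1..N2}) * real N2"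
    by (simp only: sum_constant) (simp only: mult_ac)
  show ?thesis
    by (rule order.trans[OF 1 add_mono[OF mult_left_mono[OF 3] 2[unfolded 4]]]) simp
qed

section \<open>Sieve weights\<close>

lemma not_coprime_obtain_prime_nat:
  fixes a b :: nat assumes "\<not> coprime a b"
  obtains p where "prime p" "p dvd a" "p dvd b"
proof -
  have "gcd a b \<noteq> 1" using assms unfolding coprime_iff_gcd_eq_1 .
  then obtain p where p: "prime p" "p dvd gcd a b" using prime_factor_nat by blast
  show ?thesis by (rule that[OF p(1)]) (use p(2) in auto)
qed

lemma prime_dvd_both_not_coprime_nat:
  fixes a b p :: nat assumes "prime p" "p dvd a" "p dvd b" shows "\<not> coprime a b"
proof
  assume "coprime a b"
  hence "p dvd 1" using assms(2,3) by (rule coprime_common_divisor)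
  thus False using assms(1) by simp
qed

text \<open>For \<open>p\<close> not dividing \<open>q\<close> the values \<open>c1\<close>,
  \<open>c2\<close> at 1 and 2 solve two equations: \<open>1 + c1 + c2 = 0\<close>, so that
  multiples of \<open>p ^ 2\<close> get weight 0, and \<open>c1 / p + c2 / p ^ 2 = 0\<close>, so
  that the local mean is 1, the same as when only exponent 0 is allowed. For \<open>p\<close>
  dividing \<open>q\<close> the local factor is the indicator that \<open>p\<close> does not divide
  \<open>l\<close>.\<close>

definition sf_coeff :: "nat \<Rightarrow> nat \<Rightarrow> nat \<Rightarrow> real" where
  "sf_coeff q p i = (if i = 0 then 1 else if p dvd q then (if i = 1 then -1 else 0)
     else if i = 1 then 1 / (real p - 1) else - real p / (real p - 1))"

definition sf_local :: "nat \<Rightarrow> nat \<Rightarrow> nat \<Rightarrow> real" where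
  "sf_local q p l = (\<Sum>i\<in>{0,1,2}. if p ^ i dvd l then sf_coeff q p i else 0)"

definition sf_weight :: "nat \<Rightarrow> nat set \<Rightarrow> nat \<Rightarrow> real" where
  "sf_weight q Z l = (\<Prod>p\<in>Z. sf_local q p l)"

text \<open>One exponent vector for each term of the expanded Euler product
  \<open>sf_weight\<close>. Vectors instead of divisors keep every sum over terms a product over
  \<open>Z\<close> of three-term sums; \<open>expo_val\<close> is the divisor and
  \<open>expo_coeff\<close> its coefficient.\<close>

definition expo :: "nat set \<Rightarrow> (nat \<Rightarrow> nat) set" where
  "expo Z = (Z \<rightarrow>\<^sub>E {0,1,2})"

definition expo_val :: "nat set \<Rightarrow> (nat \<Rightarrow> nat) \<Rightarrow> nat" where
  "expo_val Z h = (\<Prod>p\<in>Z. p ^ h p)"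

definition expo_coeff :: "nat \<Rightarrow> nat set \<Rightarrow> (nat \<Rightarrow> nat) \<Rightarrow> real" where
  "expo_coeff q Z h = (\<Prod>p\<in>Z. sf_coeff q p (h p))"

lemma finite_expo: "finite Z \<Longrightarrow> finite (expo Z)"
  unfolding expo_def by (intro finite_PiE) auto

lemma sum_expo_prod:
  fixes F :: "nat \<Rightarrow> nat \<Rightarrow> real"
  assumes "finite Z"
  shows "(\<Sum>h\<in>expo Z. \<Prod>p\<in>Z. F p (h p)) = (\<Prod>p\<in>Z. F p 0 + F p 1 + F p 2)"
proof -
  have "(\<Prod>p\<in>Z. F p 0 + F p 1 + F p 2) = (\<Prod>p\<in>Z. \<Sum>i\<in>{0,1,2}. F p i)"
    by (simp add: add.assoc)
  also have "\<dots> = (\<Sum>h\<in>Z \<rightarrow>\<^sub>E {0,1,2}. \<Prod>p\<in>Z. F p (h p))"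
    by (rule prod_sum_PiE) (use assms in auto)
  finally show ?thesis unfolding expo_def by simp
qed

lemma expo_val_pos:
  assumes "\<And>p. p \<in> Z \<Longrightarrow> prime p" shows "expo_val Z h > 0"
  unfolding expo_val_def using assms by (intro prod_pos) (auto intro: prime_gt_0_nat)

lemma expo_val_dvd_iff:
  assumes "finite Z" "\<And>p. p \<in> Z \<Longrightarrow> prime p"
  shows "expo_val Z h dvd l \<longleftrightarrow> (\<forall>p\<in>Z. p ^ h p dvd l)"
  using assms unfolding expo_val_def
proof (induction Z rule: finite_induct)
  case (insert x F)
  have "coprime (x ^ h x) (\<Prod>p\<in>F. p ^ h p)"
  proof (rule prod_coprime_right)
    fix p assume p: "p \<in> F"
    hence "coprime x p" using insert by (intro primes_coprime) auto
    thus "coprime (x ^ h x) (p ^ h p)" by simp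
  qed
  hence "x ^ h x * (\<Prod>p\<in>F. p ^ h p) dvd l \<longleftrightarrow> x ^ h x dvd l \<and> (\<Prod>p\<in>F. p ^ h p) dvd l"
    by (meson divides_mult dvd_mult_left dvd_mult_right)
  thus ?case using insert by simp
qed auto

lemma coprime_expo_val_iff:
  assumes "finite Z" "\<And>p. p \<in> Z \<Longrightarrow> prime p"
  shows "coprime (expo_val Z h) n \<longleftrightarrow> (\<forall>p\<in>Z. p dvd n \<longrightarrow> h p = 0)"
  using assms unfolding expo_val_def
proof (induction Z rule: finite_induct)
  case (insert x F)
  have "coprime (x ^ h x) n \<longleftrightarrow> (x dvd n \<longrightarrow> h x = 0)"
    using insert.prems[of x] by (cases "h x = 0") (auto simp: prime_imp_coprime_nat coprime_absorb_left dest: prime_gt_1_nat)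
  thus ?case using insert by (simp add: coprime_mult_left_iff)
qed auto

lemma sf_weight_eq_sum:
  assumes "finite Z" "\<And>p. p \<in> Z \<Longrightarrow> prime p"
  shows "sf_weight q Z l = (\<Sum>h\<in>expo Z. if expo_val Z h dvd l then expo_coeff q Z h else 0)"
proof -
  have "(\<Sum>h\<in>expo Z. if expo_val Z h dvd l then expo_coeff q Z h else 0) =
    (\<Sum>h\<in>expo Z. \<Prod>p\<in>Z. (if p ^ h p dvd l then sf_coeff q p (h p) else 0))"
  proof (rule sum.cong[OF refl])
    fix h
    show "(if expo_val Z h dvd l then expo_coeff q Z h else 0) = (\<Prod>p\<in>Z. (if p ^ h p dvd l then sf_coeff q p (h p) else 0))"
    proof (cases "expo_val Z h dvd l")
      case True
      hence "\<forall>p\<in>Z. p ^ h p dvd l" using expo_val_dvd_iff[OF assms] by simp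
      thus ?thesis using True unfolding expo_coeff_def by simp
    next
      case False
      then obtain p where "p \<in> Z" "\<not> p ^ h p dvd l" using expo_val_dvd_iff[OF assms, of h l] by auto
      hence "(\<Prod>p\<in>Z. (if p ^ h p dvd l then sf_coeff q p (h p) else 0)) = 0"
        using assms(1) by (intro prod_zero) auto
      thus ?thesis using False by simp
    qed
  qed
  also have "\<dots> = (\<Prod>p\<in>Z. (if p ^ 0 dvd l then sf_coeff q p 0 else 0) + (if p ^ 1 dvd l then sf_coeff q p 1 else 0) + (if p ^ 2 dvd l then sf_coeff q p 2 else 0))"
    by (rule sum_expo_prod[OF assms(1)])
  also have "\<dots> = sf_weight q Z l"
    unfolding sf_weight_def sf_local_def One_nat_def by (simp add: add.assoc)
  finally show ?thesis by simp
qed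

lemma sf_local_eq:
  assumes "prime p"
  shows "sf_local q p l = (if \<not> p dvd l then 1 else if p dvd q \<or> p\<^sup>2 dvd l then 0 else real p / (real p - 1))"
proof -
  have p: "real p - 1 > 0" using assms prime_gt_1_nat[of p] by simp
  have d: "p\<^sup>2 dvd l \<Longrightarrow> p dvd l" by (metis dvd_mult_left power2_eq_square)
  have "1 + 1 / (real p - 1) = real p / (real p - 1)" using p by (simp add: field_simps)
  thus ?thesis using d unfolding sf_local_def sf_coeff_def by (auto simp: add.assoc[symmetric])
qed

lemma sf_weight_nonneg:
  assumes "\<And>p. p \<in> Z \<Longrightarrow> prime p" shows "sf_weight q Z l \<ge> 0"
  unfolding sf_weight_def
proof (rule prod_nonneg)
  fix p assume "p \<in> Z"
  hence p: "prime p" by (rule assms)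
  thus "0 \<le> sf_local q p l" using prime_gt_1_nat[OF p] unfolding sf_local_eq[OF p] by simp
qed

lemma sf_weight_le:
  assumes "finite Z" "\<And>p. p \<in> Z \<Longrightarrow> prime p" "l > 0"
  shows "sf_weight q Z l \<le> real (card (prime_factors l)) + 1"
proof -
  have "sf_weight q Z l \<le> (\<Prod>p\<in>Z. if p dvd l then real p / (real p - 1) else 1)"
    unfolding sf_weight_def
  proof (rule prod_mono)
    fix p assume "p \<in> Z"
    hence p: "prime p" by (rule assms)
    show "0 \<le> sf_local q p l \<and> sf_local q p l \<le> (if p dvd l then real p / (real p - 1) else 1)"
      using prime_gt_1_nat[OF p] unfolding sf_local_eq[OF p] by simp
  qed
  also have "\<dots> = (\<Prod>p\<in>{p\<in>Z. p dvd l}. real p / (real p - 1))"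
    using assms(1) by (simp add: prod.If_cases Int_def)
  also have "\<dots> \<le> real (card {p\<in>Z. p dvd l}) + 1"
    using assms by (intro prod_ratio_pred_le) (auto intro: prime_ge_2_nat)
  also have "card {p\<in>Z. p dvd l} \<le> card (prime_factors l)"
    using assms by (intro card_mono) (auto simp: in_prime_factors_iff)
  finally show ?thesis by simp
qed

text \<open>All primes of \<open>l\<close> lie in \<open>Z\<close>, so a square factor or a prime
  shared with \<open>q\<close> would produce a vanishing local factor.\<close>

lemma sf_weight_nonzeroD:
  assumes "finite Z" "\<And>p. p \<in> Z \<Longrightarrow> prime p" "sf_weight q Z l \<noteq> 0" "l > 0"
    and cov: "\<And>p. prime p \<Longrightarrow> p dvd l \<Longrightarrow> p \<in> Z"
  shows "squarefree l" "coprime l q"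
proof -
  have nz: "\<not> p\<^sup>2 dvd l \<and> \<not> p dvd q" if "prime p" "p dvd l" for p
  proof -
    have "p \<in> Z" using cov that by blast
    hence "sf_local q p l \<noteq> 0" using assms(1,3) unfolding sf_weight_def by (metis prod_zero_iff)
    thus ?thesis using that sf_local_eq[OF that(1), of q l] by (auto split: if_splits)
  qed
  have nz': "\<not> p\<^sup>2 dvd l" if "prime p" for p
    using nz[OF that] that by (metis dvd_mult_left power2_eq_square)
  show "squarefree l"
    unfolding squarefree_factorial_semiring'[OF order.strict_implies_not_eq[OF assms(4), symmetric]]
  proof
    fix p assume "p \<in> prime_factors l"
    hence p: "prime p" "p dvd l" by auto
    have "multiplicity p l < 2" using nz'[OF p(1)] assms(4) p(1)
      by (intro multiplicity_lessI) (auto simp: prime_gt_1_nat not_prime_unit)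
    moreover have "multiplicity p l > 0" using p assms(4) by (simp add: prime_multiplicity_gt_zero_iff)
    ultimately show "multiplicity p l = 1" by simp
  qed
  show "coprime l q"
  proof (rule ccontr)
    assume "\<not> coprime l q"
    then obtain p where "prime p" "p dvd l" "p dvd q" by (rule not_coprime_obtain_prime_nat)
    thus False using nz by blast
  qed
qed

text \<open>A prime dividing \<open>n\<close> keeps only exponent 0; a prime dividing neither
  \<open>n\<close> nor \<open>q\<close> gives 1 by the choice of \<open>sf_coeff\<close>; a prime
  dividing \<open>q\<close> cannot divide \<open>n\<close> and gives \<open>1 - 1/p\<close>. Hence
  the density is the same for all \<open>n\<close> coprime to \<open>q\<close>.\<close>

lemma sum_expo_density:
  assumes "finite Z" "\<And>p. p \<in> Z \<Longrightarrow> prime p" "coprime n q"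
  shows "(\<Sum>h\<in>{h\<in>expo Z. coprime (expo_val Z h) n}. expo_coeff q Z h / real (expo_val Z h)) = (\<Prod>p\<in>{p\<in>Z. p dvd q}. 1 - 1 / real p)"
proof -
  let ?F = "\<lambda>p i. if p dvd n \<and> i \<noteq> 0 then 0 else sf_coeff q p i / real p ^ i"
  have "(\<Sum>h\<in>{h\<in>expo Z. coprime (expo_val Z h) n}. expo_coeff q Z h / real (expo_val Z h)) =
    (\<Sum>h\<in>expo Z. if coprime (expo_val Z h) n then expo_coeff q Z h / real (expo_val Z h) else 0)"
    using finite_expo[OF assms(1)] by (simp add: sum.If_cases Int_def)
  also have "\<dots> = (\<Sum>h\<in>expo Z. \<Prod>p\<in>Z. ?F p (h p))"
  proof (rule sum.cong[OF refl])
    fix h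
    show "(if coprime (expo_val Z h) n then expo_coeff q Z h / real (expo_val Z h) else 0) = (\<Prod>p\<in>Z. ?F p (h p))"
    proof (cases "coprime (expo_val Z h) n")
      case True
      hence "\<forall>p\<in>Z. p dvd n \<longrightarrow> h p = 0" using coprime_expo_val_iff[OF assms(1,2)] by simp
      hence "(\<Prod>p\<in>Z. ?F p (h p)) = (\<Prod>p\<in>Z. sf_coeff q p (h p) / real p ^ h p)" by (intro prod.cong) auto
      thus ?thesis using True unfolding expo_coeff_def expo_val_def by (simp add: prod_dividef)
    next
      case False
      then obtain p where "p \<in> Z" "p dvd n" "h p \<noteq> 0" using coprime_expo_val_iff[OF assms(1,2)] by auto
      hence "?F p (h p) = 0" by simp
      hence "(\<Prod>p\<in>Z. ?F p (h p)) = 0" by (rule prod_zero[OF assms(1) bexI[OF _ \<open>p \<in> Z\<close>]])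
      thus ?thesis using False by simp
    qed
  qed
  also have "\<dots> = (\<Prod>p\<in>Z. ?F p 0 + ?F p 1 + ?F p 2)" by (rule sum_expo_prod[OF assms(1)])
  also have "\<dots> = (\<Prod>p\<in>Z. if p dvd q then 1 - 1 / real p else 1)"
  proof (rule prod.cong[OF refl])
    fix p assume "p \<in> Z"
    hence p: "prime p" by (rule assms)
    have p1: "real p > 1" using prime_gt_1_nat[OF p] by simp
    have "\<not> (p dvd n \<and> p dvd q)" using assms(3) prime_dvd_both_not_coprime_nat[OF p] by blast
    moreover have "1 / (real p - 1) / real p + (- real p / (real p - 1)) / real p ^ 2 = 0"
      using p1 by (simp add: power2_eq_square field_simps)
    ultimately show "?F p 0 + ?F p 1 + ?F p 2 = (if p dvd q then 1 - 1 / real p else 1)"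
      by (auto simp: sf_coeff_def)
  qed
  also have "\<dots> = (\<Prod>p\<in>{p\<in>Z. p dvd q}. 1 - 1 / real p)"
    using assms(1) by (simp add: prod.If_cases Int_def)
  finally show ?thesis .
qed

text \<open>Telescoping against \<open>2 / sqrt\<close>, which up to sign is the primitive of the
  summand.\<close>

lemma sum_inverse_three_halves_le:
  fixes K :: nat assumes "K \<ge> 1"
  shows "(\<Sum>n=2..K. real n powr (-3/2)) \<le> 2 - 2 / sqrt (real K)"
  using assms
proof (induction K rule: nat_induct_at_least)
  case (Suc K)
  define a where "a = sqrt (real K)"
  define b where "b = sqrt (real (Suc K))"
  have ab: "0 < a" "a \<le> b" "b\<^sup>2 = a\<^sup>2 + 1" using Suc.hyps unfolding a_def b_def by auto
  have "real (Suc K) powr (-3/2) = 1 / b ^ 3"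
  proof -
    have "real (Suc K) powr (-3/2) = (real (Suc K) powr (1/2)) powr (-3)" by (simp add: powr_powr)
    also have "\<dots> = b powr (- real 3)" unfolding b_def by (simp add: powr_half_sqrt)
    also have "\<dots> = 1 / b ^ 3" using ab by (subst powr_minus_divide, subst powr_realpow) auto
    finally show ?thesis .
  qed
  also have "\<dots> \<le> 2 / a - 2 / b"
  proof -
    have d: "(b - a) * (b + a) = 1" using ab(3) by (simp add: power2_eq_square algebra_simps)
    have "1 = (b - a) * (b + a)" using d by simp
    also have "\<dots> \<le> (b - a) * (2 * b)" using ab by (intro mult_left_mono) auto
    finally have 1: "1 \<le> 2 * b * (b - a)" by (simp add: mult_ac)
    have "a * (b * b) \<le> b ^ 3" using ab by (simp add: power3_eq_cube mult_mono)
    have "1 / b ^ 3 \<le> (2 * b * (b - a)) / b ^ 3" using 1 ab by (intro divide_right_mono) auto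
    also have "\<dots> \<le> (2 * b * (b - a)) / (a * (b * b))"
      using ab \<open>a * (b * b) \<le> b ^ 3\<close> by (intro divide_left_mono) auto
    also have "\<dots> = 2 / a - 2 / b" using ab by (simp add: field_simps)
    finally show ?thesis .
  qed
  finally have "real (Suc K) powr (-3/2) \<le> 2 / a - 2 / b" .
  thus ?case using Suc.IH Suc.hyps unfolding a_def b_def by simp
qed auto

text \<open>Rankin's trick. The exponent 3/4 is above 1/2, so the terms from \<open>p\<close> and
  from \<open>p ^ 2\<close> are both within a constant of \<open>p powr (-3/2)\<close> when
  \<open>p\<close> does not divide \<open>q\<close>; it is below the natural exponent 1 and leaves
  1/4 to spend. Each prime dividing \<open>q\<close> costs a factor 2, and \<open>exp 8\<close> is
  \<open>exp (4 * 2)\<close>.\<close>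

lemma sum_expo_rankin:
  assumes "finite Z" "\<And>p. p \<in> Z \<Longrightarrow> prime p" "q > 0"
  shows "(\<Sum>h\<in>expo Z. \<bar>expo_coeff q Z h\<bar> * real (expo_val Z h) powr (-3/4)) \<le> exp 8 * 2 ^ card (prime_factors q)"
proof -
  let ?F = "\<lambda>p i. \<bar>sf_coeff q p i\<bar> * (real p ^ i) powr (-3/4)"
  have "(\<Sum>h\<in>expo Z. \<bar>expo_coeff q Z h\<bar> * real (expo_val Z h) powr (-3/4)) = (\<Sum>h\<in>expo Z. \<Prod>p\<in>Z. ?F p (h p))"
    unfolding expo_coeff_def expo_val_def
    by (rule sum.cong[OF refl]) (simp add: prod.distrib abs_prod prod_powr_distrib)
  also have "\<dots> = (\<Prod>p\<in>Z. ?F p 0 + ?F p 1 + ?F p 2)" by (rule sum_expo_prod[OF assms(1)])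
  also have "\<dots> \<le> (\<Prod>p\<in>Z. exp (4 * real p powr (-3/2)) * (if p dvd q then 2 else 1))"
  proof (rule prod_mono, intro conjI)
    fix p assume "p \<in> Z"
    hence p: "prime p" by (rule assms)
    have p2: "real p \<ge> 2" using prime_ge_2_nat[OF p] by simp
    show "0 \<le> ?F p 0 + ?F p 1 + ?F p 2" by simp
    have e1: "real p powr (-3/4) \<le> 1" using powr_mono[of "-3/4" 0 "real p"] p2 by simp
    have ex: "1 \<le> exp (4 * real p powr (-3/2))" by simp
    show "?F p 0 + ?F p 1 + ?F p 2 \<le> exp (4 * real p powr (-3/2)) * (if p dvd q then 2 else 1)"
    proof (cases "p dvd q")
      case True
      have "?F p 0 + ?F p 1 + ?F p 2 = 1 + real p powr (-3/4)" using True by (simp add: sf_coeff_def)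
      also have "\<dots> \<le> exp (4 * real p powr (-3/2)) * 2" using e1 ex by linarith
      finally show ?thesis using True by (simp only: if_True)
    next
      case False
      have "(real p ^ 2) powr (-3/4) = real p powr (-3/2)"
      proof -
        have "real p ^ 2 = real p powr 2" using p2 by (simp add: powr_numeral)
        hence "(real p ^ 2) powr (-3/4) = real p powr (2 * (-3/4))" by (simp only: powr_powr)
        thus ?thesis by simp
      qed
      hence "?F p 0 + ?F p 1 + ?F p 2 = 1 + 1 / (real p - 1) * real p powr (-3/4) + real p / (real p - 1) * real p powr (-3/2)"
        using False p2 by (simp add: sf_coeff_def)
      also have "\<dots> \<le> 1 + 2 * real p powr (-3/2) + 2 * real p powr (-3/2)"
      proof (intro add_mono order.refl)
        have "1 / (real p - 1) \<le> 2 / real p" using p2 by (simp add: field_simps)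
        hence "1 / (real p - 1) * real p powr (-3/4) \<le> 2 / real p * real p powr (-3/4)" by (rule mult_right_mono) simp
        also have "2 / real p * real p powr (-3/4) = 2 * real p powr (-7/4)"
        proof -
          have "real p powr (-7/4) = real p powr (-1) * real p powr (-3/4)" by (subst powr_add[symmetric]) simp
          also have "real p powr (-1) = 1 / real p" using p2 by (subst powr_minus_divide) simp
          finally show ?thesis by simp
        qed
        also have "\<dots> \<le> 2 * real p powr (-3/2)" using p2 by (intro mult_left_mono powr_mono) auto
        finally show "1 / (real p - 1) * real p powr (-3/4) \<le> 2 * real p powr (-3/2)" .
        have "real p / (real p - 1) \<le> 2" using p2 by (simp add: field_simps)
        thus "real p / (real p - 1) * real p powr (-3/2) \<le> 2 * real p powr (-3/2)" by (rule mult_right_mono) simp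
      qed
      also have "\<dots> = 1 + 4 * real p powr (-3/2)" by simp
      also have "\<dots> \<le> exp (4 * real p powr (-3/2))" by (rule exp_ge_add_one_self)
      finally show ?thesis using False by simp
    qed
  qed
  also have "\<dots> = exp (4 * (\<Sum>p\<in>Z. real p powr (-3/2))) * 2 ^ card {p\<in>Z. p dvd q}"
    using assms(1) by (simp add: prod.distrib exp_sum sum_distrib_left prod.If_cases Int_def)
  also have "\<dots> \<le> exp 8 * 2 ^ card (prime_factors q)"
  proof (intro mult_mono)
    define K where "K = Suc (Max (insert 0 Z))"
    have "Z \<subseteq> {2..K}" using assms prime_ge_2_nat unfolding K_def by (auto intro!: le_SucI Max_ge)
    hence "(\<Sum>p\<in>Z. real p powr (-3/2)) \<le> (\<Sum>p=2..K. real p powr (-3/2))" by (intro sum_mono2) auto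
    also have "\<dots> \<le> 2 - 2 / sqrt (real K)" by (rule sum_inverse_three_halves_le) (simp add: K_def)
    also have "\<dots> \<le> 2" by simp
    finally show "exp (4 * (\<Sum>p\<in>Z. real p powr (-3/2))) \<le> exp 8" by simp
    have "card {p\<in>Z. p dvd q} \<le> card (prime_factors q)"
      using assms by (intro card_mono) (auto simp: in_prime_factors_iff)
    thus "(2::real) ^ card {p\<in>Z. p dvd q} \<le> 2 ^ card (prime_factors q)" by (intro power_increasing) auto
  qed auto
  finally show ?thesis .
qed

text \<open>The spare exponent 1/4 is spent in three ways: as a saving for the tail beyond
  \<open>E\<close>, with the opposite sign to afford the larger weight \<open>1 / sqrt e\<close> up
  to \<open>E\<close>, and not at all for the full sum.\<close>

lemma sum_expo_consequences:
  fixes E \<Phi> :: real and q :: nat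
  defines "\<Phi> \<equiv> exp 8 * 2 ^ card (prime_factors q)"
  assumes "finite Z" "\<And>p. p \<in> Z \<Longrightarrow> prime p" "q > 0" "E > 0"
  shows "(\<Sum>h\<in>{h\<in>expo Z. real (expo_val Z h) > E}. \<bar>expo_coeff q Z h\<bar> / real (expo_val Z h)) \<le> E powr (-1/4) * \<Phi>"
    and "(\<Sum>h\<in>{h\<in>expo Z. real (expo_val Z h) \<le> E}. \<bar>expo_coeff q Z h\<bar> / sqrt (real (expo_val Z h))) \<le> E powr (1/4) * \<Phi>"
    and "(\<Sum>h\<in>expo Z. \<bar>expo_coeff q Z h\<bar> / real (expo_val Z h)) \<le> \<Phi>"
proof -
  let ?G = "\<lambda>h. \<bar>expo_coeff q Z h\<bar> * real (expo_val Z h) powr (-3/4)"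
  have tot: "(\<Sum>h\<in>expo Z. ?G h) \<le> \<Phi>" unfolding \<Phi>_def by (rule sum_expo_rankin[OF assms(2,3,4)])
  have v: "real (expo_val Z h) \<ge> 1" for h using expo_val_pos[of Z h] assms(3) by (simp add: Suc_le_eq)
  note fin = finite_expo[OF assms(2)]
  have s0: "real (expo_val Z h) powr (-1) = 1 / real (expo_val Z h)" for h
    using v[of h] by (subst powr_minus_divide) simp
  have s1: "\<bar>c\<bar> / real (expo_val Z h) = real (expo_val Z h) powr (-1/4) * (\<bar>c\<bar> * real (expo_val Z h) powr (-3/4))" for h c
  proof -
    have "real (expo_val Z h) powr (-1/4) * real (expo_val Z h) powr (-3/4) = 1 / real (expo_val Z h)"
      unfolding powr_add[symmetric] s0[symmetric] by simp
    hence "\<bar>c\<bar> * (real (expo_val Z h) powr (-1/4) * real (expo_val Z h) powr (-3/4)) = \<bar>c\<bar> * (1 / real (expo_val Z h))" by simp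
    thus ?thesis by (simp only: mult_ac) simp
  qed
  have s2: "\<bar>c\<bar> / sqrt (real (expo_val Z h)) = real (expo_val Z h) powr (1/4) * (\<bar>c\<bar> * real (expo_val Z h) powr (-3/4))" for h c
  proof -
    have "real (expo_val Z h) powr (1/4) * real (expo_val Z h) powr (-3/4) = real (expo_val Z h) powr (- (1/2))"
      unfolding powr_add[symmetric] by simp
    also have "\<dots> = 1 / sqrt (real (expo_val Z h))"
      by (subst powr_minus_divide) (simp add: powr_half_sqrt)
    finally have "\<bar>c\<bar> * (real (expo_val Z h) powr (1/4) * real (expo_val Z h) powr (-3/4)) = \<bar>c\<bar> * (1 / sqrt (real (expo_val Z h)))" by simp
    thus ?thesis by (simp only: mult_ac) simp
  qed
  have "(\<Sum>h\<in>{h\<in>expo Z. real (expo_val Z h) > E}. \<bar>expo_coeff q Z h\<bar> / real (expo_val Z h))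
     \<le> (\<Sum>h\<in>{h\<in>expo Z. real (expo_val Z h) > E}. E powr (-1/4) * ?G h)"
  proof (rule sum_mono)
    fix h assume h: "h \<in> {h\<in>expo Z. real (expo_val Z h) > E}"
    have "\<bar>expo_coeff q Z h\<bar> / real (expo_val Z h) = real (expo_val Z h) powr (-1/4) * ?G h"
      by (rule s1)
    also have "\<dots> \<le> E powr (-1/4) * ?G h"
      using h assms(5) by (intro mult_right_mono powr_mono2') auto
    finally show "\<bar>expo_coeff q Z h\<bar> / real (expo_val Z h) \<le> E powr (-1/4) * ?G h" .
  qed
  also have "\<dots> \<le> (\<Sum>h\<in>expo Z. E powr (-1/4) * ?G h)" by (rule sum_mono2[OF fin]) auto
  also have "\<dots> \<le> E powr (-1/4) * \<Phi>" unfolding sum_distrib_left[symmetric] by (intro mult_left_mono tot) simp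
  finally show "(\<Sum>h\<in>{h\<in>expo Z. real (expo_val Z h) > E}. \<bar>expo_coeff q Z h\<bar> / real (expo_val Z h)) \<le> E powr (-1/4) * \<Phi>" .
  have "(\<Sum>h\<in>{h\<in>expo Z. real (expo_val Z h) \<le> E}. \<bar>expo_coeff q Z h\<bar> / sqrt (real (expo_val Z h)))
     \<le> (\<Sum>h\<in>{h\<in>expo Z. real (expo_val Z h) \<le> E}. E powr (1/4) * ?G h)"
  proof (rule sum_mono)
    fix h assume h: "h \<in> {h\<in>expo Z. real (expo_val Z h) \<le> E}"
    have "\<bar>expo_coeff q Z h\<bar> / sqrt (real (expo_val Z h)) = real (expo_val Z h) powr (1/4) * ?G h"
      by (rule s2)
    also have "\<dots> \<le> E powr (1/4) * ?G h"
      using h by (intro mult_right_mono powr_mono2) auto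
    finally show "\<bar>expo_coeff q Z h\<bar> / sqrt (real (expo_val Z h)) \<le> E powr (1/4) * ?G h" .
  qed
  also have "\<dots> \<le> (\<Sum>h\<in>expo Z. E powr (1/4) * ?G h)" by (rule sum_mono2[OF fin]) auto
  also have "\<dots> \<le> E powr (1/4) * \<Phi>" unfolding sum_distrib_left[symmetric] by (intro mult_left_mono tot) simp
  finally show "(\<Sum>h\<in>{h\<in>expo Z. real (expo_val Z h) \<le> E}. \<bar>expo_coeff q Z h\<bar> / sqrt (real (expo_val Z h))) \<le> E powr (1/4) * \<Phi>" .
  have "(\<Sum>h\<in>expo Z. \<bar>expo_coeff q Z h\<bar> / real (expo_val Z h)) \<le> (\<Sum>h\<in>expo Z. ?G h)"
  proof (rule sum_mono)
    fix h assume "h \<in> expo Z"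
    have "\<bar>expo_coeff q Z h\<bar> / real (expo_val Z h) = \<bar>expo_coeff q Z h\<bar> * real (expo_val Z h) powr (-1)"
      unfolding s0 by simp
    also have "\<dots> \<le> ?G h" using v[of h] by (intro mult_left_mono powr_mono) auto
    finally show "\<bar>expo_coeff q Z h\<bar> / real (expo_val Z h) \<le> ?G h" .
  qed
  thus "(\<Sum>h\<in>expo Z. \<bar>expo_coeff q Z h\<bar> / real (expo_val Z h)) \<le> \<Phi>" using tot by linarith
qed

section \<open>From coprime pairs to character sums\<close>

text \<open>The range of \<open>k = (m n - q) / r\<close>, up to boundary effects, when
  \<open>m\<close> runs over \<open>(M, 2 M]\<close>, \<open>r\<close> is close to \<open>R\<close>
  and \<open>\<mu> = M / R\<close>.\<close>

definition kwin :: "real \<Rightarrow> nat \<Rightarrow> nat set" where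
  "kwin \<mu> n = {k. \<mu> * real n < real k \<and> real k \<le> 2 * \<mu> * real n}"

text \<open>The factor \<open>1 / n\<close> is the density, among the moduli \<open>r\<close>, of
  the condition \<open>n | r k + q\<close>.\<close>

definition cop_form :: "(nat \<Rightarrow> complex) \<Rightarrow> real \<Rightarrow> nat set \<Rightarrow> complex" where
  "cop_form \<chi> \<mu> A = (\<Sum>n\<in>A. cnj (\<chi> n) / of_nat n * (\<Sum>k\<in>{k\<in>kwin \<mu> n. coprime n k}. \<chi> k))"

definition full_form :: "(nat \<Rightarrow> complex) \<Rightarrow> real \<Rightarrow> nat set \<Rightarrow> complex" where
  "full_form \<chi> \<mu> A = (\<Sum>n\<in>A. cnj (\<chi> n) / of_nat n * (\<Sum>k\<in>kwin \<mu> n. \<chi> k))"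

definition upto_real :: "real \<Rightarrow> nat set" where
  "upto_real y = {n. 1 \<le> n \<and> real n \<le> y}"

lemma finite_upto_real [simp]: "finite (upto_real y)"
  unfolding upto_real_def by (rule finite_subset[of _ "{..nat \<lfloor>y\<rfloor>}"]) (auto simp: le_nat_floor)

lemma card_upto_real: "y \<ge> 0 \<Longrightarrow> real (card (upto_real y)) \<le> y"
proof -
  assume y: "y \<ge> 0"
  have "upto_real y = {1..nat \<lfloor>y\<rfloor>}" unfolding upto_real_def using y by (auto simp: le_nat_floor) linarith
  thus ?thesis using y by simp
qed

lemma finite_kwin [simp]: "finite (kwin \<mu> n)"
  unfolding kwin_def by (rule finite_nat_interval)

lemma card_kwin:
  assumes "0 \<le> \<mu>" "\<mu> \<le> 1" "n \<ge> 1" shows "real (card (kwin \<mu> n)) \<le> 2 * real n"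
proof -
  have "\<bar>real (card (kwin \<mu> n)) - (2 * \<mu> * real n - \<mu> * real n)\<bar> \<le> 1"
    unfolding kwin_def by (rule card_nat_interval) (use assms in \<open>auto simp: mult_right_mono\<close>)
  moreover have "\<mu> * real n \<le> 1 * real n" using assms by (intro mult_right_mono) auto
  moreover have "1 \<le> real n" using assms by simp
  ultimately show ?thesis by linarith
qed

lemma norm_form_term_le:
  assumes "\<And>n. norm (\<chi> n) \<le> 1" "finite K" "real (card K) \<le> c * real n" "n \<ge> 1"
  shows "norm (cnj (\<chi> n) / of_nat n * (\<Sum>k\<in>K. \<chi> k)) \<le> c"
proof -
  have "norm (\<Sum>k\<in>K. \<chi> k) \<le> (\<Sum>k\<in>K. 1)" by (rule sum_norm_le) (rule assms)
  also have "\<dots> \<le> c * real n" using assms by simp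
  finally have 1: "norm (\<Sum>k\<in>K. \<chi> k) \<le> c * real n" .
  have "norm (cnj (\<chi> n) / of_nat n * (\<Sum>k\<in>K. \<chi> k)) = norm (\<chi> n) * (norm (\<Sum>k\<in>K. \<chi> k) / real n)"
    by (simp add: norm_mult norm_divide)
  also have "\<dots> \<le> 1 * (norm (\<Sum>k\<in>K. \<chi> k) / real n)" by (intro mult_right_mono assms(1)) auto
  also have "\<dots> \<le> c" using 1 assms(4) by (simp add: field_simps)
  finally show ?thesis .
qed

lemma norm_cop_form_term_le:
  assumes "\<And>n. norm (\<chi> n) \<le> 1" "0 \<le> \<mu>" "\<mu> \<le> 1" "n \<ge> 1"
  shows "norm (cnj (\<chi> n) / of_nat n * (\<Sum>k\<in>{k\<in>kwin \<mu> n. coprime n k}. \<chi> k)) \<le> 2"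
proof (rule norm_form_term_le)
  have "real (card {k\<in>kwin \<mu> n. coprime n k}) \<le> real (card (kwin \<mu> n))"
    unfolding of_nat_le_iff by (rule card_mono) auto
  thus "real (card {k\<in>kwin \<mu> n. coprime n k}) \<le> 2 * real n" using card_kwin[OF assms(2-4)] by linarith
qed (use assms in auto)

text \<open>Halve \<open>y\<close> until it drops below \<open>2 * N1\<close>, where each term is at
  most 2. The blocks \<open>[N, 2 N]\<close> are closed at both ends, so a term at
  \<open>n = N\<close> is counted twice; the correction of size 2 is absorbed by
  \<open>4 / N1\<close> because \<open>N >= N1\<close>.\<close>

lemma norm_cop_form_upto_le:
  fixes \<beta> N1 Y :: real
  assumes \<chi>: "\<And>n. norm (\<chi> n) \<le> 1" and \<mu>: "0 \<le> \<mu>" "\<mu> \<le> 1" and N1: "N1 \<ge> 1" and \<beta>: "\<beta> \<ge> 0"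
    and hyp: "\<And>N. N1 \<le> N \<Longrightarrow> N \<le> Y \<Longrightarrow> norm (cop_form \<chi> \<mu> {n. N \<le> real n \<and> real n \<le> 2 * N}) \<le> \<beta> * N"
    and y: "0 \<le> y" "y \<le> 2 * Y"
  shows "norm (cop_form \<chi> \<mu> (upto_real y)) \<le> (\<beta> + 4 / N1) * y + 4 * N1"
proof -
  have "norm (cop_form \<chi> \<mu> (upto_real y)) \<le> (\<beta> + 4 / N1) * y + 4 * N1"
    if "0 \<le> y" "y \<le> 2 * Y" "y \<le> 2 ^ m * N1" for m :: nat and y
    using that
  proof (induction m arbitrary: y)
    case 0
    have "norm (cop_form \<chi> \<mu> (upto_real y)) \<le> (\<Sum>n\<in>upto_real y. 2)"
      unfolding cop_form_def
      by (rule sum_norm_le, rule norm_cop_form_term_le[OF \<chi> \<mu>]) (simp add: upto_real_def)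
    also have "\<dots> \<le> 2 * y" using card_upto_real[OF 0(1)] by simp
    also have "\<dots> \<le> 4 * N1" using 0 N1 by simp
    also have "\<dots> \<le> (\<beta> + 4 / N1) * y + 4 * N1" using 0 N1 \<beta> by simp
    finally show ?case .
  next
    case (Suc m)
    show ?case
    proof (cases "y \<le> 2 ^ m * N1")
      case True
      thus ?thesis using Suc by blast
    next
      case False
      define N where "N = y / 2"
      have yN: "y = 2 * N" unfolding N_def by simp
      show ?thesis
      proof (cases "N1 \<le> N")
        case False
        have "norm (cop_form \<chi> \<mu> (upto_real y)) \<le> (\<Sum>n\<in>upto_real y. 2)"
          unfolding cop_form_def
          by (rule sum_norm_le, rule norm_cop_form_term_le[OF \<chi> \<mu>]) (simp add: upto_real_def)
        also have "\<dots> \<le> 2 * y" using card_upto_real[OF Suc(2)] by simp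
        also have "\<dots> \<le> 4 * N1" using False yN by simp
        also have "\<dots> \<le> (\<beta> + 4 / N1) * y + 4 * N1" using Suc N1 \<beta> by simp
        finally show ?thesis .
      next
        case True
        let ?D = "{n. N \<le> real n \<and> real n \<le> 2 * N}" and ?E = "{n::nat. real n = N}"
        let ?f = "\<lambda>n. cnj (\<chi> n) / of_nat n * (\<Sum>k\<in>{k\<in>kwin \<mu> n. coprime n k}. \<chi> k)"
        have finD: "finite ?D" by (rule finite_subset[of _ "{..nat \<lfloor>2 * N\<rfloor>}"]) (auto simp: le_nat_floor)
        have cE: "card ?E \<le> 1"
          unfolding One_nat_def by (subst card_le_Suc0_iff_eq) (auto intro: finite_subset[OF _ finD] simp: True)
        have N0: "N > 0" using True N1 by linarith
        have un: "upto_real y = upto_real N \<union> (?D - ?E)" unfolding upto_real_def yN using True N1 by auto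
        have "sum ?f (upto_real y) = sum ?f (upto_real N) + sum ?f (?D - ?E)"
          unfolding un
        proof (rule sum.union_disjoint)
          show "upto_real N \<inter> (?D - ?E) = {}" by (auto simp: upto_real_def)
        qed (use finD in simp_all)
        also have "sum ?f (?D - ?E) = sum ?f ?D - sum ?f ?E"
          using N0 by (intro sum_diff finD) auto
        finally have eq: "sum ?f (upto_real y) = sum ?f (upto_real N) + (sum ?f ?D - sum ?f ?E)" .
        have "norm (sum ?f (upto_real y)) \<le> norm (sum ?f (upto_real N)) + (norm (sum ?f ?D) + norm (sum ?f ?E))"
          unfolding eq using norm_triangle_ineq[of "sum ?f (upto_real N)" "sum ?f ?D - sum ?f ?E"] norm_triangle_ineq4[of "sum ?f ?D" "sum ?f ?E"]
          by linarith
        moreover have "norm (sum ?f (upto_real N)) \<le> (\<beta> + 4 / N1) * N + 4 * N1"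
          unfolding cop_form_def[symmetric] using Suc.prems yN N0 by (intro Suc.IH) auto
        moreover have "norm (sum ?f ?D) \<le> \<beta> * N"
          unfolding cop_form_def[symmetric] using Suc.prems yN True by (intro hyp) auto
        moreover have "norm (sum ?f ?E) \<le> 2"
        proof -
          have "norm (sum ?f ?E) \<le> (\<Sum>n\<in>?E. 2)"
            by (rule sum_norm_le, rule norm_cop_form_term_le[OF \<chi> \<mu>]) (use N0 in auto)
          also have "\<dots> \<le> 2" using cE by simp
          finally show ?thesis .
        qed
        moreover have "2 \<le> 4 / N1 * N" using True N1 by (simp add: field_simps)
        moreover have "(\<beta> + 4 / N1) * (2 * N) = 2 * (\<beta> * N) + 2 * (4 / N1 * N)" "(\<beta> + 4 / N1) * N = \<beta> * N + 4 / N1 * N"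
          by (simp_all add: algebra_simps)
        ultimately have "norm (sum ?f (upto_real y)) \<le> (\<beta> + 4 / N1) * (2 * N) + 4 * N1" by linarith
        thus ?thesis unfolding cop_form_def yN .
      qed
    qed
  qed
  moreover obtain m :: nat where "y / N1 < 2 ^ m" using real_arch_pow[of 2 "y / N1"] by auto
  hence "y \<le> 2 ^ m * N1" using N1 by (simp add: field_simps)
  ultimately show ?thesis using y by blast
qed

lemma sum_inverse_squares_le: "K \<ge> 1 \<Longrightarrow> (\<Sum>d=1..K. 1 / (real d)\<^sup>2) \<le> 2 - 1 / real K"
proof (induction K rule: nat_induct_at_least)
  case (Suc K)
  have "1 / (real (Suc K))\<^sup>2 \<le> 1 / (real K * real (Suc K))"
    using Suc.hyps by (intro divide_left_mono) (auto simp: power2_eq_square)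
  also have "\<dots> = 1 / real K - 1 / real (Suc K)" using Suc.hyps by (simp add: field_simps)
  finally show ?case using Suc.IH by simp
qed auto

lemma sum_upto_real_inverse:
  assumes "y \<ge> 1"
  shows "(\<Sum>d\<in>upto_real y. 1 / real d) \<le> 1 + ln y" "(\<Sum>d\<in>upto_real y. 1 / (real d)\<^sup>2) \<le> 2"
proof -
  define K where "K = nat \<lfloor>y\<rfloor>"
  have K: "K \<ge> 1" "real K \<le> y" using assms unfolding K_def by linarith+
  have e: "upto_real y = {1..K}" unfolding upto_real_def K_def using assms by (auto simp: le_nat_floor) linarith
  have "(\<Sum>d=1..K. 1 / real d) \<le> 1 + ln (real K)" using K by (intro sum_inverse_le_one_plus_ln) simp
  also have "\<dots> \<le> 1 + ln y" using K by simp
  finally show "(\<Sum>d\<in>upto_real y. 1 / real d) \<le> 1 + ln y" unfolding e .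
  have "(\<Sum>d=1..K. 1 / (real d)\<^sup>2) \<le> 2 - 1 / real K" by (rule sum_inverse_squares_le[OF K(1)])
  also have "\<dots> \<le> 2" by simp
  finally show "(\<Sum>d\<in>upto_real y. 1 / (real d)\<^sup>2) \<le> 2" unfolding e .
qed

lemma mult_mem_kwin_iff:
  assumes "d > 0" shows "d * k \<in> kwin \<mu> (d * n) \<longleftrightarrow> k \<in> kwin \<mu> n"
proof -
  have "\<mu> * real (d * n) < real (d * k) \<longleftrightarrow> \<mu> * real n < real k"
  proof -
    have "\<mu> * real (d * n) = real d * (\<mu> * real n)" "real (d * k) = real d * real k" by simp_all
    thus ?thesis using assms by (simp only: mult_less_cancel_left_pos of_nat_0_less_iff)
  qed
  moreover have "real (d * k) \<le> 2 * \<mu> * real (d * n) \<longleftrightarrow> real k \<le> 2 * \<mu> * real n"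
  proof -
    have "2 * \<mu> * real (d * n) = real d * (2 * \<mu> * real n)" "real (d * k) = real d * real k" by simp_all
    thus ?thesis using assms by (simp only: mult_le_cancel_left_pos of_nat_0_less_iff)
  qed
  ultimately show ?thesis unfolding kwin_def by simp
qed

text \<open>Every pair \<open>(n, k)\<close> is \<open>(d n', d k')\<close> with \<open>n', k'\<close> coprime, and the form is scale invariant
  up to the factor \<open>1 / d\<close>.\<close>
lemma full_form_eq_sum_cop_form:
  assumes \<chi>: "\<And>m n. \<chi> (m * n) = \<chi> m * \<chi> n" and \<mu>: "\<mu> > 0"
  shows "full_form \<chi> \<mu> (upto_real y) =
    (\<Sum>d\<in>upto_real y. cnj (\<chi> d) * \<chi> d / of_nat d * cop_form \<chi> \<mu> (upto_real (y / real d)))"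
proof -
  define g where "g n k = cnj (\<chi> n) / of_nat n * \<chi> k" for n k
  have gm: "g (d * n) (d * k) = cnj (\<chi> d) * \<chi> d / of_nat d * g n k" for d n k
    unfolding g_def \<chi> by simp
  have "full_form \<chi> \<mu> (upto_real y) = (\<Sum>n\<in>upto_real y. \<Sum>k\<in>kwin \<mu> n. g n k)"
    unfolding full_form_def g_def sum_distrib_left ..
  also have "\<dots> = (\<Sum>(n,k)\<in>(SIGMA n:upto_real y. kwin \<mu> n). g n k)" by (rule sum.Sigma) auto
  also have "\<dots> = (\<Sum>(d,n,k)\<in>(SIGMA d:upto_real y. SIGMA n:upto_real (y / real d). {k\<in>kwin \<mu> n. coprime n k}). cnj (\<chi> d) * \<chi> d / of_nat d * g n k)"
  proof (rule sum.reindex_bij_witness[of _ "\<lambda>(d,n,k). (d * n, d * k)" "\<lambda>(n,k). (gcd n k, n div gcd n k, k div gcd n k)"], goal_cases)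
    case (1 a)
    obtain n k where a: "a = (n, k)" by (cases a)
    have n: "n \<ge> 1" using 1 unfolding a upto_real_def by auto
    thus ?case unfolding a by simp
  next
    case (2 a)
    obtain n k where a: "a = (n, k)" by (cases a)
    define d where "d = gcd n k"
    have n: "n \<ge> 1" "real n \<le> y" and k: "k \<in> kwin \<mu> n" using 2 unfolding a upto_real_def by auto
    have d: "d > 0" using n unfolding d_def by simp
    have nd: "n = d * (n div d)" "k = d * (k div d)" unfolding d_def by simp_all
    have "n div d > 0" using n nd d by (metis gr0I mult_0_right not_one_le_zero)
    moreover have "real (n div d) \<le> y / real d"
    proof -
      have "real n = real d * real (n div d)" using nd(1) by (metis of_nat_mult)
      thus ?thesis using n(2) d by (simp add: field_simps)
    qed
    moreover have "k div d \<in> kwin \<mu> (n div d)" using k nd mult_mem_kwin_iff[OF d, of "k div d" \<mu> "n div d"] by simp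
    moreover have "coprime (n div d) (k div d)" unfolding d_def by (rule div_gcd_coprime) (use n in auto)
    moreover have "real d \<le> y"
    proof -
      have "d \<le> n" using n unfolding d_def by (intro dvd_imp_le) auto
      thus ?thesis using n by linarith
    qed
    ultimately show ?case using d unfolding a prod.case d_def[symmetric] upto_real_def by auto
  next
    case (3 b)
    obtain d n k where b: "b = (d, n, k)" by (cases b)
    have d: "d \<ge> 1" and c: "coprime n k" using 3 unfolding b upto_real_def by auto
    have "gcd (d * n) (d * k) = d" using c by (simp add: gcd_mult_distrib_nat[symmetric])
    thus ?case using d unfolding b by simp
  next
    case (4 b)
    obtain d n k where b: "b = (d, n, k)" by (cases b)
    have d: "d \<ge> 1" and n: "n \<ge> 1" "real n \<le> y / real d" and k: "k \<in> kwin \<mu> n" using 4 unfolding b upto_real_def by auto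
    have "real (d * n) \<le> y" using d n by (simp add: field_simps)
    moreover have "d * k \<in> kwin \<mu> (d * n)" using k d mult_mem_kwin_iff[of d k \<mu> n] by simp
    ultimately show ?case using d n unfolding b upto_real_def by simp
  next
    case (5 a)
    obtain n k where a: "a = (n, k)" by (cases a)
    have "g n k = g (gcd n k * (n div gcd n k)) (gcd n k * (k div gcd n k))" by simp
    thus ?case unfolding a gm by simp
  qed
  also have "\<dots> = (\<Sum>d\<in>upto_real y. \<Sum>(n,k)\<in>(SIGMA n:upto_real (y / real d). {k\<in>kwin \<mu> n. coprime n k}). cnj (\<chi> d) * \<chi> d / of_nat d * g n k)"
    by (subst sum.Sigma) (auto simp: split_def)
  also have "\<dots> = (\<Sum>d\<in>upto_real y. \<Sum>n\<in>upto_real (y / real d). \<Sum>k\<in>{k\<in>kwin \<mu> n. coprime n k}. cnj (\<chi> d) * \<chi> d / of_nat d * g n k)"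
    by (rule sum.cong[OF refl], subst sum.Sigma) (auto simp: split_def)
  also have "\<dots> = (\<Sum>d\<in>upto_real y. cnj (\<chi> d) * \<chi> d / of_nat d * cop_form \<chi> \<mu> (upto_real (y / real d)))"
    unfolding cop_form_def g_def sum_distrib_left ..
  finally show ?thesis .
qed

text \<open>The factor \<open>1 / d\<close> from scaling meets a bound linear in
  \<open>y / d\<close>, so the main part is summed against \<open>1 / d ^ 2\<close>; only the
  constant part \<open>4 * N1\<close> costs a logarithm.\<close>

lemma norm_full_form_upto_le:
  fixes \<beta> N1 Y :: real
  assumes \<chi>m: "\<And>m n. \<chi> (m * n) = \<chi> m * \<chi> n" and \<chi>: "\<And>n. norm (\<chi> n) \<le> 1"
    and \<mu>: "0 < \<mu>" "\<mu> \<le> 1" and N1: "N1 \<ge> 1" and \<beta>: "\<beta> \<ge> 0"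
    and hyp: "\<And>N. N1 \<le> N \<Longrightarrow> N \<le> Y \<Longrightarrow> norm (cop_form \<chi> \<mu> {n. N \<le> real n \<and> real n \<le> 2 * N}) \<le> \<beta> * N"
    and y: "1 \<le> y" "y \<le> 2 * Y"
  shows "norm (full_form \<chi> \<mu> (upto_real y)) \<le> 2 * (\<beta> + 4 / N1) * y + 4 * N1 * (1 + ln y)"
proof -
  define \<beta>' where "\<beta>' = \<beta> + 4 / N1"
  have \<beta>': "\<beta>' \<ge> 0" using \<beta> N1 unfolding \<beta>'_def by simp
  have "norm (full_form \<chi> \<mu> (upto_real y)) \<le> (\<Sum>d\<in>upto_real y. \<beta>' * y * (1 / (real d)\<^sup>2) + 4 * N1 * (1 / real d))"
    unfolding full_form_eq_sum_cop_form[where \<chi> = \<chi>, OF \<chi>m \<mu>(1)]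
  proof (rule sum_norm_le)
    fix d assume d: "d \<in> upto_real y"
    hence d1: "d \<ge> 1" "real d \<le> y" unfolding upto_real_def by auto
    have "y / real d \<le> y / 1" using d1 y by (intro divide_left_mono) auto
    hence "norm (cop_form \<chi> \<mu> (upto_real (y / real d))) \<le> \<beta>' * (y / real d) + 4 * N1"
      unfolding \<beta>'_def using \<mu> y by (intro norm_cop_form_upto_le[OF \<chi> _ _ N1 \<beta> hyp]) auto
    moreover have "norm (cnj (\<chi> d) * \<chi> d / of_nat d) \<le> 1 / real d"
    proof -
      have "norm (\<chi> d) * norm (\<chi> d) \<le> 1 * 1" by (intro mult_mono \<chi>) auto
      thus ?thesis using d1 by (simp add: norm_divide norm_mult divide_right_mono)
    qed
    ultimately have "norm (cnj (\<chi> d) * \<chi> d / of_nat d * cop_form \<chi> \<mu> (upto_real (y / real d))) \<le> 1 / real d * (\<beta>' * (y / real d) + 4 * N1)"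
      unfolding norm_mult[of "cnj (\<chi> d) * \<chi> d / of_nat d"] by (intro mult_mono) auto
    also have "\<dots> = \<beta>' * y * (1 / (real d)\<^sup>2) + 4 * N1 * (1 / real d)"
      using d1 by (simp add: power2_eq_square field_simps)
    finally show "norm (cnj (\<chi> d) * \<chi> d / of_nat d * cop_form \<chi> \<mu> (upto_real (y / real d))) \<le> \<beta>' * y * (1 / (real d)\<^sup>2) + 4 * N1 * (1 / real d)" .
  qed
  also have "\<dots> = \<beta>' * y * (\<Sum>d\<in>upto_real y. 1 / (real d)\<^sup>2) + 4 * N1 * (\<Sum>d\<in>upto_real y. 1 / real d)"
    by (simp only: sum.distrib sum_distrib_left)
  also have "\<dots> \<le> \<beta>' * y * 2 + 4 * N1 * (1 + ln y)"
    using sum_upto_real_inverse[OF y(1)] \<beta>' N1 y by (intro add_mono mult_left_mono) auto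
  finally show ?thesis unfolding \<beta>'_def by (simp add: mult_ac)
qed

text \<open>Cut \<open>(N, 2 N]\<close> into \<open>H\<close> pieces of length \<open>s\<close>. On
  one piece \<open>1 / n\<close> is nearly constant and, with \<open>\<mu>\<close> adapted to the
  piece, \<open>kwin \<mu> n\<close> is nearly \<open>(N, 2 N]\<close>, so the form nearly factors
  into a sum over the piece times \<open>S\<close>. Adding up the pieces gives the square of
  \<open>norm S\<close> with an error of order \<open>N ^ 2 / H\<close>.\<close>

lemma dyadic_sum_square_le:
  fixes \<chi> :: "nat \<Rightarrow> complex" and N B :: real and H :: nat
  defines "S \<equiv> \<Sum>k\<in>{k. N < real k \<and> real k \<le> 2 * N}. \<chi> k"
  assumes \<chi>: "\<And>n. norm (\<chi> n) \<le> 1" and N: "N \<ge> 1" and H: "H \<ge> 1" "real H \<le> N"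
    and hyp: "\<And>\<mu> y. 1/2 \<le> \<mu> \<Longrightarrow> \<mu> \<le> 1 \<Longrightarrow> N \<le> y \<Longrightarrow> y \<le> 2 * N \<Longrightarrow> norm (full_form \<chi> \<mu> (upto_real y)) \<le> B"
  shows "(norm S)\<^sup>2 \<le> 4 * N * real H * B + 24 * N\<^sup>2 / real H"
proof -
  define s where "s = N / real H"
  have s: "s \<ge> 1" "s \<le> N" using H N unfolding s_def by (auto simp: field_simps)
  have Hs: "real H * s = N" using H unfolding s_def by simp
  define y where "y i = N + real i * s" for i :: nat
  define G where "G z = (\<Sum>n\<in>upto_real z. cnj (\<chi> n))" for z
  define I where "I i = {n::nat. y i < real n \<and> real n \<le> y (Suc i)}" for i
  have finI: "finite (I i)" for i unfolding I_def by (rule finite_nat_interval)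
  have yS: "y (Suc i) = y i + s" for i unfolding y_def by (simp add: algebra_simps)
  have y0: "y i \<ge> N" for i unfolding y_def using s by simp
  have un: "upto_real (y (Suc i)) = upto_real (y i) \<union> I i" "upto_real (y i) \<inter> I i = {}" for i
  proof -
    have "y (Suc i) \<ge> y i" using yS s by simp
    moreover have "1 \<le> n" if "y i < real n" for n
    proof -
      have "real n > 1" using that y0[of i] N by linarith
      thus ?thesis by simp
    qed
    ultimately show "upto_real (y (Suc i)) = upto_real (y i) \<union> I i"
      unfolding upto_real_def I_def by (auto intro: order_trans)
    show "upto_real (y i) \<inter> I i = {}" unfolding upto_real_def I_def by auto
  qed
  have G_Suc: "G (y (Suc i)) - G (y i) = (\<Sum>n\<in>I i. cnj (\<chi> n))" for i
    unfolding G_def un(1) by (subst sum.union_disjoint[OF finite_upto_real finI un(2)]) simp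
  have cS: "cnj S = (\<Sum>i<H. \<Sum>n\<in>I i. cnj (\<chi> n))"
  proof -
    have "(\<Sum>i<H. \<Sum>n\<in>I i. cnj (\<chi> n)) = G (y H) - G (y 0)"
      unfolding G_Suc[symmetric] by (rule sum_lessThan_telescope)
    also have "y H = 2 * N" unfolding y_def Hs by simp
    also have "y 0 = N" unfolding y_def by simp
    also have "G (2 * N) - G N = cnj S"
    proof -
      have "upto_real (2 * N) = upto_real N \<union> {k. N < real k \<and> real k \<le> 2 * N}"
        unfolding upto_real_def using N by auto
      moreover have "upto_real N \<inter> {k. N < real k \<and> real k \<le> 2 * N} = {}" unfolding upto_real_def by auto
      ultimately show ?thesis unfolding G_def S_def
        by (simp only:) (subst sum.union_disjoint[OF finite_upto_real finite_nat_interval], simp, simp)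
    qed
    finally show ?thesis by simp
  qed
  have cI: "real (card (I i)) \<le> 2 * s" for i
  proof -
    have "\<bar>real (card (I i)) - (y (Suc i) - y i)\<bar> \<le> 1"
      unfolding I_def using y0[of i] N yS[of i] s by (intro card_nat_interval) auto
    thus ?thesis using yS[of i] s by (simp add: abs_le_iff)
  qed
  have normS: "norm S \<le> 2 * N"
  proof -
    have "norm S \<le> (\<Sum>k\<in>{k::nat. N < real k \<and> real k \<le> 2 * N}. 1)" unfolding S_def by (rule sum_norm_le) (rule \<chi>)
    also have "\<dots> = real (card {k::nat. N < real k \<and> real k \<le> 2 * N})" by simp
    also have "\<dots> \<le> 2 * N"
    proof -
      have "\<bar>real (card {k::nat. N < real k \<and> real k \<le> 2 * N}) - (2 * N - N)\<bar> \<le> 1"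
        using N by (intro card_nat_interval) auto
      thus ?thesis using N by (simp add: abs_le_iff)
    qed
    finally show ?thesis .
  qed
  have piece: "norm (\<Sum>n\<in>I i. cnj (\<chi> n)) * norm S \<le> 4 * N * B + 24 * s\<^sup>2" if i: "i < H" for i
  proof -
    \<comment> \<open>Makes \<open>\<mu> n = N\<close> at the left end of the piece;
      \<open>N <= y i <= 2 N\<close> puts it into \<open>[1/2, 1]\<close>.\<close>
    define \<mu> where "\<mu> = N / y i"
    have yi: "y i \<le> 2 * N" "y (Suc i) \<le> 2 * N"
    proof -
      have "real (Suc i) * s \<le> real H * s" using i s by (intro mult_right_mono) auto
      thus "y (Suc i) \<le> 2 * N" unfolding y_def using Hs by simp
      thus "y i \<le> 2 * N" using yS[of i] s by linarith
    qed
    have ypos: "y i > 0" using y0[of i] N by linarith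
    have \<mu>: "1/2 \<le> \<mu>" "\<mu> \<le> 1" unfolding \<mu>_def using yi y0[of i] ypos by (auto simp: field_simps)
    define L where "L = (\<Sum>n\<in>I i. cnj (\<chi> n) / of_nat n)"
    have nI: "real n \<ge> N" "n \<ge> 1" "real n - y i \<le> s" "0 \<le> real n - y i" if "n \<in> I i" for n
    proof -
      show "real n \<ge> N" using that y0[of i] unfolding I_def by auto
      thus "n \<ge> 1" using N by (metis of_nat_1 of_nat_le_iff order_trans)
      show "real n - y i \<le> s" "0 \<le> real n - y i" using that yS[of i] unfolding I_def by auto
    qed
    have ff: "norm (full_form \<chi> \<mu> (I i)) \<le> 2 * B"
    proof -
      have "full_form \<chi> \<mu> (upto_real (y (Suc i))) = full_form \<chi> \<mu> (upto_real (y i)) + full_form \<chi> \<mu> (I i)"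
        unfolding full_form_def un(1) by (rule sum.union_disjoint[OF finite_upto_real finI un(2)])
      hence "full_form \<chi> \<mu> (I i) = full_form \<chi> \<mu> (upto_real (y (Suc i))) - full_form \<chi> \<mu> (upto_real (y i))" by simp
      moreover have "norm (full_form \<chi> \<mu> (upto_real (y (Suc i)))) \<le> B" "norm (full_form \<chi> \<mu> (upto_real (y i))) \<le> B"
        using yi y0 \<mu> by (auto intro!: hyp)
      ultimately show ?thesis using norm_triangle_ineq4[of "full_form \<chi> \<mu> (upto_real (y (Suc i)))" "full_form \<chi> \<mu> (upto_real (y i))"]
        by simp
    qed
    have inner: "norm ((\<Sum>k\<in>kwin \<mu> n. \<chi> k) - S) \<le> 5 * s" if n: "n \<in> I i" for n
    proof -
      define z where "z = \<mu> * real n"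
      have z: "N \<le> z" "z \<le> N + s"
      proof -
        have "\<mu> * y i = N" unfolding \<mu>_def using ypos by simp
        moreover have "\<mu> * (real n - y i) \<le> 1 * s" using nI[OF n] \<mu> by (intro mult_mono) auto
        moreover have "\<mu> * (real n - y i) \<ge> 0" using nI[OF n] \<mu> by simp
        ultimately show "N \<le> z" "z \<le> N + s" unfolding z_def by (auto simp: algebra_simps)
      qed
      let ?A = "{k::nat. N < real k \<and> real k \<le> z}" and ?M = "{k::nat. z < real k \<and> real k \<le> 2 * N}" and ?C = "{k::nat. 2 * N < real k \<and> real k \<le> 2 * z}"
      have "{k::nat. N < real k \<and> real k \<le> 2 * N} = ?A \<union> ?M" "?A \<inter> ?M = {}" using z s by auto
      hence 1: "S = (\<Sum>k\<in>?A. \<chi> k) + (\<Sum>k\<in>?M. \<chi> k)"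
        unfolding S_def by (simp add: sum.union_disjoint[OF finite_nat_interval finite_nat_interval])
      have "kwin \<mu> n = ?M \<union> ?C" "?M \<inter> ?C = {}" using z s unfolding kwin_def z_def by auto
      hence 2: "(\<Sum>k\<in>kwin \<mu> n. \<chi> k) = (\<Sum>k\<in>?M. \<chi> k) + (\<Sum>k\<in>?C. \<chi> k)"
        by (simp add: sum.union_disjoint[OF finite_nat_interval finite_nat_interval])
      have "norm ((\<Sum>k\<in>kwin \<mu> n. \<chi> k) - S) = norm ((\<Sum>k\<in>?C. \<chi> k) - (\<Sum>k\<in>?A. \<chi> k))" unfolding 1 2 by simp
      also have "\<dots> \<le> norm (\<Sum>k\<in>?C. \<chi> k) + norm (\<Sum>k\<in>?A. \<chi> k)" by (rule norm_triangle_ineq4)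
      also have "\<dots> \<le> (\<Sum>k\<in>?C. 1) + (\<Sum>k\<in>?A. 1)" by (intro add_mono sum_norm_le \<chi>)
      \<comment> \<open>The two gaps have lengths at most \<open>s\<close> and \<open>2 s\<close>;
        counting integers adds 1 to each, and \<open>s >= 1\<close>.\<close>
      also have "\<dots> \<le> 5 * s"
      proof -
        have "\<bar>real (card ?A) - (z - N)\<bar> \<le> 1" "\<bar>real (card ?C) - (2 * z - 2 * N)\<bar> \<le> 1"
          using z N by (auto intro!: card_nat_interval)
        thus ?thesis using z s by (simp add: abs_le_iff)
      qed
      finally show ?thesis .
    qed
    have LS: "norm (L * S) \<le> 2 * B + 10 * s\<^sup>2 / N"
    proof -
      have "L * S = full_form \<chi> \<mu> (I i) - (\<Sum>n\<in>I i. cnj (\<chi> n) / of_nat n * ((\<Sum>k\<in>kwin \<mu> n. \<chi> k) - S))"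
        unfolding L_def full_form_def sum_distrib_right sum_subtractf[symmetric]
        by (rule sum.cong[OF refl]) (simp only: right_diff_distrib diff_diff_eq2 add_diff_cancel_left')
      hence "norm (L * S) \<le> norm (full_form \<chi> \<mu> (I i)) + norm (\<Sum>n\<in>I i. cnj (\<chi> n) / of_nat n * ((\<Sum>k\<in>kwin \<mu> n. \<chi> k) - S))"
        by (simp only: norm_triangle_ineq4)
      also have "norm (\<Sum>n\<in>I i. cnj (\<chi> n) / of_nat n * ((\<Sum>k\<in>kwin \<mu> n. \<chi> k) - S)) \<le> (\<Sum>n\<in>I i. 1 / N * (5 * s))"
      proof (rule sum_norm_le)
        fix n assume n: "n \<in> I i"
        have "norm (cnj (\<chi> n) / of_nat n) \<le> 1 / N"
          using \<chi>[of n] nI[OF n] N by (simp add: norm_divide frac_le)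
        thus "norm (cnj (\<chi> n) / of_nat n * ((\<Sum>k\<in>kwin \<mu> n. \<chi> k) - S)) \<le> 1 / N * (5 * s)"
          unfolding norm_mult[of "cnj (\<chi> n) / of_nat n"] using inner[OF n] N by (intro mult_mono) auto
      qed
      also have "\<dots> = real (card (I i)) * (5 * s / N)" by simp
      also have "\<dots> \<le> 2 * s * (5 * s / N)" using cI[of i] s N by (intro mult_right_mono) auto
      also have "\<dots> = 10 * s\<^sup>2 / N" by (simp add: power2_eq_square)
      finally show ?thesis using ff by simp
    qed
    have AL: "norm ((\<Sum>n\<in>I i. cnj (\<chi> n)) - of_real (y i) * L) \<le> 2 * s\<^sup>2 / N"
    proof -
      have "(\<Sum>n\<in>I i. cnj (\<chi> n)) - of_real (y i) * L = (\<Sum>n\<in>I i. cnj (\<chi> n) * of_real ((real n - y i) / real n))"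
        unfolding L_def sum_distrib_left sum_subtractf[symmetric]
      proof (rule sum.cong[OF refl])
        fix n assume "n \<in> I i"
        hence "n \<ge> 1" by (rule nI)
        thus "cnj (\<chi> n) - complex_of_real (y i) * (cnj (\<chi> n) / of_nat n) = cnj (\<chi> n) * of_real ((real n - y i) / real n)"
          by (simp add: field_simps)
      qed
      also have "norm \<dots> \<le> (\<Sum>n\<in>I i. s / N)"
      proof (rule sum_norm_le)
        fix n assume n: "n \<in> I i"
        have "norm (\<chi> n) * ((real n - y i) / real n) \<le> 1 * (s / N)"
          using \<chi>[of n] nI[OF n] N s by (intro mult_mono frac_le) auto
        moreover have "\<bar>(real n - y i) / real n\<bar> = (real n - y i) / real n" using nI[OF n] by simp
        ultimately show "norm (cnj (\<chi> n) * of_real ((real n - y i) / real n)) \<le> s / N"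
          by (simp only: norm_mult norm_of_real complex_mod_cnj mult_1)
      qed
      also have "\<dots> = real (card (I i)) * (s / N)" by simp
      also have "\<dots> \<le> 2 * s * (s / N)" using cI[of i] s N by (intro mult_right_mono) auto
      finally show ?thesis by (simp add: power2_eq_square)
    qed
    \<comment> \<open>Replaces the sum over the piece by \<open>y i * L\<close>, for which the
      product with \<open>S\<close> is under control; the remainder is estimated with the trivial
      bound for \<open>S\<close>.\<close>
    have "norm (\<Sum>n\<in>I i. cnj (\<chi> n)) * norm S = norm ((of_real (y i) * (L * S)) + ((\<Sum>n\<in>I i. cnj (\<chi> n)) - of_real (y i) * L) * S)"
      unfolding norm_mult[symmetric] by (simp add: algebra_simps)
    also have "\<dots> \<le> norm (of_real (y i) * (L * S)) + norm (((\<Sum>n\<in>I i. cnj (\<chi> n)) - of_real (y i) * L) * S)"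
      by (rule norm_triangle_ineq)
    also have "\<dots> = y i * norm (L * S) + norm ((\<Sum>n\<in>I i. cnj (\<chi> n)) - of_real (y i) * L) * norm S"
      using ypos by (simp only: norm_mult norm_of_real abs_of_pos)
    also have "\<dots> \<le> (2 * N) * (2 * B + 10 * s\<^sup>2 / N) + (2 * s\<^sup>2 / N) * (2 * N)"
      using yi LS AL normS N by (intro add_mono mult_mono) auto
    also have "\<dots> = 4 * N * B + 24 * s\<^sup>2" using N by (simp add: field_simps)
    finally show ?thesis .
  qed
  have "(norm S)\<^sup>2 = norm (cnj S) * norm S" by (simp add: power2_eq_square)
  also have "\<dots> \<le> (\<Sum>i<H. norm (\<Sum>n\<in>I i. cnj (\<chi> n))) * norm S"
    unfolding cS by (intro mult_right_mono norm_sum) auto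
  also have "\<dots> = (\<Sum>i<H. norm (\<Sum>n\<in>I i. cnj (\<chi> n)) * norm S)" by (rule sum_distrib_right)
  also have "\<dots> \<le> (\<Sum>i<H. 4 * N * B + 24 * s\<^sup>2)" by (intro sum_mono piece) auto
  also have "\<dots> = 4 * N * real H * B + 24 * N\<^sup>2 / real H"
    using H unfolding s_def by (simp add: power2_eq_square field_simps)
  finally show ?thesis .
qed

text \<open>Dyadic decomposition of \<open>[1, Y]\<close>. The summand \<open>4 H ^ 2\<close> is for
  the blocks with \<open>N < H\<close>, which are too short to be cut into \<open>H\<close> pieces
  and are bounded trivially.\<close>

theorem char_sum_from_cop_form:
  fixes \<beta> N1 Y :: real and H :: nat
  assumes \<chi>m: "\<And>m n. \<chi> (m * n) = \<chi> m * \<chi> n" and \<chi>: "\<And>n. norm (\<chi> n) \<le> 1"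
    and N1: "N1 \<ge> 1" and \<beta>: "\<beta> \<ge> 0" and H: "H \<ge> 1" and Y: "Y \<ge> 1"
    and hyp: "\<And>\<mu> N. 1/2 \<le> \<mu> \<Longrightarrow> \<mu> \<le> 1 \<Longrightarrow> N1 \<le> N \<Longrightarrow> N \<le> Y \<Longrightarrow>
       norm (cop_form \<chi> \<mu> {n. N \<le> real n \<and> real n \<le> 2 * N}) \<le> \<beta> * N"
  shows "norm (\<Sum>n\<in>upto_real Y. \<chi> n) \<le>
    (2 * ln Y + 3) * sqrt (4 * Y * real H * (2 * (\<beta> + 4 / N1) * Y + 4 * N1 * (1 + ln Y)) + 24 * Y\<^sup>2 / real H + 4 * (real H)\<^sup>2)"
proof -
  define B where "B = 2 * (\<beta> + 4 / N1) * Y + 4 * N1 * (1 + ln Y)"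
  define K where "K = 4 * Y * real H * B + 24 * Y\<^sup>2 / real H + 4 * (real H)\<^sup>2"
  define S where "S N = (\<Sum>k\<in>{k. N < real k \<and> real k \<le> 2 * N}. \<chi> k)" for N :: real
  have B0: "B \<ge> 0" unfolding B_def using N1 \<beta> Y by simp
  have K0: "K \<ge> 0" unfolding K_def using B0 Y by simp
  have Sle: "norm (S N) \<le> sqrt K" if N: "N > 0" "2 * N \<le> Y" for N
  proof (cases "real H \<le> N")
    case True
    have N1': "N \<ge> 1" using True H by (metis of_nat_1 of_nat_le_iff order_trans)
    have "(norm (S N))\<^sup>2 \<le> 4 * N * real H * B + 24 * N\<^sup>2 / real H"
      unfolding S_def
    proof (rule dyadic_sum_square_le[OF \<chi> N1' H True])
      fix \<mu> y :: real assume a: "1/2 \<le> \<mu>" "\<mu> \<le> 1" "N \<le> y" "y \<le> 2 * N"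
      have "norm (full_form \<chi> \<mu> (upto_real y)) \<le> 2 * (\<beta> + 4 / N1) * y + 4 * N1 * (1 + ln y)"
        using a N N1' by (intro norm_full_form_upto_le[where Y = Y, OF \<chi>m \<chi> _ _ N1 \<beta> hyp]) auto
      also have "\<dots> \<le> B" unfolding B_def
        using a N N1' N1 \<beta> by (intro add_mono mult_left_mono) auto
      finally show "norm (full_form \<chi> \<mu> (upto_real y)) \<le> B" .
    qed
    also have "\<dots> \<le> 4 * Y * real H * B + 24 * Y\<^sup>2 / real H"
      using N Y B0 by (intro add_mono mult_right_mono divide_right_mono mult_left_mono power_mono) auto
    also have "\<dots> \<le> K" unfolding K_def by simp
    finally show ?thesis by (rule real_le_rsqrt)
  next
    case False
    have "norm (S N) \<le> (\<Sum>k\<in>{k::nat. N < real k \<and> real k \<le> 2 * N}. 1)" unfolding S_def by (rule sum_norm_le) (rule \<chi>)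
    also have "\<dots> \<le> (\<Sum>k\<in>upto_real (2 * N). 1)"
    proof (rule sum_mono2)
      show "{k::nat. N < real k \<and> real k \<le> 2 * N} \<subseteq> upto_real (2 * N)"
        using N by (auto simp: upto_real_def Suc_le_eq intro!: Nat.gr0I)
    qed simp_all
    also have "\<dots> \<le> 2 * N" using card_upto_real[of "2 * N"] N by simp
    also have "\<dots> \<le> 2 * real H" using False by simp
    finally have "(norm (S N))\<^sup>2 \<le> (2 * real H)\<^sup>2" by (intro power_mono) auto
    also have "\<dots> \<le> K" unfolding K_def using B0 Y by (simp add: power_mult_distrib)
    finally show ?thesis by (rule real_le_rsqrt)
  qed
  have dyadic: "norm (\<Sum>n\<in>upto_real z. \<chi> n) \<le> real m * sqrt K" if "0 < z" "z \<le> Y" "z < 2 ^ m" for m z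
    using that
  proof (induction m arbitrary: z)
    case 0
    hence "upto_real z = {}" unfolding upto_real_def by auto
    thus ?case by simp
  next
    case (Suc m)
    have "upto_real z = upto_real (z / 2) \<union> {k. z / 2 < real k \<and> real k \<le> 2 * (z / 2)}" 
      unfolding upto_real_def using Suc.prems by (auto simp: Suc_le_eq intro!: Nat.gr0I)
    moreover have "upto_real (z / 2) \<inter> {k. z / 2 < real k \<and> real k \<le> 2 * (z / 2)} = {}"
      unfolding upto_real_def by auto
    ultimately have "(\<Sum>n\<in>upto_real z. \<chi> n) = (\<Sum>n\<in>upto_real (z / 2). \<chi> n) + S (z / 2)"
      unfolding S_def using sum.union_disjoint[OF finite_upto_real finite_nat_interval, of "z / 2" "z / 2" "2 * (z / 2)" \<chi>] by simp
    hence "norm (\<Sum>n\<in>upto_real z. \<chi> n) \<le> norm (\<Sum>n\<in>upto_real (z / 2). \<chi> n) + norm (S (z / 2))"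
      by (simp add: norm_triangle_ineq)
    also have "\<dots> \<le> real m * sqrt K + sqrt K"
      using Suc.prems by (intro add_mono Suc.IH Sle) auto
    finally show ?case by (simp add: algebra_simps)
  qed
  \<comment> \<open>The number of halvings after which no positive integer is left, that is
    \<open>2 ^ m > Y\<close>.\<close>
  define m where "m = nat \<lfloor>log 2 Y\<rfloor> + 1"
  have l0: "log 2 Y \<ge> 0" using Y by simp
  have m: "log 2 Y < real m" "real m \<le> log 2 Y + 1" using l0 unfolding m_def by linarith+
  have "Y = 2 powr (log 2 Y)" using Y by simp
  also have "\<dots> < 2 powr (real m)" using m(1) by simp
  also have "\<dots> = 2 ^ m" by (simp add: powr_realpow)
  finally have "norm (\<Sum>n\<in>upto_real Y. \<chi> n) \<le> real m * sqrt K" using Y by (intro dyadic) auto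
  also have "\<dots> \<le> (2 * ln Y + 3) * sqrt K"
  proof (rule mult_right_mono)
    have "log 2 Y = ln Y / ln 2" by (simp add: log_def)
    also have "\<dots> \<le> ln Y / (1/2)" using ln_2_ge Y by (intro divide_left_mono) auto
    finally show "real m \<le> 2 * ln Y + 3" using m(2) by simp
  qed (use K0 in simp)
  finally show ?thesis unfolding K_def B_def .
qed

section \<open>Factorable moduli\<close>

text \<open>Moduli \<open>r = a t l\<close> with \<open>a\<close> in \<open>R1\<close>. The primes
  of \<open>a\<close> and \<open>t\<close> exceed \<open>Lm\<close> and avoid \<open>q\<close>,
  while \<open>short\<close> forces \<open>l <= Lm\<close>; with \<open>cop\<close> the three
  factors are pairwise coprime. For a sieve divisor \<open>e\<close> the quantity
  \<open>t l / e\<close> runs over an interval of length \<open>\<kappa> R / (a e)\<close>. For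
  \<open>e <= Lm\<close>, \<open>long\<close> makes this at least 1 and \<open>ratio_ge\<close>
  makes \<open>N\<close> at most \<open>\<theta>\<close> times it; \<open>ratio_le\<close> makes it
  at most \<open>Lm * N\<close>, so the differences \<open>j\<close> of the divisor switch are at
  most \<open>Lm\<close> and hence coprime to \<open>T\<close>.\<close>

locale moduli =
  fixes q :: nat and N R \<kappa> Lm \<theta> \<omega> :: real and R1 T :: "nat set"
  assumes q_pos: "q > 0" and N_ge: "N \<ge> 1" and R_pos: "R > 0" and kap: "0 < \<kappa>" "\<kappa> \<le> 1"
    and Lm_ge: "Lm \<ge> 1" and theta_ge: "\<theta> \<ge> 1"
    and fin: "finite R1" "finite T"
    and pos: "\<And>a. a \<in> R1 \<Longrightarrow> a > 0" "\<And>t. t \<in> T \<Longrightarrow> t > 0"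
    and R1_prime: "\<And>a p. a \<in> R1 \<Longrightarrow> prime p \<Longrightarrow> p dvd a \<Longrightarrow> Lm < real p \<and> \<not> p dvd q"
    and T_prime: "\<And>t p. t \<in> T \<Longrightarrow> prime p \<Longrightarrow> p dvd t \<Longrightarrow> Lm < real p \<and> \<not> p dvd q"
    and cop: "\<And>a t. a \<in> R1 \<Longrightarrow> t \<in> T \<Longrightarrow> coprime a t"
    and short: "\<And>a t. a \<in> R1 \<Longrightarrow> t \<in> T \<Longrightarrow> (1 + \<kappa>) * R \<le> Lm * real a * real t"
    and long: "\<And>a. a \<in> R1 \<Longrightarrow> Lm * real a \<le> \<kappa> * R"
    and ratio_ge: "\<And>a. a \<in> R1 \<Longrightarrow> Lm * N * real a \<le> \<theta> * (\<kappa> * R)"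
    and ratio_le: "\<And>a. a \<in> R1 \<Longrightarrow> \<kappa> * R \<le> Lm * N * real a"
    and omega: "\<And>a. a \<in> R1 \<Longrightarrow> real (card (prime_factors a)) \<le> \<omega>"
begin

text \<open>Covers every prime that can divide \<open>l\<close>, because
  \<open>l <= Lm\<close>.\<close>

definition Z :: "nat set" where "Z = {p. prime p \<and> real p \<le> Lm}"

definition trip :: "(nat \<times> nat \<times> nat) set" where
  "trip = {(a, t, l). a \<in> R1 \<and> t \<in> T \<and> R < real (a * t * l) \<and> real (a * t * l) \<le> (1 + \<kappa>) * R}"

definition md :: "nat \<times> nat \<times> nat \<Rightarrow> nat" where "md s = (case s of (a, t, l) \<Rightarrow> a * t * l)"

definition wt :: "nat \<times> nat \<times> nat \<Rightarrow> real" where "wt s = (case s of (a, t, l) \<Rightarrow> sf_weight q Z l)"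

definition Wsum :: "nat \<Rightarrow> nat \<Rightarrow> real" where
  "Wsum n k = (\<Sum>s\<in>{s\<in>trip. n dvd md s * k + q}. wt s)"

definition S1 :: real where "S1 = (\<Sum>a\<in>R1. 1 / real a)"
definition H :: real where "H = (\<Sum>t\<in>T. 1 / real t)"
definition cq :: real where "cq = (\<Prod>p\<in>{p\<in>Z. p dvd q}. 1 - 1 / real p)"
definition Phi :: real where "Phi = exp 8 * 2 ^ card (prime_factors q)"
definition ND :: "nat set" where "ND = {n. N \<le> real n \<and> real n \<le> 2 * N}"

lemma finite_Z: "finite Z" and Z_prime: "p \<in> Z \<Longrightarrow> prime p"
  unfolding Z_def by (rule finite_subset[of _ "{..nat \<lfloor>Lm\<rfloor>}"]) (auto simp: le_nat_floor)

lemma ND_eq: "ND = {nat \<lceil>N\<rceil>..nat \<lfloor>2 * N\<rfloor>}"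
  unfolding ND_def using N_ge by (auto simp: le_nat_floor nat_le_iff ceiling_le_iff) linarith

lemma H_nonneg: "H \<ge> 0"
  unfolding H_def by (intro sum_nonneg) simp

lemma finite_ND [simp]: "finite ND" unfolding ND_eq by simp

lemma card_ND: "real (card ND) \<le> 2 * N"
proof -
  have "card ND = nat \<lfloor>2 * N\<rfloor> + 1 - nat \<lceil>N\<rceil>" unfolding ND_eq by simp
  moreover have "nat \<lceil>N\<rceil> \<le> nat \<lfloor>2 * N\<rfloor> + 1" using N_ge by linarith
  ultimately show ?thesis using N_ge by linarith
qed

lemma Phi_ge: "Phi \<ge> 1"
proof -
  have "1 * 1 \<le> exp 8 * (2::real) ^ card (prime_factors q)" by (intro mult_mono) auto
  thus ?thesis unfolding Phi_def by simp
qed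

lemma l_le_Lm:
  assumes "a \<in> R1" "t \<in> T" "real (a * t * l) \<le> (1 + \<kappa>) * R" shows "real l \<le> Lm"
proof -
  have "real a * real t * real l \<le> (real a * real t) * Lm"
    using assms short[OF assms(1,2)] by (simp add: mult_ac)
  moreover have "real a * real t > 0" using pos assms by simp
  ultimately show ?thesis by (simp only: mult_le_cancel_left_pos)
qed

lemma trip_fst_finite: "trip \<subseteq> R1 \<times> T \<times> {..nat \<lfloor>Lm\<rfloor>}"
  unfolding trip_def using l_le_Lm by (auto simp: le_nat_floor simp del: of_nat_mult)

lemma finite_trip: "finite trip"
  by (rule finite_subset[OF trip_fst_finite]) (use fin in auto)

lemma coprime_small:
  assumes "t \<in> T" "0 < j" "real j \<le> Lm" shows "coprime t j"
proof (rule ccontr)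
  assume "\<not> coprime t j"
  then obtain p where p: "prime p" "p dvd t" "p dvd j" by (rule not_coprime_obtain_prime_nat)
  hence "p \<le> j" using assms(2) by (intro dvd_imp_le) auto
  moreover have "Lm < real p" using T_prime[OF assms(1) p(1,2)] by simp
  ultimately show False using assms(3) by simp
qed

lemma coprime_small_R1:
  assumes "a \<in> R1" "0 < j" "real j \<le> Lm" shows "coprime a j"
proof (rule ccontr)
  assume "\<not> coprime a j"
  then obtain p where p: "prime p" "p dvd a" "p dvd j" by (rule not_coprime_obtain_prime_nat)
  hence "p \<le> j" using assms(2) by (intro dvd_imp_le) auto
  moreover have "Lm < real p" using R1_prime[OF assms(1) p(1,2)] by simp
  ultimately show False using assms(3) by simp
qed

text \<open>If \<open>l = t m\<close>, then \<open>m <= Lm\<close> is coprime to \<open>t'\<close>,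
  so \<open>t'\<close> divides \<open>t\<close>; symmetrically \<open>t\<close> divides
  \<open>t'\<close>. A number in range thus has at most one divisor in \<open>T\<close>, which
  bounds \<open>dev_fun\<close> by \<open>1 + H\<close>.\<close>

lemma T_dvd_unique:
  assumes "t \<in> T" "t' \<in> T" "t dvd l" "t' dvd l" "l > 0" "a \<in> R1" "real (a * l) \<le> (1 + \<kappa>) * R"
  shows "t = t'"
proof -
  have *: "t' dvd t" if tt: "t \<in> T" "t' \<in> T" "t dvd l" "t' dvd l" for t t'
  proof -
    obtain m where m: "l = t * m" using tt(3) by blast
    have "m > 0" using m assms(5) by (cases m) auto
    moreover have "real m \<le> Lm"
      using l_le_Lm[OF assms(6) tt(1), of m] assms(7) unfolding m by (simp add: mult_ac)
    ultimately have "coprime t' m" by (intro coprime_small tt)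
    thus ?thesis using tt(4) unfolding m by (simp add: coprime_dvd_mult_left_iff)
  qed
  show ?thesis using *[of t t'] *[of t' t] assms by (intro dvd_antisym) auto
qed

definition Ucount :: "nat \<Rightarrow> (nat \<Rightarrow> nat) \<Rightarrow> nat \<Rightarrow> nat \<Rightarrow> real" where
  "Ucount a h n k = real (card {(t, l). (a, t, l) \<in> trip \<and> expo_val Z h dvd l \<and> n dvd a * t * l * k + q})"

lemma Wsum_eq: "Wsum n k = (\<Sum>a\<in>R1. \<Sum>h\<in>expo Z. expo_coeff q Z h * Ucount a h n k)"
proof -
  let ?TR = "{s\<in>trip. n dvd md s * k + q}"
  let ?A = "\<lambda>a. {(t, l). (a, t, l) \<in> trip \<and> n dvd a * t * l * k + q}"
  have finA: "finite (?A a)" for a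
  proof (rule finite_subset)
    show "?A a \<subseteq> snd ` trip" by force
  qed (use finite_trip in auto)
  have "?TR = Sigma R1 ?A" unfolding md_def trip_def by auto
  hence "Wsum n k = (\<Sum>(a, x)\<in>Sigma R1 ?A. wt (a, x))" unfolding Wsum_def by simp
  also have "\<dots> = (\<Sum>a\<in>R1. \<Sum>x\<in>?A a. wt (a, x))"
    by (rule sum.Sigma[symmetric]) (use fin finA in auto)
  also have "\<dots> = (\<Sum>a\<in>R1. \<Sum>h\<in>expo Z. expo_coeff q Z h * Ucount a h n k)"
  proof (rule sum.cong[OF refl])
    fix a
    have "(\<Sum>x\<in>?A a. wt (a, x)) = (\<Sum>x\<in>?A a. \<Sum>h\<in>expo Z. if expo_val Z h dvd snd x then expo_coeff q Z h else 0)"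
      unfolding wt_def by (rule sum.cong[OF refl]) (auto simp: sf_weight_eq_sum[OF finite_Z Z_prime])
    also have "\<dots> = (\<Sum>h\<in>expo Z. \<Sum>x\<in>?A a. if expo_val Z h dvd snd x then expo_coeff q Z h else 0)" by (rule sum.swap)
    also have "\<dots> = (\<Sum>h\<in>expo Z. expo_coeff q Z h * Ucount a h n k)"
    proof (rule sum.cong[OF refl])
      fix h
      have "(\<Sum>x\<in>?A a. if expo_val Z h dvd snd x then expo_coeff q Z h else 0) = (\<Sum>x\<in>{x\<in>?A a. expo_val Z h dvd snd x}. expo_coeff q Z h)"
        by (rule sum.inter_filter[symmetric, OF finA])
      also have "{x\<in>?A a. expo_val Z h dvd snd x} = {(t, l). (a, t, l) \<in> trip \<and> expo_val Z h dvd l \<and> n dvd a * t * l * k + q}" by auto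
      finally show "(\<Sum>x\<in>?A a. if expo_val Z h dvd snd x then expo_coeff q Z h else 0) = expo_coeff q Z h * Ucount a h n k"
        unfolding Ucount_def by simp
    qed
    finally show "(\<Sum>x\<in>?A a. wt (a, x)) = (\<Sum>h\<in>expo Z. expo_coeff q Z h * Ucount a h n k)" .
  qed
  finally show ?thesis .
qed

definition Iv :: "nat \<Rightarrow> nat \<Rightarrow> nat set" where
  "Iv a e = {y. R / (real a * real e) < real y \<and> real y \<le> (1 + \<kappa>) * R / (real a * real e)}"

text \<open>With \<open>l = e m\<close> and \<open>y = t m\<close>, size and divisibility by
  \<open>n\<close> depend on \<open>y\<close> alone, and \<open>t\<close> survives only in
  \<open>t dvd y\<close>. The count becomes a divisor count over \<open>T\<close> in one residue
  class, the shape treated by the variance bound.\<close>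

lemma Ucount_eq:
  assumes a: "a \<in> R1"
  shows "Ucount a h n k = real (card {(t, y). t \<in> T \<and> y \<in> Iv a (expo_val Z h) \<and> t dvd y \<and> n dvd a * expo_val Z h * k * y + q})"
proof -
  define e where "e = expo_val Z h"
  have e: "e > 0" unfolding e_def using expo_val_pos Z_prime by blast
  have ae: "real a * real e > 0" using pos a e by simp
  have iff: "real a * real e * x \<le> y \<longleftrightarrow> x \<le> y / (real a * real e)" "y < real a * real e * x \<longleftrightarrow> y / (real a * real e) < x" for x y
    using ae by (simp_all add: field_simps)
  have "bij_betw (\<lambda>(t, l). (t, t * (l div e))) {(t, l). (a, t, l) \<in> trip \<and> e dvd l \<and> n dvd a * t * l * k + q}
     {(t, y). t \<in> T \<and> y \<in> Iv a e \<and> t dvd y \<and> n dvd a * e * k * y + q}"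
  proof (rule bij_betw_byWitness[where f' = "\<lambda>(t, y). (t, e * (y div t))"])
    show "\<forall>x\<in>{(t, l). (a, t, l) \<in> trip \<and> e dvd l \<and> n dvd a * t * l * k + q}. (case case x of (t, l) \<Rightarrow> (t, t * (l div e)) of (t, y) \<Rightarrow> (t, e * (y div t))) = x"
      using pos unfolding trip_def by auto
    show "\<forall>x\<in>{(t, y). t \<in> T \<and> y \<in> Iv a e \<and> t dvd y \<and> n dvd a * e * k * y + q}. (case case x of (t, y) \<Rightarrow> (t, e * (y div t)) of (t, l) \<Rightarrow> (t, t * (l div e))) = x"
      using e by auto
    show "(\<lambda>(t, l). (t, t * (l div e))) ` {(t, l). (a, t, l) \<in> trip \<and> e dvd l \<and> n dvd a * t * l * k + q} \<subseteq> {(t, y). t \<in> T \<and> y \<in> Iv a e \<and> t dvd y \<and> n dvd a * e * k * y + q}"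
    proof clarify
      fix t l assume tr: "(a, t, l) \<in> trip" and "e dvd l" and d: "n dvd a * t * l * k + q"
      then obtain m where m: "l = e * m" by blast
      have eq: "real (a * t * l) = real a * real e * real (t * m)" unfolding m by simp
      have "t \<in> T" "R < real a * real e * real (t * m)" "real a * real e * real (t * m) \<le> (1 + \<kappa>) * R"
        using tr unfolding trip_def eq[symmetric] by auto
      moreover have eqn: "a * e * k * (t * m) = a * t * l * k" unfolding m by simp
      have "n dvd a * e * k * (t * m) + q" unfolding eqn by (rule d)
      moreover have "l div e = m" using e m by simp
      ultimately show "t \<in> T \<and> t * (l div e) \<in> Iv a e \<and> t dvd t * (l div e) \<and> n dvd a * e * k * (t * (l div e)) + q"
        unfolding Iv_def iff by simp
    qed
    show "(\<lambda>(t, y). (t, e * (y div t))) ` {(t, y). t \<in> T \<and> y \<in> Iv a e \<and> t dvd y \<and> n dvd a * e * k * y + q} \<subseteq> {(t, l). (a, t, l) \<in> trip \<and> e dvd l \<and> n dvd a * t * l * k + q}"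
    proof clarify
      fix t y assume t: "t \<in> T" and y: "y \<in> Iv a e" and "t dvd y" and d: "n dvd a * e * k * y + q"
      then obtain m where m: "y = t * m" by blast
      have eq: "real (a * t * (e * m)) = real a * real e * real y" unfolding m by simp
      have eqn: "a * t * (e * m) * k = a * e * k * y" unfolding m by simp
      have "n dvd a * t * (e * m) * k + q" unfolding eqn by (rule d)
      moreover have "R < real a * real e * real y" "real a * real e * real y \<le> (1 + \<kappa>) * R"
        using y unfolding Iv_def iff by auto
      moreover have "y div t = m" using pos(2)[OF t] m by simp
      ultimately show "(a, t, e * (y div t)) \<in> trip \<and> e dvd e * (y div t) \<and> n dvd a * t * (e * (y div t)) * k + q"
        using a t unfolding trip_def mem_Collect_eq prod.case by (simp only: eq dvd_triv_left simp_thms)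
    qed
  qed
  from bij_betw_same_card[OF this] show ?thesis unfolding Ucount_def e_def by simp
qed

text \<open>A prime shared by \<open>n\<close> with \<open>a\<close> or \<open>l\<close> would
  divide \<open>q\<close>; and \<open>e\<close>, as a divisor of \<open>l\<close>, is at most
  \<open>Lm\<close>.\<close>

lemma Ucount_eq_0:
  assumes a: "a \<in> R1" and n: "coprime n q" and bad: "\<not> coprime a n \<or> \<not> coprime (expo_val Z h) n \<or> real (expo_val Z h) > Lm"
  shows "Ucount a h n k = 0"
proof -
  have "{(t, l). (a, t, l) \<in> trip \<and> expo_val Z h dvd l \<and> n dvd a * t * l * k + q} = {}"
  proof (rule ccontr)
    assume "\<not> ?thesis"
    then obtain t l where tr: "(a, t, l) \<in> trip" and e: "expo_val Z h dvd l" and d: "n dvd a * t * l * k + q" by auto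
    have l: "l > 0" using tr R_pos unfolding trip_def by (cases l) auto
    have "real l \<le> Lm" using tr l_le_Lm unfolding trip_def by auto
    moreover have "expo_val Z h \<le> l" using e l by (rule dvd_imp_le)
    ultimately have "\<not> real (expo_val Z h) > Lm" by linarith
    hence "\<not> coprime (a * l) n" using bad e by (auto simp: coprime_mult_left_iff dest: coprime_divisors[of "expo_val Z h" l n n])
    then obtain p where p: "prime p" "p dvd a * l" "p dvd n" by (rule not_coprime_obtain_prime_nat)
    have "p dvd a * t * l * k + q" using p(3) d by (rule dvd_trans)
    moreover have "p dvd a * t * l * k" using p(2) by (metis dvd_mult2 mult.assoc mult.commute)
    ultimately have "p dvd q" by (simp add: dvd_add_right_iff)
    thus False using n p prime_dvd_both_not_coprime_nat by blast
  qed
  thus ?thesis unfolding Ucount_def by (simp only: card.empty of_nat_0)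
qed

end

lemma sum_abs_le_sqrt_card:
  fixes x :: "'a \<Rightarrow> real"
  shows "(\<Sum>i\<in>A. \<bar>x i\<bar>) \<le> sqrt (real (card A) * (\<Sum>i\<in>A. (x i)\<^sup>2))"
proof (rule real_le_rsqrt)
  have "(\<Sum>i\<in>A. \<bar>x i\<bar>)\<^sup>2 = (\<Sum>i\<in>A. \<Sum>j\<in>A. \<bar>x i\<bar> * \<bar>x j\<bar>)" by (simp add: power2_eq_square sum_product)
  also have "\<dots> \<le> (\<Sum>i\<in>A. \<Sum>j\<in>A. (x i)\<^sup>2 / 2 + (x j)\<^sup>2 / 2)"
  proof (intro sum_mono)
    fix i j
    show "\<bar>x i\<bar> * \<bar>x j\<bar> \<le> (x i)\<^sup>2 / 2 + (x j)\<^sup>2 / 2"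
      using sum_squares_bound[of "\<bar>x i\<bar>" "\<bar>x j\<bar>"] by simp
  qed
  also have "\<dots> = real (card A) * (\<Sum>i\<in>A. (x i)\<^sup>2)"
    by (simp add: sum.distrib sum_distrib_left[symmetric] sum_divide_distrib[symmetric])
  finally show "(\<Sum>i\<in>A. \<bar>x i\<bar>)\<^sup>2 \<le> real (card A) * (\<Sum>i\<in>A. (x i)\<^sup>2)" .
qed

lemma linear_cong_residue:
  fixes c n q :: nat
  assumes "coprime c n" "n > 0"
  obtains b where "b < n" "\<And>y. n dvd c * y + q \<longleftrightarrow> y mod n = b"
proof -
  obtain i where i: "[c * i = 1] (mod n)" using cong_solve_coprime_nat[OF assms(1)] by auto
  \<comment> \<open>The class of \<open>- q / c\<close> modulo \<open>n\<close>, with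
    \<open>n - q mod n\<close> standing for \<open>- q\<close>.\<close>
  define b where "b = ((n - q mod n) * i) mod n"
  have "[c * b + q = c * ((n - q mod n) * i) + q] (mod n)"
    unfolding b_def by (intro cong_add cong_refl cong_scalar_left) (simp add: unique_euclidean_semiring_class.cong_def)
  also have "c * ((n - q mod n) * i) + q = (n - q mod n) * (c * i) + q" by (simp only: mult_ac)
  also have "[(n - q mod n) * (c * i) + q = (n - q mod n) * 1 + q mod n] (mod n)"
    by (intro cong_add cong_scalar_left i) (simp add: unique_euclidean_semiring_class.cong_def)
  also have "(n - q mod n) * 1 + q mod n = n" using assms(2) by (simp add: less_imp_le)
  finally have bq: "n dvd c * b + q" by (simp add: unique_euclidean_semiring_class.cong_def dvd_eq_mod_eq_0)
  show ?thesis
  proof (rule that[of b])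
    show "b < n" unfolding b_def using assms(2) by simp
    fix y
    show "n dvd c * y + q \<longleftrightarrow> y mod n = b"
    proof
      assume "n dvd c * y + q"
      hence "[c * y + q = c * b + q] (mod n)" using bq by (simp add: unique_euclidean_semiring_class.cong_def dvd_eq_mod_eq_0)
      hence "[c * y = c * b] (mod n)" by (simp only: cong_add_rcancel_nat)
      hence "[y = b] (mod n)" using assms(1) by (simp add: cong_mult_lcancel_nat)
      thus "y mod n = b" using \<open>b < n\<close> by (simp add: unique_euclidean_semiring_class.cong_def)
    next
      assume "y mod n = b"
      hence "[y = b] (mod n)" using \<open>b < n\<close> by (simp add: unique_euclidean_semiring_class.cong_def)
      hence "[c * y + q = c * b + q] (mod n)" by (intro cong_add cong_refl cong_scalar_left)
      thus "n dvd c * y + q" using bq by (simp add: cong_dvd_iff)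
    qed
  qed
qed

section \<open>Mean square of the counts over residue classes\<close>

context moduli
begin

definition cnt :: "nat \<Rightarrow> nat \<Rightarrow> nat \<Rightarrow> nat \<Rightarrow> real" where
  "cnt a e n b = real (card {(t, y). t \<in> T \<and> y \<in> Iv a e \<and> t dvd y \<and> y mod n = b})"

text \<open>Expected value of \<open>cnt\<close>: the density \<open>H\<close> times the length of
  \<open>Iv a e\<close>, shared equally by \<open>n\<close> classes.\<close>

definition Vm :: "nat \<Rightarrow> nat \<Rightarrow> nat \<Rightarrow> real" where
  "Vm a e n = \<kappa> * R * H / (real a * real e * real n)"

lemma Vm_nonneg: "Vm a e n \<ge> 0"
  unfolding Vm_def using kap R_pos H_nonneg by simp

lemma dev_fun_bound:
  assumes a: "a \<in> R1" and e: "e > 0" and l: "l \<in> Iv a e"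
  shows "\<bar>dev_fun T l\<bar> \<le> 1 + H"
proof -
  have ae: "real a * real e > 0" using pos a e by simp
  have l2: "real a * real e * real l \<le> (1 + \<kappa>) * R" "0 < real l"
  proof -
    have "real l \<le> (1 + \<kappa>) * R / (real a * real e)" using l unfolding Iv_def by simp
    thus "real a * real e * real l \<le> (1 + \<kappa>) * R" using ae by (simp add: field_simps)
    have "0 < R / (real a * real e)" using ae R_pos by simp
    thus "0 < real l" using l unfolding Iv_def by auto
  qed
  have "real (a * l) \<le> (1 + \<kappa>) * R"
  proof -
    have "real a * 1 * real l \<le> real a * real e * real l" using e by (intro mult_right_mono mult_left_mono) auto
    thus ?thesis using l2 by simp
  qed
  hence "card {t\<in>T. t dvd l} \<le> 1"
    unfolding One_nat_def using fin(2) T_dvd_unique[OF _ _ _ _ _ a] l2 by (subst card_le_Suc0_iff_eq) auto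
  moreover have "dev_fun T l = real (card {t\<in>T. t dvd l}) - H"
    unfolding dev_fun_def H_def sum_subtractf using fin(2) by (simp add: sum.If_cases Int_def)
  ultimately show ?thesis using H_nonneg by (simp add: abs_le_iff)
qed

text \<open>The variance bound with \<open>J\<close> the integer part of \<open>D / N\<close>, where
  \<open>D\<close> is the length of \<open>Iv a e\<close>. \<open>ratio_le\<close> gives
  \<open>J <= Lm\<close>, hence coprimality to \<open>T\<close>; \<open>ratio_ge\<close> gives
  \<open>N <= \<theta> * D\<close>, so that the \<open>N * N\<close> from the rounding of class
  sizes fits into \<open>\<theta> * D * N\<close>.\<close>

lemma variance_cnt_le:
  fixes e :: nat
  defines "\<Delta> a \<equiv> \<kappa> * R / (real a * real e)"
  assumes a: "a \<in> R1" and e: "e > 0" "real e \<le> Lm"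
  shows "(\<Sum>n\<in>ND. \<Sum>b<n. (cnt a e n b - Vm a e n)\<^sup>2) \<le> 40 * (1 + H)\<^sup>2 * (\<theta> * \<Delta> a * N + (\<Delta> a)\<^sup>2 * real (card T) / N)"
proof -
  define D where "D = \<Delta> a"
  have ae: "real a * real e > 0" using pos a e by simp
  define u where "u = R / (real a * real e)"
  define v where "v = (1 + \<kappa>) * R / (real a * real e)"
  have vu: "v - u = D" unfolding u_def v_def D_def \<Delta>_def by (simp add: diff_divide_distrib[symmetric] algebra_simps)
  have D1: "D \<ge> 1"
  proof -
    have "real a * real e \<le> real a * Lm" using e by (intro mult_left_mono) auto
    also have "\<dots> \<le> \<kappa> * R" using long[OF a] by (simp add: mult.commute)
    finally show ?thesis unfolding D_def \<Delta>_def using ae by simp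
  qed
  have u: "0 \<le> u" "u \<le> v" using vu D1 R_pos ae unfolding u_def by auto
  define J where "J = nat \<lfloor>D / N\<rfloor>"
  have DN: "D / N \<ge> 0" using D1 N_ge by simp
  have J: "real J \<le> D / N" "D / N < real J + 1" using DN unfolding J_def by linarith+
  define N1 where "N1 = nat \<lceil>N\<rceil>"
  define N2 where "N2 = nat \<lfloor>2 * N\<rfloor>"
  have N12: "real N1 \<ge> N" "N1 \<ge> 1" "real N2 \<le> 2 * N" using N_ge unfolding N1_def N2_def by linarith+
  have ND: "ND = {N1..N2}" unfolding ND_eq N1_def N2_def ..
  have cND: "real (card {N1..N2}) \<le> 2 * N" using card_ND unfolding ND .
  have JLm: "D / N \<le> Lm"
  proof -
    have "\<kappa> * R \<le> Lm * N * real a" by (rule ratio_le[OF a])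
    also have "\<dots> \<le> Lm * N * (real a * real e)" using Lm_ge N_ge e by (intro mult_left_mono) (auto simp: mult_le_cancel_left1)
    finally show ?thesis unfolding D_def \<Delta>_def using ae N_ge by (simp add: field_simps)
  qed
  have Iv: "Iv a e = {l. u < real l \<and> real l \<le> v}" unfolding Iv_def u_def v_def ..
  have cI: "real (card (Iv a e)) \<le> 2 * D"
    using card_nat_interval[OF u] D1 unfolding Iv vu by (simp add: abs_le_iff)
  have small: "v - u < real (J + 1) * real N1"
  proof -
    have "D < (real J + 1) * N" using J(2) N_ge by (simp add: field_simps)
    also have "\<dots> \<le> real (J + 1) * real N1" using N12 by (intro mult_mono) auto
    finally show ?thesis unfolding vu .
  qed
  have "(\<Sum>n\<in>{N1..N2}. \<Sum>b<n. (real (card {(t, y). t \<in> T \<and> y \<in> {l. u < real l \<and> real l \<le> v} \<and> t dvd y \<and> y mod n = b}) - (\<Sum>t\<in>T. 1 / real t) * (v - u) / real n)\<^sup>2) \<le>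
    2 * (real (card {l::nat. u < real l \<and> real l \<le> v}) * (1 + H)\<^sup>2 * real (card {N1..N2}) + 2 * real (card {l::nat. u < real l \<and> real l \<le> v}) * (1 + H) * real J * real (card T))
     + 8 * (\<Sum>t\<in>T. 1 / real t)\<^sup>2 * real (card {N1..N2}) * real N2"
  proof (rule variance_divisor_count_le[OF fin(2) pos(2) _ u small N12(2)])
    fix t j assume t: "t \<in> T" "j \<in> {1..J}"
    hence "real j \<le> real J" by simp
    also have "\<dots> \<le> Lm" using J(1) JLm by linarith
    finally show "coprime t j" using t by (intro coprime_small) auto
  next
    fix l assume "l \<in> {l. u < real l \<and> real l \<le> v}"
    thus "\<bar>dev_fun T l\<bar> \<le> 1 + H" using dev_fun_bound[OF a e(1)] Iv by simp
  qed (use H_nonneg in auto)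
  also have "\<dots> \<le> 2 * ((2 * D) * (1 + H)\<^sup>2 * (2 * N) + 2 * (2 * D) * (1 + H) * (D / N) * real (card T)) + 8 * (1 + H)\<^sup>2 * (2 * N) * (2 * N)"
    unfolding Iv[symmetric] H_def[symmetric] using cI cND J N12 H_nonneg D1 N_ge
    by (intro add_mono mult_mono power_mono mult_left_mono) auto
  also have "\<dots> = 8 * (1 + H)\<^sup>2 * (D * N) + 8 * (1 + H) * (D\<^sup>2 * real (card T) / N) + 32 * (1 + H)\<^sup>2 * (N * N)"
    by (simp add: power2_eq_square algebra_simps)
  also have "\<dots> \<le> 8 * (1 + H)\<^sup>2 * (\<theta> * D * N) + 40 * (1 + H)\<^sup>2 * (D\<^sup>2 * real (card T) / N) + 32 * (1 + H)\<^sup>2 * (\<theta> * D * N)"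
  proof -
    have "1 * (D * N) \<le> \<theta> * (D * N)" using theta_ge D1 N_ge by (intro mult_right_mono) auto
    hence p1: "D * N \<le> \<theta> * D * N" by simp
    define Q where "Q = (1 + H) * (1 + H)"
    have "1 * (1 + H) \<le> Q" unfolding Q_def using H_nonneg by (intro mult_right_mono) auto
    hence "40 * (1 * (1 + H)) \<le> 40 * Q" by (rule mult_left_mono) simp
    moreover have "8 * (1 + H) \<le> 40 * (1 * (1 + H))" using H_nonneg by simp
    ultimately have "8 * (1 + H) \<le> 40 * Q" by (rule order.trans[rotated])
    hence p2: "8 * (1 + H) \<le> 40 * (1 + H)\<^sup>2" unfolding Q_def power2_eq_square .
    have p3: "N * N \<le> \<theta> * D * N"
    proof (rule mult_right_mono)
      have "real a * real e * N \<le> real a * Lm * N" using e N_ge by (intro mult_right_mono mult_left_mono) auto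
      also have "\<dots> = Lm * N * real a" by (simp only: mult_ac)
      also have "\<dots> \<le> \<theta> * (\<kappa> * R)" by (rule ratio_ge[OF a])
      finally show "N \<le> \<theta> * D" unfolding D_def \<Delta>_def using ae by (simp add: field_simps)
    qed (use N_ge in simp)
    have "8 * (1 + H)\<^sup>2 * (D * N) \<le> 8 * (1 + H)\<^sup>2 * (\<theta> * D * N)" by (rule mult_left_mono[OF p1]) simp
    moreover have "8 * (1 + H) * (D\<^sup>2 * real (card T) / N) \<le> 40 * (1 + H)\<^sup>2 * (D\<^sup>2 * real (card T) / N)"
      by (rule mult_right_mono[OF p2]) (use N_ge in simp)
    moreover have "32 * (1 + H)\<^sup>2 * (N * N) \<le> 32 * (1 + H)\<^sup>2 * (\<theta> * D * N)" by (rule mult_left_mono[OF p3]) simp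
    ultimately show ?thesis by linarith
  qed
  also have "\<dots> = 40 * (1 + H)\<^sup>2 * (\<theta> * D * N + D\<^sup>2 * real (card T) / N)" by (simp add: algebra_simps)
  finally have main: "(\<Sum>n\<in>{N1..N2}. \<Sum>b<n. (real (card {(t, y). t \<in> T \<and> y \<in> {l. u < real l \<and> real l \<le> v} \<and> t dvd y \<and> y mod n = b}) - (\<Sum>t\<in>T. 1 / real t) * (v - u) / real n)\<^sup>2) \<le> 40 * (1 + H)\<^sup>2 * (\<theta> * D * N + D\<^sup>2 * real (card T) / N)" .
  have "Vm a e n = (\<Sum>t\<in>T. 1 / real t) * (v - u) / real n" for n
    unfolding Vm_def vu D_def \<Delta>_def H_def[symmetric] by (simp add: field_simps)
  thus ?thesis using main unfolding ND cnt_def Iv D_def by simp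
qed

definition KC :: "real \<Rightarrow> nat \<Rightarrow> nat set" where "KC \<mu> n = {k\<in>kwin \<mu> n. coprime n k}"

definition NQ :: "nat set" where "NQ = {n\<in>ND. coprime n q}"

lemma finite_KC [simp]: "finite (KC \<mu> n)" unfolding KC_def by simp
lemma finite_NQ [simp]: "finite NQ" unfolding NQ_def by simp

lemma card_KC: assumes "0 \<le> \<mu>" "\<mu> \<le> 1" "n \<ge> 1" shows "real (card (KC \<mu> n)) \<le> 2 * real n"
proof -
  have "real (card (KC \<mu> n)) \<le> real (card (kwin \<mu> n))" unfolding of_nat_le_iff KC_def by (rule card_mono) auto
  thus ?thesis using card_kwin[OF assms] by linarith
qed

lemma ND_ge: "n \<in> ND \<Longrightarrow> n \<ge> 1" "n \<in> ND \<Longrightarrow> real n \<le> 2 * N"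
proof -
  show "n \<in> ND \<Longrightarrow> real n \<le> 2 * N" unfolding ND_def by simp
  assume "n \<in> ND"
  hence "real n \<ge> 1" using N_ge unfolding ND_def by simp
  thus "n \<ge> 1" by simp
qed

text \<open>Each \<open>k\<close> selects one class \<open>b\<close>, the solution of
  \<open>a e k b = - q (mod n)\<close>. The selection is injective: \<open>b\<close> is a unit
  because \<open>q\<close> is, so it determines \<open>k\<close> modulo \<open>n\<close>, and the
  window for \<open>k\<close> has length at most \<open>n\<close>. The sum over \<open>k\<close> is
  therefore part of the sum over all classes.\<close>

lemma Ucount_square_sum_le:
  assumes a: "a \<in> R1" and \<mu>: "0 \<le> \<mu>" "\<mu> \<le> 1" and n: "n \<in> NQ" and c: "coprime a n" "coprime (expo_val Z h) n"
  shows "(\<Sum>k\<in>KC \<mu> n. (Ucount a h n k - Vm a (expo_val Z h) n)\<^sup>2) \<le> (\<Sum>b<n. (cnt a (expo_val Z h) n b - Vm a (expo_val Z h) n)\<^sup>2)"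
proof -
  define e where "e = expo_val Z h"
  have n1: "n > 0" "coprime n q" using n ND_ge(1) unfolding NQ_def by force+
  have ex: "\<exists>b. b < n \<and> (\<forall>y. n dvd a * e * k * y + q \<longleftrightarrow> y mod n = b)" if k: "k \<in> KC \<mu> n" for k
  proof -
    have "coprime (a * e * k) n" using c k unfolding e_def KC_def by (simp add: coprime_mult_left_iff coprime_commute)
    from linear_cong_residue[OF this n1(1), of q] show ?thesis by metis
  qed
  define bk where "bk k = (SOME b. b < n \<and> (\<forall>y. n dvd a * e * k * y + q \<longleftrightarrow> y mod n = b))" for k
  have bk: "bk k < n" "\<And>y. n dvd a * e * k * y + q \<longleftrightarrow> y mod n = bk k" if "k \<in> KC \<mu> n" for k
    using someI_ex[OF ex[OF that]] unfolding bk_def[symmetric] by auto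
  have inj: "inj_on bk (KC \<mu> n)"
  proof (rule inj_onI)
    fix k k' assume k: "k \<in> KC \<mu> n" "k' \<in> KC \<mu> n" and eq: "bk k = bk k'"
    define b where "b = bk k"
    have bn: "b < n" using bk(1)[OF k(1)] unfolding b_def .
    have d: "n dvd a * e * k * b + q" "n dvd a * e * k' * b + q"
      using bk(2)[OF k(1), of b] bk(2)[OF k(2), of b] bn eq unfolding b_def by auto
    have cb: "coprime b n"
    proof (rule ccontr)
      assume "\<not> coprime b n"
      then obtain p where p: "prime p" "p dvd b" "p dvd n" by (rule not_coprime_obtain_prime_nat)
      have "p dvd a * e * k * b + q" using p(3) d(1) by (rule dvd_trans)
      moreover have "p dvd a * e * k * b" using p(2) by simp
      ultimately have "p dvd q" by (simp add: dvd_add_right_iff)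
      thus False using n1(2) p prime_dvd_both_not_coprime_nat by blast
    qed
    have "[a * e * k * b + q = a * e * k' * b + q] (mod n)"
      using d by (simp add: unique_euclidean_semiring_class.cong_def dvd_eq_mod_eq_0)
    hence "[a * e * k * b = a * e * k' * b] (mod n)" by (simp only: cong_add_rcancel_nat)
    hence "[a * e * k = a * e * k'] (mod n)" using cb by (simp add: cong_mult_rcancel_nat)
    moreover have "coprime (a * e) n" using c unfolding e_def by simp
    ultimately have "[k = k'] (mod n)" by (simp add: cong_mult_lcancel_nat)
    hence m: "k mod n = k' mod n" by (simp add: unique_euclidean_semiring_class.cong_def)
    have "\<mu> * real n \<le> 1 * real n" using \<mu> by (intro mult_right_mono) auto
    hence "real k < real (k' + n)" "real k' < real (k + n)" using k unfolding KC_def kwin_def by auto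
    hence "k < k' + n" "k' < k + n" by (simp_all only: of_nat_less_iff)
    thus "k = k'" using m by (intro mod_eq_imp_eq_nat[of k n k']) auto
  qed
  have "(\<Sum>k\<in>KC \<mu> n. (Ucount a h n k - Vm a e n)\<^sup>2) = (\<Sum>k\<in>KC \<mu> n. (cnt a e n (bk k) - Vm a e n)\<^sup>2)"
  proof (rule sum.cong[OF refl])
    fix k assume k: "k \<in> KC \<mu> n"
    show "(Ucount a h n k - Vm a e n)\<^sup>2 = (cnt a e n (bk k) - Vm a e n)\<^sup>2"
      unfolding Ucount_eq[OF a] cnt_def e_def[symmetric] bk(2)[OF k] ..
  qed
  also have "\<dots> = (\<Sum>b\<in>bk ` KC \<mu> n. (cnt a e n b - Vm a e n)\<^sup>2)" by (rule sum.reindex_cong[OF inj refl refl, symmetric])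
  also have "\<dots> \<le> (\<Sum>b<n. (cnt a e n b - Vm a e n)\<^sup>2)" by (rule sum_mono2) (use bk(1) in auto)
  finally show ?thesis unfolding e_def .
qed

end

section \<open>Averaging over n, k and the sieve divisors\<close>

context moduli
begin

text \<open>Cauchy-Schwarz over the at most \<open>8 * N ^ 2\<close> pairs \<open>(n, k)\<close>,
  then the variance bound; the constant is from \<open>8 * 40 <= 18 ^ 2\<close>. The square root
  leaves \<open>1 / sqrt e\<close> in the first error, which is why that weight appears among the
  Rankin bounds.\<close>

lemma sum_good_le:
  fixes e :: nat
  assumes a: "a \<in> R1" and \<mu>: "0 \<le> \<mu>" "\<mu> \<le> 1" and e: "e = expo_val Z h" "real e \<le> Lm"
  shows "(\<Sum>n\<in>{n\<in>NQ. coprime a n \<and> coprime e n}. \<Sum>k\<in>KC \<mu> n. \<bar>Ucount a h n k - Vm a e n\<bar>)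
    \<le> 18 * N * (1 + H) * (\<kappa> * R / real a) * (\<theta> * Lm powr (-1/2) / sqrt (real e) + sqrt (real (card T) / N) / real e)"
proof -
  let ?A = "{n\<in>NQ. coprime a n \<and> coprime e n}"
  define \<Delta> where "\<Delta> = \<kappa> * R / (real a * real e)"
  have e0: "e > 0" unfolding e(1) using expo_val_pos Z_prime by blast
  have ae: "real a > 0" "real e > 0" using pos a e0 by auto
  have \<Delta>0: "\<Delta> > 0" unfolding \<Delta>_def using kap R_pos ae by simp
  have "(\<Sum>n\<in>?A. \<Sum>k\<in>KC \<mu> n. \<bar>Ucount a h n k - Vm a e n\<bar>) = (\<Sum>(n,k)\<in>Sigma ?A (KC \<mu>). \<bar>Ucount a h n k - Vm a e n\<bar>)"
    by (rule sum.Sigma) auto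
  also have "\<dots> = (\<Sum>x\<in>Sigma ?A (KC \<mu>). \<bar>Ucount a h (fst x) (snd x) - Vm a e (fst x)\<bar>)" by (simp add: split_def)
  also have "\<dots> \<le> sqrt (real (card (Sigma ?A (KC \<mu>))) * (\<Sum>x\<in>Sigma ?A (KC \<mu>). (Ucount a h (fst x) (snd x) - Vm a e (fst x))\<^sup>2))"
    by (rule sum_abs_le_sqrt_card)
  also have "\<dots> \<le> sqrt ((8 * N\<^sup>2) * (40 * (1 + H)\<^sup>2 * (\<theta> * \<Delta> * N + \<Delta>\<^sup>2 * real (card T) / N)))"
  proof (intro real_sqrt_le_mono mult_mono)
    have "real (card (Sigma ?A (KC \<mu>))) = (\<Sum>n\<in>?A. real (card (KC \<mu> n)))"
      by (subst card_SigmaI) auto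
    also have "\<dots> \<le> (\<Sum>n\<in>?A. 4 * N)"
    proof (rule sum_mono)
      fix n assume "n \<in> ?A"
      hence "n \<in> ND" unfolding NQ_def by simp
      thus "real (card (KC \<mu> n)) \<le> 4 * N" using card_KC[OF \<mu>, of n] ND_ge[of n] by linarith
    qed
    also have "\<dots> \<le> (\<Sum>n\<in>ND. 4 * N)" by (rule sum_mono2) (use N_ge in \<open>auto simp: NQ_def\<close>)
    also have "\<dots> = real (card ND) * (4 * N)" by simp
    also have "\<dots> \<le> (2 * N) * (4 * N)" using card_ND N_ge by (intro mult_right_mono) auto
    finally show "real (card (Sigma ?A (KC \<mu>))) \<le> 8 * N\<^sup>2" by (simp add: power2_eq_square)
    have "(\<Sum>x\<in>Sigma ?A (KC \<mu>). (Ucount a h (fst x) (snd x) - Vm a e (fst x))\<^sup>2) = (\<Sum>(n,k)\<in>Sigma ?A (KC \<mu>). (Ucount a h n k - Vm a e n)\<^sup>2)"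
      by (simp add: split_def)
    also have "\<dots> = (\<Sum>n\<in>?A. \<Sum>k\<in>KC \<mu> n. (Ucount a h n k - Vm a e n)\<^sup>2)"
      by (rule sum.Sigma[symmetric]) auto
    also have "\<dots> \<le> (\<Sum>n\<in>?A. \<Sum>b<n. (cnt a e n b - Vm a e n)\<^sup>2)"
      unfolding e(1) by (rule sum_mono, rule Ucount_square_sum_le[OF a \<mu>]) auto
    also have "\<dots> \<le> (\<Sum>n\<in>ND. \<Sum>b<n. (cnt a e n b - Vm a e n)\<^sup>2)"
      by (rule sum_mono2) (auto simp: NQ_def intro: sum_nonneg)
    also have "\<dots> \<le> 40 * (1 + H)\<^sup>2 * (\<theta> * \<Delta> * N + \<Delta>\<^sup>2 * real (card T) / N)"
      unfolding \<Delta>_def by (rule variance_cnt_le[OF a e0 e(2)])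
    finally show "(\<Sum>x\<in>Sigma ?A (KC \<mu>). (Ucount a h (fst x) (snd x) - Vm a e (fst x))\<^sup>2) \<le> 40 * (1 + H)\<^sup>2 * (\<theta> * \<Delta> * N + \<Delta>\<^sup>2 * real (card T) / N)" .
  qed (auto intro: sum_nonneg)
  also have "\<dots> \<le> sqrt ((18 * N * (1 + H) * (sqrt (\<theta> * \<Delta> * N) + \<Delta> * sqrt (real (card T) / N)))\<^sup>2)"
  proof (rule real_sqrt_le_mono)
    define x where "x = sqrt (\<theta> * \<Delta> * N)"
    define y where "y = \<Delta> * sqrt (real (card T) / N)"
    have xy: "x \<ge> 0" "y \<ge> 0" unfolding x_def y_def using theta_ge \<Delta>0 N_ge by auto
    have x2: "x\<^sup>2 = \<theta> * \<Delta> * N" unfolding x_def using theta_ge \<Delta>0 N_ge by simp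
    have y2: "y\<^sup>2 = \<Delta>\<^sup>2 * real (card T) / N" unfolding y_def using N_ge by (simp add: power_mult_distrib)
    have "(8 * N\<^sup>2) * (40 * (1 + H)\<^sup>2 * (x\<^sup>2 + y\<^sup>2)) = 320 * ((N * (1 + H))\<^sup>2 * (x\<^sup>2 + y\<^sup>2))"
      by (simp add: power_mult_distrib)
    also have "\<dots> \<le> 324 * ((N * (1 + H))\<^sup>2 * (x + y)\<^sup>2)"
    proof (rule mult_mono)
      show "(N * (1 + H))\<^sup>2 * (x\<^sup>2 + y\<^sup>2) \<le> (N * (1 + H))\<^sup>2 * (x + y)\<^sup>2"
        using xy by (intro mult_left_mono) (auto simp: power2_sum)
    qed auto
    also have "\<dots> = (18 * N * (1 + H) * (x + y))\<^sup>2" by (simp add: power_mult_distrib)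
    finally show "(8 * N\<^sup>2) * (40 * (1 + H)\<^sup>2 * (\<theta> * \<Delta> * N + \<Delta>\<^sup>2 * real (card T) / N)) \<le> (18 * N * (1 + H) * (sqrt (\<theta> * \<Delta> * N) + \<Delta> * sqrt (real (card T) / N)))\<^sup>2"
      unfolding x2 y2 x_def[symmetric] y_def[symmetric] .
  qed
  also have "\<dots> = 18 * N * (1 + H) * (sqrt (\<theta> * \<Delta> * N) + \<Delta> * sqrt (real (card T) / N))"
    using N_ge H_nonneg theta_ge \<Delta>0 by simp
  also have "\<dots> \<le> 18 * N * (1 + H) * (\<kappa> * R / real a * (\<theta> * Lm powr (-1/2) / sqrt (real e)) + \<kappa> * R / real a * (sqrt (real (card T) / N) / real e))"
  proof (intro mult_left_mono add_mono)
    have Lp: "Lm powr (-1/2) = 1 / sqrt Lm"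
    proof -
      have "Lm powr (- (1/2)) = 1 / Lm powr (1/2)" by (rule powr_minus_divide)
      thus ?thesis using Lm_ge by (simp add: powr_half_sqrt)
    qed
    define g where "g = \<kappa> * R / real a"
    have g0: "g \<ge> 0" unfolding g_def using kap R_pos ae by simp
    \<comment> \<open>This bound for \<open>N\<close> turns one factor \<open>N\<close> under the
      root into the saving \<open>Lm powr (-1/2)\<close>.\<close>
    have "N \<le> \<theta> * g / Lm" unfolding g_def using ratio_ge[OF a] ae Lm_ge by (simp add: field_simps)
    hence "\<theta> * \<Delta> * N \<le> \<theta> * \<Delta> * (\<theta> * g / Lm)" using theta_ge \<Delta>0 by (intro mult_left_mono) auto
    also have "\<dots> = (\<theta> * g)\<^sup>2 / (Lm * real e)" unfolding \<Delta>_def g_def by (simp add: power2_eq_square)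
    finally have "sqrt (\<theta> * \<Delta> * N) \<le> sqrt ((\<theta> * g)\<^sup>2 / (Lm * real e))" by (rule real_sqrt_le_mono)
    also have "\<dots> = \<theta> * g / (sqrt Lm * sqrt (real e))"
      using theta_ge g0 by (simp add: real_sqrt_divide real_sqrt_mult)
    also have "\<dots> = \<kappa> * R / real a * (\<theta> * Lm powr (-1/2) / sqrt (real e))" unfolding Lp g_def by (simp add: field_simps)
    finally show "sqrt (\<theta> * \<Delta> * N) \<le> \<kappa> * R / real a * (\<theta> * Lm powr (-1/2) / sqrt (real e))" .
    show "\<Delta> * sqrt (real (card T) / N) \<le> \<kappa> * R / real a * (sqrt (real (card T) / N) / real e)"
      unfolding \<Delta>_def by (simp add: field_simps)
  qed (use N_ge H_nonneg in auto)
  also have "\<dots> = 18 * N * (1 + H) * (\<kappa> * R / real a) * (\<theta> * Lm powr (-1/2) / sqrt (real e) + sqrt (real (card T) / N) / real e)"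
    by (simp only: distrib_left[symmetric] mult.assoc)
  finally show ?thesis .
qed

lemma sum_Vm_le:
  assumes \<mu>: "0 \<le> \<mu>" "\<mu> \<le> 1" and A: "A \<subseteq> ND"
  shows "(\<Sum>n\<in>A. \<Sum>k\<in>KC \<mu> n. Vm a e n) \<le> real (card A) * (2 * \<kappa> * R * H / (real a * real e))"
proof -
  have "(\<Sum>n\<in>A. \<Sum>k\<in>KC \<mu> n. Vm a e n) \<le> (\<Sum>n\<in>A. 2 * \<kappa> * R * H / (real a * real e))"
  proof (rule sum_mono)
    fix n assume "n \<in> A"
    hence n: "n \<ge> 1" using A ND_ge(1) by blast
    have "(\<Sum>k\<in>KC \<mu> n. Vm a e n) = real (card (KC \<mu> n)) * Vm a e n" by simp
    also have "\<dots> \<le> 2 * real n * Vm a e n" by (intro mult_right_mono card_KC \<mu> n Vm_nonneg)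
    also have "\<dots> = 2 * \<kappa> * R * H / (real a * real e)" using n unfolding Vm_def by (simp add: field_simps)
    finally show "(\<Sum>k\<in>KC \<mu> n. Vm a e n) \<le> 2 * \<kappa> * R * H / (real a * real e)" .
  qed
  thus ?thesis by simp
qed

text \<open>Every prime of \<open>a\<close> exceeds \<open>Lm\<close> and so has at most
  \<open>2 * N / Lm\<close> multiples in range, and \<open>a\<close> has at most
  \<open>\<omega>\<close> primes.\<close>

lemma card_not_coprime_le:
  assumes a: "a \<in> R1"
  shows "real (card {n\<in>ND. \<not> coprime a n}) \<le> \<omega> * (2 * N / Lm)"
proof -
  have "{n\<in>ND. \<not> coprime a n} \<subseteq> (\<Union>p\<in>prime_factors a. {n\<in>ND. p dvd n})"
  proof
    fix n assume n: "n \<in> {n\<in>ND. \<not> coprime a n}"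
    then obtain p where "prime p" "p dvd a" "p dvd n" using not_coprime_obtain_prime_nat by blast
    thus "n \<in> (\<Union>p\<in>prime_factors a. {n\<in>ND. p dvd n})" using n pos(1)[OF a] by (auto simp: in_prime_factors_iff)
  qed
  hence "card {n\<in>ND. \<not> coprime a n} \<le> card (\<Union>p\<in>prime_factors a. {n\<in>ND. p dvd n})" by (intro card_mono) auto
  also have "\<dots> \<le> (\<Sum>p\<in>prime_factors a. card {n\<in>ND. p dvd n})" by (rule card_UN_le) simp
  finally have "real (card {n\<in>ND. \<not> coprime a n}) \<le> (\<Sum>p\<in>prime_factors a. real (card {n\<in>ND. p dvd n}))"
    unfolding of_nat_sum[symmetric] of_nat_le_iff .
  also have "\<dots> \<le> (\<Sum>p\<in>prime_factors a. 2 * N / Lm)"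
  proof (rule sum_mono)
    fix p assume "p \<in> prime_factors a"
    hence p: "Lm < real p" using R1_prime[OF a] by auto
    have "p > 0" using p Lm_ge by (cases p) auto
    have "{n\<in>ND. p dvd n} \<subseteq> (\<lambda>m. p * m) ` upto_real (2 * N / real p)"
    proof
      fix n assume "n \<in> {n\<in>ND. p dvd n}"
      then obtain m where m: "n = p * m" "n \<in> ND" by (auto elim: dvdE)
      have "m \<ge> 1" using ND_ge(1)[OF m(2)] m(1) by (cases m) auto
      moreover have "real m \<le> 2 * N / real p" using ND_ge(2)[OF m(2)] \<open>p > 0\<close> unfolding m(1) by (simp add: field_simps)
      ultimately show "n \<in> (\<lambda>m. p * m) ` upto_real (2 * N / real p)" unfolding m(1) upto_real_def by blast
    qed
    hence "card {n\<in>ND. p dvd n} \<le> card ((\<lambda>m. p * m) ` upto_real (2 * N / real p))" by (intro card_mono) auto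
    also have "\<dots> \<le> card (upto_real (2 * N / real p))" by (rule card_image_le) simp
    finally have "real (card {n\<in>ND. p dvd n}) \<le> real (card (upto_real (2 * N / real p)))" by simp
    also have "\<dots> \<le> 2 * N / real p" using N_ge by (intro card_upto_real) simp
    also have "\<dots> \<le> 2 * N / Lm" using p Lm_ge N_ge by (intro divide_left_mono) auto
    finally show "real (card {n\<in>ND. p dvd n}) \<le> 2 * N / Lm" .
  qed
  also have "\<dots> = real (card (prime_factors a)) * (2 * N / Lm)" by simp
  also have "\<dots> \<le> \<omega> * (2 * N / Lm)" using omega[OF a] N_ge Lm_ge by (intro mult_right_mono) auto
  finally show ?thesis .
qed

text \<open>The density lemma expands \<open>cq\<close> over the vectors \<open>h\<close> whose
  divisor is coprime to \<open>n\<close>; for the other \<open>h\<close> the count vanishes. Count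
  and mean can therefore be compared vector by vector, although \<open>cq\<close> does not depend on
  \<open>n\<close>.\<close>

lemma Wsum_minus_mean_le:
  assumes n: "n \<in> NQ"
  shows "\<bar>Wsum n k - \<kappa> * R * (cq * S1 * H) / real n\<bar> \<le>
    (\<Sum>a\<in>R1. \<Sum>h\<in>expo Z. \<bar>expo_coeff q Z h\<bar> * (if coprime (expo_val Z h) n then \<bar>Ucount a h n k - Vm a (expo_val Z h) n\<bar> else 0))"
proof -
  have n1: "coprime n q" "n \<ge> 1" using n ND_ge(1) unfolding NQ_def by auto
  let ?c = "\<lambda>h. coprime (expo_val Z h) n"
  have U0: "Ucount a h n k = 0" if "a \<in> R1" "\<not> ?c h" for a h
    using Ucount_eq_0[OF that(1) n1(1)] that(2) by blast
  have "(\<Sum>h\<in>{h\<in>expo Z. ?c h}. expo_coeff q Z h / real (expo_val Z h)) = cq"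
    unfolding cq_def by (rule sum_expo_density[OF finite_Z Z_prime n1(1)])
  hence cqe: "cq = (\<Sum>h\<in>expo Z. if ?c h then expo_coeff q Z h / real (expo_val Z h) else 0)"
    by (subst sum.inter_filter[symmetric, OF finite_expo[OF finite_Z]]) simp
  have "\<kappa> * R * (cq * S1 * H) / real n = (\<Sum>a\<in>R1. (\<kappa> * R * H / real n) * (1 / real a) * cq)"
    unfolding S1_def sum_distrib_right[symmetric] sum_distrib_left[symmetric] by simp
  also have "\<dots> = (\<Sum>a\<in>R1. \<Sum>h\<in>expo Z. expo_coeff q Z h * (if ?c h then Vm a (expo_val Z h) n else 0))"
    unfolding cqe sum_distrib_left by (intro sum.cong[OF refl]) (simp add: Vm_def mult_ac)
  finally have mean: "\<kappa> * R * (cq * S1 * H) / real n = (\<Sum>a\<in>R1. \<Sum>h\<in>expo Z. expo_coeff q Z h * (if ?c h then Vm a (expo_val Z h) n else 0))" .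
  let ?g = "\<lambda>a h. expo_coeff q Z h * (if ?c h then Ucount a h n k - Vm a (expo_val Z h) n else 0)"
  have trm: "expo_coeff q Z h * Ucount a h n k - expo_coeff q Z h * (if ?c h then Vm a (expo_val Z h) n else 0) = ?g a h" if "a \<in> R1" for a h
    using U0[OF that, of h] by (cases "?c h") (simp_all add: right_diff_distrib)
  have "Wsum n k - \<kappa> * R * (cq * S1 * H) / real n =
    (\<Sum>a\<in>R1. \<Sum>h\<in>expo Z. expo_coeff q Z h * Ucount a h n k - expo_coeff q Z h * (if ?c h then Vm a (expo_val Z h) n else 0))"
    unfolding Wsum_eq mean sum_subtractf ..
  also have "\<dots> = (\<Sum>a\<in>R1. \<Sum>h\<in>expo Z. ?g a h)"
    by (rule sum.cong[OF refl], rule sum.cong[OF refl], rule trm)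
  finally have eq: "Wsum n k - \<kappa> * R * (cq * S1 * H) / real n = (\<Sum>a\<in>R1. \<Sum>h\<in>expo Z. ?g a h)" .
  have "\<bar>\<Sum>a\<in>R1. \<Sum>h\<in>expo Z. ?g a h\<bar> \<le> (\<Sum>a\<in>R1. \<Sum>h\<in>expo Z. \<bar>?g a h\<bar>)"
    by (rule order.trans[OF sum_abs], rule sum_mono, rule sum_abs)
  moreover have "\<bar>?g a h\<bar> = \<bar>expo_coeff q Z h\<bar> * (if ?c h then \<bar>Ucount a h n k - Vm a (expo_val Z h) n\<bar> else 0)" for a h
    by (simp add: abs_mult)
  ultimately show ?thesis unfolding eq by simp
qed

text \<open>If \<open>e <= Lm\<close> and \<open>a\<close>, \<open>e\<close> are coprime to
  \<open>n\<close>, the variance bound applies. If \<open>e > Lm\<close> or \<open>a\<close> shares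
  a prime with \<open>n\<close>, the count is 0 and only the expected value remains, small by the
  Rankin tail in the first case and by the scarcity of such \<open>n\<close> in the second.\<close>

theorem sum_Wsum_deviation_le:
  assumes \<mu>: "0 \<le> \<mu>" "\<mu> \<le> 1"
  shows "(\<Sum>n\<in>NQ. \<Sum>k\<in>KC \<mu> n. \<bar>Wsum n k - \<kappa> * R * (cq * S1 * H) / real n\<bar>)
    \<le> N * \<kappa> * R * S1 * (1 + H) * Phi * (18 * sqrt (real (card T) / N) + (22 * \<theta> + 4 * \<omega>) * Lm powr (-1/4))"
proof (cases "R1 = {}")
  case True
  hence "S1 = 0" "trip = {}" unfolding S1_def trip_def by auto
  thus ?thesis unfolding Wsum_def by simp
next
  case False
  have om0: "\<omega> \<ge> 0" using omega False by (metis all_not_in_conv of_nat_0_le_iff order_trans)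
  let ?c = "\<lambda>h n. coprime (expo_val Z h) n"
  let ?e = "\<lambda>h. expo_val Z h"
  define X where "X a h n k = (if ?c h n then \<bar>Ucount a h n k - Vm a (?e h) n\<bar> else 0)" for a h n k
  have per: "(\<Sum>n\<in>NQ. \<Sum>k\<in>KC \<mu> n. X a h n k) \<le>
      (if real (?e h) \<le> Lm then 18 * N * (1 + H) * (\<kappa> * R / real a) * (\<theta> * Lm powr (-1/2) / sqrt (real (?e h)) + sqrt (real (card T) / N) / real (?e h)) else 0)
      + (if real (?e h) > Lm then 4 * N * \<kappa> * R * H / (real a * real (?e h)) else 0)
      + 4 * N * \<kappa> * R * H * \<omega> / Lm / (real a * real (?e h))" if a: "a \<in> R1" for a h
  proof -
    let ?G = "{n\<in>NQ. coprime a n \<and> coprime (?e h) n}"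
    have X_le: "X a h n k \<le> (if real (?e h) \<le> Lm \<and> coprime a n \<and> ?c h n then \<bar>Ucount a h n k - Vm a (?e h) n\<bar> else 0)
       + (if real (?e h) > Lm then Vm a (?e h) n else 0) + (if \<not> coprime a n then Vm a (?e h) n else 0)" if n: "n \<in> NQ" for n k
    proof (cases "real (?e h) \<le> Lm \<and> coprime a n \<and> ?c h n")
      case True
      thus ?thesis unfolding X_def by simp
    next
      case F: False
      have nq: "coprime n q" using n unfolding NQ_def by simp
      have "Ucount a h n k = 0" by (rule Ucount_eq_0[OF a nq]) (use F in auto)
      thus ?thesis using F Vm_nonneg[of a "?e h" n] unfolding X_def by auto
    qed
    have "(\<Sum>n\<in>NQ. \<Sum>k\<in>KC \<mu> n. X a h n k) \<le> (\<Sum>n\<in>NQ. \<Sum>k\<in>KC \<mu> n. (if real (?e h) \<le> Lm \<and> coprime a n \<and> ?c h n then \<bar>Ucount a h n k - Vm a (?e h) n\<bar> else 0)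
       + (if real (?e h) > Lm then Vm a (?e h) n else 0) + (if \<not> coprime a n then Vm a (?e h) n else 0))"
      by (intro sum_mono X_le)
    also have "\<dots> = (\<Sum>n\<in>NQ. \<Sum>k\<in>KC \<mu> n. (if real (?e h) \<le> Lm \<and> coprime a n \<and> ?c h n then \<bar>Ucount a h n k - Vm a (?e h) n\<bar> else 0))
       + (\<Sum>n\<in>NQ. \<Sum>k\<in>KC \<mu> n. (if real (?e h) > Lm then Vm a (?e h) n else 0))
       + (\<Sum>n\<in>NQ. \<Sum>k\<in>KC \<mu> n. (if \<not> coprime a n then Vm a (?e h) n else 0))"
      by (simp only: sum.distrib)
    also have "\<dots> \<le> (if real (?e h) \<le> Lm then 18 * N * (1 + H) * (\<kappa> * R / real a) * (\<theta> * Lm powr (-1/2) / sqrt (real (?e h)) + sqrt (real (card T) / N) / real (?e h)) else 0)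
      + (if real (?e h) > Lm then 4 * N * \<kappa> * R * H / (real a * real (?e h)) else 0)
      + 4 * N * \<kappa> * R * H * \<omega> / Lm / (real a * real (?e h))"
    proof (intro add_mono)
      show "(\<Sum>n\<in>NQ. \<Sum>k\<in>KC \<mu> n. (if real (?e h) \<le> Lm \<and> coprime a n \<and> ?c h n then \<bar>Ucount a h n k - Vm a (?e h) n\<bar> else 0)) \<le>
        (if real (?e h) \<le> Lm then 18 * N * (1 + H) * (\<kappa> * R / real a) * (\<theta> * Lm powr (-1/2) / sqrt (real (?e h)) + sqrt (real (card T) / N) / real (?e h)) else 0)"
      proof (cases "real (?e h) \<le> Lm")
        case True
        have "(\<Sum>n\<in>NQ. \<Sum>k\<in>KC \<mu> n. (if real (?e h) \<le> Lm \<and> coprime a n \<and> ?c h n then \<bar>Ucount a h n k - Vm a (?e h) n\<bar> else 0)) =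
          (\<Sum>n\<in>NQ. if coprime a n \<and> ?c h n then \<Sum>k\<in>KC \<mu> n. \<bar>Ucount a h n k - Vm a (?e h) n\<bar> else 0)"
          by (rule sum.cong[OF refl]) (use True in auto)
        also have "\<dots> = (\<Sum>n\<in>?G. \<Sum>k\<in>KC \<mu> n. \<bar>Ucount a h n k - Vm a (?e h) n\<bar>)"
          by (rule sum.inter_filter[symmetric]) simp
        also have "\<dots> \<le> 18 * N * (1 + H) * (\<kappa> * R / real a) * (\<theta> * Lm powr (-1/2) / sqrt (real (?e h)) + sqrt (real (card T) / N) / real (?e h))"
          by (rule sum_good_le[OF a \<mu> refl True])
        finally show ?thesis using True by (simp only: if_True)
      qed auto
      show "(\<Sum>n\<in>NQ. \<Sum>k\<in>KC \<mu> n. (if real (?e h) > Lm then Vm a (?e h) n else 0)) \<le> (if real (?e h) > Lm then 4 * N * \<kappa> * R * H / (real a * real (?e h)) else 0)"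
      proof (cases "real (?e h) > Lm")
        case True
        have "(\<Sum>n\<in>NQ. \<Sum>k\<in>KC \<mu> n. Vm a (?e h) n) \<le> real (card NQ) * (2 * \<kappa> * R * H / (real a * real (?e h)))"
          by (rule sum_Vm_le[OF \<mu>]) (auto simp: NQ_def)
        also have "\<dots> \<le> (2 * N) * (2 * \<kappa> * R * H / (real a * real (?e h)))"
        proof (rule mult_right_mono)
          have "real (card NQ) \<le> real (card ND)" unfolding NQ_def of_nat_le_iff by (rule card_mono) auto
          thus "real (card NQ) \<le> 2 * N" using card_ND by linarith
        qed (use kap R_pos H_nonneg in simp)
        finally show ?thesis using True by simp
      qed auto
      have "(\<Sum>n\<in>NQ. \<Sum>k\<in>KC \<mu> n. (if \<not> coprime a n then Vm a (?e h) n else 0)) =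
          (\<Sum>n\<in>NQ. if \<not> coprime a n then \<Sum>k\<in>KC \<mu> n. Vm a (?e h) n else 0)"
        by (rule sum.cong[OF refl]) auto
      also have "\<dots> = (\<Sum>n\<in>{n\<in>NQ. \<not> coprime a n}. \<Sum>k\<in>KC \<mu> n. Vm a (?e h) n)"
        by (rule sum.inter_filter[symmetric]) simp
      also have "\<dots> \<le> real (card {n\<in>NQ. \<not> coprime a n}) * (2 * \<kappa> * R * H / (real a * real (?e h)))"
        by (rule sum_Vm_le[OF \<mu>]) (auto simp: NQ_def)
      also have "\<dots> \<le> (\<omega> * (2 * N / Lm)) * (2 * \<kappa> * R * H / (real a * real (?e h)))"
      proof (rule mult_right_mono)
        have "real (card {n\<in>NQ. \<not> coprime a n}) \<le> real (card {n\<in>ND. \<not> coprime a n})"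
          unfolding of_nat_le_iff by (rule card_mono) (auto simp: NQ_def)
        thus "real (card {n\<in>NQ. \<not> coprime a n}) \<le> \<omega> * (2 * N / Lm)" using card_not_coprime_le[OF a] by linarith
      qed (use kap R_pos H_nonneg in simp)
      also have "\<dots> = 4 * N * \<kappa> * R * H * \<omega> / Lm / (real a * real (?e h))" by simp
      finally show "(\<Sum>n\<in>NQ. \<Sum>k\<in>KC \<mu> n. (if \<not> coprime a n then Vm a (?e h) n else 0)) \<le> 4 * N * \<kappa> * R * H * \<omega> / Lm / (real a * real (?e h))" .
    qed
    finally show ?thesis .
  qed
  let ?f = "\<lambda>h. \<bar>expo_coeff q Z h\<bar>"
  note cons = sum_expo_consequences[OF finite_Z Z_prime q_pos, folded Phi_def]
  have Lp: "Lm > 0" using Lm_ge by simp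
  have perA: "(\<Sum>h\<in>expo Z. ?f h * (\<Sum>n\<in>NQ. \<Sum>k\<in>KC \<mu> n. X a h n k)) \<le>
     N * \<kappa> * R * (1 + H) * Phi * (18 * sqrt (real (card T) / N) + (22 * \<theta> + 4 * \<omega>) * Lm powr (-1/4)) * (1 / real a)" if a: "a \<in> R1" for a
  proof -
    define g where "g = N * \<kappa> * R * (1 + H) / real a"
    have g0: "g \<ge> 0" unfolding g_def using N_ge kap R_pos H_nonneg by simp
    have gH: "4 * N * \<kappa> * R * H / (real a * x) \<le> 4 * g / x" if "x > 0" for x
    proof -
      have "N * \<kappa> * R * H \<le> N * \<kappa> * R * (1 + H)" using N_ge kap R_pos H_nonneg by (intro mult_left_mono) auto
      hence "4 * (N * \<kappa> * R * H) / (real a * x) \<le> 4 * (N * \<kappa> * R * (1 + H)) / (real a * x)"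
        using that N_ge kap R_pos by (intro divide_right_mono mult_left_mono) auto
      moreover have "4 * N * \<kappa> * R * H / (real a * x) = 4 * (N * \<kappa> * R * H) / (real a * x)" by (simp only: mult.assoc)
      moreover have "4 * g / x = 4 * (N * \<kappa> * R * (1 + H)) / (real a * x)" unfolding g_def by (simp only: times_divide_eq_right divide_divide_eq_left)
      ultimately show ?thesis by (simp only:)
    qed
    have epos: "real (?e h) > 0" for h using expo_val_pos[of Z h] Z_prime by simp
    let ?s = "sqrt (real (card T) / N)"
    have "(\<Sum>h\<in>expo Z. ?f h * (\<Sum>n\<in>NQ. \<Sum>k\<in>KC \<mu> n. X a h n k)) \<le>
      (\<Sum>h\<in>expo Z. (if real (?e h) \<le> Lm then 18 * g * \<theta> * Lm powr (-1/2) * (?f h / sqrt (real (?e h))) else 0)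
        + 18 * g * ?s * (?f h / real (?e h))
        + (if real (?e h) > Lm then 4 * g * (?f h / real (?e h)) else 0)
        + 4 * g * \<omega> / Lm * (?f h / real (?e h)))"
    proof (rule sum_mono)
      fix h
      have g18: "18 * N * (1 + H) * (\<kappa> * R / real a) = 18 * g" unfolding g_def by simp
      have "(\<Sum>n\<in>NQ. \<Sum>k\<in>KC \<mu> n. X a h n k) \<le>
        (if real (?e h) \<le> Lm then 18 * g * (\<theta> * Lm powr (-1/2) / sqrt (real (?e h)) + ?s / real (?e h)) else 0)
        + (if real (?e h) > Lm then 4 * N * \<kappa> * R * H / (real a * real (?e h)) else 0)
        + 4 * N * \<kappa> * R * H * \<omega> / Lm / (real a * real (?e h))"
        using per[OF a, of h] unfolding g18 .
      also have "\<dots> \<le> (if real (?e h) \<le> Lm then 18 * g * \<theta> * Lm powr (-1/2) / sqrt (real (?e h)) else 0)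
        + 18 * g * ?s / real (?e h) + (if real (?e h) > Lm then 4 * g / real (?e h) else 0) + 4 * g * \<omega> / Lm / real (?e h)"
      proof -
        have "(if real (?e h) \<le> Lm then 18 * g * (\<theta> * Lm powr (-1/2) / sqrt (real (?e h)) + ?s / real (?e h)) else 0)
          \<le> (if real (?e h) \<le> Lm then 18 * g * \<theta> * Lm powr (-1/2) / sqrt (real (?e h)) else 0) + 18 * g * ?s / real (?e h)"
          using g0 N_ge by (auto simp: distrib_left)
        moreover have "(if real (?e h) > Lm then 4 * N * \<kappa> * R * H / (real a * real (?e h)) else 0) \<le> (if real (?e h) > Lm then 4 * g / real (?e h) else 0)"
          using gH[OF epos] by simp
        moreover have "4 * N * \<kappa> * R * H * \<omega> / Lm / (real a * real (?e h)) \<le> 4 * g * \<omega> / Lm / real (?e h)"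
        proof -
          have "4 * N * \<kappa> * R * H / (real a * real (?e h)) * (\<omega> / Lm) \<le> 4 * g / real (?e h) * (\<omega> / Lm)"
            using om0 Lp by (intro mult_right_mono gH epos) auto
          thus ?thesis by (simp add: mult_ac)
        qed
        ultimately show ?thesis by linarith
      qed
      finally have "?f h * (\<Sum>n\<in>NQ. \<Sum>k\<in>KC \<mu> n. X a h n k) \<le> ?f h * ((if real (?e h) \<le> Lm then 18 * g * \<theta> * Lm powr (-1/2) / sqrt (real (?e h)) else 0)
        + 18 * g * ?s / real (?e h) + (if real (?e h) > Lm then 4 * g / real (?e h) else 0) + 4 * g * \<omega> / Lm / real (?e h))"
        by (rule mult_left_mono) simp
      also have "\<dots> = (if real (?e h) \<le> Lm then 18 * g * \<theta> * Lm powr (-1/2) * (?f h / sqrt (real (?e h))) else 0)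
        + 18 * g * ?s * (?f h / real (?e h))
        + (if real (?e h) > Lm then 4 * g * (?f h / real (?e h)) else 0)
        + 4 * g * \<omega> / Lm * (?f h / real (?e h))"
        by (simp add: distrib_left mult_ac)
      finally show "?f h * (\<Sum>n\<in>NQ. \<Sum>k\<in>KC \<mu> n. X a h n k) \<le> (if real (?e h) \<le> Lm then 18 * g * \<theta> * Lm powr (-1/2) * (?f h / sqrt (real (?e h))) else 0)
        + 18 * g * ?s * (?f h / real (?e h))
        + (if real (?e h) > Lm then 4 * g * (?f h / real (?e h)) else 0)
        + 4 * g * \<omega> / Lm * (?f h / real (?e h))" .
    qed
    also have "\<dots> = 18 * g * \<theta> * Lm powr (-1/2) * (\<Sum>h\<in>{h\<in>expo Z. real (?e h) \<le> Lm}. ?f h / sqrt (real (?e h)))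
        + 18 * g * ?s * (\<Sum>h\<in>expo Z. ?f h / real (?e h))
        + 4 * g * (\<Sum>h\<in>{h\<in>expo Z. real (?e h) > Lm}. ?f h / real (?e h))
        + 4 * g * \<omega> / Lm * (\<Sum>h\<in>expo Z. ?f h / real (?e h))"
    proof -
      have mi: "(if c then A * x else 0) = A * (if c then x else 0)" for c and A x :: real by simp
      show ?thesis unfolding sum.inter_filter[OF finite_expo[OF finite_Z]] mi sum.distrib sum_distrib_left ..
    qed
    also have "\<dots> \<le> 18 * g * \<theta> * Lm powr (-1/2) * (Lm powr (1/4) * Phi) + 18 * g * ?s * Phi + 4 * g * (Lm powr (-1/4) * Phi) + 4 * g * \<omega> / Lm * Phi"
      using cons[OF _ Lp] cons(3)[OF _ Lp] g0 theta_ge om0 Lp N_ge by (intro add_mono mult_left_mono) auto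
    \<comment> \<open>Since \<open>-1/2 + 1/4 = -1/4\<close>, the variance error after the loss from
      \<open>1 / sqrt e\<close> and the Rankin tail end at the same power of \<open>Lm\<close>;
      \<open>1 / Lm\<close> is smaller still.\<close>
    also have "\<dots> \<le> 18 * g * \<theta> * (Lm powr (-1/4) * Phi) + 18 * g * ?s * Phi + 4 * g * \<theta> * (Lm powr (-1/4) * Phi) + 4 * g * \<omega> * (Lm powr (-1/4) * Phi)"
    proof -
      have e1: "18 * g * \<theta> * Lm powr (-1/2) * (Lm powr (1/4) * Phi) = 18 * g * \<theta> * (Lm powr (-1/4) * Phi)"
      proof -
        have "Lm powr (-1/2) * Lm powr (1/4) = Lm powr (-1/4)" by (simp add: powr_add[symmetric])
        hence "18 * g * \<theta> * (Lm powr (-1/2) * Lm powr (1/4)) * Phi = 18 * g * \<theta> * Lm powr (-1/4) * Phi" by simp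
        thus ?thesis by (simp only: mult.assoc)
      qed
      have "4 * g * 1 * (Lm powr (-1/4) * Phi) \<le> 4 * g * \<theta> * (Lm powr (-1/4) * Phi)"
        using g0 theta_ge Phi_ge by (intro mult_right_mono mult_left_mono) auto
      hence "4 * g * (Lm powr (-1/4) * Phi) \<le> 4 * g * \<theta> * (Lm powr (-1/4) * Phi)" unfolding mult_1_right .
      moreover have "4 * g * \<omega> / Lm * Phi \<le> 4 * g * \<omega> * (Lm powr (-1/4) * Phi)"
      proof -
        have "1 / Lm = Lm powr (-1)" using Lp by (subst powr_minus_divide) simp
        also have "\<dots> \<le> Lm powr (-1/4)" using Lm_ge by (intro powr_mono) auto
        finally have "4 * g * \<omega> * (1 / Lm * Phi) \<le> 4 * g * \<omega> * (Lm powr (-1/4) * Phi)"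
          using g0 om0 Phi_ge by (intro mult_left_mono mult_right_mono) auto
        thus ?thesis by simp
      qed
      ultimately show ?thesis unfolding e1 by (intro add_mono order.refl)
    qed
    also have "\<dots> = g * Phi * (18 * ?s + (22 * \<theta> + 4 * \<omega>) * Lm powr (-1/4))" by (simp add: algebra_simps)
    also have "\<dots> = N * \<kappa> * R * (1 + H) * Phi * (18 * ?s + (22 * \<theta> + 4 * \<omega>) * Lm powr (-1/4)) * (1 / real a)"
      unfolding g_def by simp
    finally show ?thesis .
  qed
  have "(\<Sum>n\<in>NQ. \<Sum>k\<in>KC \<mu> n. \<bar>Wsum n k - \<kappa> * R * (cq * S1 * H) / real n\<bar>) \<le> (\<Sum>n\<in>NQ. \<Sum>k\<in>KC \<mu> n. \<Sum>a\<in>R1. \<Sum>h\<in>expo Z. ?f h * X a h n k)"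
    unfolding X_def by (intro sum_mono Wsum_minus_mean_le)
  also have "\<dots> = (\<Sum>n\<in>NQ. \<Sum>a\<in>R1. \<Sum>k\<in>KC \<mu> n. \<Sum>h\<in>expo Z. ?f h * X a h n k)"
    by (rule sum.cong[OF refl], rule sum.swap)
  also have "\<dots> = (\<Sum>a\<in>R1. \<Sum>n\<in>NQ. \<Sum>k\<in>KC \<mu> n. \<Sum>h\<in>expo Z. ?f h * X a h n k)" by (rule sum.swap)
  also have "\<dots> = (\<Sum>a\<in>R1. \<Sum>n\<in>NQ. \<Sum>h\<in>expo Z. \<Sum>k\<in>KC \<mu> n. ?f h * X a h n k)"
    by (rule sum.cong[OF refl], rule sum.cong[OF refl], rule sum.swap)
  also have "\<dots> = (\<Sum>a\<in>R1. \<Sum>h\<in>expo Z. \<Sum>n\<in>NQ. \<Sum>k\<in>KC \<mu> n. ?f h * X a h n k)"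
    by (rule sum.cong[OF refl], rule sum.swap)
  also have "\<dots> = (\<Sum>a\<in>R1. \<Sum>h\<in>expo Z. ?f h * (\<Sum>n\<in>NQ. \<Sum>k\<in>KC \<mu> n. X a h n k))"
    by (simp only: sum_distrib_left)
  also have "\<dots> \<le> (\<Sum>a\<in>R1. N * \<kappa> * R * (1 + H) * Phi * (18 * sqrt (real (card T) / N) + (22 * \<theta> + 4 * \<omega>) * Lm powr (-1/4)) * (1 / real a))"
    by (intro sum_mono perA)
  also have "\<dots> = N * \<kappa> * R * S1 * (1 + H) * Phi * (18 * sqrt (real (card T) / N) + (22 * \<theta> + 4 * \<omega>) * Lm powr (-1/4))"
    unfolding S1_def sum_distrib_left[symmetric] by (simp add: mult_ac)
  finally show ?thesis .
qed

end

section \<open>The Type II sum\<close>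

text \<open>\<open>disc\<close> sums a convolution over its nonzero values only. Grouping the pairs
  \<open>(m, n)\<close> by their product recovers a double sum, the vanishing values contributing
  nothing.\<close>

lemma sum_dconv_indicator:
  fixes \<alpha> :: "nat \<Rightarrow> real" and A B :: "nat set"
  assumes fin: "finite A" "finite B" and pos: "\<And>m. m \<in> A \<Longrightarrow> m > 0" "\<And>n. n \<in> B \<Longrightarrow> n > 0"
    and supp: "\<And>m. m > 0 \<Longrightarrow> \<alpha> m \<noteq> 0 \<Longrightarrow> m \<in> A"
  shows "(\<Sum>n | 1 \<le> n \<and> dconv \<alpha> (\<lambda>n. if n \<in> B then 1 else 0) n \<noteq> 0 \<and> Q n. dconv \<alpha> (\<lambda>n. if n \<in> B then 1 else 0) n)
     = (\<Sum>m\<in>A. \<Sum>n\<in>B. if Q (m * n) then \<alpha> m else 0)"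
proof -
  let ?D = "dconv \<alpha> (\<lambda>n. if n \<in> B then 1 else 0)"
  define S where "S = (\<lambda>(m, n). m * n) ` (A \<times> B)"
  have finS: "finite S" unfolding S_def using fin by simp
  have Spos: "n \<ge> 1" if "n \<in> S" for n using that pos unfolding S_def by (auto simp: Suc_le_eq)
  have D_eq: "?D n = (\<Sum>x\<in>{x\<in>A \<times> B. (case x of (m, n) \<Rightarrow> m * n) = n}. \<alpha> (fst x))" if n: "n \<ge> 1" for n
  proof -
    have "?D n = (\<Sum>d\<in>{d. d dvd n \<and> d \<in> A \<and> n div d \<in> B}. \<alpha> d)"
      unfolding dconv_def
    proof (rule sum.mono_neutral_cong_right)
      show "finite {d. d dvd n}" using n by simp
      show "\<forall>d\<in>{d. d dvd n} - {d. d dvd n \<and> d \<in> A \<and> n div d \<in> B}. \<alpha> d * (if n div d \<in> B then 1 else 0) = 0"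
        using supp n by (auto dest: dvd_pos_nat)
    qed auto
    also have "\<dots> = (\<Sum>x\<in>{x\<in>A \<times> B. (case x of (m, n) \<Rightarrow> m * n) = n}. \<alpha> (fst x))"
      by (rule sum.reindex_bij_witness[of _ fst "\<lambda>d. (d, n div d)"]) (use pos in auto)
    finally show ?thesis .
  qed
  have D0: "?D n = 0" if "n \<ge> 1" "n \<notin> S" for n
    unfolding D_eq[OF that(1)] by (rule sum.neutral) (use that(2) in \<open>auto simp: S_def\<close>)
  have "(\<Sum>n | 1 \<le> n \<and> ?D n \<noteq> 0 \<and> Q n. ?D n) = (\<Sum>n\<in>S. if Q n then ?D n else 0)"
  proof (rule sum.mono_neutral_cong_left[OF finS])
    show "{n. 1 \<le> n \<and> ?D n \<noteq> 0 \<and> Q n} \<subseteq> S" using D0 by auto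
  qed (use Spos in auto)
  also have "\<dots> = (\<Sum>n\<in>S. \<Sum>x\<in>{x\<in>A \<times> B. (case x of (m, n) \<Rightarrow> m * n) = n}. if Q (fst x * snd x) then \<alpha> (fst x) else 0)"
  proof (rule sum.cong[OF refl])
    fix n assume n: "n \<in> S"
    show "(if Q n then ?D n else 0) = (\<Sum>x\<in>{x\<in>A \<times> B. (case x of (m, n) \<Rightarrow> m * n) = n}. if Q (fst x * snd x) then \<alpha> (fst x) else 0)"
    proof -
      have "(\<Sum>x\<in>{x\<in>A \<times> B. (case x of (m, n) \<Rightarrow> m * n) = n}. if Q (fst x * snd x) then \<alpha> (fst x) else 0) =
        (\<Sum>x\<in>{x\<in>A \<times> B. (case x of (m, n) \<Rightarrow> m * n) = n}. if Q n then \<alpha> (fst x) else 0)"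
        by (rule sum.cong[OF refl]) auto
      thus ?thesis unfolding D_eq[OF Spos[OF n]] by (cases "Q n") simp_all
    qed
  qed
  also have "\<dots> = (\<Sum>x\<in>A \<times> B. if Q (fst x * snd x) then \<alpha> (fst x) else 0)"
    by (rule sum.group) (use fin finS in \<open>auto simp: S_def\<close>)
  also have "\<dots> = (\<Sum>m\<in>A. \<Sum>n\<in>B. if Q (m * n) then \<alpha> m else 0)"
    by (simp add: sum.cartesian_product split_def)
  finally show ?thesis .
qed

lemma disc_dconv_indicator:
  fixes \<alpha> :: "nat \<Rightarrow> real" and A B :: "nat set"
  assumes fin: "finite A" "finite B" and pos: "\<And>m. m \<in> A \<Longrightarrow> m > 0" "\<And>n. n \<in> B \<Longrightarrow> n > 0"
    and supp: "\<And>m. m > 0 \<Longrightarrow> \<alpha> m \<noteq> 0 \<Longrightarrow> m \<in> A"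
  shows "disc (dconv \<alpha> (\<lambda>n. if n \<in> B then 1 else 0)) a r =
     (\<Sum>m\<in>A. \<Sum>n\<in>B. if [m * n = a] (mod r) then \<alpha> m else 0)
     - 1 / real (totient r) * (\<Sum>m\<in>A. \<Sum>n\<in>B. if coprime (m * n) r then \<alpha> m else 0)"
  unfolding disc_def
  using sum_dconv_indicator[OF fin pos supp, where Q = "\<lambda>n. [n = a] (mod r)"]
    sum_dconv_indicator[OF fin pos supp, where Q = "\<lambda>n. coprime n r"] by simp

section \<open>Character sums over integers coprime to r\<close>

lemma div_ceiling_le_iff:
  fixes a m p :: nat assumes "p > 0" shows "(a + p - 1) div p \<le> m \<longleftrightarrow> a \<le> p * m"
proof -
  have "(a + p - 1) div p \<le> m \<longleftrightarrow> (a + p - 1) div p < m + 1" by auto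
  also have "\<dots> \<longleftrightarrow> a + p - 1 < (m + 1) * p" by (rule div_less_iff_less_mult[OF assms])
  also have "(m + 1) * p = p * m + p" by (simp add: algebra_simps)
  also have "a + p - 1 < p * m + p \<longleftrightarrow> a \<le> p * m" using assms by linarith
  finally show ?thesis .
qed

text \<open>Removing a prime \<open>p\<close> subtracts the multiples of \<open>p\<close>, which are
  \<open>p\<close> times the points of another interval, and multiplicativity pulls out
  \<open>\<chi> p\<close>. Each prime doubles the bound, and the induction has to run over all
  intervals at once.\<close>

lemma norm_sum_avoiding_primes_le:
  fixes \<chi> :: "nat \<Rightarrow> complex" and B :: real
  assumes fin: "finite P" and prime: "\<And>p. p \<in> P \<Longrightarrow> prime p"
    and mult: "\<And>m n. \<chi> (m * n) = \<chi> m * \<chi> n" and le1: "\<And>n. norm (\<chi> n) \<le> 1"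
    and bound: "\<And>a c. norm (\<Sum>m\<in>{a..<c}. \<chi> m) \<le> B"
  shows "norm (\<Sum>m\<in>{m\<in>{a..<c}. \<forall>p\<in>P. \<not> p dvd m}. \<chi> m) \<le> 2 ^ card P * B"
  using fin prime
proof (induction P arbitrary: a c rule: finite_induct)
  case empty
  have "{m\<in>{a..<c}. \<forall>p\<in>{}. \<not> p dvd m} = {a..<c}" by auto
  thus ?case using bound by simp
next
  case (insert p P)
  have p: "prime p" using insert.prems by simp
  have p0: "p > 0" using p by (rule prime_gt_0_nat)
  \<comment> \<open>The ceilings of \<open>a / p\<close> and \<open>c / p\<close>.\<close>
  define a' c' where "a' = (a + p - 1) div p" and "c' = (c + p - 1) div p"
  let ?F = "\<lambda>a c. {m\<in>{a..<c}. \<forall>p'\<in>P. \<not> p' dvd m}"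
  have "(\<lambda>m. p * m) ` ?F a' c' = {m\<in>?F a c. p dvd m}"
  proof (intro equalityI subsetI)
    fix x assume "x \<in> (\<lambda>m. p * m) ` ?F a' c'"
    then obtain m where m: "x = p * m" "a' \<le> m" "m < c'" "\<forall>p'\<in>P. \<not> p' dvd m" by auto
    have "\<not> p' dvd p * m" if "p' \<in> P" for p'
    proof -
      have "prime p'" "p' \<noteq> p" using insert that by auto
      thus ?thesis using m(4) that p by (auto simp: prime_dvd_mult_iff dest: primes_dvd_imp_eq)
    qed
    thus "x \<in> {m\<in>?F a c. p dvd m}"
      using m div_ceiling_le_iff[OF p0, of a m] div_ceiling_le_iff[OF p0, of c m] unfolding a'_def c'_def by auto
  next
    fix x assume x: "x \<in> {m\<in>?F a c. p dvd m}"
    then obtain m where m: "x = p * m" by auto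
    hence "m \<in> ?F a' c'"
      using x div_ceiling_le_iff[OF p0, of a m] div_ceiling_le_iff[OF p0, of c m] unfolding a'_def c'_def by auto
    thus "x \<in> (\<lambda>m. p * m) ` ?F a' c'" using m by blast
  qed
  hence "(\<Sum>m\<in>{m\<in>?F a c. p dvd m}. \<chi> m) = (\<Sum>m\<in>(\<lambda>m. p * m) ` ?F a' c'. \<chi> m)" by simp
  also have "\<dots> = (\<Sum>m\<in>?F a' c'. \<chi> (p * m))"
    by (rule sum.reindex_cong[OF _ refl refl]) (use p0 in \<open>auto simp: inj_on_def\<close>)
  also have "\<dots> = \<chi> p * (\<Sum>m\<in>?F a' c'. \<chi> m)" by (simp only: mult sum_distrib_left)
  finally have 1: "(\<Sum>m\<in>{m\<in>?F a c. p dvd m}. \<chi> m) = \<chi> p * (\<Sum>m\<in>?F a' c'. \<chi> m)" .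
  have "{m\<in>{a..<c}. \<forall>p'\<in>insert p P. \<not> p' dvd m} = ?F a c - {m\<in>?F a c. p dvd m}" by auto
  hence "(\<Sum>m\<in>{m\<in>{a..<c}. \<forall>p'\<in>insert p P. \<not> p' dvd m}. \<chi> m) = (\<Sum>m\<in>?F a c. \<chi> m) - (\<Sum>m\<in>{m\<in>?F a c. p dvd m}. \<chi> m)"
    by (simp only:) (rule sum_diff, auto)
  hence "norm (\<Sum>m\<in>{m\<in>{a..<c}. \<forall>p'\<in>insert p P. \<not> p' dvd m}. \<chi> m) \<le> norm (\<Sum>m\<in>?F a c. \<chi> m) + norm (\<chi> p) * norm (\<Sum>m\<in>?F a' c'. \<chi> m)"
    unfolding 1 norm_mult[symmetric] by (simp only: norm_triangle_ineq4)
  also have "\<dots> \<le> 2 ^ card P * B + 1 * (2 ^ card P * B)"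
    using insert by (intro add_mono mult_mono le1 insert.IH) auto
  also have "\<dots> = 2 ^ card (insert p P) * B" using insert by simp
  finally show ?case .
qed

lemma norm_sum_coprime_le:
  assumes \<chi>: "primitive_character q \<chi>" "q > 1" and r: "r > 0" and uv: "0 \<le> u" "u \<le> v"
  shows "norm (\<Sum>m\<in>{m. u < real m \<and> real m \<le> v \<and> coprime m r}. \<chi> m) \<le> 2 ^ card (prime_factors r) * (2 * sqrt (real q) * (1 + ln (real q)))"
proof -
  have ch: "dirichlet_character q \<chi>" using \<chi>(1) unfolding primitive_character_def by simp
  have cop: "coprime m r \<longleftrightarrow> (\<forall>p\<in>prime_factors r. \<not> p dvd m)" for m
  proof
    assume "coprime m r" thus "\<forall>p\<in>prime_factors r. \<not> p dvd m"
      using prime_dvd_both_not_coprime_nat by (auto simp: in_prime_factors_iff)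
  next
    assume "\<forall>p\<in>prime_factors r. \<not> p dvd m" thus "coprime m r"
      using r not_coprime_obtain_prime_nat[of m r] by (auto simp: in_prime_factors_iff)
  qed
  define A C where "A = nat \<lfloor>u\<rfloor> + 1" and "C = nat \<lfloor>u\<rfloor> + 1 + (nat \<lfloor>v\<rfloor> - nat \<lfloor>u\<rfloor>)"
  have "{m. u < real m \<and> real m \<le> v \<and> coprime m r} = {m\<in>{m. u < real m \<and> real m \<le> v}. coprime m r}" by auto
  also have "\<dots> = {m\<in>{A..<C}. \<forall>p\<in>prime_factors r. \<not> p dvd m}"
    unfolding nat_interval_eq[OF uv] A_def C_def cop ..
  finally show ?thesis
    using norm_sum_avoiding_primes_le[of "prime_factors r" \<chi> "2 * sqrt (real q) * (1 + ln (real q))" A C]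
      dirichlet_character_mult[OF ch] norm_dirichlet_character_le_1[OF ch] polya_vinogradov[OF \<chi>] by auto
qed

text \<open>\<open>q_le\<close> gives \<open>m n > q\<close> for \<open>m > M\<close> and
  \<open>n >= N\<close>, so \<open>k\<close> is a natural number. The three inequalities with
  \<open>\<kappa>\<close> absorb the shift by \<open>q\<close>, the rounding of interval counts and
  the rounding of class counts into errors proportional to \<open>\<kappa>\<close>.\<close>

locale moduli_char = moduli +
  fixes \<chi> :: "nat \<Rightarrow> complex" and M \<mu> :: real
  assumes prim: "primitive_character q \<chi>" and q_gt: "q > 1"
    and mu: "1/2 \<le> \<mu>" "\<mu> \<le> 1" and M_eq: "M = \<mu> * R"
    and q_small: "real q \<le> \<kappa> * N * R" and kN: "1 \<le> \<kappa> * N" and kR: "N \<le> \<kappa> * R" and q_le: "real q \<le> N * M"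
    and sqf: "\<And>a. a \<in> R1 \<Longrightarrow> squarefree a" "\<And>t. t \<in> T \<Longrightarrow> squarefree t"
begin

lemma ch: "dirichlet_character q \<chi>"
  using prim unfolding primitive_character_def by simp

lemmas ch_mult = dirichlet_character_mult[OF ch]
lemmas ch_le_1 = norm_dirichlet_character_le_1[OF ch]

lemma M_pos: "M > 0" and M_le_R: "M \<le> R"
proof -
  show "M > 0" unfolding M_eq using mu R_pos by simp
  have "\<mu> * R \<le> 1 * R" using mu R_pos by (intro mult_right_mono) auto
  thus "M \<le> R" unfolding M_eq by simp
qed

text \<open>The moduli of these triples are squarefree and coprime to \<open>q\<close>, as the Type
  II estimate and the switch require.\<close>

definition tripq :: "(nat \<times> nat \<times> nat) set" where "tripq = {s\<in>trip. wt s \<noteq> 0}"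

lemma tripD:
  assumes "(a, t, l) \<in> trip"
  shows "a \<in> R1" "t \<in> T" "R < real (md (a, t, l))" "real (md (a, t, l)) \<le> (1 + \<kappa>) * R" "l > 0" "real l \<le> Lm"
proof -
  show "a \<in> R1" "t \<in> T" "R < real (md (a, t, l))" "real (md (a, t, l)) \<le> (1 + \<kappa>) * R"
    using assms unfolding trip_def md_def by auto
  have "R < real (a * t * l)" "real (a * t * l) \<le> (1 + \<kappa>) * R" using assms unfolding trip_def by auto
  thus "l > 0" using R_pos by (cases l) auto
  show "real l \<le> Lm" using \<open>a \<in> R1\<close> \<open>t \<in> T\<close> \<open>real (a * t * l) \<le> (1 + \<kappa>) * R\<close> by (rule l_le_Lm)
qed

lemma md_range:
  assumes "s \<in> trip" shows "R < real (md s)" "real (md s) \<le> (1 + \<kappa>) * R" "md s > 0"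
proof -
  obtain a t l where s: "s = (a, t, l)" by (cases s)
  show 1: "R < real (md s)" "real (md s) \<le> (1 + \<kappa>) * R" using tripD(3,4)[of a t l] assms unfolding s by auto
  thus "md s > 0" using R_pos by (cases "md s") auto
qed

text \<open>\<open>a\<close> is coprime to \<open>t'\<close> and to \<open>l' <= Lm\<close>, so it
  divides \<open>a'\<close>; likewise for \<open>t\<close>, and by symmetry both agree. Sums over
  triples are thus sums over distinct moduli.\<close>

lemma inj_on_md: "inj_on md trip"
proof (rule inj_onI)
  fix s s' assume A: "s \<in> trip" "s' \<in> trip" "md s = md s'"
  obtain a t l where s: "s = (a, t, l)" by (cases s)
  obtain a' t' l' where s': "s' = (a', t', l')" by (cases s')
  note D = tripD[of a t l] tripD[of a' t' l']
  have *: "a dvd a' \<and> t dvd t'" if A: "(a, t, l) \<in> trip" "(a', t', l') \<in> trip" "a * t * l = a' * t' * l'" for a t l a' t' l'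
  proof -
    note D = tripD[OF A(1)] tripD[OF A(2)]
    have "a dvd a' * (t' * l')" using A(3) by (metis dvd_triv_left mult.assoc)
    moreover have "coprime a (t' * l')" using D by (simp add: cop coprime_small_R1)
    ultimately have "a dvd a'" by (simp add: coprime_dvd_mult_left_iff)
    have "t dvd t' * (a' * l')" using A(3) by (metis dvd_triv_left mult.assoc mult.commute)
    moreover have "coprime t a'" using cop[OF D(7,2)] by (simp only: coprime_commute)
    moreover have "coprime t l'" using D by (intro coprime_small) auto
    ultimately have "t dvd t'" by (simp add: coprime_dvd_mult_left_iff)
    thus ?thesis using \<open>a dvd a'\<close> by simp
  qed
  have eq: "a * t * l = a' * t' * l'" using A(3) unfolding s s' md_def by simp
  have "a = a'" "t = t'"
    using *[of a t l a' t' l'] *[of a' t' l' a t l] A eq unfolding s s' by (auto intro: dvd_antisym)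
  moreover have "a' * t' > 0" using A(2) D(7,8) pos unfolding s' by simp
  ultimately show "s = s'" using eq unfolding s s' by simp
qed

lemma wt_nonneg: "wt s \<ge> 0"
  unfolding wt_def by (cases s) (simp add: sf_weight_nonneg Z_prime)

definition cmax :: real where "cmax = 2 * ln Lm + 1"

lemma cmax_ge: "cmax \<ge> 1" unfolding cmax_def using Lm_ge by simp

lemma wt_le: assumes "s \<in> trip" shows "wt s \<le> cmax"
proof -
  obtain a t l where s: "s = (a, t, l)" by (cases s)
  have l: "l > 0" "real l \<le> Lm" using tripD[of a t l] assms unfolding s by auto
  have "sf_weight q Z l \<le> real (card (prime_factors l)) + 1" by (rule sf_weight_le[OF finite_Z Z_prime l(1)])
  also have "\<dots> \<le> 2 * ln (real l) + 1" using card_prime_factors_le_ln[OF l(1)] by simp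
  also have "\<dots> \<le> cmax" unfolding cmax_def using l by simp
  finally show ?thesis unfolding s wt_def by simp
qed

lemma tripq_sf:
  assumes "s \<in> tripq" shows "squarefree (md s)" "coprime (md s) q"
proof -
  obtain a t l where s: "s = (a, t, l)" by (cases s)
  have tr: "(a, t, l) \<in> trip" and w: "sf_weight q Z l \<noteq> 0" using assms unfolding tripq_def s wt_def by auto
  note D = tripD[OF tr]
  have cov: "p \<in> Z" if "prime p" "p dvd l" for p
  proof -
    have "p \<le> l" using that D(5) by (intro dvd_imp_le) auto
    thus ?thesis using that D(6) unfolding Z_def by simp
  qed
  note L = sf_weight_nonzeroD[OF finite_Z Z_prime w D(5) cov]
  have ca: "coprime a q"
    using R1_prime[OF D(1)] not_coprime_obtain_prime_nat[of a q] by blast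
  have ct: "coprime t q"
    using T_prime[OF D(2)] not_coprime_obtain_prime_nat[of t q] by blast
  show "coprime (md s) q" unfolding s md_def using ca ct L(2) by simp
  have "coprime a t" by (rule cop[OF D(1,2)])
  moreover have "coprime (a * t) l" using D by (simp add: coprime_small coprime_small_R1)
  ultimately show "squarefree (md s)" unfolding s md_def prod.case
    using sqf(1)[OF D(1)] sqf(2)[OF D(2)] L(1) by (intro squarefree_mult_coprime) auto
qed

definition MD :: "nat set" where "MD = {m. M < real m \<and> real m \<le> 2 * M}"

lemma finite_MD [simp]: "finite MD" unfolding MD_def by (rule finite_nat_interval)

lemma ND_coprime_iff: "n \<in> NQ \<longleftrightarrow> n \<in> ND \<and> \<chi> n \<noteq> 0"
  unfolding NQ_def using dirichlet_character_eq_0_iff[OF ch] by auto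

text \<open>The equation \<open>m n = r k + q\<close> turns \<open>\<chi>(m) cnj (\<chi>(r))\<close> into \<open>cnj (\<chi>(n)) \<chi>(k)\<close>.\<close>
lemma switch_sum:
  assumes s: "s \<in> tripq" and n: "n \<in> NQ"
  shows "(\<Sum>m\<in>{m\<in>MD. [m * n = q] (mod md s)}. cnj (\<chi> (md s)) * \<chi> m) =
    (\<Sum>k\<in>{k. n dvd md s * k + q \<and> real n * M < real (md s * k + q) \<and> real (md s * k + q) \<le> 2 * (real n * M)}. cnj (\<chi> n) * \<chi> k)"
proof -
  define r where "r = md s"
  have r: "r > 0" "coprime r q" using s md_range(3) tripq_sf(2) unfolding tripq_def r_def by auto
  have nq: "coprime n q" "n \<in> ND" using n unfolding NQ_def by auto
  have nN: "n \<ge> 1" "N \<le> real n" using ND_ge(1)[OF nq(2)] nq(2) unfolding ND_def by auto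
  show ?thesis unfolding r_def[symmetric]
  proof (rule sum.reindex_bij_witness[of _ "\<lambda>k. (r * k + q) div n" "\<lambda>m. (m * n - q) div r"])
    fix m assume m: "m \<in> {m\<in>MD. [m * n = q] (mod r)}"
    have "real q \<le> N * M" by (rule q_le)
    also have "\<dots> \<le> real n * M" using nN M_pos by (intro mult_right_mono) auto
    also have "\<dots> < real n * real m" using m nN unfolding MD_def by simp
    finally have "real q < real (m * n)" by (simp add: mult.commute)
    hence mq: "q < m * n" by (simp only: of_nat_less_iff)
    have "r dvd m * n - q" using m mq by (simp add: cong_altdef_nat)
    then obtain k where k: "m * n - q = r * k" by blast
    have e: "r * k + q = m * n" using k mq by simp
    have kd: "(m * n - q) div r = k" using k r by simp
    show "(r * ((m * n - q) div r) + q) div n = m" unfolding kd e using nN by simp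
    have "real n * M < real n * real m" "real n * real m \<le> real n * (2 * M)"
      using m nN unfolding MD_def by auto
    thus "(m * n - q) div r \<in> {k. n dvd r * k + q \<and> real n * M < real (r * k + q) \<and> real (r * k + q) \<le> 2 * (real n * M)}"
      unfolding kd mem_Collect_eq e by (simp add: mult_ac)
    show "cnj (\<chi> n) * \<chi> ((m * n - q) div r) = cnj (\<chi> r) * \<chi> m" unfolding kd
    proof -
      have "\<chi> m * \<chi> n = \<chi> (r * k + q)" unfolding e ch_mult ..
      also have "\<dots> = \<chi> (r * k)" by (rule dirichlet_character_cong[OF ch]) (simp add: unique_euclidean_semiring_class.cong_def)
      finally have mn: "\<chi> m * \<chi> n = \<chi> r * \<chi> k" unfolding ch_mult .
      have "cnj (\<chi> r) * \<chi> m = cnj (\<chi> r) * (\<chi> m * \<chi> n) * cnj (\<chi> n)"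
        using dirichlet_character_cnj_mult(2)[OF ch nq(1)] by (simp add: mult.assoc)
      also have "\<dots> = (cnj (\<chi> r) * \<chi> r) * (cnj (\<chi> n) * \<chi> k)" unfolding mn by (simp only: mult_ac)
      also have "\<dots> = cnj (\<chi> n) * \<chi> k" using dirichlet_character_cnj_mult(1)[OF ch r(2)] by simp
      finally show "cnj (\<chi> n) * \<chi> k = cnj (\<chi> r) * \<chi> m" ..
    qed
  next
    fix k assume k: "k \<in> {k. n dvd r * k + q \<and> real n * M < real (r * k + q) \<and> real (r * k + q) \<le> 2 * (real n * M)}"
    then obtain m where m: "r * k + q = n * m" by blast
    have md: "(r * k + q) div n = m" unfolding m using nN by simp
    show "((r * k + q) div n * n - q) div r = k" unfolding md
    proof -
      have "m * n - q = r * k" using m by (simp add: mult.commute)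
      thus "(m * n - q) div r = k" using r by simp
    qed
    have "real n * M < real n * real m" "real n * real m \<le> real n * (2 * M)"
      using k unfolding mem_Collect_eq m by (auto simp: mult_ac)
    hence "M < real m" "real m \<le> 2 * M" using nN by auto
    moreover have "[m * n = q] (mod r)"
    proof -
      have "[r * k + q = 0 + q] (mod r)" by (intro cong_add cong_refl) (simp add: cong_mult_self_left)
      thus ?thesis unfolding m by (simp add: mult.commute)
    qed
    ultimately show "(r * k + q) div n \<in> {m\<in>MD. [m * n = q] (mod r)}" unfolding md MD_def by simp
  qed
qed

text \<open>The exact condition on \<open>k\<close> involves \<open>r k + q\<close> with
  \<open>r\<close> between \<open>R\<close> and \<open>(1 + \<kappa>) R\<close>, so its end points
  move with \<open>r\<close>. These are the \<open>k\<close> near the ends of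
  \<open>kwin \<mu> n\<close> whose membership may depend on \<open>r\<close>.\<close>

definition bdry :: "nat \<Rightarrow> nat set" where
  "bdry n = {k. \<mu> * real n * (1 - \<kappa>) - real q / R < real k \<and> real k \<le> \<mu> * real n} \<union>
     {k. 2 * \<mu> * real n * (1 - \<kappa>) - real q / R < real k \<and> real k \<le> 2 * \<mu> * real n}"

lemma finite_bdry [simp]: "finite (bdry n)" unfolding bdry_def by (auto intro: finite_nat_interval)

lemma card_nat_interval_le:
  fixes u v :: real assumes "u \<le> v" "0 \<le> v"
  shows "real (card {l::nat. u < real l \<and> real l \<le> v}) \<le> (v - u) + 2"
proof (cases "0 \<le> u")
  case True
  thus ?thesis using card_nat_interval[OF True assms(1)] by (simp add: abs_le_iff)
next
  case False
  have "{l::nat. u < real l \<and> real l \<le> v} \<subseteq> {..nat \<lfloor>v\<rfloor>}" by (auto simp: le_nat_floor)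
  hence "card {l::nat. u < real l \<and> real l \<le> v} \<le> card {..nat \<lfloor>v\<rfloor>}" by (intro card_mono) auto
  hence "real (card {l::nat. u < real l \<and> real l \<le> v}) \<le> real (nat \<lfloor>v\<rfloor>) + 1" by simp
  also have "\<dots> \<le> v + 1" using assms by simp
  finally show ?thesis using False by simp
qed

lemma card_bdry_le:
  assumes "n \<in> ND" shows "real (card (bdry n)) \<le> 12 * \<kappa> * N"
proof -
  have n: "real n \<le> 2 * N" "n \<ge> 1" using ND_ge assms by auto
  have qR: "0 \<le> real q / R" "real q / R \<le> \<kappa> * N" using q_small R_pos by (auto simp: field_simps)
  have mn: "0 \<le> \<mu> * real n" using mu by simp
  have d: "\<mu> * real n * (1 - \<kappa>) = \<mu> * real n - \<kappa> * (\<mu> * real n)" "2 * \<mu> * real n * (1 - \<kappa>) = 2 * (\<mu> * real n) - 2 * (\<kappa> * (\<mu> * real n))"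
    by (simp_all add: algebra_simps)
  have km: "0 \<le> \<kappa> * (\<mu> * real n)" "\<kappa> * (\<mu> * real n) \<le> \<kappa> * (2 * N)"
  proof -
    show "0 \<le> \<kappa> * (\<mu> * real n)" using kap mn by simp
    have "\<mu> * real n \<le> 1 * (2 * N)" using mu n by (intro mult_mono) auto
    thus "\<kappa> * (\<mu> * real n) \<le> \<kappa> * (2 * N)" using kap by (intro mult_left_mono) auto
  qed
  have "real (card (bdry n)) \<le> real (card {k::nat. \<mu> * real n * (1 - \<kappa>) - real q / R < real k \<and> real k \<le> \<mu> * real n})
     + real (card {k::nat. 2 * \<mu> * real n * (1 - \<kappa>) - real q / R < real k \<and> real k \<le> 2 * \<mu> * real n})"
    unfolding bdry_def of_nat_add[symmetric] of_nat_le_iff by (rule card_Un_le)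
  also have "\<dots> \<le> (\<mu> * real n - (\<mu> * real n * (1 - \<kappa>) - real q / R) + 2) + (2 * \<mu> * real n - (2 * \<mu> * real n * (1 - \<kappa>) - real q / R) + 2)"
    using d km qR mn by (intro add_mono card_nat_interval_le) auto
  also have "\<dots> = 3 * (\<kappa> * (\<mu> * real n)) + 2 * (real q / R) + 4" unfolding d by simp
  also have "\<dots> \<le> 3 * (\<kappa> * (2 * N)) + 2 * (\<kappa> * N) + 4 * (\<kappa> * N)" using km qR kN by linarith
  finally show ?thesis by (simp add: algebra_simps)
qed

text \<open>As \<open>r > R\<close>, any \<open>k\<close> above an end point of
  \<open>kwin \<mu> n\<close> already makes \<open>r k + q\<close> exceed the corresponding multiple
  of \<open>n M\<close>. The true window is therefore shifted downwards, and only \<open>k\<close>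
  below the two end points are in doubt.\<close>

lemma window_symdiff:
  fixes r k :: nat
  assumes r: "R < real r" "real r \<le> (1 + \<kappa>) * R" and n: "n \<in> ND"
  shows "real n * M < real (r * k + q) \<and> real (r * k + q) \<le> 2 * (real n * M) \<Longrightarrow> k \<notin> kwin \<mu> n \<Longrightarrow> k \<in> bdry n"
    and "\<not> (real n * M < real (r * k + q) \<and> real (r * k + q) \<le> 2 * (real n * M)) \<Longrightarrow> k \<in> kwin \<mu> n \<Longrightarrow> k \<in> bdry n"
proof -
  have Rr: "R > 0" by (rule R_pos)
  have low: "R * real k \<le> real r * real k" "real r * real k \<le> (1 + \<kappa>) * (R * real k)"
    using r mult_right_mono[of R "real r" "real k"] mult_right_mono[of "real r" "(1 + \<kappa>) * R" "real k"] by (auto simp: mult.assoc)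
  \<comment> \<open>Multiplication by \<open>1 - \<kappa>\<close> replaces division by
    \<open>1 + \<kappa>\<close>, since \<open>(1 - \<kappa>) (1 + \<kappa>) <= 1\<close>.\<close>
  have sl: "x * (1 - \<kappa>) - real q / R < real k" if "x \<ge> 0" "R * x < (1 + \<kappa>) * (R * real k) + real q" for x
  proof -
    have "R * x - real q < R * ((1 + \<kappa>) * real k)" using that(2) by (simp add: mult_ac)
    hence "x - real q / R < (1 + \<kappa>) * real k" using Rr by (simp add: field_simps)
    hence "(1 - \<kappa>) * (x - real q / R) \<le> (1 - \<kappa>) * ((1 + \<kappa>) * real k)" using kap by (intro mult_left_mono) auto
    moreover have "(1 - \<kappa>) * ((1 + \<kappa>) * real k) = real k - \<kappa> * \<kappa> * real k" by (simp add: algebra_simps)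
    moreover have "\<kappa> * \<kappa> * real k \<ge> 0" using kap by simp
    moreover have "(1 - \<kappa>) * (x - y) = x * (1 - \<kappa>) - y + \<kappa> * y" for y by (simp add: algebra_simps)
    note this[of "real q / R"]
    moreover have "\<kappa> * (real q / R) > 0" using kap Rr q_pos by simp
    ultimately show ?thesis by linarith
  qed
  have nM: "real n * M = R * (\<mu> * real n)" unfolding M_eq by (simp only: mult_ac)
  have mn: "0 \<le> \<mu> * real n" using mu by simp
  have rk: "real (r * k + q) = real r * real k + real q" by simp
  have s1: "\<mu> * real n * (1 - \<kappa>) - real q / R < real k" if "real n * M < real (r * k + q)"
    using sl[OF mn] that low unfolding nM rk by linarith
  have s2: "2 * \<mu> * real n * (1 - \<kappa>) - real q / R < real k" if "2 * (real n * M) < real (r * k + q)"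
  proof -
    have e: "R * (2 * \<mu> * real n) = 2 * (real n * M)" unfolding nM by simp
    show ?thesis
    proof (rule sl)
      show "R * (2 * \<mu> * real n) < (1 + \<kappa>) * (R * real k) + real q"
        unfolding e using that low unfolding rk by linarith
    qed (use mn in simp)
  qed
  {
    assume a: "real n * M < real (r * k + q) \<and> real (r * k + q) \<le> 2 * (real n * M)" and b: "k \<notin> kwin \<mu> n"
    have "R * real k \<le> R * (2 * (\<mu> * real n))" using a low unfolding nM rk by simp
    hence "real k \<le> 2 * (\<mu> * real n)" using Rr by simp
    hence "real k \<le> \<mu> * real n" using b unfolding kwin_def by auto
    thus "k \<in> bdry n" using s1 a unfolding bdry_def by simp
  }
  {
    assume a: "\<not> (real n * M < real (r * k + q) \<and> real (r * k + q) \<le> 2 * (real n * M))" and b: "k \<in> kwin \<mu> n"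
    have "R * (\<mu> * real n) < R * real k" using b Rr unfolding kwin_def by simp
    hence "real n * M < real (r * k + q)" unfolding nM rk using low by (simp add: add_strict_increasing2)
    hence "2 * (real n * M) < real (r * k + q)" using a by simp
    thus "k \<in> bdry n" using s2 b unfolding bdry_def kwin_def by simp
  }
qed

text \<open>Distinct triples have distinct moduli, and those solving the divisibility lie in one
  class modulo \<open>n\<close> inside \<open>(R, (1 + \<kappa>) R]\<close>; there is none unless
  \<open>k\<close> is coprime to \<open>n\<close>. \<open>kR\<close> lets the rounding error 2 be
  counted as \<open>2 * \<kappa> * R / N\<close>.\<close>

lemma Wsum_le:
  assumes n: "n \<in> NQ"
  shows "Wsum n k \<le> cmax * (3 * \<kappa> * R / N)"
proof -
  have nq: "coprime n q" "n \<in> ND" using n unfolding NQ_def by auto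
  have nN: "n \<ge> 1" "N \<le> real n" using ND_ge(1)[OF nq(2)] nq(2) unfolding ND_def by auto
  let ?S = "{s\<in>trip. n dvd md s * k + q}"
  have "Wsum n k \<le> (\<Sum>s\<in>?S. cmax)" unfolding Wsum_def by (intro sum_mono wt_le) auto
  also have "\<dots> = real (card ?S) * cmax" by simp
  also have "\<dots> \<le> (3 * \<kappa> * R / N) * cmax"
  proof (rule mult_right_mono)
    show "real (card ?S) \<le> 3 * \<kappa> * R / N"
    proof (cases "coprime k n")
      case False
      then obtain p where p: "prime p" "p dvd k" "p dvd n" by (rule not_coprime_obtain_prime_nat)
      have "?S = {}"
      proof (rule ccontr)
        assume "?S \<noteq> {}"
        then obtain s where "n dvd md s * k + q" by auto
        hence "p dvd md s * k + q" using p(3) by (rule dvd_trans[rotated])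
        moreover have "p dvd md s * k" using p(2) by simp
        ultimately have "p dvd q" by (simp add: dvd_add_right_iff)
        thus False using nq p prime_dvd_both_not_coprime_nat by blast
      qed
      thus ?thesis using kap R_pos N_ge by (simp only: card.empty) simp
    next
      case True
      have n0: "n > 0" using nN by simp
      have "\<exists>b<n. \<forall>y. n dvd k * y + q \<longleftrightarrow> y mod n = b"
        by (rule linear_cong_residue[OF True n0, of q], blast)
      then obtain b where b: "b < n" "\<And>y. n dvd k * y + q \<longleftrightarrow> y mod n = b" by blast
      let ?Y = "{y::nat. R < real y \<and> real y \<le> (1 + \<kappa>) * R \<and> y mod n = b mod n}"
      have sub: "md ` ?S \<subseteq> ?Y"
      proof (rule image_subsetI)
        fix s assume s: "s \<in> ?S"
        hence "n dvd k * md s + q" by (simp add: mult.commute)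
        hence "md s mod n = b" unfolding b(2) .
        thus "md s \<in> ?Y" using md_range(1,2)[of s] s b(1) by simp
      qed
      have finY: "finite ?Y" by (rule finite_subset[OF _ finite_nat_interval[of R "(1 + \<kappa>) * R"]]) auto
      have "card (md ` ?S) = card ?S" by (rule card_image, rule inj_on_subset[OF inj_on_md]) auto
      hence "real (card ?S) \<le> real (card ?Y)" using card_mono[OF finY sub] by simp
      also have "\<dots> \<le> ((1 + \<kappa>) * R - R) / real n + 2"
        using card_residue_class_nat_interval[of R "(1 + \<kappa>) * R" n b] R_pos kap nN by (simp add: abs_le_iff)
      also have "(1 + \<kappa>) * R - R = \<kappa> * R" by (simp add: algebra_simps)
      also have "\<kappa> * R / real n + 2 \<le> \<kappa> * R / N + 2 * (\<kappa> * R / N)"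
      proof (rule add_mono)
        show "\<kappa> * R / real n \<le> \<kappa> * R / N" using nN N_ge kap R_pos by (intro divide_left_mono) auto
        have "1 \<le> \<kappa> * R / N" using kR N_ge by (subst le_divide_eq_1_pos) auto
        thus "2 \<le> 2 * (\<kappa> * R / N)" by linarith
      qed
      also have "\<dots> = 3 * \<kappa> * R / N" by simp
      finally show ?thesis .
    qed
  qed (use cmax_ge in simp)
  finally show ?thesis by (simp add: mult.commute)
qed

end

lemma norm_sum_diff_le_card:
  fixes g :: "'a \<Rightarrow> complex"
  assumes "finite A" "finite B" "finite X" "A - B \<subseteq> X" "B - A \<subseteq> X" "\<And>x. norm (g x) \<le> 1"
  shows "norm (sum g A - sum g B) \<le> real (card X)"
proof -
  have "sum g A = sum g (A \<inter> B) + sum g (A - B)" by (rule sum.Int_Diff[OF assms(1)])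
  moreover have "sum g B = sum g (A \<inter> B) + sum g (B - A)"
    using sum.Int_Diff[OF assms(2), of g A] by (simp add: Int_commute)
  ultimately have "norm (sum g A - sum g B) = norm (sum g (A - B) - sum g (B - A))" by simp
  also have "\<dots> \<le> norm (sum g (A - B)) + norm (sum g (B - A))" by (rule norm_triangle_ineq4)
  also have "\<dots> \<le> (\<Sum>x\<in>A - B. 1) + (\<Sum>x\<in>B - A. 1)" by (intro add_mono sum_norm_le assms(6))
  also have "\<dots> = real (card ((A - B) \<union> (B - A)))"
    using assms(1,2) by (subst card_Un_disjoint) auto
  also have "\<dots> \<le> real (card X)" unfolding of_nat_le_iff by (rule card_mono) (use assms in auto)
  finally show ?thesis .
qed

section \<open>The Type II sum before and after the switch\<close>

context moduli_char
begin

definition Dsum :: "nat \<times> nat \<times> nat \<Rightarrow> complex" where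
  "Dsum s = (\<Sum>n\<in>NQ. \<Sum>m\<in>{m\<in>MD. [m * n = q] (mod md s)}. \<chi> m)"

text \<open>The factor \<open>cnj (\<chi> (md s))\<close> is bounded by 1 and harmless for an upper
  bound, but the switch cannot be made without it.\<close>

definition Tsum :: complex where
  "Tsum = (\<Sum>s\<in>tripq. of_real (wt s) * cnj (\<chi> (md s)) * Dsum s)"

text \<open>The switched form of \<open>Tsum\<close>, with the window for \<open>k\<close> replaced
  by one independent of \<open>r\<close>, so that the sum over the moduli is gathered in
  \<open>Wsum\<close>.\<close>

definition Main :: complex where
  "Main = (\<Sum>n\<in>NQ. \<Sum>k\<in>KC \<mu> n. cnj (\<chi> n) * \<chi> k * of_real (Wsum n k))"

lemma Wsum_tripq: "Wsum n k = (\<Sum>s\<in>tripq. if n dvd md s * k + q then wt s else 0)"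
proof -
  have "Wsum n k = (\<Sum>s\<in>trip. if n dvd md s * k + q then wt s else 0)"
    unfolding Wsum_def by (rule sum.inter_filter[OF finite_trip])
  also have "\<dots> = (\<Sum>s\<in>tripq. if n dvd md s * k + q then wt s else 0)"
    by (rule sum.mono_neutral_right[OF finite_trip]) (auto simp: tripq_def)
  finally show ?thesis .
qed

lemma norm_unit_le: "norm (cnj (\<chi> n) * \<chi> k) \<le> 1"
proof -
  have "norm (\<chi> n) * norm (\<chi> k) \<le> 1 * 1" by (intro mult_mono ch_le_1) auto
  thus ?thesis by (simp add: norm_mult)
qed

text \<open>The two windows differ only inside \<open>bdry n\<close>, so the difference is at most
  the sum of \<open>Wsum\<close> over \<open>bdry n\<close>. The size of \<open>bdry n\<close> and
  the bound for \<open>Wsum\<close> each carry a factor \<open>\<kappa>\<close>, whereas the main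
  term carries only one. The constant is \<open>2 * 12 * 3\<close>.\<close>

lemma norm_Tsum_minus_Main: "norm (Tsum - Main) \<le> 72 * \<kappa>\<^sup>2 * N * R * cmax"
proof -
  let ?g = "\<lambda>n k. cnj (\<chi> n) * \<chi> k"
  define A where "A n s = {k. n dvd md s * k + q \<and> real n * M < real (md s * k + q) \<and> real (md s * k + q) \<le> 2 * (real n * M)}" for n s
  define B where "B n s = {k\<in>KC \<mu> n. n dvd md s * k + q}" for n s
  define X where "X n s = {k\<in>bdry n. n dvd md s * k + q}" for n s
  have T: "Tsum = (\<Sum>s\<in>tripq. \<Sum>n\<in>NQ. of_real (wt s) * (\<Sum>k\<in>A n s. ?g n k))"
    unfolding Tsum_def Dsum_def A_def
  proof (rule sum.cong[OF refl])
    fix s assume s: "s \<in> tripq"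
    have "of_real (wt s) * cnj (\<chi> (md s)) * (\<Sum>n\<in>NQ. \<Sum>m\<in>{m\<in>MD. [m * n = q] (mod md s)}. \<chi> m) =
      (\<Sum>n\<in>NQ. of_real (wt s) * (\<Sum>m\<in>{m\<in>MD. [m * n = q] (mod md s)}. cnj (\<chi> (md s)) * \<chi> m))"
      by (simp only: sum_distrib_left mult.assoc)
    also have "\<dots> = (\<Sum>n\<in>NQ. of_real (wt s) * (\<Sum>k\<in>{k. n dvd md s * k + q \<and> real n * M < real (md s * k + q) \<and> real (md s * k + q) \<le> 2 * (real n * M)}. ?g n k))"
      by (rule sum.cong[OF refl]) (simp only: switch_sum[OF s])
    finally show "of_real (wt s) * cnj (\<chi> (md s)) * (\<Sum>n\<in>NQ. \<Sum>m\<in>{m\<in>MD. [m * n = q] (mod md s)}. \<chi> m) = (\<Sum>n\<in>NQ. of_real (wt s) * (\<Sum>k\<in>{k. n dvd md s * k + q \<and> real n * M < real (md s * k + q) \<and> real (md s * k + q) \<le> 2 * (real n * M)}. ?g n k))" .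
  qed
  have Mn: "Main = (\<Sum>s\<in>tripq. \<Sum>n\<in>NQ. of_real (wt s) * (\<Sum>k\<in>B n s. ?g n k))"
  proof -
    have "Main = (\<Sum>n\<in>NQ. \<Sum>k\<in>KC \<mu> n. \<Sum>s\<in>tripq. of_real (wt s) * (if n dvd md s * k + q then ?g n k else 0))"
      unfolding Main_def Wsum_tripq of_real_sum sum_distrib_left
      by (intro sum.cong[OF refl]) (simp add: mult_ac)
    also have "\<dots> = (\<Sum>n\<in>NQ. \<Sum>s\<in>tripq. \<Sum>k\<in>KC \<mu> n. of_real (wt s) * (if n dvd md s * k + q then ?g n k else 0))"
      by (rule sum.cong[OF refl], rule sum.swap)
    also have "\<dots> = (\<Sum>s\<in>tripq. \<Sum>n\<in>NQ. \<Sum>k\<in>KC \<mu> n. of_real (wt s) * (if n dvd md s * k + q then ?g n k else 0))"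
      by (rule sum.swap)
    also have "\<dots> = (\<Sum>s\<in>tripq. \<Sum>n\<in>NQ. of_real (wt s) * (\<Sum>k\<in>B n s. ?g n k))"
    proof (rule sum.cong[OF refl], rule sum.cong[OF refl])
      fix s n
      show "(\<Sum>k\<in>KC \<mu> n. of_real (wt s) * (if n dvd md s * k + q then ?g n k else 0)) = of_real (wt s) * (\<Sum>k\<in>B n s. ?g n k)"
        unfolding B_def sum.inter_filter[OF finite_KC] sum_distrib_left ..
    qed
    finally show ?thesis .
  qed
  have piece: "norm ((\<Sum>k\<in>A n s. ?g n k) - (\<Sum>k\<in>B n s. ?g n k)) \<le> real (card (X n s))" if s: "s \<in> tripq" and n: "n \<in> NQ" for s n
  proof (rule norm_sum_diff_le_card)
    have st: "s \<in> trip" using s unfolding tripq_def by simp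
    note mr = md_range[OF st]
    have nq: "coprime n q" "n \<in> ND" using n unfolding NQ_def by auto
    show "finite (A n s)"
    proof (rule finite_subset)
      show "A n s \<subseteq> {..nat \<lfloor>2 * (real n * M)\<rfloor>}"
      proof
        fix k assume k: "k \<in> A n s"
        have "1 * k \<le> md s * k" using mr(3) by (intro mult_le_mono1) simp
        hence "real k \<le> real (md s * k + q)" unfolding of_nat_le_iff by linarith
        thus "k \<in> {..nat \<lfloor>2 * (real n * M)\<rfloor>}" using k unfolding A_def by (auto intro!: le_nat_floor simp del: of_nat_mult of_nat_add)
      qed
    qed simp
    show "finite (B n s)" unfolding B_def by simp
    show "finite (X n s)" unfolding X_def by simp
    have cp: "coprime n k" if "n dvd md s * k + q" for k
    proof (rule ccontr)
      assume "\<not> coprime n k"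
      then obtain p where p: "prime p" "p dvd n" "p dvd k" by (rule not_coprime_obtain_prime_nat)
      have "p dvd md s * k + q" using p(2) that by (rule dvd_trans)
      moreover have "p dvd md s * k" using p(3) by simp
      ultimately have "p dvd q" by (simp add: dvd_add_right_iff)
      thus False using nq p prime_dvd_both_not_coprime_nat by blast
    qed
    show "A n s - B n s \<subseteq> X n s"
      using window_symdiff(1)[OF mr(1,2) nq(2)] cp unfolding A_def B_def X_def KC_def by blast
    show "B n s - A n s \<subseteq> X n s"
      using window_symdiff(2)[OF mr(1,2) nq(2)] unfolding A_def B_def X_def KC_def by blast
  qed (rule norm_unit_le)
  have "Tsum - Main = (\<Sum>s\<in>tripq. \<Sum>n\<in>NQ. of_real (wt s) * ((\<Sum>k\<in>A n s. ?g n k) - (\<Sum>k\<in>B n s. ?g n k)))"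
    unfolding T Mn by (simp only: sum_subtractf right_diff_distrib)
  hence "norm (Tsum - Main) = norm (\<Sum>s\<in>tripq. \<Sum>n\<in>NQ. of_real (wt s) * ((\<Sum>k\<in>A n s. ?g n k) - (\<Sum>k\<in>B n s. ?g n k)))" by (rule arg_cong)
  also have "\<dots> \<le> (\<Sum>s\<in>tripq. \<Sum>n\<in>NQ. wt s * real (card (X n s)))"
  proof (rule sum_norm_le, rule sum_norm_le)
    fix s n assume "s \<in> tripq" "n \<in> NQ"
    from mult_left_mono[OF piece[OF this] wt_nonneg[of s]]
    show "norm (of_real (wt s) * ((\<Sum>k\<in>A n s. ?g n k) - (\<Sum>k\<in>B n s. ?g n k))) \<le> wt s * real (card (X n s))"
      by (simp only: norm_mult norm_of_real abs_of_nonneg[OF wt_nonneg])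
  qed
  also have "\<dots> = (\<Sum>n\<in>NQ. \<Sum>s\<in>tripq. wt s * real (card (X n s)))" by (rule sum.swap)
  also have "\<dots> = (\<Sum>n\<in>NQ. \<Sum>k\<in>bdry n. Wsum n k)"
  proof (rule sum.cong[OF refl])
    fix n
    have "(\<Sum>s\<in>tripq. wt s * real (card (X n s))) = (\<Sum>s\<in>tripq. \<Sum>k\<in>bdry n. if n dvd md s * k + q then wt s else 0)"
    proof (rule sum.cong[OF refl])
      fix s
      have "(\<Sum>k\<in>bdry n. if n dvd md s * k + q then wt s else 0) = (\<Sum>k\<in>X n s. wt s)"
        unfolding X_def by (rule sum.inter_filter[symmetric]) simp
      thus "wt s * real (card (X n s)) = (\<Sum>k\<in>bdry n. if n dvd md s * k + q then wt s else 0)" by simp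
    qed
    also have "\<dots> = (\<Sum>k\<in>bdry n. \<Sum>s\<in>tripq. if n dvd md s * k + q then wt s else 0)" by (rule sum.swap)
    finally show "(\<Sum>s\<in>tripq. wt s * real (card (X n s))) = (\<Sum>k\<in>bdry n. Wsum n k)" unfolding Wsum_tripq .
  qed
  also have "\<dots> \<le> (\<Sum>n\<in>NQ. (12 * \<kappa> * N) * (cmax * (3 * \<kappa> * R / N)))"
  proof (rule sum_mono)
    fix n assume n: "n \<in> NQ"
    have c0: "0 \<le> cmax * (3 * \<kappa> * R / N)" using cmax_ge kap R_pos N_ge by simp
    have "(\<Sum>k\<in>bdry n. Wsum n k) \<le> (\<Sum>k\<in>bdry n. cmax * (3 * \<kappa> * R / N))" by (intro sum_mono Wsum_le n)
    also have "\<dots> = real (card (bdry n)) * (cmax * (3 * \<kappa> * R / N))" by simp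
    also have "\<dots> \<le> (12 * \<kappa> * N) * (cmax * (3 * \<kappa> * R / N))"
      using n c0 by (intro mult_right_mono card_bdry_le) (auto simp: NQ_def)
    finally show "(\<Sum>k\<in>bdry n. Wsum n k) \<le> (12 * \<kappa> * N) * (cmax * (3 * \<kappa> * R / N))" .
  qed
  also have "\<dots> = real (card NQ) * (36 * \<kappa>\<^sup>2 * R * cmax)" using N_ge by (simp add: power2_eq_square)
  also have "\<dots> \<le> (2 * N) * (36 * \<kappa>\<^sup>2 * R * cmax)"
  proof (rule mult_right_mono)
    have "real (card NQ) \<le> real (card ND)" unfolding NQ_def of_nat_le_iff by (rule card_mono) auto
    thus "real (card NQ) \<le> 2 * N" using card_ND by linarith
  qed (use cmax_ge R_pos in simp)
  finally show ?thesis by (simp add: mult_ac)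
qed

lemma norm_Main_minus:
  "norm (Main - of_real (\<kappa> * R * (cq * S1 * H)) * cop_form \<chi> \<mu> ND)
     \<le> N * \<kappa> * R * S1 * (1 + H) * Phi * (18 * sqrt (real (card T) / N) + (22 * \<theta> + 4 * \<omega>) * Lm powr (-1/4))"
proof -
  let ?c = "\<kappa> * R * (cq * S1 * H)"
  have cf: "cop_form \<chi> \<mu> ND = (\<Sum>n\<in>NQ. cnj (\<chi> n) / of_nat n * (\<Sum>k\<in>KC \<mu> n. \<chi> k))"
    unfolding cop_form_def KC_def
    by (rule sum.mono_neutral_right) (auto simp: ND_coprime_iff)
  have "of_real ?c * cop_form \<chi> \<mu> ND = (\<Sum>n\<in>NQ. \<Sum>k\<in>KC \<mu> n. cnj (\<chi> n) * \<chi> k * of_real (?c / real n))"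
    unfolding cf sum_distrib_left by (rule sum.cong[OF refl], rule sum.cong[OF refl]) (simp add: mult_ac)
  hence "Main - of_real ?c * cop_form \<chi> \<mu> ND = (\<Sum>n\<in>NQ. \<Sum>k\<in>KC \<mu> n. cnj (\<chi> n) * \<chi> k * of_real (Wsum n k - ?c / real n))"
    unfolding Main_def by (simp only: sum_subtractf[symmetric] right_diff_distrib[symmetric] of_real_diff)
  hence "norm (Main - of_real ?c * cop_form \<chi> \<mu> ND) = norm (\<Sum>n\<in>NQ. \<Sum>k\<in>KC \<mu> n. cnj (\<chi> n) * \<chi> k * of_real (Wsum n k - ?c / real n))"
    by (rule arg_cong)
  also have "\<dots> \<le> (\<Sum>n\<in>NQ. \<Sum>k\<in>KC \<mu> n. \<bar>Wsum n k - ?c / real n\<bar>)"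
  proof (rule sum_norm_le, rule sum_norm_le)
    fix n k
    have "norm (cnj (\<chi> n) * \<chi> k) * \<bar>Wsum n k - ?c / real n\<bar> \<le> 1 * \<bar>Wsum n k - ?c / real n\<bar>"
      by (intro mult_right_mono norm_unit_le) simp
    thus "norm (cnj (\<chi> n) * \<chi> k * of_real (Wsum n k - ?c / real n)) \<le> \<bar>Wsum n k - ?c / real n\<bar>"
      by (simp only: norm_mult norm_of_real mult_1)
  qed
  also have "\<dots> \<le> N * \<kappa> * R * S1 * (1 + H) * Phi * (18 * sqrt (real (card T) / N) + (22 * \<theta> + 4 * \<omega>) * Lm powr (-1/4))"
    by (rule sum_Wsum_deviation_le) (use mu in auto)
  finally show ?thesis .
qed

end

section \<open>Removing the common factor of n and q\<close>

lemma sf_weight_prime_factors: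
  assumes "q > 0"
  shows "sf_weight q (prime_factors q) n = (if coprime n q then 1 else 0)"
proof (cases "coprime n q")
  case True
  have "sf_local q p n = 1" if "p \<in> prime_factors q" for p
  proof -
    have p: "prime p" "p dvd q" using that by auto
    hence "\<not> p dvd n" using True prime_dvd_both_not_coprime_nat by blast
    thus ?thesis using sf_local_eq[OF p(1)] by simp
  qed
  thus ?thesis using True unfolding sf_weight_def by simp
next
  case False
  then obtain p where p: "prime p" "p dvd n" "p dvd q" by (rule not_coprime_obtain_prime_nat)
  hence "p \<in> prime_factors q" "sf_local q p n = 0"
    using assms sf_local_eq[OF p(1)] by (auto simp: in_prime_factors_iff)
  hence "sf_weight q (prime_factors q) n = 0" unfolding sf_weight_def by (intro prod_zero) auto
  thus ?thesis using False by simp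
qed

text \<open>When \<open>Z\<close> is the set of primes of \<open>q\<close>, the expanded weight is
  the Moebius expansion of coprimality to \<open>q\<close>: a nonzero coefficient forces all
  exponents to be at most 1.\<close>

lemma expo_prime_factors:
  assumes q: "q > 0" and h: "h \<in> expo (prime_factors q)" and nz: "expo_coeff q (prime_factors q) h \<noteq> 0"
  shows "expo_val (prime_factors q) h dvd q"
proof -
  have "p ^ h p dvd p ^ multiplicity p q" if p: "p \<in> prime_factors q" for p
  proof -
    have "sf_coeff q p (h p) \<noteq> 0" using nz p unfolding expo_coeff_def by auto
    moreover have "p dvd q" using p by auto
    ultimately have "h p \<le> 1" unfolding sf_coeff_def by (auto split: if_splits)
    moreover have "multiplicity p q \<ge> 1" using p q by (simp add: prime_factors_multiplicity)
    ultimately show ?thesis by (intro le_imp_power_dvd) linarith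
  qed
  hence "expo_val (prime_factors q) h dvd (\<Prod>p\<in>prime_factors q. p ^ multiplicity p q)"
    unfolding expo_val_def by (rule prod_dvd_prod)
  thus ?thesis using prime_factorization_nat[of q] q by simp
qed

text \<open>The Euler product of \<open>1 + 1/p\<close> over the primes of \<open>q\<close>,
  compared with that of \<open>p / (p - 1)\<close>.\<close>

lemma sum_expo_prime_factors_le:
  assumes q: "q > 0"
  shows "(\<Sum>h\<in>expo (prime_factors q). \<bar>expo_coeff q (prime_factors q) h\<bar> / real (expo_val (prime_factors q) h)) \<le> 2 * ln (real q) + 1"
proof -
  let ?P = "prime_factors q"
  let ?F = "\<lambda>p i. \<bar>sf_coeff q p i\<bar> / real p ^ i"
  have "(\<Sum>h\<in>expo ?P. \<bar>expo_coeff q ?P h\<bar> / real (expo_val ?P h)) = (\<Sum>h\<in>expo ?P. \<Prod>p\<in>?P. ?F p (h p))"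
    unfolding expo_coeff_def expo_val_def by (rule sum.cong[OF refl]) (simp add: abs_prod prod_dividef)
  also have "\<dots> = (\<Prod>p\<in>?P. ?F p 0 + ?F p 1 + ?F p 2)" by (rule sum_expo_prod) simp
  also have "\<dots> \<le> (\<Prod>p\<in>?P. real p / (real p - 1))"
  proof (rule prod_mono, intro conjI)
    fix p assume "p \<in> ?P"
    hence p: "prime p" "p dvd q" by auto
    have p1: "real p > 1" using prime_gt_1_nat[OF p(1)] by simp
    show "0 \<le> ?F p 0 + ?F p 1 + ?F p 2" by simp
    have "?F p 0 + ?F p 1 + ?F p 2 = 1 + 1 / real p" using p by (simp add: sf_coeff_def)
    also have "\<dots> \<le> real p / (real p - 1)" using p1 by (simp add: field_simps)
    finally show "?F p 0 + ?F p 1 + ?F p 2 \<le> real p / (real p - 1)" .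
  qed
  also have "\<dots> \<le> real (card ?P) + 1"
    by (rule prod_ratio_pred_le) (auto intro: prime_ge_2_nat)
  also have "\<dots> \<le> 2 * ln (real q) + 1" using card_prime_factors_le_ln[OF q] by simp
  finally show ?thesis .
qed

context moduli_char
begin

text \<open>The range of \<open>n / g\<close> for multiples \<open>n\<close> of \<open>g\<close>,
  with the upper end written as in the indicator that the Type II estimate uses for the length
  \<open>N / g\<close>.\<close>

definition NDg :: "nat \<Rightarrow> nat set" where
  "NDg g = {n. N / real g \<le> real n \<and> real n \<le> 2 * (N / real g)}"

definition Dg :: "nat \<Rightarrow> nat \<Rightarrow> complex" where
  "Dg g r = (\<Sum>n\<in>NDg g. \<Sum>m\<in>{m\<in>MD. [m * n = q div g] (mod r)}. \<chi> m)"

text \<open>The Type II estimate takes real coefficients, so \<open>f\<close> will be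
  \<open>Re\<close> or \<open>Im\<close>.\<close>

definition chi_part :: "(complex \<Rightarrow> real) \<Rightarrow> nat \<Rightarrow> real" where
  "chi_part f m = (if M < real m \<and> real m \<le> 2 * M then f (\<chi> m) else 0)"

definition betag :: "nat \<Rightarrow> nat \<Rightarrow> real" where
  "betag g = (\<lambda>n. if N / real g \<le> real n \<and> real n \<le> 2 * (N / real g) then 1 else 0)"

lemma NDg_subset: assumes "g > 0" shows "NDg g \<subseteq> upto_real (2 * N / real g)"
proof
  fix n assume n: "n \<in> NDg g"
  have "0 < N / real g" using N_ge assms by simp
  hence "0 < real n" using n unfolding NDg_def by auto
  thus "n \<in> upto_real (2 * N / real g)" using n unfolding NDg_def upto_real_def by auto
qed

lemma finite_NDg: "g > 0 \<Longrightarrow> finite (NDg g)"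
  by (rule finite_subset[OF NDg_subset]) auto

lemma card_NDg: assumes "g > 0" shows "real (card (NDg g)) \<le> 2 * N / real g"
proof -
  have "real (card (NDg g)) \<le> real (card (upto_real (2 * N / real g)))"
    unfolding of_nat_le_iff by (rule card_mono[OF finite_upto_real NDg_subset[OF assms]])
  also have "\<dots> \<le> 2 * N / real g" using N_ge by (intro card_upto_real) simp
  finally show ?thesis .
qed

text \<open>For \<open>n = e n'\<close> the divisor \<open>e\<close> of \<open>q\<close> is a unit
  modulo \<open>r\<close> and can be cancelled, turning \<open>m n = q\<close> into
  \<open>m n' = q / e (mod r)\<close>. The new residue still divides \<open>q\<close>, hence is
  again coprime to \<open>r\<close>.\<close>

lemma Dsum_eq:
  assumes s: "s \<in> tripq"
  shows "Dsum s = (\<Sum>h\<in>expo (prime_factors q). of_real (expo_coeff q (prime_factors q) h) * Dg (expo_val (prime_factors q) h) (md s))"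
proof -
  let ?P = "prime_factors q"
  define r where "r = md s"
  have r: "coprime r q" "r > 0" using tripq_sf(2)[OF s] md_range(3) s unfolding r_def tripq_def by auto
  define I where "I n = (\<Sum>m\<in>{m\<in>MD. [m * n = q] (mod r)}. \<chi> m)" for n
  have Pp: "p \<in> ?P \<Longrightarrow> prime p" for p by auto
  have "Dsum s = (\<Sum>n\<in>ND. of_real (sf_weight q ?P n) * I n)"
    unfolding Dsum_def NQ_def r_def[symmetric] I_def[symmetric] sf_weight_prime_factors[OF q_pos] sum.inter_filter[OF finite_ND]
    by (rule sum.cong[OF refl]) simp
  also have "\<dots> = (\<Sum>n\<in>ND. \<Sum>h\<in>expo ?P. of_real (expo_coeff q ?P h) * (if expo_val ?P h dvd n then I n else 0))"
  proof (rule sum.cong[OF refl])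
    fix n
    have "of_real (sf_weight q ?P n) * I n = (\<Sum>h\<in>expo ?P. of_real (if expo_val ?P h dvd n then expo_coeff q ?P h else 0) * I n)"
      by (subst sf_weight_eq_sum[OF _ Pp]) (simp_all only: finite_set_mset of_real_sum sum_distrib_right)
    also have "\<dots> = (\<Sum>h\<in>expo ?P. of_real (expo_coeff q ?P h) * (if expo_val ?P h dvd n then I n else 0))"
      by (rule sum.cong[OF refl]) simp
    finally show "of_real (sf_weight q ?P n) * I n = (\<Sum>h\<in>expo ?P. of_real (expo_coeff q ?P h) * (if expo_val ?P h dvd n then I n else 0))" .
  qed
  also have "\<dots> = (\<Sum>h\<in>expo ?P. \<Sum>n\<in>ND. of_real (expo_coeff q ?P h) * (if expo_val ?P h dvd n then I n else 0))"
    by (rule sum.swap)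
  also have "\<dots> = (\<Sum>h\<in>expo ?P. of_real (expo_coeff q ?P h) * Dg (expo_val ?P h) r)"
  proof (rule sum.cong[OF refl])
    fix h assume h: "h \<in> expo ?P"
    show "(\<Sum>n\<in>ND. of_real (expo_coeff q ?P h) * (if expo_val ?P h dvd n then I n else 0)) = of_real (expo_coeff q ?P h) * Dg (expo_val ?P h) r"
    proof (cases "expo_coeff q ?P h = 0")
      case False
      define e where "e = expo_val ?P h"
      have eq: "e dvd q" unfolding e_def by (rule expo_prime_factors[OF q_pos h False])
      have e0: "e > 0" using eq q_pos by (auto intro: Nat.gr0I)
      have er: "coprime e r" using r(1) eq by (meson coprime_commute coprime_divisors dvd_refl)
      obtain q' where q': "q = e * q'" using eq by blast
      have qe: "q div e = q'" using q' e0 by simp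
      have iff: "[m * (e * n) = q] (mod r) \<longleftrightarrow> [m * n = q div e] (mod r)" for m n
      proof -
        have eqn: "m * (e * n) = e * (m * n)" by (rule mult.left_commute)
        have "[m * (e * n) = q] (mod r) \<longleftrightarrow> [e * (m * n) = e * q'] (mod r)" by (simp only: eqn q'[symmetric])
        also have "\<dots> \<longleftrightarrow> [m * n = q'] (mod r)" using er by (simp add: cong_mult_lcancel_nat)
        finally show ?thesis unfolding qe .
      qed
      have "(\<Sum>n\<in>ND. if e dvd n then I n else 0) = (\<Sum>n\<in>{n\<in>ND. e dvd n}. I n)"
        by (rule sum.inter_filter[symmetric]) simp
      also have "\<dots> = (\<Sum>n\<in>NDg e. I (e * n))"
      proof (rule sum.reindex_bij_witness[of _ "\<lambda>n. e * n" "\<lambda>n. n div e"])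
        fix n assume n: "n \<in> {n\<in>ND. e dvd n}"
        then obtain m where m: "n = e * m" by auto
        thus "e * (n div e) = n" using e0 by simp
        show "n div e \<in> NDg e" using n e0 unfolding m NDg_def ND_def by (simp add: field_simps)
        show "I (e * (n div e)) = I n" using m e0 by simp
      next
        fix n assume n: "n \<in> NDg e"
        show "e * n div e = n" using e0 by simp
        show "e * n \<in> {n\<in>ND. e dvd n}" using n e0 unfolding NDg_def ND_def by (simp add: field_simps)
      qed
      also have "\<dots> = Dg e r" unfolding I_def iff Dg_def ..
      finally show ?thesis unfolding e_def[symmetric] sum_distrib_left[symmetric] by simp
    qed simp
  qed
  finally show ?thesis unfolding r_def .
qed

text \<open>The congruence forces \<open>n\<close> to be a unit modulo \<open>r\<close>, so
  \<open>m\<close> is confined to one class; as \<open>r > R >= M\<close>, that class meets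
  \<open>MD\<close> at most three times.\<close>

lemma norm_Dg_trivial:
  assumes s: "s \<in> tripq" and g: "g dvd q"
  shows "norm (Dg g (md s)) \<le> 6 * N / real g"
proof -
  define r where "r = md s"
  have g0: "g > 0" using g q_pos by (auto intro: Nat.gr0I)
  have r: "coprime r q" "r > 0" "R < real r" using tripq_sf(2)[OF s] md_range s unfolding r_def tripq_def by auto
  have "norm (Dg g r) \<le> (\<Sum>n\<in>NDg g. 3)"
    unfolding Dg_def
  proof (rule sum_norm_le)
    fix n assume n: "n \<in> NDg g"
    let ?S = "{m\<in>MD. [m * n = q div g] (mod r)}"
    have "norm (\<Sum>m\<in>?S. \<chi> m) \<le> (\<Sum>m\<in>?S. 1)" by (rule sum_norm_le) (rule ch_le_1)
    also have "\<dots> = real (card ?S)" by simp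
    also have "\<dots> \<le> 3"
    proof (cases "?S = {}")
      case True show ?thesis unfolding True by simp
    next
      case False
      then obtain m0 where m0: "[m0 * n = q div g] (mod r)" by auto
      have nr: "coprime n r"
      proof (rule ccontr)
        assume "\<not> coprime n r"
        then obtain p where p: "prime p" "p dvd n" "p dvd r" by (rule not_coprime_obtain_prime_nat)
        have "[m0 * n = q div g] (mod p)" using m0 p(3) by (rule cong_dvd_modulus_nat)
        hence "p dvd q div g" using p(2) by (simp add: cong_dvd_iff[symmetric])
        hence "p dvd q" using g by (metis dvd_div_mult_self dvd_mult2)
        thus False using r(1) p prime_dvd_both_not_coprime_nat by blast
      qed
      have "?S \<subseteq> {m. M < real m \<and> real m \<le> 2 * M \<and> m mod r = m0 mod r}"
      proof
        fix m assume m: "m \<in> ?S"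
        hence "[m * n = m0 * n] (mod r)" using m0 by (auto intro: cong_trans cong_sym)
        hence "[m = m0] (mod r)" using nr by (simp add: cong_mult_rcancel_nat)
        thus "m \<in> {m. M < real m \<and> real m \<le> 2 * M \<and> m mod r = m0 mod r}"
          using m unfolding MD_def unique_euclidean_semiring_class.cong_def by auto
      qed
      moreover have "finite {m. M < real m \<and> real m \<le> 2 * M \<and> m mod r = m0 mod r}"
        by (rule finite_subset[OF _ finite_nat_interval[of M "2 * M"]]) auto
      ultimately have "real (card ?S) \<le> real (card {m. M < real m \<and> real m \<le> 2 * M \<and> m mod r = m0 mod r})"
        unfolding of_nat_le_iff by (rule card_mono[rotated])
      also have "\<dots> \<le> (2 * M - M) / real r + 2"
        using card_residue_class_nat_interval[of M "2 * M" r m0] M_pos r by (simp add: abs_le_iff)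
      also have "(2 * M - M) / real r \<le> 1" using M_le_R r R_pos by (simp add: field_simps)
      finally show ?thesis by simp
    qed
    finally show "norm (\<Sum>m\<in>?S. \<chi> m) \<le> 3" .
  qed
  also have "\<dots> \<le> 6 * N / real g" using card_NDg[OF g0] by simp
  finally show ?thesis unfolding r_def .
qed

lemma disc_chi_part:
  assumes g: "g > 0"
  shows "disc (dconv (chi_part f) (betag g)) a r =
     (\<Sum>m\<in>MD. \<Sum>n\<in>NDg g. if [m * n = a] (mod r) then f (\<chi> m) else 0)
     - 1 / real (totient r) * (\<Sum>m\<in>MD. \<Sum>n\<in>NDg g. if coprime (m * n) r then f (\<chi> m) else 0)"
proof -
  have b: "betag g = (\<lambda>n. if n \<in> NDg g then 1 else 0)" unfolding betag_def NDg_def by simp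
  have "disc (dconv (chi_part f) (betag g)) a r =
     (\<Sum>m\<in>MD. \<Sum>n\<in>NDg g. if [m * n = a] (mod r) then chi_part f m else 0)
     - 1 / real (totient r) * (\<Sum>m\<in>MD. \<Sum>n\<in>NDg g. if coprime (m * n) r then chi_part f m else 0)"
    unfolding b
  proof (rule disc_dconv_indicator)
    show "finite MD" "finite (NDg g)" using finite_NDg[OF g] by auto
    show "m > 0" if "m \<in> MD" for m using that M_pos unfolding MD_def by (auto intro: Nat.gr0I)
    show "n > 0" if "n \<in> NDg g" for n using that NDg_subset[OF g] unfolding upto_real_def by auto
    show "m \<in> MD" if "chi_part f m \<noteq> 0" for m using that unfolding chi_part_def MD_def by (auto split: if_splits)
  qed
  moreover have cp: "chi_part f m = f (\<chi> m)" if "m \<in> MD" for m using that unfolding chi_part_def MD_def by simp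
  have "(\<Sum>m\<in>MD. \<Sum>n\<in>NDg g. if Q m n then chi_part f m else 0) = (\<Sum>m\<in>MD. \<Sum>n\<in>NDg g. if Q m n then f (\<chi> m) else 0)" for Q
    by (rule sum.cong[OF refl], rule sum.cong[OF refl]) (simp add: cp)
  ultimately show ?thesis by (simp only:)
qed

definition PV0 :: real where "PV0 = 2 * sqrt (real q) * (1 + ln (real q))"

text \<open>\<open>disc\<close> is the sum in the residue class minus its mean. Putting the mean
  back costs \<open>1 / totient r\<close> times a sum in which, for each \<open>n\<close>,
  Polya-Vinogradov applies to the \<open>m\<close> coprime to \<open>r\<close>.\<close>

lemma norm_Dg_le:
  assumes g: "g > 0" and r: "r > 0"
  shows "norm (Dg g r) \<le> \<bar>disc (dconv (chi_part Re) (betag g)) (q div g) r\<bar> + \<bar>disc (dconv (chi_part Im) (betag g)) (q div g) r\<bar>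
    + 1 / real (totient r) * (2 * N / real g * (2 ^ card (prime_factors r) * PV0))"
proof -
  define a where "a = q div g"
  define C where "C = (\<Sum>m\<in>MD. \<Sum>n\<in>NDg g. if coprime (m * n) r then \<chi> m else 0)"
  have D: "Dg g r = (\<Sum>m\<in>MD. \<Sum>n\<in>NDg g. if [m * n = a] (mod r) then \<chi> m else 0)"
    unfolding Dg_def a_def sum.inter_filter[OF finite_MD] by (rule sum.swap)
  have re: "Re (Dg g r) - 1 / real (totient r) * Re C = disc (dconv (chi_part Re) (betag g)) a r"
    unfolding disc_chi_part[OF g] D C_def Re_sum by (simp add: if_distrib[of Re] cong: if_cong)
  have im: "Im (Dg g r) - 1 / real (totient r) * Im C = disc (dconv (chi_part Im) (betag g)) a r"
    unfolding disc_chi_part[OF g] D C_def Im_sum by (simp add: if_distrib[of Im] cong: if_cong)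
  have "norm (Dg g r - of_real (1 / real (totient r)) * C) \<le> \<bar>Re (Dg g r - of_real (1 / real (totient r)) * C)\<bar> + \<bar>Im (Dg g r - of_real (1 / real (totient r)) * C)\<bar>"
    by (rule cmod_le)
  also have "Re (Dg g r - of_real (1 / real (totient r)) * C) = disc (dconv (chi_part Re) (betag g)) a r"
    unfolding re[symmetric] by simp
  also have "Im (Dg g r - of_real (1 / real (totient r)) * C) = disc (dconv (chi_part Im) (betag g)) a r"
    unfolding im[symmetric] by simp
  finally have 1: "norm (Dg g r - of_real (1 / real (totient r)) * C) \<le> \<bar>disc (dconv (chi_part Re) (betag g)) a r\<bar> + \<bar>disc (dconv (chi_part Im) (betag g)) a r\<bar>" .
  have "norm C \<le> 2 * N / real g * (2 ^ card (prime_factors r) * PV0)"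
  proof -
    let ?PV = "2 ^ card (prime_factors r) * PV0"
    have "C = (\<Sum>n\<in>NDg g. \<Sum>m\<in>MD. if coprime (m * n) r then \<chi> m else 0)" unfolding C_def by (rule sum.swap)
    hence "norm C = norm (\<Sum>n\<in>NDg g. \<Sum>m\<in>MD. if coprime (m * n) r then \<chi> m else 0)" by simp
    also have "\<dots> \<le> (\<Sum>n\<in>NDg g. ?PV)"
    proof (rule sum_norm_le)
      fix n
      have pv: "norm (\<Sum>m\<in>{m. M < real m \<and> real m \<le> 2 * M \<and> coprime m r}. \<chi> m) \<le> ?PV"
        unfolding PV0_def using M_pos by (intro norm_sum_coprime_le[OF prim q_gt r]) auto
      show "norm (\<Sum>m\<in>MD. if coprime (m * n) r then \<chi> m else 0) \<le> ?PV"
      proof (cases "coprime n r")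
        case True
        have "(\<Sum>m\<in>MD. if coprime (m * n) r then \<chi> m else 0) = (\<Sum>m\<in>{m\<in>MD. coprime m r}. \<chi> m)"
          unfolding sum.inter_filter[OF finite_MD] using True by simp
        moreover have "{m\<in>MD. coprime m r} = {m. M < real m \<and> real m \<le> 2 * M \<and> coprime m r}" unfolding MD_def by auto
        ultimately show ?thesis using pv by simp
      next
        case False
        hence "(\<Sum>m\<in>MD. if coprime (m * n) r then \<chi> m else 0) = 0" by simp
        moreover have "?PV \<ge> 0" using q_gt unfolding PV0_def by simp
        ultimately show ?thesis by simp
      qed
    qed
    also have "\<dots> = real (card (NDg g)) * ?PV" by simp
    also have "\<dots> \<le> 2 * N / real g * ?PV" using q_gt unfolding PV0_def by (intro mult_right_mono card_NDg g) simp
    finally show ?thesis .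
  qed
  hence 2: "norm (of_real (1 / real (totient r)) * C) \<le> 1 / real (totient r) * (2 * N / real g * (2 ^ card (prime_factors r) * PV0))"
    unfolding norm_mult norm_of_real by (simp only: abs_of_nonneg[of "1 / real (totient r)"] zero_le_divide_1_iff of_nat_0_le_iff) (rule mult_left_mono, simp_all)
  have "norm (Dg g r) \<le> norm (Dg g r - of_real (1 / real (totient r)) * C) + norm (of_real (1 / real (totient r)) * C)"
    using norm_triangle_ineq[of "Dg g r - of_real (1 / real (totient r)) * C" "of_real (1 / real (totient r)) * C"] by simp
  thus ?thesis using 1 2 unfolding a_def by linarith
qed


lemma md_le: "s \<in> trip \<Longrightarrow> real (md s) \<le> 2 * R"
proof -
  assume s: "s \<in> trip"
  have "(1 + \<kappa>) * R \<le> 2 * R" using kap R_pos by (intro mult_right_mono) auto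
  thus ?thesis using md_range(2)[OF s] by linarith
qed

lemma card_tripq: "real (card tripq) \<le> 2 * R"
proof -
  have "inj_on md tripq" by (rule inj_on_subset[OF inj_on_md]) (auto simp: tripq_def)
  hence "card tripq = card (md ` tripq)" by (rule card_image[symmetric])
  also have "\<dots> \<le> card (upto_real (2 * R))"
  proof (rule card_mono)
    show "md ` tripq \<subseteq> upto_real (2 * R)"
      using md_le md_range(3) unfolding tripq_def upto_real_def by (auto simp: Suc_le_eq)
  qed simp
  finally have "real (card tripq) \<le> real (card (upto_real (2 * R)))" by simp
  also have "\<dots> \<le> 2 * R" using R_pos by (intro card_upto_real) simp
  finally show ?thesis .
qed

lemma inverse_totient_le:
  assumes s: "s \<in> trip" shows "1 / real (totient (md s)) \<le> (2 * ln (2 * R) + 1) / R"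
proof -
  note r = md_range[OF s] md_le[OF s]
  have "real (md s) \<le> real (totient (md s)) * (real (card (prime_factors (md s))) + 1)" by (rule le_totient_mult[OF r(3)])
  also have "\<dots> \<le> real (totient (md s)) * (2 * ln (2 * R) + 1)"
  proof (intro mult_left_mono add_mono)
    have "real (card (prime_factors (md s))) \<le> 2 * ln (real (md s))" by (rule card_prime_factors_le_ln[OF r(3)])
    also have "\<dots> \<le> 2 * ln (2 * R)" using r R_pos by simp
    finally show "real (card (prime_factors (md s))) \<le> 2 * ln (2 * R)" .
  qed auto
  finally have "R \<le> real (totient (md s)) * (2 * ln (2 * R) + 1)" using r(1) by linarith
  moreover have "real (totient (md s)) > 0" using r(3) by simp
  ultimately show ?thesis using R_pos by (simp add: field_simps)
qed

lemma PV0_nonneg: "PV0 \<ge> 0"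
  using q_gt unfolding PV0_def by simp

text \<open>The divisors \<open>e\<close> of \<open>q\<close> are split at \<open>G\<close>. Up to
  \<open>G\<close> the Type II bound for the length \<open>N / e\<close> is used, and its factor
  \<open>1 / e\<close> is summed at the cost of a logarithm. Beyond \<open>G\<close> the trivial
  bound suffices because of the Rankin tail.\<close>

theorem norm_Tsum_le:
  assumes G: "G \<ge> 1" and E2: "E2 \<ge> 0" and W20: "W2 \<ge> 1"
    and W2: "\<And>s. s \<in> tripq \<Longrightarrow> 2 ^ card (prime_factors (md s)) \<le> W2"
    and TII: "\<And>e f. e dvd q \<Longrightarrow> real e \<le> G \<Longrightarrow> f = Re \<or> f = Im \<Longrightarrow>
       (\<Sum>r\<in>md ` tripq. \<bar>disc (dconv (chi_part f) (betag e)) (q div e) r\<bar>) \<le> E2 / real e"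
  shows "norm Tsum \<le> cmax * ((2 * E2 + 4 * N * (2 * ln (2 * R) + 1) * W2 * PV0) * (2 * ln (real q) + 1) + 12 * N * R * (G powr (-1/4) * Phi))"
proof (cases "tripq = {}")
  case True
  \<comment> \<open>With no triples only the sign of the right-hand side matters, and the logarithm
    in it needs \<open>R >= 1\<close>.\<close>
  have "N * \<kappa> \<le> \<kappa> * R * \<kappa>" using kR kap by (intro mult_right_mono) auto
  hence "1 \<le> \<kappa> * R * \<kappa>" using kN by (simp only: mult.commute[of N])
  also have "\<dots> \<le> 1 * R * 1" using kap R_pos by (intro mult_mono) auto
  finally have "R \<ge> 1" by simp
  hence l: "ln (2 * R) \<ge> 0" by simp
  have q1: "ln (real q) \<ge> 0" using q_gt by simp
  have "0 \<le> cmax * ((2 * E2 + 4 * N * (2 * ln (2 * R) + 1) * W2 * PV0) * (2 * ln (real q) + 1) + 12 * N * R * (G powr (-1/4) * Phi))"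
    using cmax_ge E2 N_ge R_pos W20 PV0_nonneg l q1 unfolding Phi_def
    by (intro mult_nonneg_nonneg add_nonneg_nonneg) auto
  thus ?thesis unfolding Tsum_def True by simp
next
  case False
  let ?P = "prime_factors q"
  let ?co = "\<lambda>h. \<bar>expo_coeff q ?P h\<bar>"
  let ?e = "\<lambda>h. expo_val ?P h"
  define LR where "LR = 2 * ln (2 * R) + 1"
  obtain s0 where s0: "s0 \<in> tripq" using False by auto
  have s0t: "s0 \<in> trip" using s0 unfolding tripq_def by simp
  have LR0: "LR \<ge> 0"
  proof -
    have "0 \<le> 1 / real (totient (md s0))" by simp
    hence "0 \<le> LR / R" using inverse_totient_le[OF s0t] unfolding LR_def by linarith
    thus ?thesis using R_pos by (simp add: zero_le_divide_iff)
  qed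
  have K0: "0 \<le> 2 * E2 + 4 * N * LR * W2 * PV0" using E2 N_ge LR0 W20 PV0_nonneg by simp
  have good: "(\<Sum>s\<in>tripq. wt s * norm (Dg g (md s))) \<le> cmax * (2 * E2 + 4 * N * LR * W2 * PV0) / real g" if g: "g dvd q" "real g \<le> G" for g
  proof -
    have g0: "g > 0" using g(1) q_pos by (auto intro: Nat.gr0I)
    let ?d = "\<lambda>f r. \<bar>disc (dconv (chi_part f) (betag g)) (q div g) r\<bar>"
    have inj: "inj_on md tripq" by (rule inj_on_subset[OF inj_on_md]) (auto simp: tripq_def)
    have d: "(\<Sum>s\<in>tripq. ?d f (md s)) \<le> E2 / real g" if "f = Re \<or> f = Im" for f
      using TII[OF g that] by (simp only: sum.reindex[OF inj] comp_def)
    have "(\<Sum>s\<in>tripq. wt s * norm (Dg g (md s))) \<le> (\<Sum>s\<in>tripq. cmax * (?d Re (md s) + ?d Im (md s) + LR / R * (2 * N / real g * (W2 * PV0))))"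
    proof (rule sum_mono)
      fix s assume s: "s \<in> tripq"
      hence st: "s \<in> trip" unfolding tripq_def by simp
      have "norm (Dg g (md s)) \<le> ?d Re (md s) + ?d Im (md s) + 1 / real (totient (md s)) * (2 * N / real g * (2 ^ card (prime_factors (md s)) * PV0))"
        by (rule norm_Dg_le[OF g0 md_range(3)[OF st]])
      also have "\<dots> \<le> ?d Re (md s) + ?d Im (md s) + LR / R * (2 * N / real g * (W2 * PV0))"
        using inverse_totient_le[OF st] W2[OF s] N_ge PV0_nonneg LR0 R_pos unfolding LR_def[symmetric]
        by (intro add_left_mono mult_mono mult_left_mono mult_right_mono) auto
      finally show "wt s * norm (Dg g (md s)) \<le> cmax * (?d Re (md s) + ?d Im (md s) + LR / R * (2 * N / real g * (W2 * PV0)))"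
        using wt_le[OF st] wt_nonneg[of s] cmax_ge by (intro mult_mono) auto
    qed
    also have "\<dots> = cmax * ((\<Sum>s\<in>tripq. ?d Re (md s)) + (\<Sum>s\<in>tripq. ?d Im (md s)) + real (card tripq) * (LR / R * (2 * N / real g * (W2 * PV0))))"
    proof -
      define K where "K = LR / R * (2 * N / real g * (W2 * PV0))"
      show ?thesis unfolding K_def[symmetric] sum_distrib_left[symmetric] sum.distrib by simp
    qed
    also have "\<dots> \<le> cmax * (E2 / real g + E2 / real g + (2 * R) * (LR / R * (2 * N / real g * (W2 * PV0))))"
      using d[of Re] d[of Im] card_tripq cmax_ge LR0 R_pos N_ge W20 PV0_nonneg
      by (intro mult_left_mono add_mono mult_right_mono) auto
    also have "\<dots> = cmax * (2 * E2 + 4 * N * LR * W2 * PV0) / real g"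
      using R_pos g0 by (simp add: field_simps)
    finally show ?thesis .
  qed
  have bad: "(\<Sum>s\<in>tripq. wt s * norm (Dg g (md s))) \<le> cmax * (12 * N * R) / real g" if g: "g dvd q" for g
  proof -
    have "(\<Sum>s\<in>tripq. wt s * norm (Dg g (md s))) \<le> (\<Sum>s\<in>tripq. cmax * (6 * N / real g))"
    proof (rule sum_mono)
      fix s assume s: "s \<in> tripq"
      thus "wt s * norm (Dg g (md s)) \<le> cmax * (6 * N / real g)"
        using wt_le[of s] wt_nonneg[of s] cmax_ge norm_Dg_trivial[OF s g] by (intro mult_mono) (auto simp: tripq_def)
    qed
    also have "\<dots> = real (card tripq) * (cmax * (6 * N / real g))" by simp
    also have "\<dots> \<le> (2 * R) * (cmax * (6 * N / real g))"
      using card_tripq cmax_ge N_ge by (intro mult_right_mono) auto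
    also have "\<dots> = cmax * (12 * N * R) / real g" by simp
    finally show ?thesis .
  qed
  have Pp: "p \<in> ?P \<Longrightarrow> prime p" for p by auto
  have "norm Tsum \<le> (\<Sum>s\<in>tripq. wt s * norm (Dsum s))"
    unfolding Tsum_def
  proof (rule sum_norm_le)
    fix s
    have "wt s * norm (\<chi> (md s)) * norm (Dsum s) \<le> wt s * 1 * norm (Dsum s)"
      using wt_nonneg[of s] by (intro mult_right_mono mult_left_mono ch_le_1) auto
    thus "norm (of_real (wt s) * cnj (\<chi> (md s)) * Dsum s) \<le> wt s * norm (Dsum s)"
      by (simp only: norm_mult norm_of_real abs_of_nonneg[OF wt_nonneg] complex_mod_cnj mult_1_right)
  qed
  also have "\<dots> \<le> (\<Sum>s\<in>tripq. wt s * (\<Sum>h\<in>expo ?P. ?co h * norm (Dg (?e h) (md s))))"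
  proof (rule sum_mono, rule mult_left_mono[OF _ wt_nonneg])
    fix s assume "s \<in> tripq"
    show "norm (Dsum s) \<le> (\<Sum>h\<in>expo ?P. ?co h * norm (Dg (?e h) (md s)))"
      unfolding Dsum_eq[OF \<open>s \<in> tripq\<close>] by (intro sum_norm_le) (simp add: norm_mult)
  qed
  also have "\<dots> = (\<Sum>h\<in>expo ?P. ?co h * (\<Sum>s\<in>tripq. wt s * norm (Dg (?e h) (md s))))"
  proof -
    have "(\<Sum>s\<in>tripq. wt s * (\<Sum>h\<in>expo ?P. ?co h * norm (Dg (?e h) (md s)))) = (\<Sum>s\<in>tripq. \<Sum>h\<in>expo ?P. ?co h * (wt s * norm (Dg (?e h) (md s))))"
      unfolding sum_distrib_left by (rule sum.cong[OF refl], rule sum.cong[OF refl]) (simp only: mult.left_commute)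
    also have "\<dots> = (\<Sum>h\<in>expo ?P. \<Sum>s\<in>tripq. ?co h * (wt s * norm (Dg (?e h) (md s))))" by (rule sum.swap)
    finally show ?thesis by (simp only: sum_distrib_left)
  qed
  also have "\<dots> \<le> (\<Sum>h\<in>expo ?P. cmax * (2 * E2 + 4 * N * LR * W2 * PV0) * (?co h / real (?e h)) + (if real (?e h) > G then cmax * (12 * N * R) * (?co h / real (?e h)) else 0))"
  proof (rule sum_mono)
    fix h assume h: "h \<in> expo ?P"
    have c0: "0 \<le> cmax * (2 * E2 + 4 * N * LR * W2 * PV0) * (?co h / real (?e h))" using cmax_ge K0 by (intro mult_nonneg_nonneg) auto
    show "?co h * (\<Sum>s\<in>tripq. wt s * norm (Dg (?e h) (md s))) \<le> cmax * (2 * E2 + 4 * N * LR * W2 * PV0) * (?co h / real (?e h)) + (if real (?e h) > G then cmax * (12 * N * R) * (?co h / real (?e h)) else 0)"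
    proof (cases "expo_coeff q ?P h = 0")
      case True thus ?thesis by simp
    next
      case nz: False
      have dv: "?e h dvd q" by (rule expo_prime_factors[OF q_pos h nz])
      show ?thesis
      proof (cases "real (?e h) > G")
        case True
        have "?co h * (\<Sum>s\<in>tripq. wt s * norm (Dg (?e h) (md s))) \<le> ?co h * (cmax * (12 * N * R) / real (?e h))"
          by (intro mult_left_mono bad dv) simp
        also have "\<dots> = cmax * (12 * N * R) * (?co h / real (?e h))" by simp
        finally show ?thesis using True c0 by simp
      next
        case False
        have "?co h * (\<Sum>s\<in>tripq. wt s * norm (Dg (?e h) (md s))) \<le> ?co h * (cmax * (2 * E2 + 4 * N * LR * W2 * PV0) / real (?e h))"
          using False by (intro mult_left_mono good dv) auto
        also have "\<dots> = cmax * (2 * E2 + 4 * N * LR * W2 * PV0) * (?co h / real (?e h))" by simp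
        finally show ?thesis using False by simp
      qed
    qed
  qed
  also have "\<dots> = cmax * (2 * E2 + 4 * N * LR * W2 * PV0) * (\<Sum>h\<in>expo ?P. ?co h / real (?e h))
     + cmax * (12 * N * R) * (\<Sum>h\<in>{h\<in>expo ?P. real (?e h) > G}. ?co h / real (?e h))"
  proof -
    have mi: "(if c then A * x else 0) = A * (if c then x else 0)" for c and A x :: real by simp
    have fe: "finite (expo ?P)" by (rule finite_expo) simp
    show ?thesis unfolding sum.inter_filter[OF fe] mi sum.distrib sum_distrib_left ..
  qed
  also have "\<dots> \<le> cmax * (2 * E2 + 4 * N * LR * W2 * PV0) * (2 * ln (real q) + 1) + cmax * (12 * N * R) * (G powr (-1/4) * Phi)"
  proof (intro add_mono mult_left_mono)
    show "(\<Sum>h\<in>expo ?P. ?co h / real (?e h)) \<le> 2 * ln (real q) + 1" by (rule sum_expo_prime_factors_le[OF q_pos])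
    show "(\<Sum>h\<in>{h\<in>expo ?P. real (?e h) > G}. ?co h / real (?e h)) \<le> G powr (-1/4) * Phi"
      unfolding Phi_def using G by (intro sum_expo_consequences(1) q_pos) (auto intro: Pp)
    show "0 \<le> cmax * (2 * E2 + 4 * N * LR * W2 * PV0)" using cmax_ge K0 by (intro mult_nonneg_nonneg) auto
    show "0 \<le> cmax * (12 * N * R)" using cmax_ge N_ge R_pos by simp
  qed
  also have "\<dots> = cmax * ((2 * E2 + 4 * N * LR * W2 * PV0) * (2 * ln (real q) + 1) + 12 * N * R * (G powr (-1/4) * Phi))"
    by (simp add: algebra_simps)
  finally show ?thesis unfolding LR_def .
qed

end

section \<open>Products of primes\<close>

definition prime_window :: "nat \<Rightarrow> real \<Rightarrow> real \<Rightarrow> nat set" where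
  "prime_window q X Y = {p. prime p \<and> X < real p \<and> real p \<le> Y \<and> \<not> p dvd q}"

text \<open>Subsets of the window give products of distinct primes, hence squarefree numbers, and
  make their number a binomial coefficient.\<close>

definition prime_products :: "nat \<Rightarrow> real \<Rightarrow> real \<Rightarrow> nat \<Rightarrow> nat set" where
  "prime_products q X Y k = Prod ` {A. A \<subseteq> prime_window q X Y \<and> card A = k}"

lemma finite_prime_window [simp]: "finite (prime_window q X Y)"
  unfolding prime_window_def by (rule finite_subset[of _ "{..nat \<lfloor>Y\<rfloor>}"]) (auto simp: le_nat_floor)

lemma card_prime_window_le: "Y \<ge> 0 \<Longrightarrow> real (card (prime_window q X Y)) \<le> Y"
proof -
  assume Y: "Y \<ge> 0"
  have "card (prime_window q X Y) \<le> card (upto_real Y)"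
    by (rule card_mono[OF finite_upto_real]) (auto simp: prime_window_def upto_real_def Suc_le_eq prime_gt_0_nat)
  thus ?thesis using card_upto_real[OF Y] by linarith
qed

lemma finite_prime_products [simp]: "finite (prime_products q X Y k)"
  unfolding prime_products_def by (rule finite_imageI, rule finite_subset[of _ "Pow (prime_window q X Y)"]) auto

lemma prime_factors_Prod:
  assumes "finite A" "\<And>p. p \<in> A \<Longrightarrow> prime (p :: nat)"
  shows "prime_factors (\<Prod>A) = A"
proof -
  have "\<Prod>A = prod_mset (mset_set A)" by (simp add: prod_unfold_prod_mset)
  moreover have "prime_factorization (prod_mset (mset_set A)) = mset_set A"
    by (rule prime_factorization_prod_mset_primes) (use assms in auto)
  ultimately show ?thesis using assms by simp
qed

lemma prime_productsE:
  assumes "a \<in> prime_products q X Y k" "X \<ge> 0"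
  obtains A where "A \<subseteq> prime_window q X Y" "finite A" "card A = k" "a = \<Prod>A" "prime_factors a = A"
proof -
  obtain A where A: "A \<subseteq> prime_window q X Y" "card A = k" "a = \<Prod>A"
    using assms unfolding prime_products_def by auto
  have f: "finite A" by (rule finite_subset[OF A(1)]) simp
  have "prime_factors a = A" unfolding A(3) using A(1) f by (intro prime_factors_Prod) (auto simp: prime_window_def)
  thus thesis using that A f by blast
qed

lemma
  assumes a: "a \<in> prime_products q X Y k" and X: "X \<ge> 0"
  shows prime_products_pos: "a > 0"
    and squarefree_prime_products: "squarefree a"
    and card_prime_factors_prime_products: "card (prime_factors a) = k"
    and prime_products_prime_factor: "prime p \<Longrightarrow> p dvd a \<Longrightarrow> p \<in> prime_window q X Y"
    and prime_products_ge: "X ^ k \<le> real a"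
    and prime_products_le: "real a \<le> Y ^ k"
proof -
  obtain A where A: "A \<subseteq> prime_window q X Y" "finite A" "card A = k" "a = \<Prod>A" "prime_factors a = A"
    using prime_productsE[OF a X] .
  have pr: "prime p" "X \<le> real p" "real p \<le> Y" if "p \<in> A" for p using A(1) that unfolding prime_window_def by auto
  show a0: "a > 0" unfolding A(4) using pr prime_gt_0_nat by (intro prod_pos) auto
  show "squarefree a" unfolding A(4)
    by (rule squarefree_prod_coprime) (auto intro: primes_coprime pr squarefree_prime)
  show "card (prime_factors a) = k" using A by simp
  show "p \<in> prime_window q X Y" if "prime p" "p dvd a"
  proof -
    have "p \<in> prime_factors a" using that a0 by (auto simp: in_prime_factors_iff)
    thus ?thesis using A by blast
  qed
  have "(\<Prod>p\<in>A. X) \<le> (\<Prod>p\<in>A. real p)" by (rule prod_mono) (use pr X in auto)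
  thus "X ^ k \<le> real a" using A by simp
  have "(\<Prod>p\<in>A. real p) \<le> (\<Prod>p\<in>A. Y)" by (rule prod_mono) (use pr in auto)
  thus "real a \<le> Y ^ k" using A by simp
qed

lemma inj_on_Prod: "inj_on Prod {A. A \<subseteq> prime_window q X Y \<and> card A = k}"
proof (rule inj_onI)
  fix A B assume AB: "A \<in> {A. A \<subseteq> prime_window q X Y \<and> card A = k}" "B \<in> {A. A \<subseteq> prime_window q X Y \<and> card A = k}" "\<Prod>A = \<Prod>B"
  have "prime_factors (\<Prod>C) = C" if "C \<in> {A. A \<subseteq> prime_window q X Y \<and> card A = k}" for C
    using that finite_subset[OF _ finite_prime_window, of C q X Y] by (intro prime_factors_Prod) (auto simp: prime_window_def)
  thus "A = B" using AB by metis
qed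

lemma card_prime_products: "card (prime_products q X Y k) = card (prime_window q X Y) choose k"
  unfolding prime_products_def card_image[OF inj_on_Prod] by (rule n_subsets) simp

lemma card_prime_products_le:
  assumes "Y \<ge> 0" shows "real (card (prime_products q X Y k)) \<le> Y ^ k"
proof (cases "k \<le> card (prime_window q X Y)")
  case True
  have "card (prime_products q X Y k) \<le> card (prime_window q X Y) ^ k"
    unfolding card_prime_products by (rule binomial_le_pow[OF True])
  hence "real (card (prime_products q X Y k)) \<le> real (card (prime_window q X Y)) ^ k"
    by (metis of_nat_mono of_nat_power)
  also have "\<dots> \<le> Y ^ k" using card_prime_window_le[OF assms] by (intro power_mono) auto
  finally show ?thesis .
next
  case False
  thus ?thesis unfolding card_prime_products using assms by (simp add: binomial_eq_0)
qed

text \<open>There are at least \<open>(X / k) ^ k\<close> products, none above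
  \<open>(X \<Lambda>) ^ k\<close>. The loss \<open>(k \<Lambda>) ^ k\<close> is a power of the
  logarithm if \<open>k\<close> is fixed and \<open>\<Lambda>\<close> is such a power.\<close>

lemma sum_inverse_prime_products_ge:
  assumes X: "X > 0" "\<Lambda> > 0" and k: "k > 0" "real k \<le> X" and c: "X \<le> real (card (prime_window q X (X * \<Lambda>)))"
  shows "1 / (real k * \<Lambda>) ^ k \<le> (\<Sum>a\<in>prime_products q X (X * \<Lambda>) k. 1 / real a)"
proof -
  let ?n = "card (prime_window q X (X * \<Lambda>))"
  have kn: "k \<le> ?n" using k c by linarith
  have "1 / (real k * \<Lambda>) ^ k = (X / real k) ^ k * (1 / (X * \<Lambda>) ^ k)"
    using X by (simp add: power_mult_distrib power_divide field_simps)
  also have "\<dots> \<le> (real ?n / real k) ^ k * (1 / (X * \<Lambda>) ^ k)"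
    using X c by (intro mult_right_mono power_mono divide_right_mono) auto
  also have "\<dots> \<le> real (?n choose k) * (1 / (X * \<Lambda>) ^ k)"
    using X kn by (intro mult_right_mono binomial_ge_n_over_k_pow_k) auto
  also have "\<dots> = (\<Sum>a\<in>prime_products q X (X * \<Lambda>) k. 1 / (X * \<Lambda>) ^ k)" unfolding card_prime_products[symmetric] by simp
  also have "\<dots> \<le> (\<Sum>a\<in>prime_products q X (X * \<Lambda>) k. 1 / real a)"
  proof (rule sum_mono)
    fix a assume a: "a \<in> prime_products q X (X * \<Lambda>) k"
    show "1 / (X * \<Lambda>) ^ k \<le> 1 / real a"
      using prime_products_le[OF a] prime_products_pos[OF a] X by (intro divide_left_mono) auto
  qed
  finally show ?thesis .
qed

text \<open>Chebyshev gives at least \<open>X L / 4\<close> primes up to \<open>X L ^ 2\<close>, of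
  which at most \<open>X + 2 L\<close> are excluded; \<open>L\<close> and \<open>X\<close> at least
  16 make \<open>X L / 4 >= 2 X + 2 L\<close>.\<close>

lemma card_prime_window_ge:
  assumes L: "L = ln (real q)" "L \<ge> 16" and X: "X \<ge> 16" and XL: "X * L\<^sup>2 \<le> real q" and q: "q > 1"
  shows "X \<le> real (card (prime_window q X (X * L\<^sup>2)))"
proof -
  have L2: "16 * 16 \<le> L\<^sup>2" unfolding power2_eq_square using L by (intro mult_mono) auto
  have "16 * 16 \<le> X * L\<^sup>2" using X L2 by (intro mult_mono) auto
  hence Z: "X * L\<^sup>2 \<ge> 6" "ln (X * L\<^sup>2) > 0" by auto
  have lnle: "ln (X * L\<^sup>2) \<le> L" unfolding L(1) using XL Z by (subst ln_le_cancel_iff) (auto simp: L(1))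
  have "X * L / 4 = X * L\<^sup>2 / (4 * L)" using L by (simp add: power2_eq_square)
  also have "\<dots> \<le> X * L\<^sup>2 / (4 * ln (X * L\<^sup>2))"
    using Z lnle L X by (intro divide_left_mono) auto
  finally have "X * L / 4 - X - 2 * L \<le> X * L\<^sup>2 / (4 * ln (X * L\<^sup>2)) - X - 2 * ln q" using L(1) by simp
  also have "\<dots> \<le> real (card (prime_window q X (X * L\<^sup>2)))"
    unfolding prime_window_def using Z X q by (intro card_primes_window) auto
  finally have "X * L / 4 - X - 2 * L \<le> real (card (prime_window q X (X * L\<^sup>2)))" .
  moreover have "X * 16 \<le> X * L" "16 * L \<le> X * L" using X L by (intro mult_left_mono mult_right_mono; simp)+
  ultimately show ?thesis by linarith
qed

section \<open>Assembling the bound for the coprime form\<close>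

context moduli_char
begin

lemma cq_ge: "1 / cq \<le> 2 * ln (real q) + 1" and cq_pos: "cq > 0"
proof -
  have fin: "finite {p\<in>Z. p dvd q}" using finite_Z by simp
  have p: "prime p" if "p \<in> {p\<in>Z. p dvd q}" for p using that Z_prime by auto
  show "cq > 0" unfolding cq_def
  proof (rule prod_pos)
    fix p assume "p \<in> {p\<in>Z. p dvd q}"
    hence "real p > 1" using p prime_gt_1_nat by auto
    thus "0 < 1 - 1 / real p" by simp
  qed
  have "1 / cq = (\<Prod>p\<in>{p\<in>Z. p dvd q}. 1 / (1 - 1 / real p))" unfolding cq_def by (simp only: prod_dividef prod.neutral_const)
  also have "\<dots> = (\<Prod>p\<in>{p\<in>Z. p dvd q}. real p / (real p - 1))"
  proof (rule prod.cong[OF refl])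
    fix p assume "p \<in> {p\<in>Z. p dvd q}"
    hence "real p > 1" using p prime_gt_1_nat by auto
    thus "1 / (1 - 1 / real p) = real p / (real p - 1)" by (simp add: field_simps)
  qed
  also have "\<dots> \<le> real (card {p\<in>Z. p dvd q}) + 1" by (rule prod_ratio_pred_le[OF fin]) (use p prime_ge_2_nat in blast)
  also have "\<dots> \<le> real (card (prime_factors q)) + 1"
  proof -
    have "card {p\<in>Z. p dvd q} \<le> card (prime_factors q)"
      using p q_pos by (intro card_mono) (auto simp: in_prime_factors_iff Z_prime)
    thus ?thesis by simp
  qed
  also have "\<dots> \<le> 2 * ln (real q) + 1" using card_prime_factors_le_ln[OF q_pos] by simp
  finally show "1 / cq \<le> 2 * ln (real q) + 1" .
qed

theorem norm_cop_form_le: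
  "\<kappa> * R * (cq * S1 * H) * norm (cop_form \<chi> \<mu> ND) \<le> norm Tsum + 72 * \<kappa>\<^sup>2 * N * R * cmax
     + N * \<kappa> * R * S1 * (1 + H) * Phi * (18 * sqrt (real (card T) / N) + (22 * \<theta> + 4 * \<omega>) * Lm powr (-1/4))"
proof -
  let ?C = "of_real (\<kappa> * R * (cq * S1 * H)) * cop_form \<chi> \<mu> ND"
  have nn: "0 \<le> \<kappa> * R * (cq * S1 * H)"
    using kap R_pos cq_pos unfolding S1_def H_def by (intro mult_nonneg_nonneg sum_nonneg) auto
  have "\<kappa> * R * (cq * S1 * H) * norm (cop_form \<chi> \<mu> ND) = norm ?C"
    by (simp only: norm_mult norm_of_real abs_of_nonneg[OF nn])
  also have "?C = Tsum - (Tsum - Main) - (Main - ?C)" by simp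
  also have "norm \<dots> \<le> norm Tsum + norm (Tsum - Main) + norm (Main - ?C)"
    by (rule order_trans[OF norm_triangle_ineq4]) (intro add_right_mono norm_triangle_ineq4)
  also have "\<dots> \<le> norm Tsum + 72 * \<kappa>\<^sup>2 * N * R * cmax
     + N * \<kappa> * R * S1 * (1 + H) * Phi * (18 * sqrt (real (card T) / N) + (22 * \<theta> + 4 * \<omega>) * Lm powr (-1/4))"
    by (intro add_mono norm_Tsum_minus_Main norm_Main_minus order_refl)
  finally show ?thesis .
qed

end

section \<open>The choice of parameters\<close>

text \<open>The hypothesis of the theorem at a single \<open>x\<close>, phrased so that it can be
  folded there.\<close>

definition type_II_bound :: "real \<Rightarrow> real \<Rightarrow> real \<Rightarrow> real \<Rightarrow> real \<Rightarrow> real \<Rightarrow> bool" where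
  "type_II_bound w \<delta> A C\<^sub>0 C x \<longleftrightarrow> (\<forall>(P::nat) (N::real) (M::real) (\<alpha>::nat \<Rightarrow> real).
       squarefree P \<longrightarrow> (\<forall>p\<in>prime_factors P. real p \<le> x powr \<delta>) \<longrightarrow>
       x powr (1/2 - 2*w) / C\<^sub>0 \<le> N \<longrightarrow> N \<le> C\<^sub>0 * M \<longrightarrow>
       M \<le> C\<^sub>0 * x powr (1/2 + 2*w) \<longrightarrow>
       x / C\<^sub>0 \<le> N * M \<longrightarrow> N * M \<le> C\<^sub>0 * x \<longrightarrow>
       (\<forall>n. \<alpha> n \<noteq> 0 \<longrightarrow> M \<le> real n \<and> real n \<le> 2 * M) \<longrightarrow>
       (\<forall>n. \<bar>\<alpha> n\<bar> \<le> C\<^sub>0) \<longrightarrow>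
       (\<forall>a::nat. 1 \<le> a \<and> real a \<le> x \<and> coprime a P \<longrightarrow>
          (\<Sum>r | 1 \<le> r \<and> real r \<le> C\<^sub>0 * x powr (1/2 + 2*w) \<and> r dvd P.
             \<bar>disc (dconv \<alpha> (\<lambda>n. if N \<le> real n \<and> real n \<le> 2 * N then 1 else 0)) a r\<bar>)
          \<le> C * x * ln x powr (-A)))"

lemma type_II_boundD:
  assumes "type_II_bound w \<delta> A C\<^sub>0 C x" "squarefree P" "\<forall>p\<in>prime_factors P. real p \<le> x powr \<delta>"
    "x powr (1/2 - 2*w) / C\<^sub>0 \<le> N" "N \<le> C\<^sub>0 * M" "M \<le> C\<^sub>0 * x powr (1/2 + 2*w)"
    "x / C\<^sub>0 \<le> N * M" "N * M \<le> C\<^sub>0 * x"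
    "\<forall>n. \<alpha> n \<noteq> 0 \<longrightarrow> M \<le> real n \<and> real n \<le> 2 * M" "\<forall>n. \<bar>\<alpha> n\<bar> \<le> C\<^sub>0"
    "1 \<le> a" "real a \<le> x" "coprime a P"
  shows "(\<Sum>r | 1 \<le> r \<and> real r \<le> C\<^sub>0 * x powr (1/2 + 2*w) \<and> r dvd P.
             \<bar>disc (dconv \<alpha> (\<lambda>n. if N \<le> real n \<and> real n \<le> 2 * N then 1 else 0)) a r\<bar>)
          \<le> C * x * ln x powr (-A)"
  using assms unfolding type_II_bound_def by blast

text \<open>A smaller smoothness exponent admits fewer \<open>P\<close>; this allows
  \<open>\<delta> <= 1\<close> to be assumed.\<close>

lemma type_II_bound_antimono:
  assumes "type_II_bound w \<delta>' A C\<^sub>0 C x" "\<delta> \<le> \<delta>'" "x \<ge> 1"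
  shows "type_II_bound w \<delta> A C\<^sub>0 C x"
proof -
  have "x powr \<delta> \<le> x powr \<delta>'" using assms by (intro powr_mono) auto
  hence "\<forall>p\<in>prime_factors P. real p \<le> x powr \<delta>'" if "\<forall>p\<in>prime_factors P. real p \<le> x powr \<delta>" for P :: nat
    using that by fastforce
  thus ?thesis using assms(1) unfolding type_II_bound_def by blast
qed

text \<open>\<open>a\<close> and \<open>b\<close> count the primes of the elements of
  \<open>T\<close> and of \<open>R1\<close>. \<open>4 <= \<delta> * b\<close> makes the primes of
  \<open>R1\<close> at most \<open>q powr \<delta>\<close>, and \<open>b <= w * a\<close> makes
  those of \<open>T\<close> smaller still, so the two prime ranges are disjoint.
  \<open>\<eta>\<close> measures the gaps between the lengths of the factors; the much smaller
  \<open>s\<close> absorbs logarithms and divisor bounds through \<open>LD\<close> and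
  \<open>omega_q\<close>. \<open>B\<close> is the wanted saving, and \<open>B2\<close>,
  \<open>A2\<close> are the exponents of \<open>\<kappa>\<close> and of the Type II estimate that
  leave it after division by the main term.\<close>

locale type_II_setup =
  fixes w \<epsilon> \<delta> \<eta> s C :: real and a b B B2 A2 D q :: nat and \<chi> :: "nat \<Rightarrow> complex" and N \<mu> :: real
  assumes w: "0 < w" "w < 1/4" and eps: "0 < \<epsilon>" "\<epsilon> < w" and del: "0 < \<delta>" "\<delta> \<le> 1"
    and ab: "1 \<le> a" "1 \<le> b" "4 \<le> \<delta> * real b" "real b \<le> w * real a"
    and eta: "0 < \<eta>" "12 * \<eta> \<le> w" "\<eta> \<le> \<epsilon>" "8 * real a * \<eta> \<le> 1/2 - 2 * w"
    and s: "0 < s" "48 * s \<le> \<eta>" "2 * s * real b \<le> w" "4 * s \<le> \<delta>"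
    and B2: "B2 = 3 * a + 3 * b + 7 + B" and A2: "A2 = 3 * a + 3 * b + B2 + 10 + B"
    and D: "D = A2 + B2 + 5 * a + 5 * b + 20"
    and L_large: "16 \<le> ln (real q)" "real a \<le> ln (real q)" "real b \<le> ln (real q)" "\<bar>C\<bar> \<le> ln (real q)"
    and LD: "ln (real q) ^ D \<le> real q powr s"
    and omega_q: "exp 8 * 2 ^ card (prime_factors q) \<le> real q powr s"
    and prim: "primitive_character q \<chi>" and q_gt: "q > 1"
    and N_range: "real q powr (1/2 - 2 * w + \<epsilon>/2) \<le> N" "N \<le> real q powr (1/2 - 2 * w + \<epsilon>)"
    and mu: "1/2 \<le> \<mu>" "\<mu> \<le> 1"
    and type_II: "\<And>x. x \<ge> real q \<Longrightarrow> type_II_bound w \<delta> (real A2) 4 C x"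
begin

definition L :: real where "L = ln (real q)"
definition Q :: "real \<Rightarrow> real" where "Q e = real q powr e"
text \<open>The room in \<open>N M = q powr (1 + c)\<close>. Being positive, it allows division by
  \<open>e <= q powr c\<close> while keeping \<open>x >= q\<close>; being at most
  \<open>\<epsilon> / 2\<close>, it keeps \<open>N / e\<close> above
  \<open>x powr (1/2 - 2 w)\<close> and \<open>M\<close> below
  \<open>q powr (1/2 + 2 w)\<close>.\<close>

definition c :: real where "c = \<epsilon> / 3"
definition M :: real where "M = Q (1 + c) / N"
definition R :: real where "R = M / \<mu>"
definition \<kappa> :: real where "\<kappa> = 1 / L ^ B2"
text \<open>\<open>Lm\<close>, \<open>\<rho>\<close> and \<open>\<tau>\<close> are the lengths of
  \<open>l\<close>, of \<open>R1\<close> and of \<open>T\<close>, with product \<open>2 R\<close>.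
  That \<open>\<tau>\<close> falls short of \<open>N\<close> by \<open>q powr \<eta>\<close> saves
  \<open>q powr (- \<eta> / 2)\<close> under the square root. The exponent 6 makes
  \<open>Lm powr (-1/4)\<close>, about \<open>q powr (- 3 \<eta> / 2)\<close>, beat
  \<open>\<theta>\<close>, about \<open>q powr \<eta>\<close>, by the same amount.\<close>

definition Lm :: real where "Lm = 2 * Q (6 * \<eta>)"
definition \<theta> :: real where "\<theta> = 2 * Q \<eta> * L ^ (2 * b) * L ^ B2"
definition \<rho> :: real where "\<rho> = R / N * Q (- 5 * \<eta>)"
definition \<tau> :: real where "\<tau> = N * Q (- \<eta>)"
definition X1 :: real where "X1 = \<rho> powr (1 / real b)"
definition X2 :: real where "X2 = \<tau> powr (1 / real a)"
definition R1 :: "nat set" where "R1 = prime_products q X1 (X1 * L\<^sup>2) b"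
definition T :: "nat set" where "T = prime_products q X2 (X2 * L\<^sup>2) a"

lemma Q_pos [simp]: "Q e > 0" and Q_nonneg [simp]: "Q e \<ge> 0" and Q_nz [simp]: "Q e \<noteq> 0"
  unfolding Q_def using q_gt by auto
lemma Q_add: "Q e * Q f = Q (e + f)" unfolding Q_def by (simp add: powr_add)
lemma Q_diff: "Q e / Q f = Q (e - f)" unfolding Q_def using q_gt by (simp add: powr_diff)
lemma Q_powr: "Q e powr f = Q (e * f)" unfolding Q_def by (simp add: powr_powr)
lemma Q_mono: "e \<le> f \<Longrightarrow> Q e \<le> Q f" unfolding Q_def using q_gt by (intro powr_mono) auto
lemma Q_ge_1: "0 \<le> e \<Longrightarrow> 1 \<le> Q e" using Q_mono[of 0 e] q_gt unfolding Q_def by simp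
lemma Q_1: "Q 1 = real q" unfolding Q_def using q_gt by simp

lemma L_ge: "L \<ge> 16" "L > 0" "L \<ge> 1" "real a \<le> L" "real b \<le> L" "\<bar>C\<bar> \<le> L"
  using L_large unfolding L_def by auto

lemma L_pow_le: "n \<le> D \<Longrightarrow> L ^ n \<le> Q s"
proof -
  assume n: "n \<le> D"
  have "L ^ n \<le> L ^ D" using n L_ge by (intro power_increasing) auto
  thus ?thesis using LD unfolding L_def Q_def by linarith
qed

lemma L_le_Q: "L \<le> Q s" and L2_le_Q: "L\<^sup>2 \<le> Q s"
  using L_pow_le[of 1] L_pow_le[of 2] D by auto

lemma L_pow_mono: "m \<le> n \<Longrightarrow> L ^ m \<le> L ^ n" using L_ge by (intro power_increasing) auto

lemma N_facts: "N \<ge> Q (1/2 - 2 * w + \<epsilon>/2)" "N \<le> Q (1/2 - 2 * w + \<epsilon>)" "N > 0" "N \<ge> 1"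
proof -
  show 1: "N \<ge> Q (1/2 - 2 * w + \<epsilon>/2)" "N \<le> Q (1/2 - 2 * w + \<epsilon>)" using N_range unfolding Q_def by auto
  have "1 \<le> Q (1/2 - 2 * w + \<epsilon>/2)" by (rule Q_ge_1) (use w eps in auto)
  thus "N \<ge> 1" using 1 by linarith
  thus "N > 0" by simp
qed

lemma NM: "N * M = Q (1 + c)" unfolding M_def using N_facts by simp

lemma M_facts: "M > 0" "M \<ge> Q (1/2 + 2 * w - 2 * \<epsilon> / 3)" "M \<le> Q (1/2 + 2 * w)"
proof -
  show "M > 0" unfolding M_def using N_facts by simp
  have "Q (1/2 + 2 * w - 2 * \<epsilon> / 3) = Q (1 + c) / Q (1/2 - 2 * w + \<epsilon>)" unfolding Q_diff c_def by (simp add: algebra_simps)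
  also have "\<dots> \<le> M" unfolding M_def using N_facts by (intro divide_left_mono) auto
  finally show "M \<ge> Q (1/2 + 2 * w - 2 * \<epsilon> / 3)" .
  have "M \<le> Q (1 + c) / Q (1/2 - 2 * w + \<epsilon>/2)" unfolding M_def using N_facts by (intro divide_left_mono) auto
  also have "\<dots> = Q (1 + c - (1/2 - 2 * w + \<epsilon>/2))" by (rule Q_diff)
  also have "\<dots> \<le> Q (1/2 + 2 * w)" unfolding c_def using eps by (intro Q_mono) auto
  finally show "M \<le> Q (1/2 + 2 * w)" .
qed

lemma M_eq': "M = \<mu> * R" unfolding R_def using mu by simp

text \<open>The lower bound for \<open>R / N\<close> uses \<open>\<epsilon> < w\<close>: its true
  exponent is at least \<open>4 w - 5 \<epsilon> / 3\<close>.\<close>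

lemma R_facts: "R > 0" "M \<le> R" "R \<le> 2 * M" "R \<le> Q 2" "Q (2 * w) \<le> R / N" "N * R \<ge> Q (1 + c)"
proof -
  show R0: "R > 0" unfolding R_def using M_facts mu by simp
  have "M * \<mu> \<le> M * 1" "M * 1 \<le> M * (2 * \<mu>)" using M_facts mu by (intro mult_left_mono; simp)+
  thus 1: "M \<le> R" "R \<le> 2 * M" unfolding R_def using mu by (auto simp: field_simps)
  have "R \<le> 2 * Q (1/2 + 2 * w)" using 1 M_facts by linarith
  also have "\<dots> \<le> Q s * Q (1/2 + 2 * w)" using L_le_Q L_ge by (intro mult_right_mono) auto
  also have "\<dots> = Q (s + (1/2 + 2 * w))" by (rule Q_add)
  also have "\<dots> \<le> Q 2" using s w eta by (intro Q_mono) auto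
  finally show "R \<le> Q 2" .
  have "Q (2 * w) \<le> Q (1/2 + 2 * w - 2 * \<epsilon> / 3 - (1/2 - 2 * w + \<epsilon>))" using eps by (intro Q_mono) auto
  also have "\<dots> = Q (1/2 + 2 * w - 2 * \<epsilon> / 3) / Q (1/2 - 2 * w + \<epsilon>)" by (rule Q_diff[symmetric])
  also have "\<dots> \<le> R / N" using 1 M_facts N_facts by (intro frac_le) auto
  finally show "Q (2 * w) \<le> R / N" .
  have "N * M \<le> N * R" using 1 N_facts by (intro mult_left_mono) auto
  thus "N * R \<ge> Q (1 + c)" unfolding NM .
qed

lemma rho_facts: "\<rho> > 0" "Q w \<le> \<rho>" "\<rho> \<le> Q 2"
proof -
  show "\<rho> > 0" unfolding \<rho>_def using R_facts N_facts by simp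
  have "Q w \<le> Q (2 * w + - 5 * \<eta>)" using eta by (intro Q_mono) auto
  also have "\<dots> \<le> \<rho>" unfolding \<rho>_def Q_add[symmetric] using R_facts by (intro mult_right_mono) auto
  finally show "Q w \<le> \<rho>" .
  have "R / N \<le> R" using R_facts N_facts by (simp add: field_simps)
  have "Q (- 5 * \<eta>) \<le> Q 0" using eta by (intro Q_mono) auto
  hence "\<rho> \<le> R * 1" unfolding \<rho>_def using \<open>R / N \<le> R\<close> R_facts q_gt by (intro mult_mono) (auto simp: Q_def)
  thus "\<rho> \<le> Q 2" using R_facts by linarith
qed

lemma eta_le: "\<eta> \<le> real a * \<eta>" "8 * (real a * \<eta>) \<le> 1/2 - 2 * w"
proof -
  have "1 * \<eta> \<le> real a * \<eta>" using eta ab by (intro mult_right_mono) auto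
  thus "\<eta> \<le> real a * \<eta>" by simp
  show "8 * (real a * \<eta>) \<le> 1/2 - 2 * w" using eta by (simp only: mult.assoc)
qed

lemma tau_facts: "\<tau> > 0" "Q (7 * real a * \<eta>) \<le> \<tau>" "\<tau> \<le> Q (1/2)"
proof -
  show "\<tau> > 0" unfolding \<tau>_def using N_facts by simp
  have "7 * real a * \<eta> \<le> 1/2 - 2 * w + \<epsilon>/2 + - \<eta>"
    using eta_le eps unfolding mult.assoc by linarith
  hence "Q (7 * real a * \<eta>) \<le> Q (1/2 - 2 * w + \<epsilon>/2 + - \<eta>)" by (rule Q_mono)
  also have "\<dots> = Q (1/2 - 2 * w + \<epsilon>/2) * Q (- \<eta>)" by (rule Q_add[symmetric])
  also have "\<dots> \<le> \<tau>" unfolding \<tau>_def using N_facts by (intro mult_right_mono) auto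
  finally show "Q (7 * real a * \<eta>) \<le> \<tau>" .
  have "\<tau> \<le> Q (1/2 - 2 * w + \<epsilon>) * Q (- \<eta>)" unfolding \<tau>_def using N_facts by (intro mult_right_mono) auto
  also have "\<dots> \<le> Q (1/2)" unfolding Q_add using w eps eta by (intro Q_mono) auto
  finally show "\<tau> \<le> Q (1/2)" .
qed

lemma X1_facts: "X1 > 0" "Q (w / real b) \<le> X1" "X1 \<le> Q (\<delta> / 2)" "X1 ^ b = \<rho>"
proof -
  show 0: "X1 > 0" unfolding X1_def using rho_facts by simp
  have "Q (w / real b) = Q w powr (1 / real b)" unfolding Q_powr by simp
  also have "\<dots> \<le> X1" unfolding X1_def using rho_facts by (intro powr_mono2) auto
  finally show "Q (w / real b) \<le> X1" .
  have "X1 \<le> Q 2 powr (1 / real b)" unfolding X1_def using rho_facts by (intro powr_mono2) auto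
  also have "\<dots> \<le> Q (\<delta> / 2)" unfolding Q_powr using ab by (intro Q_mono) (auto simp: field_simps)
  finally show "X1 \<le> Q (\<delta> / 2)" .
  have "X1 ^ b = X1 powr real b" using 0 by (simp add: powr_realpow)
  also have "\<dots> = \<rho>" unfolding X1_def powr_powr using ab rho_facts by simp
  finally show "X1 ^ b = \<rho>" .
qed

lemma X2_facts: "X2 > 0" "Lm \<le> X2" "X2 * L\<^sup>2 \<le> X1" "X2 ^ a = \<tau>"
proof -
  show 0: "X2 > 0" unfolding X2_def using tau_facts by simp
  have "Lm \<le> Q s * Q (6 * \<eta>)" unfolding Lm_def using L_le_Q L_ge by (intro mult_right_mono) auto
  also have "\<dots> \<le> Q (7 * \<eta>)" unfolding Q_add using s eta by (intro Q_mono) auto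
  also have "\<dots> = Q (7 * real a * \<eta>) powr (1 / real a)" unfolding Q_powr using ab by simp
  also have "\<dots> \<le> X2" unfolding X2_def using tau_facts by (intro powr_mono2) auto
  finally show "Lm \<le> X2" .
  have "X2 \<le> Q (1/2) powr (1 / real a)" unfolding X2_def using tau_facts by (intro powr_mono2) auto
  hence "X2 * L\<^sup>2 \<le> Q (1 / (2 * real a)) * Q s" unfolding Q_powr using L2_le_Q by (intro mult_mono) auto
  \<comment> \<open>\<open>b <= w * a\<close> bounds \<open>1 / (2 a)\<close> by half of
    \<open>w / b\<close>; the choice of \<open>s\<close> leaves the other half for
    \<open>L ^ 2\<close>.\<close>
  also have "\<dots> \<le> Q (w / real b)" unfolding Q_add
  proof (intro Q_mono)
    have "1 / (2 * real a) \<le> w / (2 * real b)" using ab by (simp add: field_simps)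
    moreover have "s \<le> w / (2 * real b)" using ab s by (simp add: field_simps)
    moreover have "w / real b = w / (2 * real b) + w / (2 * real b)" by simp
    ultimately show "1 / (2 * real a) + s \<le> w / real b" by linarith
  qed
  also have "\<dots> \<le> X1" by (rule X1_facts)
  finally show "X2 * L\<^sup>2 \<le> X1" .
  have "X2 ^ a = X2 powr real a" using 0 by (simp add: powr_realpow)
  also have "\<dots> = \<tau>" unfolding X2_def powr_powr using ab tau_facts by simp
  finally show "X2 ^ a = \<tau>" .
qed

lemma X_facts: "L \<le> Lm" "Lm \<le> X1" "X1 * L\<^sup>2 \<le> Q \<delta>" "X1 * L\<^sup>2 \<le> real q" "X2 * L\<^sup>2 \<le> real q" "X2 * L\<^sup>2 \<le> Q \<delta>" "X2 \<le> X1"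
proof -
  have "L \<le> Q (6 * \<eta>)" using Q_mono[of s "6 * \<eta>"] s eta L_le_Q by linarith
  thus "L \<le> Lm" unfolding Lm_def using L_ge by linarith
  have L1: "1 \<le> L\<^sup>2" using L_ge by simp
  have "X2 * 1 \<le> X2 * L\<^sup>2" using X2_facts L1 by (intro mult_left_mono) auto
  thus "Lm \<le> X1" "X2 \<le> X1" using X2_facts by linarith+
  have "X1 * L\<^sup>2 \<le> Q (\<delta> / 2) * Q s" using X1_facts L2_le_Q by (intro mult_mono) auto
  also have "\<dots> \<le> Q \<delta>" unfolding Q_add using s del by (intro Q_mono) auto
  finally show 1: "X1 * L\<^sup>2 \<le> Q \<delta>" .
  moreover have "Q \<delta> \<le> Q 1" using del by (intro Q_mono) auto
  ultimately show 2: "X1 * L\<^sup>2 \<le> real q" unfolding Q_1 by linarith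
  have "X1 * 1 \<le> X1 * L\<^sup>2" using X1_facts L1 by (intro mult_left_mono) auto
  thus "X2 * L\<^sup>2 \<le> real q" "X2 * L\<^sup>2 \<le> Q \<delta>" using X2_facts 1 2 by linarith+
qed

lemma R1_bounds: assumes "r \<in> R1" shows "\<rho> \<le> real r" "real r \<le> \<rho> * L ^ (2 * b)"
proof -
  show "\<rho> \<le> real r" using prime_products_ge[OF assms[unfolded R1_def]] X1_facts by simp
  have "real r \<le> (X1 * L\<^sup>2) ^ b" using prime_products_le[OF assms[unfolded R1_def]] X1_facts by simp
  also have "\<dots> = \<rho> * L ^ (2 * b)" using X1_facts by (simp add: power_mult_distrib power_mult)
  finally show "real r \<le> \<rho> * L ^ (2 * b)" .
qed

lemma T_bounds: assumes "t \<in> T" shows "\<tau> \<le> real t"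
  using prime_products_ge[OF assms[unfolded T_def]] X2_facts by simp

lemma card_T_le: "real (card T) \<le> \<tau> * L ^ (2 * a)"
proof -
  have "real (card T) \<le> (X2 * L\<^sup>2) ^ a" unfolding T_def using X2_facts by (intro card_prime_products_le) auto
  also have "\<dots> = \<tau> * L ^ (2 * a)" using X2_facts by (simp add: power_mult_distrib power_mult)
  finally show ?thesis .
qed

lemma Lm_rho: "Lm * \<rho> = 2 * Q \<eta> * (R / N)" and Lm_rho_tau: "Lm * \<rho> * \<tau> = 2 * R"
proof -
  have "Q (6 * \<eta>) * Q (- 5 * \<eta>) = Q \<eta>" unfolding Q_add by simp
  thus 1: "Lm * \<rho> = 2 * Q \<eta> * (R / N)" unfolding Lm_def \<rho>_def by (simp add: mult.commute mult.left_commute)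
  have "Q \<eta> * Q (- \<eta>) = 1" unfolding Q_add using q_gt by (simp add: Q_def)
  hence "2 * Q \<eta> * (R / N) * \<tau> = 2 * R" unfolding \<tau>_def using N_facts by (simp add: field_simps)
  thus "Lm * \<rho> * \<tau> = 2 * R" unfolding 1 .
qed

lemma kap_facts: "0 < \<kappa>" "\<kappa> \<le> 1" "1 \<le> \<kappa> * Q s" "\<kappa> * L ^ B2 = 1"
proof -
  have p: "1 \<le> L ^ B2" using L_ge by (intro one_le_power) auto
  thus "0 < \<kappa>" "\<kappa> \<le> 1" "\<kappa> * L ^ B2 = 1" unfolding \<kappa>_def using L_ge by auto
  have "\<kappa> * L ^ B2 \<le> \<kappa> * Q s" using L_pow_le[of B2] D \<open>0 < \<kappa>\<close> by (intro mult_left_mono) auto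
  thus "1 \<le> \<kappa> * Q s" using \<open>\<kappa> * L ^ B2 = 1\<close> by simp
qed

lemma s_eps: "s \<le> \<epsilon> / 48" "s \<le> w" using s eta eps by auto

sublocale moduli_char q N R \<kappa> Lm \<theta> "real b" R1 T \<chi> M \<mu>
proof
  show "q > 0" using q_gt by simp
  show "N \<ge> 1" "R > 0" "0 < \<kappa>" "\<kappa> \<le> 1" by (rule N_facts R_facts kap_facts)+
  show "Lm \<ge> 1" using X_facts L_ge by linarith
  show "\<theta> \<ge> 1"
  proof -
    have "1 * 1 * 1 * 1 \<le> 2 * Q \<eta> * L ^ (2 * b) * L ^ B2"
      using Q_ge_1[of \<eta>] eta L_ge by (intro mult_mono one_le_power) auto
    thus ?thesis unfolding \<theta>_def by simp
  qed
  show "finite R1" "finite T" unfolding R1_def T_def by simp_all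
  show "r > 0" if "r \<in> R1" for r using prime_products_pos[OF that[unfolded R1_def]] X1_facts by simp
  show "r > 0" if "r \<in> T" for r using prime_products_pos[OF that[unfolded T_def]] X2_facts by simp
  show "Lm < real p \<and> \<not> p dvd q" if "r \<in> R1" "prime p" "p dvd r" for r p
    using prime_products_prime_factor[OF that(1)[unfolded R1_def] _ that(2,3)] X1_facts X_facts unfolding prime_window_def by auto
  show "Lm < real p \<and> \<not> p dvd q" if "r \<in> T" "prime p" "p dvd r" for r p
    using prime_products_prime_factor[OF that(1)[unfolded T_def] _ that(2,3)] X2_facts unfolding prime_window_def by auto
  show "coprime r t" if "r \<in> R1" "t \<in> T" for r t
  proof (rule ccontr)
    assume "\<not> coprime r t"
    then obtain p where p: "prime p" "p dvd r" "p dvd t" by (rule not_coprime_obtain_prime_nat)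
    have "X1 < real p" using prime_products_prime_factor[OF that(1)[unfolded R1_def] _ p(1,2)] X1_facts unfolding prime_window_def by auto
    moreover have "real p \<le> X2 * L\<^sup>2" using prime_products_prime_factor[OF that(2)[unfolded T_def] _ p(1,3)] X2_facts unfolding prime_window_def by auto
    ultimately show False using X2_facts by linarith
  qed
  have Lm0: "Lm > 0" using X_facts L_ge by linarith
  show "(1 + \<kappa>) * R \<le> Lm * real r * real t" if "r \<in> R1" "t \<in> T" for r t
  proof -
    have "(1 + \<kappa>) * R \<le> 2 * R" using kap_facts R_facts by (intro mult_right_mono) auto
    also have "\<dots> = Lm * \<rho> * \<tau>" by (simp only: Lm_rho_tau)
    also have "\<dots> \<le> Lm * real r * real t"
      using R1_bounds[OF that(1)] T_bounds[OF that(2)] Lm0 rho_facts tau_facts by (intro mult_mono) auto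
    finally show ?thesis .
  qed
  have up: "Lm * N * real r \<le> \<theta> * (\<kappa> * R)" if "r \<in> R1" for r
  proof -
    have "Lm * N * real r \<le> Lm * N * (\<rho> * L ^ (2 * b))"
      using R1_bounds[OF that] Lm0 N_facts by (intro mult_left_mono) auto
    also have "\<dots> = (Lm * \<rho>) * N * L ^ (2 * b)" by simp
    also have "\<dots> = 2 * Q \<eta> * L ^ (2 * b) * R" unfolding Lm_rho using N_facts by simp
    also have "\<dots> = \<theta> * (\<kappa> * R)" unfolding \<theta>_def using kap_facts(4) by (simp add: mult.assoc mult.left_commute)
    finally show ?thesis .
  qed
  thus "Lm * N * real r \<le> \<theta> * (\<kappa> * R)" if "r \<in> R1" for r using that .
  show "Lm * real r \<le> \<kappa> * R" if "r \<in> R1" for r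
  proof -
    \<comment> \<open>Since \<open>\<theta>\<close> is only slightly longer than
      \<open>q powr \<eta>\<close>, the condition \<open>long\<close> follows from
      \<open>ratio_ge\<close> on dividing by \<open>N\<close>.\<close>
    have "\<theta> \<le> N"
    proof -
      have "\<theta> \<le> L * Q \<eta> * L ^ (2 * b) * L ^ B2" unfolding \<theta>_def using L_ge by (intro mult_right_mono) auto
      also have "\<dots> = L ^ (1 + 2 * b + B2) * Q \<eta>" by (simp add: power_add)
      also have "\<dots> \<le> Q s * Q \<eta>" using D by (intro mult_right_mono L_pow_le) auto
      also have "\<dots> \<le> Q (1/2 - 2 * w + \<epsilon>/2)"
        unfolding Q_add
        using eta_le eta s eps by (intro Q_mono) linarith
      also have "\<dots> \<le> N" by (rule N_facts)
      finally show ?thesis .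
    qed
    have "N * (Lm * real r) \<le> \<theta> * (\<kappa> * R)" using up[OF that] by (simp add: mult.assoc mult.left_commute)
    also have "\<dots> \<le> N * (\<kappa> * R)" using \<open>\<theta> \<le> N\<close> kap_facts R_facts by (intro mult_right_mono) auto
    finally show ?thesis using N_facts by simp
  qed
  show "\<kappa> * R \<le> Lm * N * real r" if "r \<in> R1" for r
  proof -
    have "\<kappa> * R \<le> 1 * R" using kap_facts R_facts by (intro mult_right_mono) auto
    also have "\<dots> \<le> 2 * Q \<eta> * R" using Q_ge_1[of \<eta>] eta R_facts by (intro mult_right_mono) auto
    also have "\<dots> = Lm * \<rho> * N" unfolding Lm_rho using N_facts by simp
    also have "\<dots> = Lm * N * \<rho>" by simp
    also have "\<dots> \<le> Lm * N * real r" using R1_bounds[OF that] Lm0 N_facts by (intro mult_left_mono) auto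
    finally show ?thesis .
  qed
  show "real (card (prime_factors r)) \<le> real b" if "r \<in> R1" for r
    using card_prime_factors_prime_products[OF that[unfolded R1_def]] X1_facts by simp
  show "primitive_character q \<chi>" "q > 1" "1/2 \<le> \<mu>" "\<mu> \<le> 1" "M = \<mu> * R" by (rule prim q_gt mu M_eq')+
  have q1: "real q \<le> Q (1 + c)" unfolding Q_1[symmetric] c_def using eps by (intro Q_mono) auto
  thus "real q \<le> N * M" unfolding NM .
  show "real q \<le> \<kappa> * N * R"
  proof -
    have "real q \<le> \<kappa> * Q s * Q 1" using kap_facts(3) unfolding Q_1 by (metis mult_right_mono mult_1 of_nat_0_le_iff)
    also have "\<dots> = \<kappa> * Q (s + 1)" unfolding mult.assoc Q_add ..
    also have "\<dots> \<le> \<kappa> * Q (1 + c)" using kap_facts s_eps eps unfolding c_def by (intro mult_left_mono Q_mono) auto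
    also have "\<dots> \<le> \<kappa> * (N * R)" using kap_facts R_facts by (intro mult_left_mono) auto
    finally show ?thesis by (simp only: mult.assoc)
  qed
  show "1 \<le> \<kappa> * N"
  proof -
    have "\<kappa> * Q s \<le> \<kappa> * Q (1/2 - 2 * w + \<epsilon>/2)" using kap_facts s_eps eps w by (intro mult_left_mono Q_mono) auto
    also have "\<dots> \<le> \<kappa> * N" using kap_facts N_facts by (intro mult_left_mono) auto
    finally show ?thesis using kap_facts by linarith
  qed
  show "N \<le> \<kappa> * R"
  proof -
    have "1 \<le> \<kappa> * Q s" by (rule kap_facts)
    also have "\<dots> \<le> \<kappa> * Q (2 * w)" using kap_facts s_eps w by (intro mult_left_mono Q_mono) auto
    also have "\<dots> \<le> \<kappa> * (R / N)" using kap_facts R_facts by (intro mult_left_mono) auto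
    finally show ?thesis using N_facts by (simp add: field_simps)
  qed
  show "squarefree r" if "r \<in> R1" for r using squarefree_prime_products[OF that[unfolded R1_def]] X1_facts by simp
  show "squarefree r" if "r \<in> T" for r using squarefree_prime_products[OF that[unfolded T_def]] X2_facts by simp
qed

end

lemma squarefree_dvd_if_prime_factors_subset:
  assumes r: "squarefree (r::nat)" and P: "P \<noteq> 0" "\<And>p. prime p \<Longrightarrow> p dvd r \<Longrightarrow> p dvd P"
  shows "r dvd P"
proof -
  have r0: "r \<noteq> 0" using r by (auto intro: Nat.gr0I)
  show ?thesis
  proof (rule multiplicity_le_imp_dvd[OF r0])
    fix p :: nat assume p: "prime p"
    have le: "multiplicity p r \<le> 1" using r squarefree_factorial_semiring''[OF r0] p by auto
    show "multiplicity p r \<le> multiplicity p P"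
    proof (cases "p dvd r")
      case True
      hence "multiplicity p P \<ge> 1" using p P by (intro multiplicity_geI) auto
      thus ?thesis using le by linarith
    next
      case False thus ?thesis by (simp add: not_dvd_imp_multiplicity_0)
    qed
  qed
qed

section \<open>Densities of the factors and application of the Type II estimate\<close>

context type_II_setup
begin

text \<open>From \<open>b <= L\<close> one gets \<open>(b L ^ 2) ^ b <= L ^ (3 b)\<close>, and the
  same with \<open>a\<close>: the sparsity of products of primes costs fixed powers of the
  logarithm.\<close>

lemma inverse_S1_le: "1 / S1 \<le> L ^ (3 * b)" and S1_pos: "S1 > 0"
  and inverse_H_le: "1 / H \<le> L ^ (3 * a)" and H_pos: "H > 0"
proof -
  have L2: "L\<^sup>2 > 0" using L_ge by simp
  have X16: "X1 \<ge> 16" "X2 \<ge> 16" "real b \<le> X1" "real a \<le> X2" using X2_facts X_facts L_ge by linarith+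
  have cube: "(real k * L\<^sup>2) ^ k \<le> L ^ (3 * k)" if "real k \<le> L" for k
  proof -
    have "(real k * L\<^sup>2) ^ k \<le> (L * L\<^sup>2) ^ k" using that L_ge by (intro power_mono mult_right_mono) auto
    also have "L * L\<^sup>2 = L ^ 3" by (simp add: power3_eq_cube power2_eq_square)
    also have "(L ^ 3) ^ k = L ^ (3 * k)" by (rule power_mult[symmetric])
    finally show ?thesis .
  qed
  have "1 / (real b * L\<^sup>2) ^ b \<le> S1" unfolding S1_def unfolding R1_def
    using X16 L2 X1_facts X_facts ab q_gt L_ge(1)
    by (intro sum_inverse_prime_products_ge card_prime_window_ge) (auto simp: L_def)
  moreover have p: "(real b * L\<^sup>2) ^ b > 0" using ab L2 by simp
  ultimately show "S1 > 0" by (metis divide_pos_pos zero_less_one less_le_trans)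
  have "1 / S1 \<le> (real b * L\<^sup>2) ^ b"
    using \<open>1 / (real b * L\<^sup>2) ^ b \<le> S1\<close> p \<open>S1 > 0\<close> by (simp add: field_simps)
  thus "1 / S1 \<le> L ^ (3 * b)" using cube[OF L_ge(5)] by linarith
  have "1 / (real a * L\<^sup>2) ^ a \<le> H" unfolding H_def unfolding T_def
    using X16 L2 X2_facts X_facts ab q_gt L_ge(1)
    by (intro sum_inverse_prime_products_ge card_prime_window_ge) (auto simp: L_def)
  moreover have p: "(real a * L\<^sup>2) ^ a > 0" using ab L2 by simp
  ultimately show "H > 0" by (metis divide_pos_pos zero_less_one less_le_trans)
  have "1 / H \<le> (real a * L\<^sup>2) ^ a"
    using \<open>1 / (real a * L\<^sup>2) ^ a \<le> H\<close> p \<open>H > 0\<close> by (simp add: field_simps)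
  thus "1 / H \<le> L ^ (3 * a)" using cube[OF L_ge(4)] by linarith
qed

lemma card_prime_factors_mult_le:
  assumes "m > 0" "n > (0::nat)" shows "card (prime_factors (m * n)) \<le> card (prime_factors m) + card (prime_factors n)"
  using assms by (simp add: prime_factors_product card_Un_le)

text \<open>For \<open>l\<close> the crude bound of \<open>2 ^ card (prime_factors l)\<close> by
  \<open>l\<close> itself is affordable: it enters only the Polya-Vinogradov term, which has a power
  of \<open>q\<close> to spare.\<close>

lemma two_power_omega_md_le:
  assumes s: "v \<in> tripq" shows "2 ^ card (prime_factors (md v)) \<le> L ^ (a + b) * Lm"
proof -
  obtain r t l where v: "v = (r, t, l)" by (cases v)
  have "v \<in> trip" using s unfolding tripq_def by simp
  note D = tripD[OF this[unfolded v]]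
  have p: "r > 0" "t > 0" using pos D by auto
  have "card (prime_factors (md v)) \<le> card (prime_factors r) + card (prime_factors t) + card (prime_factors l)"
    unfolding v md_def prod.case
    using card_prime_factors_mult_le[of "r * t" l] card_prime_factors_mult_le[of r t] p D(5) by simp
  also have "\<dots> = a + b + card (prime_factors l)"
    using card_prime_factors_prime_products[OF D(1)[unfolded R1_def]] card_prime_factors_prime_products[OF D(2)[unfolded T_def]] X1_facts X2_facts by simp
  finally have "(2::real) ^ card (prime_factors (md v)) \<le> 2 ^ (a + b + card (prime_factors l))" by (intro power_increasing) auto
  also have "\<dots> = 2 ^ (a + b) * 2 ^ card (prime_factors l)" by (simp add: power_add)
  also have "\<dots> \<le> L ^ (a + b) * Lm"
  proof (intro mult_mono power_mono)
    have "(2::real) ^ card (prime_factors l) = real (2 ^ card (prime_factors l))" by simp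
    also have "\<dots> \<le> real l" by (rule of_nat_mono[OF two_power_card_prime_factors_le[OF D(5)]])
    finally show "2 ^ card (prime_factors l) \<le> Lm" using D(6) by linarith
  qed (use L_ge in auto)
  finally show ?thesis .
qed

text \<open>The estimate is applied with \<open>x = q powr (1 + c) / e\<close> and length
  \<open>N / e\<close>, so that \<open>(N / e) M = x\<close>. \<open>P\<close> is the product of all
  primes up to \<open>q powr \<delta>\<close> not dividing \<open>q\<close>: the moduli divide it
  and \<open>q / e\<close> is coprime to it. The constant \<open>C\<^sub>0 = 4\<close> accommodates
  \<open>r <= 2 R <= 4 M\<close>.\<close>

lemma sum_disc_le:
  assumes e: "e dvd q" "real e \<le> Q c" and f: "f = Re \<or> f = Im"
  shows "(\<Sum>r\<in>md ` tripq. \<bar>disc (dconv (chi_part f) (betag e)) (q div e) r\<bar>) \<le> \<bar>C\<bar> * Q (1 + c) / L ^ A2 / real e"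
proof -
  have e0: "e > 0" using e q_pos by (auto intro: Nat.gr0I)
  define x where "x = Q (1 + c) / real e"
  define u where "u = 1/2 - 2 * w"
  define PW where "PW = prime_window q 0 (Q \<delta>)"
  define P where "P = \<Prod>PW"
  have fPW: "finite PW" unfolding PW_def by simp
  have PWp: "prime p" if "p \<in> PW" for p using that unfolding PW_def prime_window_def by simp
  have P_in: "P \<in> prime_products q 0 (Q \<delta>) (card PW)" unfolding P_def prime_products_def PW_def by auto
  note P_facts = prime_products_pos[OF P_in] squarefree_prime_products[OF P_in]
  have pfP: "prime_factors P = PW" unfolding P_def by (rule prime_factors_Prod[OF fPW PWp])
  have "Q 1 = Q (1 + c) / Q c" unfolding Q_diff by simp
  also have "\<dots> \<le> x" unfolding x_def using e e0 by (intro divide_left_mono) auto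
  finally have xq: "x \<ge> real q" unfolding Q_1 .
  have x0: "x > 0" using xq q_gt by linarith
  have lnx: "L \<le> ln x" unfolding L_def using xq q_gt by simp
  have bt: "betag e = (\<lambda>n. if N / real e \<le> real n \<and> real n \<le> 2 * (N / real e) then 1 else 0)" by (rule betag_def)
  have NeN: "N / real e \<le> N" using N_facts e0 by (simp add: field_simps)
  have NM: "N / real e * M = x" unfolding x_def NM[symmetric] by simp
  have qe: "q div e * e = q" using e by simp
  have "(\<Sum>r\<in>md ` tripq. \<bar>disc (dconv (chi_part f) (betag e)) (q div e) r\<bar>)
     \<le> (\<Sum>r | 1 \<le> r \<and> real r \<le> 4 * x powr (1/2 + 2 * w) \<and> r dvd P. \<bar>disc (dconv (chi_part f) (betag e)) (q div e) r\<bar>)"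
  proof (rule sum_mono2)
    show "finite {r. 1 \<le> r \<and> real r \<le> 4 * x powr (1/2 + 2 * w) \<and> r dvd P}"
      by (rule finite_subset[of _ "{r. r dvd P}"]) (use P_facts in auto)
    show "md ` tripq \<subseteq> {r. 1 \<le> r \<and> real r \<le> 4 * x powr (1/2 + 2 * w) \<and> r dvd P}"
    proof
      fix m assume "m \<in> md ` tripq"
      then obtain v where v: "v \<in> tripq" "m = md v" by auto
      obtain r t l where vv: "v = (r, t, l)" by (cases v)
      have vt: "v \<in> trip" using v unfolding tripq_def by simp
      note D = tripD[OF vt[unfolded vv]]
      have "real m \<le> 4 * M" using md_le[OF vt] R_facts unfolding v(2) by linarith
      also have "\<dots> \<le> 4 * Q (1/2 + 2 * w)" using M_facts by simp
      also have "\<dots> \<le> 4 * x powr (1/2 + 2 * w)" unfolding Q_def using xq w by (intro mult_left_mono powr_mono2) auto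
      finally have "real m \<le> 4 * x powr (1/2 + 2 * w)" .
      moreover have "m dvd P"
      proof (rule squarefree_dvd_if_prime_factors_subset)
        show "squarefree m" using tripq_sf[OF v(1)] v by simp
        show "P \<noteq> 0" using P_facts by simp
        fix p assume p: "prime p" "p dvd m"
        have nq: "\<not> p dvd q" using tripq_sf(2)[OF v(1)] p v(2) prime_dvd_both_not_coprime_nat by blast
        have "p dvd r \<or> p dvd t \<or> p dvd l" using p unfolding v(2) vv md_def by (auto simp: prime_dvd_mult_iff)
        hence "real p \<le> Q \<delta>"
        proof (elim disjE)
          assume "p dvd r"
          hence "real p \<le> X1 * L\<^sup>2" using prime_products_prime_factor[OF D(1)[unfolded R1_def] _ p(1)] X1_facts unfolding prime_window_def by auto
          thus ?thesis using X_facts by linarith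
        next
          assume "p dvd t"
          hence "real p \<le> X2 * L\<^sup>2" using prime_products_prime_factor[OF D(2)[unfolded T_def] _ p(1)] X2_facts unfolding prime_window_def by auto
          thus ?thesis using X_facts by linarith
        next
          assume "p dvd l"
          hence "p \<le> l" using D(5) by (intro dvd_imp_le) auto
          moreover have "X1 * 1 \<le> X1 * L\<^sup>2" using X1_facts L_ge by (intro mult_left_mono) auto
          ultimately show ?thesis using D(6) X_facts by linarith
        qed
        hence "p \<in> PW" unfolding PW_def prime_window_def using p nq prime_gt_0_nat by simp
        thus "p dvd P" unfolding P_def using fPW by (rule dvd_prodI[rotated])
      qed
      ultimately show "m \<in> {r. 1 \<le> r \<and> real r \<le> 4 * x powr (1/2 + 2 * w) \<and> r dvd P}"
        using md_range(3)[OF vt] v by auto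
    qed
  qed auto
  also have "\<dots> \<le> C * x * ln x powr (- real A2)"
    unfolding bt
  proof (rule type_II_boundD)
    show "type_II_bound w \<delta> (real A2) 4 C x" by (rule type_II[OF xq])
    show "squarefree P" using P_facts by simp
    have "Q \<delta> \<le> x powr \<delta>" unfolding Q_def using xq del by (intro powr_mono2) auto
    thus "\<forall>p\<in>prime_factors P. real p \<le> x powr \<delta>" unfolding pfP PW_def prime_window_def by auto
    show "x powr (1/2 - 2 * w) / 4 \<le> N / real e"
    proof -
      \<comment> \<open>The worst case is \<open>e = q powr c\<close>, where the exponents combine
        to \<open>u + c\<close>, below the exponent of the lower bound for \<open>N\<close>.\<close>
      have "x powr u * real e = Q ((1 + c) * u) * real e powr (1 - u)"
        unfolding x_def using e0 by (simp add: powr_divide Q_powr powr_diff)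
      also have "\<dots> \<le> Q ((1 + c) * u) * Q c powr (1 - u)"
        using e w unfolding u_def by (intro mult_left_mono powr_mono2) auto
      also have "\<dots> = Q ((1 + c) * u + c * (1 - u))" unfolding Q_powr by (rule Q_add)
      also have "(1 + c) * u + c * (1 - u) = u + c" by (simp add: algebra_simps)
      also have "Q (u + c) \<le> Q (1/2 - 2 * w + \<epsilon>/2)" unfolding u_def c_def using eps by (intro Q_mono) auto
      also have "\<dots> \<le> N" by (rule N_facts)
      finally have "x powr u \<le> N / real e" using e0 by (simp add: field_simps)
      moreover have "x powr u \<ge> 0" by simp
      ultimately show ?thesis unfolding u_def by linarith
    qed
    have "\<kappa> * R \<le> 1 * R" using kap_facts R_facts by (intro mult_right_mono) auto
    thus "N / real e \<le> 4 * M" using NeN kR R_facts by linarith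
    have "M \<le> Q (1/2 + 2 * w)" by (rule M_facts)
    also have "\<dots> \<le> x powr (1/2 + 2 * w)" unfolding Q_def using xq w by (intro powr_mono2) auto
    finally show "M \<le> 4 * x powr (1/2 + 2 * w)" using powr_ge_zero[of x "1/2 + 2 * w"] by linarith
    show "x / 4 \<le> N / real e * M" "N / real e * M \<le> 4 * x" unfolding NM using x0 by auto
    show "\<forall>m. chi_part f m \<noteq> 0 \<longrightarrow> M \<le> real m \<and> real m \<le> 2 * M" unfolding chi_part_def by auto
    show "\<forall>m. \<bar>chi_part f m\<bar> \<le> 4"
    proof
      fix m
      have "\<bar>f (\<chi> m)\<bar> \<le> norm (\<chi> m)" using f abs_Re_le_cmod abs_Im_le_cmod by auto
      thus "\<bar>chi_part f m\<bar> \<le> 4" using ch_le_1[of m] unfolding chi_part_def by auto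
    qed
    show "1 \<le> q div e" using qe q_pos by (cases "q div e") auto
    have "q div e \<le> q" by simp
    thus "real (q div e) \<le> x" using xq by (meson of_nat_mono order_trans)
    show "coprime (q div e) P"
    proof (rule ccontr)
      assume "\<not> coprime (q div e) P"
      then obtain p where p: "prime p" "p dvd q div e" "p dvd P" by (rule not_coprime_obtain_prime_nat)
      have "p \<in> prime_factors P" using p P_facts by (auto simp: in_prime_factors_iff)
      hence "\<not> p dvd q" unfolding pfP PW_def prime_window_def by simp
      moreover have "p dvd q div e * e" using p(2) by simp
      ultimately show False unfolding qe by simp
    qed
  qed
  also have "\<dots> \<le> \<bar>C\<bar> * x * (1 / L ^ A2)"
  proof (intro mult_mono)
    have "ln x powr (- real A2) \<le> L powr (- real A2)" using lnx L_ge by (intro powr_mono2') auto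
    also have "\<dots> = 1 / L ^ A2" using L_ge by (simp add: powr_minus powr_realpow divide_inverse)
    finally show "ln x powr (- real A2) \<le> 1 / L ^ A2" .
  qed (use x0 in auto)
  also have "\<dots> = \<bar>C\<bar> * Q (1 + c) / L ^ A2 / real e" unfolding x_def by simp
  finally show ?thesis .
qed

end

section \<open>Collecting the error terms\<close>

context type_II_setup
begin

lemma L_pow_div: "m + k \<le> n \<Longrightarrow> L ^ m / L ^ n \<le> 1 / L ^ k"
proof -
  assume "m + k \<le> n"
  hence "L ^ m * L ^ k \<le> L ^ n" unfolding power_add[symmetric] by (rule L_pow_mono)
  thus ?thesis using L_ge by (simp add: field_simps)
qed

lemma Q_minus: "Q (- s) * Q s = 1" unfolding Q_add using q_gt by (simp add: Q_def)

text \<open>A single factor \<open>Q (- s)\<close> pays for all powers of the logarithm up to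
  \<open>D\<close>; every term with a power saving is finished this way.\<close>

lemma L_pow_Q: "m + k \<le> D \<Longrightarrow> L ^ m * Q (- s) \<le> 1 / L ^ k"
proof -
  assume "m + k \<le> D"
  hence "L ^ m * L ^ k \<le> Q s" unfolding power_add[symmetric] by (rule L_pow_le)
  hence "Q (- s) * (L ^ m * L ^ k) \<le> Q (- s) * Q s" by (intro mult_left_mono) auto
  hence "L ^ m * Q (- s) * L ^ k \<le> 1" unfolding Q_minus by (simp only: ac_simps)
  thus ?thesis using L_ge by (simp add: field_simps)
qed

lemma const_le_L2: "y \<le> 256 \<Longrightarrow> y \<le> L\<^sup>2"
proof -
  assume y: "y \<le> 256"
  have "16 * 16 \<le> L * L" using L_ge by (intro mult_mono) auto
  thus ?thesis using y by (simp add: power2_eq_square)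
qed

lemma linear_le_L2: "y \<le> 15 \<Longrightarrow> y * L + 1 \<le> L\<^sup>2"
proof -
  assume y: "y \<le> 15"
  have "y * L \<le> 15 * L" using y L_ge by (intro mult_right_mono) auto
  moreover have "16 * L \<le> L * L" using L_ge by (intro mult_right_mono) auto
  ultimately show ?thesis using L_ge unfolding power2_eq_square by linarith
qed

lemma cmax_le: "cmax \<le> L\<^sup>2" and ln_2R_le: "2 * ln (2 * R) + 1 \<le> L\<^sup>2" and Phi_le: "Phi \<le> Q s" and PV0_le: "PV0 \<le> L\<^sup>2 * Q (1/2)"
proof -
  have lnQ: "ln (Q y) = y * L" for y unfolding Q_def L_def using q_gt by (simp add: ln_powr)
  have "Lm \<le> Q s * Q (6 * \<eta>)" unfolding Lm_def using L_le_Q L_ge by (intro mult_right_mono) auto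
  also have "\<dots> \<le> Q 1" unfolding Q_add using s eta w by (intro Q_mono) linarith
  finally have "ln Lm \<le> ln (Q 1)" using Lm_ge by simp
  hence "cmax \<le> 2 * L + 1" unfolding lnQ cmax_def by simp
  also have "\<dots> \<le> L\<^sup>2" by (rule linear_le_L2) simp
  finally show "cmax \<le> L\<^sup>2" .
  have "2 * R \<le> Q s * Q 2" using L_le_Q L_ge R_facts by (intro mult_mono) auto
  also have "\<dots> \<le> Q 3" unfolding Q_add using s eta w by (intro Q_mono) linarith
  finally have "ln (2 * R) \<le> ln (Q 3)" using R_facts by simp
  hence "2 * ln (2 * R) + 1 \<le> 6 * L + 1" unfolding lnQ by simp
  also have "\<dots> \<le> L\<^sup>2" by (rule linear_le_L2) simp
  finally show "2 * ln (2 * R) + 1 \<le> L\<^sup>2" .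
  show "Phi \<le> Q s" unfolding Phi_def Q_def by (rule omega_q)
  have "PV0 = (2 + 2 * L) * Q (1/2)" unfolding PV0_def Q_def L_def[symmetric] by (simp add: powr_half_sqrt)
  also have "\<dots> \<le> (3 * L + 1) * Q (1/2)" using L_ge by (intro mult_right_mono) auto
  also have "\<dots> \<le> L\<^sup>2 * Q (1/2)" using linear_le_L2[of 3] by (intro mult_right_mono) auto
  finally show "PV0 \<le> L\<^sup>2 * Q (1/2)" .
qed

text \<open>The Type II part saves \<open>A2\<close> logarithms. The other two save a power of
  \<open>q\<close>: the Polya-Vinogradov part because \<open>M\<close> exceeds \<open>sqrt q\<close>
  by \<open>2 w - 2 \<epsilon> / 3\<close> in the exponent while \<open>Lm\<close> costs only
  \<open>6 \<eta>\<close>, the tail beyond \<open>q powr c\<close> because \<open>c / 4\<close> is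
  at least \<open>2 s\<close> and \<open>Phi <= Q s\<close>.\<close>

lemma norm_Tsum_bound: "norm Tsum \<le> N * R * (L ^ 7 / L ^ A2)"
proof -
  define E2 where "E2 = \<bar>C\<bar> * Q (1 + c) / L ^ A2"
  define W2 where "W2 = L ^ (a + b) * Lm"
  define V where "V = 4 * (2 * ln (2 * R) + 1) * W2 * PV0 / R"
  have c0: "c > 0" unfolding c_def using eps by simp
  have La: "L ^ A2 > 0" using L_ge by simp
  have "norm Tsum \<le> cmax * ((2 * E2 + 4 * N * (2 * ln (2 * R) + 1) * W2 * PV0) * (2 * ln (real q) + 1) + 12 * N * R * (Q c powr (-1/4) * Phi))"
  proof (rule norm_Tsum_le)
    show "Q c \<ge> 1" using c0 by (intro Q_ge_1) auto
    show "E2 \<ge> 0" unfolding E2_def using La by simp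
    have "1 * 1 \<le> W2" unfolding W2_def using L_ge Lm_ge by (intro mult_mono one_le_power) auto
    thus "W2 \<ge> 1" by simp
    show "2 ^ card (prime_factors (md v)) \<le> W2" if "v \<in> tripq" for v
      unfolding W2_def by (rule two_power_omega_md_le[OF that])
    show "(\<Sum>r\<in>md ` tripq. \<bar>disc (dconv (chi_part f) (betag e)) (q div e) r\<bar>) \<le> E2 / real e"
      if "e dvd q" "real e \<le> Q c" "f = Re \<or> f = Im" for e f
      unfolding E2_def by (rule sum_disc_le[OF that])
  qed
  also have "\<dots> = cmax * ((2 * E2 + N * R * V) * (2 * L + 1) + N * R * (12 * (Q c powr (-1/4) * Phi)))"
    unfolding V_def L_def using R_facts by simp
  also have "\<dots> \<le> L\<^sup>2 * ((N * R * (L\<^sup>2 / L ^ A2) + N * R * (1 / L ^ A2)) * L\<^sup>2 + N * R * (1 / L ^ A2))"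
  proof -
    have "\<kappa> * R \<le> 1 * R" using kap_facts R_facts by (intro mult_right_mono) auto
    hence "R \<ge> 1" using kR N_ge by linarith
    hence lnR0: "2 * ln (2 * R) + 1 \<ge> 0" by simp
    have "2 * E2 = Q (1 + c) * (2 * \<bar>C\<bar> / L ^ A2)" unfolding E2_def by simp
    also have "\<dots> \<le> (N * R) * (L\<^sup>2 / L ^ A2)"
    proof (intro mult_mono divide_right_mono)
      have "2 * \<bar>C\<bar> \<le> 2 * L" using L_ge by simp
      also have "\<dots> \<le> L * L" using L_ge by (intro mult_right_mono) auto
      finally show "2 * \<bar>C\<bar> \<le> L\<^sup>2" by (simp add: power2_eq_square)
    qed (use R_facts N_facts La in auto)
    finally have h1: "2 * E2 \<le> N * R * (L\<^sup>2 / L ^ A2)" .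
    have "V \<le> 4 * L\<^sup>2 * W2 * (L\<^sup>2 * Q (1/2)) / R" unfolding V_def
      using ln_2R_le PV0_le PV0_nonneg Lm_ge L_ge R_facts unfolding W2_def
      by (intro divide_right_mono mult_mono mult_left_mono mult_right_mono mult_nonneg_nonneg) simp_all
    also have "\<dots> = 8 * L ^ (a + b + 4) * Q (6 * \<eta> + 1/2) / R"
      unfolding W2_def Lm_def Q_add[symmetric] by (simp add: power_add power2_eq_square power4_eq_xxxx)
    also have "\<dots> \<le> L * L ^ (a + b + 4) * Q (6 * \<eta> + 1/2) / Q (1/2 + 2 * w - 2 * \<epsilon> / 3)"
      using L_ge R_facts M_facts by (intro frac_le mult_right_mono) auto
    also have "\<dots> = L ^ (a + b + 5) * Q (6 * \<eta> + 1/2 - (1/2 + 2 * w - 2 * \<epsilon> / 3))"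
      unfolding Q_diff[symmetric] by (simp add: power_add eval_nat_numeral)
    also have "\<dots> \<le> L ^ (a + b + 5) * Q (- s)"
      using eta eps s L_ge by (intro mult_left_mono Q_mono) auto
    also have "\<dots> \<le> 1 / L ^ A2" using D by (intro L_pow_Q) auto
    finally have "V \<le> 1 / L ^ A2" .
    hence h2: "N * R * V \<le> N * R * (1 / L ^ A2)" using N_facts R_facts by (intro mult_left_mono) auto
    have "12 * (Q c powr (-1/4) * Phi) \<le> L ^ 1 * (Q (- c / 4) * Q s)"
      using Phi_le L_ge Phi_ge unfolding Q_powr by (intro mult_mono) auto
    also have "\<dots> \<le> L ^ 1 * Q (- s)" unfolding Q_add using eta s L_ge by (intro mult_left_mono Q_mono) (auto simp: c_def)
    also have "\<dots> \<le> 1 / L ^ A2" using D by (intro L_pow_Q) auto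
    finally have "12 * (Q c powr (-1/4) * Phi) \<le> 1 / L ^ A2" .
    hence h3: "N * R * (12 * (Q c powr (-1/4) * Phi)) \<le> N * R * (1 / L ^ A2)"
      using N_facts R_facts by (intro mult_left_mono) auto
    have V0: "V \<ge> 0" unfolding V_def W2_def using lnR0 Lm_ge PV0_nonneg R_facts L_ge
      by (intro divide_nonneg_nonneg mult_nonneg_nonneg zero_le_power) auto
    have E0: "E2 \<ge> 0" unfolding E2_def using La by simp
    have "(2 * E2 + N * R * V) * (2 * L + 1) \<le> (N * R * (L\<^sup>2 / L ^ A2) + N * R * (1 / L ^ A2)) * L\<^sup>2"
      using linear_le_L2[of 2] V0 E0 N_facts R_facts L_ge by (intro mult_mono[OF add_mono[OF h1 h2]]) auto
    moreover have "0 \<le> (2 * E2 + N * R * V) * (2 * L + 1) + N * R * (12 * (Q c powr (-1/4) * Phi))"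
      using V0 E0 N_facts R_facts L_ge Phi_ge by (intro add_nonneg_nonneg mult_nonneg_nonneg) auto
    ultimately show ?thesis by (intro mult_mono[OF cmax_le add_mono[OF _ h3]]) auto
  qed
  also have "\<dots> = N * R * (L\<^sup>2 * ((L\<^sup>2 + 1) * L\<^sup>2 + 1)) / L ^ A2"
  proof -
    have "Y * ((Z * (Y / W) + Z * (1 / W)) * Y + Z * (1 / W)) = Z * (Y * ((Y + 1) * Y + 1)) / W" if "W > 0" for W Y Z :: real
      using that by (simp add: field_simps)
    from this[OF La] show ?thesis .
  qed
  also have "\<dots> \<le> N * R * (L ^ 7) / L ^ A2"
  proof (intro divide_right_mono mult_left_mono)
    have L1: "1 \<le> L" by (rule L_ge)
    have "(L\<^sup>2 + 1) * L\<^sup>2 + 1 = L ^ 4 + L ^ 2 + 1" by (simp add: algebra_simps power2_eq_square power4_eq_xxxx)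
    also have "\<dots> \<le> L ^ 4 + L ^ 4 + L ^ 4" using L_pow_mono[of 2 4] one_le_power[OF L1, of 4] by linarith
    also have "\<dots> = 3 * L ^ 4" by simp
    also have "\<dots> \<le> L * L ^ 4" using L_ge by (intro mult_right_mono) auto
    finally have "(L\<^sup>2 + 1) * L\<^sup>2 + 1 \<le> L * L ^ 4" .
    hence "L\<^sup>2 * ((L\<^sup>2 + 1) * L\<^sup>2 + 1) \<le> L\<^sup>2 * (L * L ^ 4)" by (intro mult_left_mono) auto
    also have "\<dots> = L ^ 7" by (simp add: eval_nat_numeral)
    finally show "L\<^sup>2 * ((L\<^sup>2 + 1) * L\<^sup>2 + 1) \<le> L ^ 7" .
  qed (use N_facts R_facts La in auto)
  finally show ?thesis by simp
qed

lemma error_bound: "18 * sqrt (real (card T) / N) + (22 * \<theta> + 4 * real b) * Lm powr (-1/4) \<le> L ^ (a + 2 * b + B2 + 3) * Q (- \<eta> / 2)"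
proof -
  let ?n = "a + 2 * b + B2 + 1"
  have "real (card T) / N \<le> \<tau> * L ^ (2 * a) / N" using card_T_le N_facts by (intro divide_right_mono) auto
  also have "\<dots> = (Q (- \<eta> / 2) * Q (- \<eta> / 2)) * (L ^ a * L ^ a)"
  proof -
    have "\<tau> * L ^ (2 * a) / N = \<tau> / N * L ^ (2 * a)" by (rule times_divide_eq_left[symmetric])
    also have "\<tau> / N = Q (- \<eta>)" unfolding \<tau>_def using N_facts by simp
    also have "Q (- \<eta>) = Q (- \<eta> / 2) * Q (- \<eta> / 2)" unfolding Q_add by (simp only: field_sum_of_halves)
    finally show ?thesis unfolding mult_2 power_add .
  qed
  also have "\<dots> = (L ^ a * Q (- \<eta> / 2))\<^sup>2" by (simp add: power2_eq_square)
  finally have "sqrt (real (card T) / N) \<le> L ^ a * Q (- \<eta> / 2)" using L_ge by (intro real_le_lsqrt) auto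
  also have "\<dots> \<le> L ^ ?n * Q (- \<eta> / 2)" by (intro mult_right_mono L_pow_mono) auto
  finally have 1: "sqrt (real (card T) / N) \<le> L ^ ?n * Q (- \<eta> / 2)" .
  have "Q (6 * \<eta>) \<le> Lm" unfolding Lm_def by simp
  hence "Lm powr (-1/4) \<le> Q (6 * \<eta>) powr (-1/4)" by (intro powr_mono2') auto
  also have "\<dots> = Q (- 3 * \<eta> / 2)" unfolding Q_powr by (simp add: field_simps)
  finally have l: "Lm powr (-1/4) \<le> Q (- 3 * \<eta> / 2)" .
  have "\<theta> * Lm powr (-1/4) \<le> \<theta> * Q (- 3 * \<eta> / 2)" using l theta_ge by (intro mult_left_mono) auto
  also have "\<dots> = 2 * L ^ (2 * b + B2) * (Q \<eta> * Q (- 3 * \<eta> / 2))" unfolding \<theta>_def by (simp add: power_add)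
  also have "Q \<eta> * Q (- 3 * \<eta> / 2) = Q (- \<eta> / 2)" unfolding Q_add by (simp add: field_simps)
  also have "2 * L ^ (2 * b + B2) * Q (- \<eta> / 2) \<le> 2 * L ^ ?n * Q (- \<eta> / 2)"
    by (intro mult_right_mono mult_left_mono L_pow_mono) auto
  finally have 2: "\<theta> * Lm powr (-1/4) \<le> 2 * L ^ ?n * Q (- \<eta> / 2)" .
  have "real b * Lm powr (-1/4) \<le> L ^ 1 * Q (- 3 * \<eta> / 2)" using l L_ge by (intro mult_mono) auto
  also have "\<dots> \<le> L ^ ?n * Q (- \<eta> / 2)" using eta L_ge by (intro mult_mono L_pow_mono Q_mono) auto
  finally have 3: "real b * Lm powr (-1/4) \<le> L ^ ?n * Q (- \<eta> / 2)" .
  have "18 * sqrt (real (card T) / N) + (22 * \<theta> + 4 * real b) * Lm powr (-1/4)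
     = 18 * sqrt (real (card T) / N) + 22 * (\<theta> * Lm powr (-1/4)) + 4 * (real b * Lm powr (-1/4))" by (simp add: algebra_simps)
  \<comment> \<open>\<open>66 = 18 + 2 * 22 + 4\<close>.\<close>
  also have "\<dots> \<le> 66 * (L ^ ?n * Q (- \<eta> / 2))" using 1 2 3 by linarith
  also have "\<dots> \<le> L\<^sup>2 * (L ^ ?n * Q (- \<eta> / 2))" using const_le_L2[of 66] L_ge by (intro mult_right_mono) auto
  also have "\<dots> = L ^ (a + 2 * b + B2 + 3) * Q (- \<eta> / 2)" by (simp add: power_add eval_nat_numeral)
  finally show ?thesis .
qed

text \<open>Division by \<open>\<kappa> R K\<close> costs \<open>1 / K\<close>, at most
  \<open>L ^ (3 a + 3 b + 2)\<close>. The exponents \<open>A2\<close> and \<open>B2\<close> are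
  exactly those leaving \<open>1 / L ^ (B + 1)\<close> for the Type II term and for the boundary
  term, and the variance term has a power saving. The spare \<open>1 / L\<close> pays for adding
  three terms.\<close>

theorem norm_cop_form_bound: "norm (cop_form \<chi> \<mu> {n. N \<le> real n \<and> real n \<le> 2 * N}) \<le> 1 / L ^ B * N"
proof -
  let ?E = "3 * a + 3 * b + 2"
  let ?F = "norm (cop_form \<chi> \<mu> ND)"
  define Er where "Er = 18 * sqrt (real (card T) / N) + (22 * \<theta> + 4 * real b) * Lm powr (-1/4)"
  define K where "K = cq * S1 * H"
  have K0: "K > 0" unfolding K_def using cq_pos S1_pos H_pos by simp
  have icq: "1 / cq \<le> L\<^sup>2" using cq_ge linear_le_L2[of 2] unfolding L_def by simp
  have iK: "1 / K \<le> L ^ ?E"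
  proof -
    have "1 / K = 1 / cq * (1 / S1) * (1 / H)" unfolding K_def by simp
    also have "\<dots> \<le> L\<^sup>2 * L ^ (3 * b) * L ^ (3 * a)"
      using icq inverse_S1_le inverse_H_le S1_pos H_pos cq_pos L_ge by (intro mult_mono) auto
    also have "\<dots> = L ^ ?E" unfolding power_add[symmetric] by (simp add: ac_simps)
    finally show ?thesis .
  qed
  have "\<kappa> * R * K * ?F \<le> N * R * (L ^ 7 / L ^ A2) + 72 * \<kappa>\<^sup>2 * N * R * cmax + N * \<kappa> * R * S1 * (1 + H) * Phi * Er"
    using norm_cop_form_le norm_Tsum_bound unfolding K_def Er_def by linarith
  also have "\<dots> = \<kappa> * R * K * (N * (1 / K * (L ^ 7 / L ^ A2 * L ^ B2) + 1 / K * (72 * \<kappa> * cmax) + (1 + H) / (cq * H) * (Phi * Er)))"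
  proof -
    have "1 / \<kappa> = L ^ B2" unfolding \<kappa>_def by simp
    hence e1: "\<kappa> * R * K * (N * (1 / K * (L ^ 7 / L ^ A2 * L ^ B2))) = N * R * (L ^ 7 / L ^ A2)"
      using K0 kap_facts by (simp add: field_simps)
    have e2: "\<kappa> * R * K * (N * (1 / K * (72 * \<kappa> * cmax))) = 72 * \<kappa>\<^sup>2 * N * R * cmax"
      using K0 by (simp add: power2_eq_square)
    \<comment> \<open>The variance error is already proportional to \<open>S1\<close>, so only
      \<open>cq\<close> and \<open>H\<close> have to be inverted in it.\<close>
    have KS: "K / (cq * H) = S1" unfolding K_def using cq_pos H_pos by simp
    have "\<kappa> * R * K * (N * ((1 + H) / (cq * H) * (Phi * Er))) = N * \<kappa> * R * (K / (cq * H)) * (1 + H) * Phi * Er"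
      by (simp add: ac_simps)
    hence e3: "\<kappa> * R * K * (N * ((1 + H) / (cq * H) * (Phi * Er))) = N * \<kappa> * R * S1 * (1 + H) * Phi * Er"
      unfolding KS .
    show ?thesis unfolding distrib_left e1 e2 e3 ..
  qed
  finally have "?F \<le> N * (1 / K * (L ^ 7 / L ^ A2 * L ^ B2) + 1 / K * (72 * \<kappa> * cmax) + (1 + H) / (cq * H) * (Phi * Er))"
    using kap_facts R_facts K0 by (simp only: mult_le_cancel_left_pos mult_pos_pos)
  also have "\<dots> \<le> N * (1 / L ^ (B + 1) + 1 / L ^ (B + 1) + 1 / L ^ (B + 1))"
  proof (intro mult_left_mono add_mono)
    have "1 / K * (L ^ 7 / L ^ A2 * L ^ B2) \<le> L ^ ?E * (L ^ 7 / L ^ A2 * L ^ B2)" using iK L_ge by (intro mult_right_mono) auto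
    also have "\<dots> = L ^ (?E + 7 + B2) / L ^ A2"
      unfolding times_divide_eq_right times_divide_eq_left mult.assoc power_add[symmetric] by (simp only: ac_simps)
    also have "\<dots> \<le> 1 / L ^ (B + 1)" using A2 by (intro L_pow_div) auto
    finally show "1 / K * (L ^ 7 / L ^ A2 * L ^ B2) \<le> 1 / L ^ (B + 1)" .
    have "1 / K * (72 * \<kappa> * cmax) \<le> L ^ ?E * (L\<^sup>2 * \<kappa> * L\<^sup>2)"
      using iK K0 kap_facts cmax_ge cmax_le const_le_L2[of 72] L_ge by (intro mult_mono) auto
    also have "\<dots> = L ^ (?E + 4) / L ^ B2" unfolding \<kappa>_def by (simp add: power_add eval_nat_numeral)
    also have "\<dots> \<le> 1 / L ^ (B + 1)" using B2 by (intro L_pow_div) auto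
    finally show "1 / K * (72 * \<kappa> * cmax) \<le> 1 / L ^ (B + 1)" .
    have "(1 + H) / (cq * H) = 1 / cq * (1 / H + 1)" using H_pos cq_pos by (simp add: field_simps)
    also have "\<dots> \<le> L\<^sup>2 * (L ^ (3 * a) + L ^ (3 * a))"
      using icq inverse_H_le L_ge cq_pos H_pos by (intro mult_mono add_mono one_le_power) auto
    also have "\<dots> = 2 * L ^ (3 * a + 2)" by (simp add: power_add eval_nat_numeral)
    also have "\<dots> \<le> L * L ^ (3 * a + 2)" using L_ge by (intro mult_right_mono) auto
    finally have h: "(1 + H) / (cq * H) \<le> L ^ (3 * a + 3)" by (simp add: eval_nat_numeral)
    have Er0: "Er \<ge> 0" unfolding Er_def using theta_ge N_facts by (intro add_nonneg_nonneg mult_nonneg_nonneg) auto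
    have "(1 + H) / (cq * H) * (Phi * Er) \<le> L ^ (3 * a + 3) * (Q s * (L ^ (a + 2 * b + B2 + 3) * Q (- \<eta> / 2)))"
      using h Phi_le error_bound[folded Er_def] Er0 Phi_ge H_pos cq_pos L_ge by (intro mult_mono) auto
    also have "\<dots> = L ^ (4 * a + 2 * b + B2 + 6) * (Q s * Q (- \<eta> / 2))" by (simp add: power_add eval_nat_numeral)
    also have "\<dots> \<le> L ^ (4 * a + 2 * b + B2 + 6) * Q (- s)" unfolding Q_add using s L_ge by (intro mult_left_mono Q_mono) auto
    also have "\<dots> \<le> 1 / L ^ (B + 1)" using D A2 B2 by (intro L_pow_Q) auto
    finally show "(1 + H) / (cq * H) * (Phi * Er) \<le> 1 / L ^ (B + 1)" .
  qed (use N_facts in auto)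
  also have "\<dots> = N * (3 / L / L ^ B)" by simp
  also have "\<dots> \<le> N * (1 / L ^ B)" using L_ge N_facts by (intro mult_left_mono divide_right_mono) auto
  finally show ?thesis unfolding ND_def by (simp add: mult.commute)
qed

end

section \<open>The character sum bound\<close>

text \<open>\<open>H\<close> near \<open>L ^ (2 k + 4)\<close> makes the covering error
  \<open>Y ^ 2 / H\<close> small enough, and \<open>4 k + 8\<close> logarithms in the form bound
  leave as much after multiplication by \<open>H\<close>. The radicand is then at most
  \<open>64 Y ^ 2 / L ^ (2 k + 4)\<close>, and \<open>2 ln Y + 3 <= 2 L\<close> gives
  \<open>16 Y / L ^ (k + 1)\<close>.\<close>

lemma final_inequality:
  fixes L Y N1 H :: real and k :: nat
  assumes L: "L \<ge> 16" and N1: "L ^ (8 * k + 20) \<le> N1" and Y: "N1 * L ^ (8 * k + 20) \<le> Y" "0 \<le> ln Y" "ln Y \<le> L / 2"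
    and H: "L ^ (2 * k + 4) \<le> H" "H \<le> 2 * L ^ (2 * k + 4)"
  shows "(2 * ln Y + 3) * sqrt (4 * Y * H * (2 * (1 / L ^ (4 * k + 8) + 4 / N1) * Y + 4 * N1 * (1 + ln Y)) + 24 * Y\<^sup>2 / H + 4 * H\<^sup>2) \<le> Y / L ^ k"
proof -
  let ?e = "1 / L ^ (2 * k + 4)"
  have mono: "L ^ m \<le> L ^ n" if "m \<le> n" for m n using L that by (intro power_increasing) auto
  have div: "L ^ m / L ^ n \<le> ?e" if "m + (2 * k + 4) \<le> n" for m n
  proof -
    have "L ^ m * L ^ (2 * k + 4) \<le> L ^ n" unfolding power_add[symmetric] by (rule mono[OF that])
    thus ?thesis using L by (simp add: field_simps)
  qed
  have L0: "L > 0" "L \<ge> 1" using L by auto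
  have Lp: "L ^ n > 0" for n using L by simp
  have L1: "1 \<le> L ^ n" for n using L by simp
  have N0: "N1 > 0" "N1 \<ge> 1" using N1 Lp[of "8 * k + 20"] L1[of "8 * k + 20"] by linarith+
  have "1 * L ^ (8 * k + 20) \<le> N1 * L ^ (8 * k + 20)" using N0 L by (intro mult_right_mono) auto
  hence YD: "L ^ (8 * k + 20) \<le> Y" using Y by linarith
  hence Y0: "Y > 0" "Y \<ge> 1" using Lp[of "8 * k + 20"] L1[of "8 * k + 20"] by linarith+
  have H0: "H > 0" using H Lp[of "2 * k + 4"] by linarith
  have c256: "16 * 16 \<le> L\<^sup>2" unfolding power2_eq_square using L by (intro mult_mono) auto
  have t1: "8 * H * (1 / L ^ (4 * k + 8)) \<le> 16 * ?e"
  proof -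
    have "8 * H * (1 / L ^ (4 * k + 8)) \<le> 8 * (2 * L ^ (2 * k + 4)) * (1 / L ^ (4 * k + 8))"
      using H L0 by (intro mult_right_mono mult_left_mono) auto
    also have "\<dots> = 16 * (L ^ (2 * k + 4) / L ^ (4 * k + 8))" by simp
    also have "\<dots> \<le> 16 * ?e" by (intro mult_left_mono div) auto
    finally show ?thesis .
  qed
  have t2: "32 * H / N1 \<le> ?e"
  proof -
    have "32 * H / N1 \<le> 64 * L ^ (2 * k + 4) / L ^ (8 * k + 20)"
      using H N1 N0 Lp H0 by (intro frac_le) auto
    also have "\<dots> \<le> L\<^sup>2 * L ^ (2 * k + 4) / L ^ (8 * k + 20)" using c256 L by (intro divide_right_mono mult_right_mono) auto
    also have "\<dots> = L ^ (2 * k + 6) / L ^ (8 * k + 20)" by (simp add: power_add[symmetric] ac_simps)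
    also have "\<dots> \<le> ?e" by (rule div) simp
    finally show ?thesis .
  qed
  have t3: "16 * H * N1 * (1 + ln Y) / Y \<le> ?e"
  proof -
    have "16 * H * N1 * (1 + ln Y) / Y \<le> 16 * (2 * L ^ (2 * k + 4)) * N1 * L / (N1 * L ^ (8 * k + 20))"
      using H N0 Y Y0 Lp H0 L by (intro frac_le mult_mono) auto
    also have "\<dots> = 32 * L * L ^ (2 * k + 4) / L ^ (8 * k + 20)" using N0 by simp
    also have "\<dots> \<le> L\<^sup>2 * L * L ^ (2 * k + 4) / L ^ (8 * k + 20)" using c256 L by (intro divide_right_mono mult_right_mono) auto
    also have "\<dots> = L ^ (2 * k + 7) / L ^ (8 * k + 20)" by (simp add: power_add eval_nat_numeral ac_simps)
    also have "\<dots> \<le> ?e" by (rule div) simp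
    finally show ?thesis .
  qed
  have t4: "24 / H \<le> 24 * ?e"
  proof -
    have "24 / H \<le> 24 / L ^ (2 * k + 4)" using H Lp H0 by (intro divide_left_mono) auto
    thus ?thesis by simp
  qed
  have t5: "4 * H\<^sup>2 / Y\<^sup>2 \<le> ?e"
  proof -
    have "Y * 1 \<le> Y * Y" using Y0 by (intro mult_left_mono) auto
    hence "L ^ (8 * k + 20) \<le> Y\<^sup>2" using YD by (simp add: power2_eq_square)
    hence "4 * H\<^sup>2 / Y\<^sup>2 \<le> 4 * (2 * L ^ (2 * k + 4))\<^sup>2 / L ^ (8 * k + 20)"
      using H Lp H0 by (intro frac_le mult_left_mono power_mono) auto
    also have "\<dots> = 16 * (L ^ (2 * k + 4) * L ^ (2 * k + 4)) / L ^ (8 * k + 20)" by (simp add: power2_eq_square)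
    also have "\<dots> \<le> L\<^sup>2 * (L ^ (2 * k + 4) * L ^ (2 * k + 4)) / L ^ (8 * k + 20)" using c256 L by (intro divide_right_mono mult_right_mono) auto
    also have "\<dots> = L ^ (4 * k + 10) / L ^ (8 * k + 20)" by (simp add: power_add[symmetric] ac_simps)
    also have "\<dots> \<le> ?e" by (rule div) simp
    finally show ?thesis .
  qed
  have "4 * Y * H * (2 * (1 / L ^ (4 * k + 8) + 4 / N1) * Y + 4 * N1 * (1 + ln Y)) + 24 * Y\<^sup>2 / H + 4 * H\<^sup>2
    = Y\<^sup>2 * (8 * H * (1 / L ^ (4 * k + 8)) + 32 * H / N1 + 16 * H * N1 * (1 + ln Y) / Y + 24 / H + 4 * H\<^sup>2 / Y\<^sup>2)"
  proof -
    have "4 * Y * H * (2 * (b + 4 / N1) * Y + 4 * N1 * z) + 24 * Y\<^sup>2 / H + 4 * H\<^sup>2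
      = Y\<^sup>2 * (8 * H * b + 32 * H / N1 + 16 * H * N1 * z / Y + 24 / H + 4 * H\<^sup>2 / Y\<^sup>2)" for b z
      using Y0 H0 N0 by (simp add: field_simps power2_eq_square)
    from this[of "1 / L ^ (4 * k + 8)" "1 + ln Y"] show ?thesis .
  qed
  also have "\<dots> \<le> Y\<^sup>2 * (64 * ?e)"
  proof (intro mult_left_mono)
    have "?e \<ge> 0" using L by simp
    thus "8 * H * (1 / L ^ (4 * k + 8)) + 32 * H / N1 + 16 * H * N1 * (1 + ln Y) / Y + 24 / H + 4 * H\<^sup>2 / Y\<^sup>2 \<le> 64 * ?e"
      using t1 t2 t3 t4 t5 by linarith
  qed simp
  also have "\<dots> = (Y * 8 / L ^ (k + 2))\<^sup>2"
  proof -
    have "2 * k + 4 = (k + 2) * 2" by simp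
    hence "L ^ (2 * k + 4) = (L ^ (k + 2))\<^sup>2" by (simp only: power_mult)
    thus ?thesis by (simp add: power_divide power_mult_distrib)
  qed
  finally have "sqrt (4 * Y * H * (2 * (1 / L ^ (4 * k + 8) + 4 / N1) * Y + 4 * N1 * (1 + ln Y)) + 24 * Y\<^sup>2 / H + 4 * H\<^sup>2) \<le> Y * 8 / L ^ (k + 2)"
    using Y0 L0 by (intro real_le_lsqrt) auto
  hence "(2 * ln Y + 3) * sqrt (4 * Y * H * (2 * (1 / L ^ (4 * k + 8) + 4 / N1) * Y + 4 * N1 * (1 + ln Y)) + 24 * Y\<^sup>2 / H + 4 * H\<^sup>2)
     \<le> (2 * L) * (Y * 8 / L ^ (k + 2))"
    using Y L by (intro mult_mono) (auto intro!: real_sqrt_ge_zero add_nonneg_nonneg mult_nonneg_nonneg simp: Y0 H0 N0 less_imp_le)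
  also have "\<dots> = Y / L ^ k * (16 / L)" using L0 by (simp add: field_simps power2_eq_square)
  also have "\<dots> \<le> Y / L ^ k * 1" using L Y0 Lp by (intro mult_left_mono) auto
  finally show ?thesis by simp
qed

lemma eventually_ln_power_le: "s > 0 \<Longrightarrow> \<forall>\<^sub>F x in at_top. ln x ^ D \<le> x powr (s :: real)"
proof -
  assume s: "s > 0"
  have "\<forall>\<^sub>F x in at_top. ln x powr (real D) \<le> x powr s" using s by real_asymp
  moreover have "\<forall>\<^sub>F x :: real in at_top. x > 1" by (rule eventually_gt_at_top)
  ultimately show ?thesis by eventually_elim (simp add: powr_realpow)
qed

text \<open>The claim is about \<open>n < Y\<close>, the dyadic argument about
  \<open>n <= Y\<close>; they differ in at most one term.\<close>

lemma norm_char_sum_less_le: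
  assumes \<chi>: "\<And>n. norm (\<chi> n :: complex) \<le> 1" and Y: "Y \<ge> 0"
  shows "norm (\<Sum>n | 1 \<le> n \<and> real n < Y. \<chi> n) \<le> Y"
    and "norm (\<Sum>n | 1 \<le> n \<and> real n < Y. \<chi> n) \<le> norm (\<Sum>n\<in>upto_real Y. \<chi> n) + 1"
proof -
  let ?S = "{n. 1 \<le> n \<and> real n < Y}" and ?T = "{n. 1 \<le> n \<and> real n = Y}"
  have sub: "?S \<subseteq> upto_real Y" unfolding upto_real_def by auto
  have fin: "finite ?S" by (rule finite_subset[OF sub]) simp
  have "norm (\<Sum>n\<in>?S. \<chi> n) \<le> (\<Sum>n\<in>?S. 1)" by (rule sum_norm_le) (rule \<chi>)
  also have "\<dots> = real (card ?S)" by simp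
  also have "\<dots> \<le> real (card (upto_real Y))" using card_mono[OF finite_upto_real sub] by simp
  also have "\<dots> \<le> Y" by (rule card_upto_real[OF Y])
  finally show "norm (\<Sum>n\<in>?S. \<chi> n) \<le> Y" .
  have T1: "?T \<subseteq> {nat \<lfloor>Y\<rfloor>}" by auto
  have finT: "finite ?T" by (rule finite_subset[OF T1]) simp
  have "upto_real Y = ?S \<union> ?T" unfolding upto_real_def by auto
  hence "(\<Sum>n\<in>upto_real Y. \<chi> n) = (\<Sum>n\<in>?S. \<chi> n) + (\<Sum>n\<in>?T. \<chi> n)"
    using fin finT by (simp add: sum.union_disjoint[symmetric] Int_def)
  hence "(\<Sum>n\<in>?S. \<chi> n) = (\<Sum>n\<in>upto_real Y. \<chi> n) - (\<Sum>n\<in>?T. \<chi> n)" by simp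
  hence "norm (\<Sum>n\<in>?S. \<chi> n) \<le> norm (\<Sum>n\<in>upto_real Y. \<chi> n) + norm (\<Sum>n\<in>?T. \<chi> n)" by (simp only: norm_triangle_ineq4)
  moreover have "norm (\<Sum>n\<in>?T. \<chi> n) \<le> 1"
  proof -
    have "norm (\<Sum>n\<in>?T. \<chi> n) \<le> (\<Sum>n\<in>?T. 1)" by (rule sum_norm_le) (rule \<chi>)
    also have "\<dots> = real (card ?T)" by simp
    also have "\<dots> \<le> 1" using card_mono[OF _ T1] by simp
    finally show ?thesis .
  qed
  ultimately show "norm (\<Sum>n\<in>?S. \<chi> n) \<le> norm (\<Sum>n\<in>upto_real Y. \<chi> n) + 1" by linarith
qed

text \<open>Period 1 makes the character constant. This excludes \<open>q = 1\<close>, where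
  \<open>ln q\<close> vanishes.\<close>

lemma dirichlet_character_1_principal: "dirichlet_character 1 \<chi> \<Longrightarrow> principal_character 1 \<chi>"
proof -
  assume ch: "dirichlet_character 1 \<chi>"
  have per: "\<chi> (Suc n) = \<chi> n" for n using ch unfolding dirichlet_character_def by auto
  have "\<chi> n = \<chi> 0" for n by (induction n) (auto simp: per)
  moreover have "\<chi> 1 = 1" using ch unfolding dirichlet_character_def by auto
  ultimately show ?thesis unfolding principal_character_def by metis
qed

theorem theorem1p6:
  fixes w :: real
  assumes varpi: "0 < w" "w < 1/4"
  assumes typeII: "\<exists>\<delta>>0. \<forall>A>0. \<forall>C\<^sub>0\<ge>1. \<exists>C. \<exists>x\<^sub>0. \<forall>x\<ge>x\<^sub>0.
     \<forall>(P::nat) (N::real) (M::real) (\<alpha>::nat \<Rightarrow> real).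
       squarefree P \<longrightarrow> (\<forall>p\<in>prime_factors P. real p \<le> x powr \<delta>) \<longrightarrow>
       x powr (1/2 - 2*w) / C\<^sub>0 \<le> N \<longrightarrow> N \<le> C\<^sub>0 * M \<longrightarrow>
       M \<le> C\<^sub>0 * x powr (1/2 + 2*w) \<longrightarrow>
       x / C\<^sub>0 \<le> N * M \<longrightarrow> N * M \<le> C\<^sub>0 * x \<longrightarrow>
       (\<forall>n. \<alpha> n \<noteq> 0 \<longrightarrow> M \<le> real n \<and> real n \<le> 2 * M) \<longrightarrow>
       (\<forall>n. \<bar>\<alpha> n\<bar> \<le> C\<^sub>0) \<longrightarrow>
       (\<forall>a::nat. 1 \<le> a \<and> real a \<le> x \<and> coprime a P \<longrightarrow>
          (\<Sum>r | 1 \<le> r \<and> real r \<le> C\<^sub>0 * x powr (1/2 + 2*w) \<and> r dvd P.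
             \<bar>disc (dconv \<alpha> (\<lambda>n. if N \<le> real n \<and> real n \<le> 2 * N then 1 else 0)) a r\<bar>)
          \<le> C * x * ln x powr (-A))"
  shows "\<exists>\<epsilon>\<^sub>0>0. \<forall>\<epsilon>. 0 < \<epsilon> \<and> \<epsilon> < \<epsilon>\<^sub>0 \<longrightarrow> (\<forall>A>0. \<exists>C'. \<forall>(q::nat) (\<chi>::nat \<Rightarrow> complex).
     primitive_character q \<chi> \<and> \<not> principal_character q \<chi> \<longrightarrow>
     norm (\<Sum>n | 1 \<le> n \<and> real n < real q powr (1/2 - 2*w + \<epsilon>). \<chi> n)
       \<le> C' * real q powr (1/2 - 2*w + \<epsilon>) * ln (real q) powr (-A))"
proof (rule exI[of _ w], intro conjI allI impI varpi)
  fix \<epsilon> A :: real assume eps: "0 < \<epsilon> \<and> \<epsilon> < w" and A: "A > 0"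
  obtain \<delta>0 where d0: "\<delta>0 > 0" and
    II: "\<And>A C\<^sub>0. A > 0 \<Longrightarrow> C\<^sub>0 \<ge> 1 \<Longrightarrow> \<exists>C x\<^sub>0. \<forall>x\<ge>x\<^sub>0. type_II_bound w \<delta>0 A C\<^sub>0 C x"
    using typeII[folded type_II_bound_def] by blast
  \<comment> \<open>An integral number of logarithms to save, at least \<open>A\<close>.\<close>
  define k where "k = nat \<lceil>A\<rceil>"
  define \<delta> where "\<delta> = min \<delta>0 1"
  \<comment> \<open>First \<open>b\<close> makes primes of size about \<open>q powr (2 / b)\<close>
    smooth enough, then \<open>a\<close> makes the primes of \<open>T\<close> smaller than those of
    \<open>R1\<close>; all further exponents depend on these two and not on
    \<open>q\<close>.\<close>
  define b where "b = nat \<lceil>4 / \<delta>\<rceil> + 1"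
  define a where "a = nat \<lceil>real b / w\<rceil> + 1"
  define \<eta> where "\<eta> = min (w / 12) (min \<epsilon> ((1/2 - 2 * w) / (8 * real a)))"
  define s where "s = min (\<eta> / 48) (min (w / (2 * real b)) (\<delta> / 4))"
  define B where "B = 4 * k + 8"
  define B2 where "B2 = 3 * a + 3 * b + 7 + B"
  define A2 where "A2 = 3 * a + 3 * b + B2 + 10 + B"
  define D where "D = A2 + B2 + 5 * a + 5 * b + 20"
  define \<sigma> where "\<sigma> = \<epsilon> / 2"
  have kA: "A \<le> real k" unfolding k_def by linarith
  have del: "0 < \<delta>" "\<delta> \<le> 1" "\<delta> \<le> \<delta>0" unfolding \<delta>_def using d0 by auto
  have ab: "1 \<le> a" "1 \<le> b" "4 \<le> \<delta> * real b" "real b \<le> w * real a"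
  proof -
    show "1 \<le> a" "1 \<le> b" unfolding a_def b_def by auto
    have "4 / \<delta> \<le> real b" unfolding b_def by linarith
    thus "4 \<le> \<delta> * real b" using del by (simp add: field_simps)
    have "real b / w \<le> real a" unfolding a_def by linarith
    thus "real b \<le> w * real a" using varpi by (simp add: field_simps)
  qed
  have a0: "real a > 0" "real b > 0" using ab by auto
  have eta: "0 < \<eta>" "12 * \<eta> \<le> w" "\<eta> \<le> \<epsilon>" "8 * real a * \<eta> \<le> 1/2 - 2 * w"
  proof -
    show "0 < \<eta>" unfolding \<eta>_def using varpi eps a0 by simp
    show "12 * \<eta> \<le> w" "\<eta> \<le> \<epsilon>" unfolding \<eta>_def by auto
    have "\<eta> \<le> (1/2 - 2 * w) / (8 * real a)" unfolding \<eta>_def by auto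
    thus "8 * real a * \<eta> \<le> 1/2 - 2 * w" using a0 by (simp add: field_simps)
  qed
  have s: "0 < s" "48 * s \<le> \<eta>" "2 * s * real b \<le> w" "4 * s \<le> \<delta>"
  proof -
    show "0 < s" unfolding s_def using varpi eta del a0 by simp
    show "48 * s \<le> \<eta>" "4 * s \<le> \<delta>" unfolding s_def by auto
    have "s \<le> w / (2 * real b)" unfolding s_def by auto
    thus "2 * s * real b \<le> w" using a0 by (simp add: field_simps)
  qed
  have "real A2 > 0" unfolding A2_def by simp
  then obtain C x0 where CII: "\<And>x. x \<ge> x0 \<Longrightarrow> type_II_bound w \<delta>0 (real A2) 4 C x"
    using II[of "real A2" 4] by auto
  \<comment> \<open>The exponent \<open>s / 2\<close> leaves the other half of
    \<open>q powr s\<close> for the constants \<open>exp 8\<close> and \<open>Cw\<close>.\<close>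
  obtain Cw where Cw: "Cw \<ge> 1" "\<And>n::nat. n > 0 \<Longrightarrow> 2 ^ card (prime_factors n) \<le> Cw * real n powr (s / 2)"
    using two_power_card_prime_factors_bound[of "s / 2"] s by auto
  define K where "K = Max {16, real a, real b, \<bar>C\<bar>}"
  \<comment> \<open>An exponent not exceeding those of \<open>N1\<close> and of
    \<open>Y / N1\<close>; \<open>q powr E\<close> absorbs the logarithms demanded by the final
    inequality in both places.\<close>
  define E where "E = min (1/2 - 2 * w + \<epsilon> / 2) (\<epsilon> / 2)"
  have E_le: "E \<le> 1/2 - 2 * w + \<epsilon> / 2" "E \<le> \<epsilon> / 2"
    unfolding E_def by (rule min.cobounded1, rule min.cobounded2)
  have E0: "E > 0" unfolding E_def using varpi eps by simp
  have "\<forall>\<^sub>F x :: real in at_top. ln x \<ge> K \<and> ln x ^ D \<le> x powr s \<and> exp 8 * (Cw * x powr (s / 2)) \<le> x powr s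
      \<and> x \<ge> x0 \<and> ln x ^ (8 * k + 20) \<le> x powr E \<and> x > 1"
  proof (intro eventually_conj eventually_ln_power_le s E0 eventually_ge_at_top eventually_gt_at_top)
    show "\<forall>\<^sub>F x :: real in at_top. ln x \<ge> K" by real_asymp
    show "\<forall>\<^sub>F x :: real in at_top. exp 8 * (Cw * x powr (s / 2)) \<le> x powr s" using s Cw by real_asymp
  qed
  then obtain q0 where q0: "\<And>x. x \<ge> q0 \<Longrightarrow> ln x \<ge> K \<and> ln x ^ D \<le> x powr s \<and> exp 8 * (Cw * x powr (s / 2)) \<le> x powr s
      \<and> x \<ge> x0 \<and> ln x ^ (8 * k + 20) \<le> x powr E \<and> x > 1"
    unfolding eventually_at_top_linorder by blast
  \<comment> \<open>For \<open>q < q0\<close> the trivial bound \<open>Y\<close> suffices with the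
    second entry; the 2 pays for the possible extra term at \<open>n = Y\<close>.\<close>
  define C' where "C' = max 2 (ln (max q0 2) powr A)"
  show "\<exists>C'. \<forall>(q::nat) (\<chi>::nat \<Rightarrow> complex).
     primitive_character q \<chi> \<and> \<not> principal_character q \<chi> \<longrightarrow>
     norm (\<Sum>n | 1 \<le> n \<and> real n < real q powr (1/2 - 2*w + \<epsilon>). \<chi> n)
       \<le> C' * real q powr (1/2 - 2*w + \<epsilon>) * ln (real q) powr (-A)"
  proof (rule exI[of _ C'], intro allI impI)
    fix q :: nat and \<chi> :: "nat \<Rightarrow> complex"
    assume as: "primitive_character q \<chi> \<and> \<not> principal_character q \<chi>"
    have ch: "dirichlet_character q \<chi>" using as unfolding primitive_character_def by simp
    note ch_mult = dirichlet_character_mult[OF ch] and ch_le_1 = norm_dirichlet_character_le_1[OF ch]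
    have "q \<ge> 1" using ch unfolding dirichlet_character_def by simp
    moreover have "q \<noteq> 1" using as ch dirichlet_character_1_principal by auto
    ultimately have q1: "q > 1" by simp
    define Lq where "Lq = ln (real q)"
    define Y where "Y = real q powr (1/2 - 2*w + \<epsilon>)"
    \<comment> \<open>Below this length the Type II estimate is not invoked and blocks are bounded
      trivially; the gap \<open>q powr (\<epsilon> / 2)\<close> up to \<open>Y\<close> makes that
      negligible.\<close>
    define N1 where "N1 = real q powr (1/2 - 2 * w + \<epsilon> / 2)"
    let ?S = "\<Sum>n | 1 \<le> n \<and> real n < Y. \<chi> n"
    have L0: "Lq > 0" unfolding Lq_def using q1 by simp
    have Y0: "Y > 0" unfolding Y_def using q1 by simp
    have "norm ?S \<le> C' * Y * Lq powr (-A)"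
    proof (cases "real q \<ge> q0")
      case False
      have "norm ?S \<le> Y" using Y0 by (intro norm_char_sum_less_le ch_le_1) auto
      also have "\<dots> = Lq powr A * Y * Lq powr (-A)" using L0 by (simp add: powr_minus)
      also have "\<dots> \<le> C' * Y * Lq powr (-A)"
      proof (intro mult_right_mono)
        have "Lq \<le> ln (max q0 2)" unfolding Lq_def using False q1 by simp
        hence "Lq powr A \<le> ln (max q0 2) powr A" using L0 A by (intro powr_mono2) auto
        thus "Lq powr A \<le> C'" unfolding C'_def by simp
      qed (use Y0 in auto)
      finally show ?thesis .
    next
      case True
      note Q = q0[OF True]
      have Kb: "16 \<le> Lq" "real a \<le> Lq" "real b \<le> Lq" "\<bar>C\<bar> \<le> Lq" using Q unfolding Lq_def K_def by simp_all
      have cop: "norm (cop_form \<chi> \<mu> {n. N \<le> real n \<and> real n \<le> 2 * N}) \<le> 1 / Lq ^ B * N"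
        if mu: "1/2 \<le> \<mu>" "\<mu> \<le> 1" and N: "N1 \<le> N" "N \<le> Y" for \<mu> N
      proof -
        interpret type_II_setup w \<epsilon> \<delta> \<eta> s C a b B B2 A2 D q \<chi> N \<mu>
        proof
          have "exp 8 * 2 ^ card (prime_factors q) \<le> exp 8 * (Cw * real q powr (s / 2))" using Cw(2)[of q] q1 by simp
          also have "\<dots> \<le> real q powr s" using Q by simp
          finally show "exp 8 * 2 ^ card (prime_factors q) \<le> real q powr s" .
          fix x :: real assume "real q \<le> x"
          thus "type_II_bound w \<delta> (real A2) 4 C x" using Q q1 del
            by (intro type_II_bound_antimono[OF CII]) auto
        qed (use varpi eps del ab eta s Kb Q as q1 mu N in \<open>simp_all add: B2_def A2_def D_def Lq_def N1_def Y_def\<close>)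
        show ?thesis using norm_cop_form_bound unfolding L_def Lq_def .
      qed
      define H where "H = nat \<lceil>Lq ^ (2 * k + 4)\<rceil>"
      have L1: "1 \<le> Lq ^ n" for n using Kb by simp
      have Hb: "Lq ^ (2 * k + 4) \<le> real H" "real H \<le> 2 * Lq ^ (2 * k + 4)" unfolding H_def using L1[of "2 * k + 4"] by linarith+
      have H1: "H \<ge> 1" using Hb L1[of "2 * k + 4"] by linarith
      have LE: "Lq ^ (8 * k + 20) \<le> real q powr E" using Q unfolding Lq_def by simp
      have qE: "real q powr E \<le> real q powr f" if "E \<le> f" for f using that q1 by (intro powr_mono) auto
      have N1b: "Lq ^ (8 * k + 20) \<le> N1"
        using LE qE[OF E_le(1)] unfolding N1_def by linarith
      have "N1 * Lq ^ (8 * k + 20) \<le> N1 * real q powr (\<epsilon> / 2)"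
        unfolding N1_def by (intro mult_left_mono order_trans[OF LE qE] E_le) auto
      also have "\<dots> = Y" unfolding N1_def Y_def powr_add[symmetric] by (simp only: add.assoc field_sum_of_halves)
      finally have Yb: "N1 * Lq ^ (8 * k + 20) \<le> Y" .
      have N11: "N1 \<ge> 1" using N1b L1[of "8 * k + 20"] by linarith
      have "1 * Lq ^ (8 * k + 20) \<le> N1 * Lq ^ (8 * k + 20)" using N11 L0 by (intro mult_right_mono) auto
      hence YL: "Lq ^ (8 * k + 20) \<le> Y" using Yb by linarith
      hence Y1: "Y \<ge> 1" using L1[of "8 * k + 20"] by linarith
      have lnY: "ln Y = (1/2 - 2 * w + \<epsilon>) * Lq" unfolding Y_def Lq_def using q1 by (simp add: ln_powr)
      have lnY2: "ln Y \<le> Lq / 2"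
      proof -
        have "(1/2 - 2 * w + \<epsilon>) * Lq \<le> 1/2 * Lq" using eps varpi L0 by (intro mult_right_mono) auto
        thus ?thesis unfolding lnY by simp
      qed
      have "norm (\<Sum>n\<in>upto_real Y. \<chi> n) \<le> (2 * ln Y + 3) * sqrt (4 * Y * real H * (2 * (1 / Lq ^ B + 4 / N1) * Y + 4 * N1 * (1 + ln Y)) + 24 * Y\<^sup>2 / real H + 4 * (real H)\<^sup>2)"
        using L0 by (intro char_sum_from_cop_form ch_mult ch_le_1 N11 H1 Y1 cop) auto
      also have "\<dots> \<le> Y / Lq ^ k" unfolding B_def
        using Kb N1b Yb Y1 lnY2 Hb by (intro final_inequality) auto
      finally have main: "norm (\<Sum>n\<in>upto_real Y. \<chi> n) \<le> Y / Lq ^ k" .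
      have "Lq ^ k \<le> Lq ^ (8 * k + 20)" using Kb by (intro power_increasing) auto
      hence "1 \<le> Y / Lq ^ k" using YL L0 by simp
      moreover have "norm ?S \<le> norm (\<Sum>n\<in>upto_real Y. \<chi> n) + 1" using Y0 by (intro norm_char_sum_less_le ch_le_1) auto
      ultimately have "norm ?S \<le> 2 * (Y / Lq ^ k)" using main by linarith
      also have "\<dots> = 2 * Y * Lq powr (- real k)" using L0 by (simp add: powr_minus powr_realpow divide_inverse)
      also have "\<dots> \<le> C' * Y * Lq powr (-A)"
        using kA Kb Y0 by (intro mult_mono powr_mono) (auto simp: C'_def)
      finally show ?thesis .
    qed
    thus "norm (\<Sum>n | 1 \<le> n \<and> real n < real q powr (1/2 - 2*w + \<epsilon>). \<chi> n)
       \<le> C' * real q powr (1/2 - 2*w + \<epsilon>) * ln (real q) powr (-A)" unfolding Y_def Lq_def .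
  qed
qed

end
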